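(* Let $N\ge1$, $\lambda\in\mathbb{R}\setminus\{0\}$ and $\alpha=\frac4N$. For $\varphi\in H^1(\mathbb{R}^N)$ let $u$ be the associated solution of $$i\frac{\partial u}{\partial t}+\Delta u+\lambda|u|^\alpha u=0,\qquad u(0)=\varphi .$$ If $\varphi\not\equiv0$ and if $\|\varphi\|_{H^1}$ is small enough (that is, $\|\varphi\|_{H^1}\le\delta$ for some threshold $\delta>0$ not depending on $\varphi$), then $u$ is global in time and for every $r\in[2,\infty]$, $$\liminf_{t\to\infty}|t|^{N\left(\frac12-\frac1r\right)}\|u(t)\|_{L^r}>0 .$$
   Context: Functions are complex-valued, $L^p=L^p(\mathbb{R}^N;\mathbb{C})$, and $\|f\|_{L^p}=\infty$ by convention if $f\notin L^p$. For $\varphi\in H^1(\mathbb{R}^N)$, the associated solution is the unique maximal solution $u\in C((-T_*,T^* );H^1(\mathbb{R}^N))$ of the equation with $u(0)=\varphi$. "Global in time" means $T_*=T^*=\infty$. *)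

theory Defs
  imports "HOL-Analysis.Analysis" "HOL-Probability.Essential_Supremum"
begin

section \<open>Lebesgue norms\<close>

text \<open>
  Elements of a Lebesgue space are represented by functions; equality of classes is
  equality almost everywhere. \<open>Lp_norm r f\<close> is the $L^r$ norm for $1 \le r \le \infty$,
  with value \<open>\<infinity>\<close> whenever \<open>f\<close> is not in $L^r$.
\<close>

definition Lp_norm :: "ennreal \<Rightarrow> (real ^ 'n \<Rightarrow> complex) \<Rightarrow> ennreal" where
  "Lp_norm r f =
    (if f \<notin> borel_measurable lebesgue then \<infinity>
     else if r = \<infinity> then esssup lebesgue (\<lambda>x. ennreal (norm (f x)))
     else let p = enn2real r; J = (\<integral>\<^sup>+ x. ennreal (norm (f x) powr p) \<partial>lebesgue)
          in if J = \<infinity> then \<infinity> else ennreal (enn2real J powr (1 / p)))"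

definition L2 :: "(real ^ 'n \<Rightarrow> complex) set" where
  "L2 = {f. Lp_norm 2 f < \<infinity>}"

section \<open>Test functions and the Sobolev space $H^1$\<close>

definition partial :: "'n \<Rightarrow> (real ^ 'n \<Rightarrow> complex) \<Rightarrow> real ^ 'n \<Rightarrow> complex" where
  "partial i f x = frechet_derivative f (at x) (axis i 1)"

definition laplacian :: "(real ^ 'n \<Rightarrow> complex) \<Rightarrow> real ^ 'n \<Rightarrow> complex" where
  "laplacian f x = (\<Sum>i\<in>UNIV. partial i (partial i f) x)"

primrec Ck :: "nat \<Rightarrow> (real ^ 'n \<Rightarrow> complex) \<Rightarrow> bool" where
  "Ck 0 f \<longleftrightarrow> continuous_on UNIV f"
| "Ck (Suc k) f \<longleftrightarrow> (\<forall>x. f differentiable (at x)) \<and> (\<forall>i. Ck k (partial i f))"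

definition test_functions :: "(real ^ 'n \<Rightarrow> complex) set" where
  "test_functions = {\<psi>. (\<forall>k. Ck k \<psi>) \<and> compact (closure {x. \<psi> x \<noteq> 0})}"

definition weak_partial :: "'n \<Rightarrow> (real ^ 'n \<Rightarrow> complex) \<Rightarrow> (real ^ 'n \<Rightarrow> complex) \<Rightarrow> bool" where
  "weak_partial i f g \<longleftrightarrow> (\<forall>\<psi>\<in>test_functions.
     (LINT x|lebesgue. f x * partial i \<psi> x) = - (LINT x|lebesgue. g x * \<psi> x))"

definition H1 :: "(real ^ 'n \<Rightarrow> complex) set" where
  "H1 = {f \<in> L2. \<forall>i. \<exists>g\<in>L2. weak_partial i f g}"

text \<open>For \<open>f \<in> H1\<close> the weak derivative chosen here is unique up to null sets.\<close>

definition weak_deriv :: "'n \<Rightarrow> (real ^ 'n \<Rightarrow> complex) \<Rightarrow> real ^ 'n \<Rightarrow> complex" where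
  "weak_deriv i f = (SOME g. g \<in> L2 \<and> weak_partial i f g)"

definition H1_norm :: "(real ^ 'n \<Rightarrow> complex) \<Rightarrow> real" where
  "H1_norm f = sqrt ((LINT x|lebesgue. (norm (f x))\<^sup>2)
                 + (\<Sum>i\<in>UNIV. LINT x|lebesgue. (norm (weak_deriv i f x))\<^sup>2))"

section \<open>The nonlinear Schroedinger equation\<close>

definition time_interval :: "ereal \<Rightarrow> ereal \<Rightarrow> real set" where
  "time_interval T1 T2 = {t. - T1 < ereal t \<and> ereal t < T2}"

text \<open>
  \<open>nls_solution lam \<alpha> \<phi> T1 T2 u\<close>: the curve \<open>u\<close> belongs to $C((-T_1,T_2);H^1)$, has
  initial value \<open>\<phi>\<close>, and satisfies $i u_t + \Delta u + lam |u|^\alpha u = 0$ in the sense of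
  distributions on space, at every time of the interval. Values of \<open>u\<close> at times outside
  the interval are irrelevant.
\<close>

definition nls_solution ::
  "real \<Rightarrow> real \<Rightarrow> (real ^ 'n \<Rightarrow> complex) \<Rightarrow> ereal \<Rightarrow> ereal \<Rightarrow> (real \<Rightarrow> real ^ 'n \<Rightarrow> complex) \<Rightarrow> bool"
where
  "nls_solution lam \<alpha> \<phi> T1 T2 u \<longleftrightarrow>
     0 < T1 \<and> 0 < T2 \<and>
     (\<forall>t\<in>time_interval T1 T2. u t \<in> H1 \<and> ((\<lambda>s. H1_norm (\<lambda>x. u s x - u t x)) \<longlongrightarrow> 0) (at t)) \<and>
     (AE x in lebesgue. u 0 x = \<phi> x) \<and>
     (\<forall>t\<in>time_interval T1 T2. \<forall>\<psi>\<in>test_functions. \<exists>D.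
        ((\<lambda>s. LINT x|lebesgue. u s x * \<psi> x) has_vector_derivative D) (at t) \<and>
        \<i> * D + (LINT x|lebesgue. u t x * laplacian \<psi> x)
          + complex_of_real lam *
            (LINT x|lebesgue. complex_of_real (norm (u t x) powr \<alpha>) * u t x * \<psi> x) = 0)"

definition same_on ::
  "ereal \<Rightarrow> ereal \<Rightarrow> (real \<Rightarrow> real ^ 'n \<Rightarrow> complex) \<Rightarrow> (real \<Rightarrow> real ^ 'n \<Rightarrow> complex) \<Rightarrow> bool" where
  "same_on T1 T2 u v \<longleftrightarrow> (\<forall>t\<in>time_interval T1 T2. AE x in lebesgue. u t x = v t x)"

definition maximal_solution ::
  "real \<Rightarrow> real \<Rightarrow> (real ^ 'n \<Rightarrow> complex) \<Rightarrow> ereal \<Rightarrow> ereal \<Rightarrow> (real \<Rightarrow> real ^ 'n \<Rightarrow> complex) \<Rightarrow> bool"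
where
  "maximal_solution lam \<alpha> \<phi> T1 T2 u \<longleftrightarrow>
     nls_solution lam \<alpha> \<phi> T1 T2 u \<and>
     (\<forall>S1 S2 v. nls_solution lam \<alpha> \<phi> S1 S2 v \<and> T1 \<le> S1 \<and> T2 \<le> S2 \<and> same_on T1 T2 u v
        \<longrightarrow> S1 = T1 \<and> S2 = T2)"

text \<open>The solution associated with \<open>\<phi>\<close> is the unique maximal solution.\<close>

definition associated_solution ::
  "real \<Rightarrow> real \<Rightarrow> (real ^ 'n \<Rightarrow> complex) \<Rightarrow> ereal \<Rightarrow> ereal \<Rightarrow> (real \<Rightarrow> real ^ 'n \<Rightarrow> complex) \<Rightarrow> bool"
where
  "associated_solution lam \<alpha> \<phi> T1 T2 u \<longleftrightarrow>
     maximal_solution lam \<alpha> \<phi> T1 T2 u \<and>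
     (\<forall>S1 S2 v. maximal_solution lam \<alpha> \<phi> S1 S2 v
        \<longrightarrow> S1 = T1 \<and> S2 = T2 \<and> same_on T1 T2 u v)"

end

(*
 A solution is constructed as a limit of solutions of a regularised Duhamel equation in which the
 Schroedinger kernel at time t is replaced by the heat kernel at complex time r + i t, r > 0, and r
 decreases to 0 along the iteration. Every iterate is smooth, and the Strichartz estimates hold
 uniformly in r, because the complex-time kernels are bounded by (4 pi |t|)^(-N/2) and contract L^2;
 they follow from the dispersive estimate and the Hardy-Littlewood-Sobolev inequality in time.
 The derivatives of the iterates solve the linearised equation and converge as well, since the
 derivative of |z|^alpha z is Hoelder continuous, so the limit v is continuous with values in H^1. It
 exists for all times, hence it is maximal and equals the associated solution.

 For the lower bound, v(t) is paired with theta(t), the free flow started at a smoothed truncation of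
 the initial value. The Duhamel part of v(t) has L^2 norm at most a quarter of that of the initial
 value, so the pairing stays bounded away from 0, while the Gaussian form of the kernel shows that the
 norm of theta(t) in the dual space L^(r') is O(t^(N(1/2 - 1/r))). Hoelder's inequality then bounds
 ||v(t)||_r from below, for all r in [2, infinity] at once.
*)

theory Submission
 imports Defs "HOL-Complex_Analysis.Complex_Analysis" "HOL-Probability.Distributions" "HOL-Real_Asymp.Real_Asymp"
begin

text \<open>For r > 0 the kernel at time r + i t is a Gaussian, so convolutions with L^2 functions,
  Fubini and differentiation under the integral are absolutely convergent; the L^2 contraction comes
  from the semigroup law, as z + cnj z is a real heat time. The price is that consecutive iterates
  use different kernels. The semigroup law pays it: the flow with the larger parameter is the flow
  with the smaller one, applied to data and forcing smoothed by heat for the difference. So each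
  parameter is chosen after its iterate, small enough for all such smoothings to cost at most 2^-n.
  The exponent \<alpha> + 2 = 2 + 4/N is the Strichartz exponent that is equal in time and space,
  and |u|^\<alpha> u maps that space to its dual. Contraction then involves the L^2 norm of the data
  only; gradients may be large. They converge at the slower rate 2^(-\<beta>), \<beta> being the
  Hoelder exponent of the derivative of the nonlinearity. Weak derivatives are tested against
  Gaussian kernels throughout and are converted from and to test functions at the two ends.
  Uniqueness of solutions enters through the hypothesis that u is the associated solution.\<close>

abbreviation nn_lborel :: "('a::euclidean_space => ennreal) => ennreal" (binder "NN " 10) where
 "nn_lborel f == nn_integral lborel f"

abbreviation int_lborel :: "('a::euclidean_space => 'b::{banach,second_countable_topology}) => 'b" (binder "LL " 60) where
 "int_lborel f == integral\<^sup>L lborel f"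

abbreviation lborel2 :: "('a::euclidean_space \<times> 'b::euclidean_space) measure" where
 "lborel2 == lborel \<Otimes>\<^sub>M lborel"

abbreviation bm :: "('a::topological_space => 'b::topological_space) => bool" where
 "bm f == f \<in> borel_measurable borel"

abbreviation jm :: "('a::topological_space => 'b::topological_space => 'c::topological_space) => bool" where
 "jm f == case_prod f \<in> borel_measurable (borel \<Otimes>\<^sub>M borel)"

section \<open>Norm bounds\<close>

text \<open>Membership in L^p together with a numerical bound, as one predicate: estimates transport
  explicit constants, and extended nonnegative integrals carry the finiteness along.\<close>

definition lpb :: "'a measure => real => ('a => 'b::{real_normed_vector,second_countable_topology}) => real => bool" where
 "lpb M p f B \<longleftrightarrow> f \<in> borel_measurable M \<and> 0 <= B \<and>
   (\<integral>\<^sup>+x. ennreal (norm (f x) powr p) \<partial>M) <= ennreal (B powr p)"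

abbreviation l2b :: "('a::euclidean_space => 'b::{real_normed_vector,second_countable_topology}) => real => bool" where
 "l2b == lpb lborel 2"

lemma lpb_measurable: "lpb M p f B ==> f \<in> borel_measurable M"
 and lpb_nonneg: "lpb M p f B ==> 0 <= B"
 and lpb_le: "lpb M p f B ==> (\<integral>\<^sup>+x. ennreal (norm (f x) powr p) \<partial>M) <= ennreal (B powr p)"
 by (auto simp: lpb_def)

lemma lpb_mono: "lpb M p f A ==> A <= B ==> 0 <= p ==> lpb M p f B"
 unfolding lpb_def by (meson ennreal_leI order_trans powr_mono2)

lemma lpb_dominated:
 assumes "lpb M p g B" "f \<in> borel_measurable M" "AE x in M. norm (f x) <= norm (g x)" "0 <= p"
 shows "lpb M p f B"
proof -
 have "(\<integral>\<^sup>+x. ennreal (norm (f x) powr p) \<partial>M) <= (\<integral>\<^sup>+x. ennreal (norm (g x) powr p) \<partial>M)"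
  using assms(3,4) by (intro nn_integral_mono_AE) (auto intro!: ennreal_leI powr_mono2 elim!: eventually_mono)
 then show ?thesis using assms unfolding lpb_def by auto
qed

lemma lpb_cong_AE:
 assumes "lpb M p g B" "f \<in> borel_measurable M" "AE x in M. f x = g x"
 shows "lpb M p f B"
proof -
 have "(\<integral>\<^sup>+x. ennreal (norm (f x) powr p) \<partial>M) = (\<integral>\<^sup>+x. ennreal (norm (g x) powr p) \<partial>M)"
  using assms(3) by (intro nn_integral_cong_AE) (auto elim!: eventually_mono)
 then show ?thesis using assms unfolding lpb_def by auto
qed

lemma lpb_zero [simp]: "0 <= B ==> 0 < p ==> lpb M p (%x. 0) B"
 by (auto simp: lpb_def)

lemma LIMSEQ_lower_bound:
 fixes x :: "'a::linorder_topology"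
 assumes "X \<longlonglongrightarrow> x" "!!n. a <= X n"
 shows "a <= x"
 using assms(2) by (intro LIMSEQ_le_const[OF assms(1)]) blast

text \<open>Lets a proof assume strictly positive bounds, as every normalisation by division
  requires.\<close>

lemma lpb_limit:
 assumes "!!e. 0 < e ==> lpb M p f (B + e)" "0 <= B" "0 < p"
 shows "lpb M p f B"
proof -
 have "(%n. ennreal ((B + inverse (real (Suc n))) powr p)) \<longlonglongrightarrow> ennreal ((B + 0) powr p)"
  by (intro tendsto_ennrealI tendsto_powr' tendsto_add tendsto_const LIMSEQ_inverse_real_of_nat)
    (use assms in auto)
 moreover have "(\<integral>\<^sup>+x. ennreal (norm (f x) powr p) \<partial>M) <= ennreal ((B + inverse (real (Suc n))) powr p)" for n
  using assms(1)[of "inverse (real (Suc n))"] by (auto simp: lpb_def)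
 ultimately have "(\<integral>\<^sup>+x. ennreal (norm (f x) powr p) \<partial>M) <= ennreal ((B + 0) powr p)"
  by (rule LIMSEQ_lower_bound)
 then show ?thesis using assms(1)[of 1] assms(2) by (auto simp: lpb_def)
qed

lemma lpb_scale:
 fixes f g :: "'a => 'b::{real_normed_vector,second_countable_topology}"
 assumes "lpb M p f B" "g \<in> borel_measurable M" "!!x. norm (g x) = c * norm (f x)" "0 <= c"
 shows "lpb M p g (c * B)"
proof -
 have f: "f \<in> borel_measurable M" "0 <= B" and le: "(\<integral>\<^sup>+x. ennreal (norm (f x) powr p) \<partial>M) <= ennreal (B powr p)"
  using assms(1) by (auto simp: lpb_def)
 have "(\<integral>\<^sup>+x. ennreal (norm (g x) powr p) \<partial>M) = (\<integral>\<^sup>+x. ennreal (c powr p) * ennreal (norm (f x) powr p) \<partial>M)"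
  by (intro nn_integral_cong) (simp add: assms(3,4) powr_mult ennreal_mult')
 also have "\<dots> = ennreal (c powr p) * (\<integral>\<^sup>+x. ennreal (norm (f x) powr p) \<partial>M)"
  using f by (intro nn_integral_cmult) simp
 also have "\<dots> <= ennreal (c powr p) * ennreal (B powr p)" by (intro mult_left_mono le) simp
 also have "\<dots> = ennreal ((c * B) powr p)" using assms(4) f by (simp add: powr_mult ennreal_mult')
 finally show ?thesis using assms f by (auto simp: lpb_def)
qed

lemma lpb_cmult:
 fixes f :: "'a => 'b::{real_normed_field,second_countable_topology}"
 shows "lpb M p f B ==> lpb M p (%x. c * f x) (norm c * B)"
 by (rule lpb_scale[of M p f B]) (auto simp: norm_mult dest: lpb_measurable)

lemma lpb_norm: "lpb M p f B ==> lpb M p (%x. norm (f x)) B"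
 by (auto simp: lpb_def)

lemma lpb_cong_norm:
 fixes g :: "'a => 'c::{real_normed_vector,second_countable_topology}"
 shows "lpb M p f B ==> g \<in> borel_measurable M ==> (!!x. norm (g x) = norm (f x)) ==> lpb M p g B"
 by (auto simp: lpb_def)

text \<open>Common core of Minkowski's and Hoelder's inequalities: divided by their bounds,
  \<open>F\<close> and \<open>H\<close> have integral at most one, hence so does a convex
  combination, and \<open>c\<close> is the factor left over.\<close>

lemma nn_integral_convex_combination_le:
 fixes F H :: "'a => real"
 assumes [measurable]: "F \<in> borel_measurable M" "H \<in> borel_measurable M" and nn: "!!x. 0 <= F x" "!!x. 0 <= H x"
  and F: "(\<integral>\<^sup>+x. F x \<partial>M) <= ennreal a" and H: "(\<integral>\<^sup>+x. H x \<partial>M) <= ennreal b"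
  and ab: "0 < a" "0 < b" "0 <= c" "0 < t" "t < 1" and le: "!!x. G x <= c * (t * (F x / a) + (1 - t) * (H x / b))"
 shows "(\<integral>\<^sup>+x. ennreal (G x) \<partial>M) <= ennreal c"
proof -
 let ?a = "c * t / a" and ?b = "c * (1 - t) / b"
 have "G x <= ?a * F x + ?b * H x" for x using le[of x] by (simp add: distrib_left mult.assoc)
 then have "(\<integral>\<^sup>+x. ennreal (G x) \<partial>M) <= (\<integral>\<^sup>+x. ennreal ?a * F x + ennreal ?b * H x \<partial>M)"
  using ab nn by (intro nn_integral_mono) (simp add: ennreal_leI flip: ennreal_mult ennreal_plus)
 also have "\<dots> <= ennreal ?a * ennreal a + ennreal ?b * ennreal b"
  by (simp add: nn_integral_cmult nn_integral_add) (intro add_mono mult_left_mono F H, auto)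
 also have "\<dots> = ennreal (?a * a + ?b * b)" using ab by (simp add: ennreal_mult'[symmetric] ennreal_plus[symmetric] del: ennreal_plus)
 also have "?a * a + ?b * b = c" using ab by (simp add: right_diff_distrib)
 finally show ?thesis .
qed

lemma convex_on_powr_atLeast_0:
 fixes p :: real
 assumes "1 <= p"
 shows "convex_on {0..} (%x. x powr p)"
proof (rule convex_onI)
 fix t x y :: real assume t: "0 < t" "t < 1" and xy: "x \<in> {0..}" "y \<in> {0..}"
 have le: "(s * z) powr p <= s * z powr p" if "0 < s" "s < 1" "0 <= z" for s z :: real
  using that powr_mono'[of 1 p s] assms by (auto simp: powr_mult intro!: mult_right_mono)
 consider "x = 0" | "y = 0" | "0 < x" "0 < y" using xy by fastforce
 then show "((1 - t) *\<^sub>R x + t *\<^sub>R y) powr p <= (1 - t) * x powr p + t * y powr p"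
 proof cases
  case 3
  then show ?thesis using convex_onD[OF powr_convex, OF assms, of t x y] t by simp
 qed (use le[of t y] le[of "1 - t" x] t xy assms in auto)
qed simp

lemma lpb_add:
 fixes f g :: "'a => 'b::{real_normed_vector,second_countable_topology}"
 assumes p: "1 <= p" and f: "lpb M p f A" and g: "lpb M p g B"
 shows "lpb M p (%x. f x + g x) (A + B)"
proof (rule lpb_limit)
 fix e :: real assume e: "0 < e"
 define a b where "a = A + e/2" and "b = B + e/2"
 have ab: "0 < a" "0 < b" "a + b = A + B + e"
  using e lpb_nonneg[OF f] lpb_nonneg[OF g] by (auto simp: a_def b_def)
 have fa: "lpb M p f a" and gb: "lpb M p g b"
  using lpb_mono[OF f, of a] lpb_mono[OF g, of b] e p by (auto simp: a_def b_def)
 have [measurable]: "f \<in> borel_measurable M" "g \<in> borel_measurable M"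
  using f g by (auto simp: lpb_def)
 \<comment> \<open>These weights bound the norm of \<open>f + g\<close> by \<open>a + b\<close>
   times a convex combination of the normalised norms, to which convexity of the power
   applies.\<close>
 define t where "t = a / (a + b)"
 have t: "0 < t" "t < 1" "(a + b) * t = a" "(a + b) * (1 - t) = b" using ab(1,2) by (auto simp: t_def field_simps)
 have "(\<integral>\<^sup>+x. ennreal (norm (f x + g x) powr p) \<partial>M) <= ennreal ((a + b) powr p)"
 proof (rule nn_integral_convex_combination_le[OF _ _ _ _ lpb_le[OF fa] lpb_le[OF gb] _ _ _ t(1,2)])
  fix x
  let ?f = "norm (f x) / a" and ?g = "norm (g x) / b"
  have "norm (f x + g x) <= (a + b) * t * ?f + (a + b) * (1 - t) * ?g"
   unfolding t(3,4) using ab by (simp add: norm_triangle_ineq)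
  then have "norm (f x + g x) powr p <= ((a + b) * (t * ?f + (1 - t) * ?g)) powr p"
   using p by (intro powr_mono2) (auto simp: distrib_left mult.assoc)
  also have "\<dots> <= (a + b) powr p * (t * ?f powr p + (1 - t) * ?g powr p)"
   using convex_onD[OF convex_on_powr_atLeast_0[OF p], of "1 - t" ?f ?g] ab t by (simp add: powr_mult)
  finally show "norm (f x + g x) powr p <= (a + b) powr p * (t * (norm (f x) powr p / a powr p) + (1 - t) * (norm (g x) powr p / b powr p))"
   using ab by (simp add: powr_divide)
 qed (use ab in auto)
 then show "lpb M p (%x. f x + g x) (A + B + e)" using ab by (auto simp: lpb_def)
qed (use p lpb_nonneg[OF f] lpb_nonneg[OF g] in auto)

lemma lpb_diff:
 fixes f g :: "'a => 'b::{real_normed_vector,second_countable_topology}"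
 assumes "1 <= p" and "lpb M p f A" and g: "lpb M p g B"
 shows "lpb M p (%x. f x - g x) (A + B)"
proof -
 have "lpb M p (%x. - g x) B" using lpb_cong_norm[OF g, of "%x. - g x"] lpb_measurable[OF g] by auto
 from lpb_add[OF assms(1,2) this] show ?thesis by simp
qed

text \<open>Hoelder's inequality for geometric means, from the weighted arithmetic-geometric
  inequality. The bounds are enlarged by \<open>e\<close> so that they may vanish.\<close>

lemma nn_integral_geometric_mean:
 fixes F H :: "'a => real"
 assumes [measurable]: "F \<in> borel_measurable M" "H \<in> borel_measurable M"
  and nn: "!!x. 0 <= F x" "!!x. 0 <= H x"
  and F: "(\<integral>\<^sup>+x. F x \<partial>M) <= ennreal a" and H: "(\<integral>\<^sup>+x. H x \<partial>M) <= ennreal b"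
  and ab: "0 <= a" "0 <= b" and th: "0 < \<theta>" "\<theta> < 1"
 shows "(\<integral>\<^sup>+x. ennreal (F x powr \<theta> * H x powr (1 - \<theta>)) \<partial>M) <= ennreal (a powr \<theta> * b powr (1 - \<theta>))"
proof -
 have *: "(\<integral>\<^sup>+x. ennreal (F x powr \<theta> * H x powr (1 - \<theta>)) \<partial>M) <= ennreal ((a + e) powr \<theta> * (b + e) powr (1 - \<theta>))"
  if e: "0 < e" for e
 proof (rule nn_integral_convex_combination_le[OF assms(1-4) order_trans[OF F] order_trans[OF H] _ _ _ th])
  fix x
  have ae: "0 < a + e" "0 < b + e" using ab e by auto
  have "(F x / (a+e)) powr \<theta> * (H x / (b+e)) powr (1 - \<theta>) <= \<theta> * (F x / (a+e)) + (1 - \<theta>) * (H x / (b+e))"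
   using Youngs_inequality_0[of \<theta> "1-\<theta>" "F x / (a+e)" "H x / (b+e)"] nn[of x] ae th
   by (cases "F x = 0"; cases "H x = 0") auto
  then show "F x powr \<theta> * H x powr (1 - \<theta>) <= (a + e) powr \<theta> * (b + e) powr (1 - \<theta>) * (\<theta> * (F x / (a+e)) + (1 - \<theta>) * (H x / (b+e)))"
   using nn[of x] ae by (simp add: powr_divide divide_le_eq mult.commute)
 qed (use ab e in \<open>auto intro!: ennreal_leI\<close>)
 have "(%n. ennreal ((a + inverse (real (Suc n))) powr \<theta> * (b + inverse (real (Suc n))) powr (1 - \<theta>))) \<longlonglongrightarrow> ennreal ((a + 0) powr \<theta> * (b + 0) powr (1 - \<theta>))"
  by (intro tendsto_ennrealI tendsto_mult tendsto_powr' tendsto_add tendsto_const LIMSEQ_inverse_real_of_nat)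
    (use ab th in auto)
 then have "(\<integral>\<^sup>+x. ennreal (F x powr \<theta> * H x powr (1 - \<theta>)) \<partial>M) <= ennreal ((a + 0) powr \<theta> * (b + 0) powr (1 - \<theta>))"
  by (rule LIMSEQ_lower_bound) (rule *, simp)
 then show ?thesis by simp
qed

lemma lpb_geometric_mean:
 fixes f :: "'a => 'b::{real_normed_vector,second_countable_topology}"
  and h :: "'a => 'c::{real_normed_vector,second_countable_topology}"
 assumes f: "lpb M p f A" and h: "lpb M p h B" and th: "0 < \<theta>" "\<theta> < 1"
 shows "lpb M p (%x. norm (f x) powr \<theta> * norm (h x) powr (1 - \<theta>)) (A powr \<theta> * B powr (1 - \<theta>))"
proof -
 have [measurable]: "f \<in> borel_measurable M" "h \<in> borel_measurable M"
  using f h by (auto simp: lpb_def)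
 have "(\<integral>\<^sup>+x. ennreal ((norm (f x) powr p) powr \<theta> * (norm (h x) powr p) powr (1 - \<theta>)) \<partial>M)
  <= ennreal ((A powr p) powr \<theta> * (B powr p) powr (1 - \<theta>))"
  by (intro nn_integral_geometric_mean lpb_le f h th) auto
 moreover have "((A powr p) powr \<theta> * (B powr p) powr (1 - \<theta>)) = (A powr \<theta> * B powr (1 - \<theta>)) powr p"
  using f h by (simp add: lpb_def powr_powr powr_mult mult.commute)
 moreover have "((norm (f x) powr p) powr \<theta> * (norm (h x) powr p) powr (1 - \<theta>)) = norm (norm (f x) powr \<theta> * norm (h x) powr (1 - \<theta>)) powr p" for x
  by (simp add: powr_powr powr_mult mult.commute)
 ultimately show ?thesis by (simp add: lpb_def)
qed

lemma lpb_powr: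
 fixes f :: "'a => 'b::{real_normed_vector,second_countable_topology}"
 assumes f: "lpb M p f A" and "0 < s" "p = q * s"
 shows "lpb M q (%x. norm (f x) powr s) (A powr s)"
 using assms by (auto simp: lpb_def powr_powr mult.commute)

lemma lpb_holder:
 fixes f :: "'a => 'b::{real_normed_vector,second_countable_topology}"
  and h :: "'a => 'c::{real_normed_vector,second_countable_topology}"
 assumes f: "lpb M p f A" and h: "lpb M q h B" and pq: "1 < p" "1 < q" "1/p + 1/q = 1"
 shows "(\<integral>\<^sup>+x. ennreal (norm (f x) * norm (h x)) \<partial>M) <= ennreal (A * B)"
proof -
 have [measurable]: "f \<in> borel_measurable M" "h \<in> borel_measurable M"
  using f h by (auto simp: lpb_def)
 have q: "1 - 1/p = 1/q" using pq by simp
 have "(\<integral>\<^sup>+x. ennreal ((norm (f x) powr p) powr (1/p) * (norm (h x) powr q) powr (1 - 1/p)) \<partial>M)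
  <= ennreal ((A powr p) powr (1/p) * (B powr q) powr (1 - 1/p))"
  by (intro nn_integral_geometric_mean lpb_le f h) (use pq in auto)
 then show ?thesis using pq lpb_nonneg[OF f] lpb_nonneg[OF h]
  unfolding q by (simp add: powr_powr)
qed

lemma lpb_Fatou:
 fixes f :: "nat => 'a => 'b::{real_normed_vector,second_countable_topology}"
 assumes f: "!!n. lpb M p (f n) B" and [measurable]: "g \<in> borel_measurable M" and p: "0 < p"
  and lim: "AE x in M. (%n. f n x) \<longlonglongrightarrow> g x"
 shows "lpb M p g B"
proof -
 have [measurable]: "f n \<in> borel_measurable M" for n using f[of n] by (auto simp: lpb_def)
 have "(\<integral>\<^sup>+x. ennreal (norm (g x) powr p) \<partial>M) = (\<integral>\<^sup>+x. liminf (%n. ennreal (norm (f n x) powr p)) \<partial>M)"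
 proof (intro nn_integral_cong_AE AE_mp[OF lim AE_I2] impI)
  fix x assume "(%n. f n x) \<longlonglongrightarrow> g x"
  then have "(%n. ennreal (norm (f n x) powr p)) \<longlonglongrightarrow> ennreal (norm (g x) powr p)"
   using p by (intro tendsto_ennrealI tendsto_powr' tendsto_norm tendsto_const) auto
  then show "ennreal (norm (g x) powr p) = liminf (%n. ennreal (norm (f n x) powr p))"
   by (intro lim_imp_Liminf[symmetric]) auto
 qed
 also have "\<dots> <= liminf (%n. \<integral>\<^sup>+x. ennreal (norm (f n x) powr p) \<partial>M)"
  by (intro nn_integral_liminf) simp
 also have "\<dots> <= liminf (%n. ennreal (B powr p))"
  by (intro Liminf_mono always_eventually allI lpb_le f)
 also have "\<dots> = ennreal (B powr p)" by (simp add: Liminf_const)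
 finally show ?thesis using lpb_nonneg[OF f[of 0]] by (auto simp: lpb_def)
qed

section \<open>Power integrals on the line and the layer cake formula\<close>

lemma nn_integral_powr_0:
 assumes "0 < a" "0 <= m"
 shows "(NN l. ennreal (a * l powr (a - 1)) * indicator {0<..<m} l) = ennreal (m powr a)"
proof -
 have "((%x. a * x powr (a-1)) has_integral a * (m powr (a-1+1) / (a-1+1))) {0..m}"
  by (intro has_integral_mult_right has_integral_powr_from_0) (use assms in auto)
 then have "(NN x. ennreal (a * x powr (a-1)) * indicator {0..m} x) = ennreal (m powr a)"
  using assms nn_integral_has_integral_lebesgue'[of "{0..m}" "%x. a * x powr (a-1)"] by simp
 moreover have "(NN x. ennreal (a * x powr (a-1)) * indicator {0..m} x) = (NN x. ennreal (a * x powr (a-1)) * indicator {0<..<m} x)"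
  using AE_lborel_singleton[of 0] AE_lborel_singleton[of m]
  by (intro nn_integral_cong_AE) (auto simp: indicator_def elim!: eventually_elim2)
 ultimately show ?thesis by simp
qed

lemma (in sigma_finite_measure) nn_integral_layer_cake:
 fixes f :: "'a => real"
 assumes [measurable]: "f \<in> borel_measurable M" and "!!x. 0 <= f x" and a: "0 < a"
 shows "(\<integral>\<^sup>+x. ennreal (f x powr a) \<partial>M) =
  (NN l. ennreal (a * l powr (a - 1)) * indicator {0<..} l * emeasure M {x\<in>space M. l < f x})"
proof -
 interpret pair_sigma_finite M "lborel :: real measure" ..
 have "(\<integral>\<^sup>+x. ennreal (f x powr a) \<partial>M) =
  (\<integral>\<^sup>+x. (NN l. ennreal (a * l powr (a - 1)) * indicator {0<..<f x} l) \<partial>M)"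
  by (intro nn_integral_cong) (simp add: nn_integral_powr_0 assms)
 also have "\<dots> = (\<integral>\<^sup>+x. (NN l. ennreal (a * l powr (a - 1)) * (if 0 < l \<and> l < f x then 1 else 0)) \<partial>M)"
  by (intro nn_integral_cong) (auto simp: indicator_def)
 also have "\<dots> = (NN l. (\<integral>\<^sup>+x. ennreal (a * l powr (a - 1)) * (if 0 < l \<and> l < f x then 1 else 0) \<partial>M))"
  by (intro Fubini'[symmetric]) measurable
 also have "\<dots> = (NN l. (\<integral>\<^sup>+x. ennreal (a * l powr (a - 1)) * indicator {0<..} l * indicator {x\<in>space M. l < f x} x \<partial>M))"
  by (intro nn_integral_cong) (auto simp: indicator_def)
 also have "\<dots> = (NN l. ennreal (a * l powr (a - 1)) * indicator {0<..} l * emeasure M {x\<in>space M. l < f x})"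
  by (intro nn_integral_cong) (simp add: nn_integral_cmult)
 finally show ?thesis .
qed

lemma nn_integral_powr_0':
 assumes "0 < a" "0 <= m"
 shows "(NN l. ennreal (a * l powr (a - 1)) * indicator {0<..m} l) = ennreal (m powr a)"
proof -
 have "(NN x. ennreal (a * x powr (a-1)) * indicator {0<..m} x) = (NN x. ennreal (a * x powr (a-1)) * indicator {0<..<m} x)"
  using AE_lborel_singleton[of m]
  by (intro nn_integral_cong_AE) (auto simp: indicator_def elim!: eventually_mono)
 then show ?thesis using nn_integral_powr_0[OF assms] by simp
qed

lemma nn_integral_even:
 fixes g :: "real => ennreal"
 assumes [measurable]: "bm g" and even: "!!s. g (- s) = g s"
 shows "(NN s. g s) = 2 * (NN s. g s * indicator {0<..} s)"
proof -
 have "(NN s. g s) = (NN s. g s * indicator {0<..} s + g s * indicator {..<0} s)"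
  using AE_lborel_singleton[of 0]
  by (intro nn_integral_cong_AE) (auto simp: indicator_def elim!: eventually_mono)
 also have "\<dots> = (NN s. g s * indicator {0<..} s) + (NN s. g s * indicator {..<0} s)"
  by (intro nn_integral_add) auto
 also have "(NN s. g s * indicator {..<0} s) = (NN s. g s * indicator {0<..} s)"
  by (subst nn_integral_real_affine[where c="-1" and t=0]) (auto simp: even indicator_def intro!: nn_integral_cong)
 finally show ?thesis by (simp add: mult_2)
qed

lemma nn_integral_riesz_near:
 assumes g: "0 < g" "g < 1" and R: "0 < R"
 shows "(NN s. ennreal (abs (t - s) powr (- g)) * indicator {s. abs (t - s) < R} s) = ennreal (2 / (1 - g) * R powr (1 - g))"
proof -
 have "(NN s. ennreal (abs (t - s) powr (- g)) * indicator {s. abs (t - s) < R} s)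
  = (NN s. ennreal (abs s powr (- g)) * indicator {s. abs s < R} s)"
  by (subst nn_integral_real_affine[where c="-1" and t=t]) (auto simp: indicator_def intro!: nn_integral_cong)
 also have "\<dots> = 2 * (NN s. ennreal (abs s powr (- g)) * indicator {s. abs s < R} s * indicator {0<..} s)"
  by (intro nn_integral_even) (auto simp: indicator_def)
 also have "(NN s. ennreal (abs s powr (- g)) * indicator {s. abs s < R} s * indicator {0<..} s)
   = (NN s. ennreal (1 / (1 - g)) * (ennreal ((1 - g) * s powr ((1 - g) - 1)) * indicator {0<..<R} s))"
  using g by (intro nn_integral_cong) (auto simp: indicator_def ennreal_mult'[symmetric])
 also have "\<dots> = ennreal (1 / (1 - g)) * ennreal (R powr (1 - g))"
  using g R nn_integral_powr_0[of "1 - g" R] by (subst nn_integral_cmult) auto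
 also have "2 * \<dots> = ennreal (2 / (1 - g) * R powr (1 - g))"
  using g by (simp add: ennreal_mult'[symmetric] flip: ennreal_numeral)
 finally show ?thesis .
qed

lemma nn_integral_riesz_far:
 assumes R: "0 < R"
 shows "(NN s. ennreal (abs (t - s) powr (- 2)) * indicator {s. R <= abs (t - s)} s) = ennreal (2 / R)"
proof -
 have "(NN s. ennreal (abs (t - s) powr (- 2)) * indicator {s. R <= abs (t - s)} s)
  = (NN s. ennreal (abs s powr (- 2)) * indicator {s. R <= abs s} s)"
  by (subst nn_integral_real_affine[where c="-1" and t=t]) (auto simp: indicator_def intro!: nn_integral_cong)
 also have "\<dots> = 2 * (NN s. ennreal (abs s powr (- 2)) * indicator {s. R <= abs s} s * indicator {0<..} s)"
  by (intro nn_integral_even) (auto simp: indicator_def)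
 also have "(NN s. ennreal (abs s powr (- 2)) * indicator {s. R <= abs s} s * indicator {0<..} s)
   = (NN s. ennreal (inverse (s^2)) * indicator {R..} s)"
  using R by (intro nn_integral_cong) (auto simp: indicator_def powr_minus powr_numeral)
 also have "\<dots> = ennreal (0 - (- inverse R))"
 proof (intro nn_integral_FTC_atLeast)
  show "((%x. - inverse x) has_real_derivative inverse (x^2)) (at x)" if "R <= x" for x :: real
   using R that by (auto intro!: derivative_eq_intros simp: power2_eq_square)
  show "((%x::real. - inverse x) \<longlongrightarrow> 0) at_top"
   using tendsto_minus[OF tendsto_inverse_0_at_top[OF filterlim_ident]] by simp
 qed auto
 also have "2 * \<dots> = ennreal (2 / R)"
  using R by (simp add: ennreal_mult'[symmetric] divide_inverse flip: ennreal_numeral)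
 finally show ?thesis .
qed

section \<open>Interpolation and the Hardy--Littlewood--Sobolev inequality\<close>

text \<open>Real interpolation between a bound from L^1 to L^infinity with constant \<open>A\<close>
  and an L^2 contraction. At level \<open>l\<close> the function is cut at a height
  \<open>h l\<close> for which the large part maps below \<open>l / 2\<close>; the level set of
  \<open>T f\<close> is then controlled by the small part and Chebyshev's inequality in L^2, and the
  layer cake formula sums over \<open>l\<close>. Additivity is asked for the cuts of
  \<open>f\<close> only, because a convolution integral is additive only where it converges.\<close>

lemma marcinkiewicz_L1_Linfinity:
 fixes f :: "'a => complex" and T :: "('a => complex) => 'b => complex"
 assumes M: "sigma_finite_measure M" and M': "sigma_finite_measure M'"
  and b: "2 < b" "a = b / (b - 1)"
  and [measurable]: "f \<in> borel_measurable M" "T f \<in> borel_measurable M'"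
  and norm1: "(\<integral>\<^sup>+x. ennreal (norm (f x) powr a) \<partial>M) <= 1"
  and A: "0 < A"
  and split: "!!h y. 0 < h ==> T f y = T (%x. if h < norm (f x) then f x else 0) y + T (%x. if h < norm (f x) then 0 else f x) y"
  and big: "!!h y. 0 < h ==> ennreal (norm (T (%x. if h < norm (f x) then f x else 0) y)) <=
    ennreal A * (\<integral>\<^sup>+x. ennreal (norm (if h < norm (f x) then f x else 0)) \<partial>M)"
  and small_measurable: "!!h. 0 < h ==> T (%x. if h < norm (f x) then 0 else f x) \<in> borel_measurable M'"
  and small: "!!h. 0 < h ==> (\<integral>\<^sup>+y. ennreal ((norm (T (%x. if h < norm (f x) then 0 else f x) y))^2) \<partial>M') <=
    (\<integral>\<^sup>+x. ennreal ((norm (if h < norm (f x) then 0 else f x))^2) \<partial>M)"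
 shows "(\<integral>\<^sup>+y. ennreal (norm (T f y) powr b) \<partial>M') <= ennreal (4 * b / (b - 2) * (2 * A) powr (b - 2))"
proof -
 interpret M: sigma_finite_measure M by fact
 interpret M': sigma_finite_measure M' by fact
 interpret pair_sigma_finite M "lborel :: real measure" ..
 have a: "1 < a" "a < 2" "(b - 1) * (1 - a) = -1" "a - 1 = 1 / (b - 1)" "2 - (a - 1) * (b - 2) = a"
  using b(1) unfolding b(2) by (auto simp: divide_simps algebra_simps)
 \<comment> \<open>The solution of \<open>A * h powr (1 - a) = l / 2\<close>: by
   \<open>norm1\<close> the part of \<open>f\<close> above height \<open>h\<close> has L^1 norm at
   most \<open>h powr (1 - a)\<close>.\<close>
 define h where "h l = (2 * A / l) powr (b - 1)" for l
 have h_pos: "0 < h l" if "0 < l" for l using that A by (simp add: h_def)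
 have weak: "emeasure M' {y\<in>space M'. l < norm (T f y)} <=
   ennreal (4 / l^2) * (\<integral>\<^sup>+x. ennreal ((norm (if h l < norm (f x) then 0 else f x))^2) \<partial>M)" if l: "0 < l" for l
 proof -
  let ?big = "%x. if h l < norm (f x) then f x else 0"
  let ?small = "%x. if h l < norm (f x) then 0 else f x"
  note [measurable] = small_measurable[OF h_pos[OF l]]
  have "(\<integral>\<^sup>+x. ennreal (norm (?big x)) \<partial>M) <= (\<integral>\<^sup>+x. ennreal (h l powr (1 - a)) * ennreal (norm (f x) powr a) \<partial>M)"
  proof (intro nn_integral_mono)
   fix x
   have "norm (f x) <= h l powr (1 - a) * norm (f x) powr a" if "h l < norm (f x)"
   proof -
    have "norm (f x) = norm (f x) powr (1 - a) * norm (f x) powr a"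
     using that h_pos[OF l] by (simp flip: powr_add)
    also have "\<dots> <= h l powr (1 - a) * norm (f x) powr a"
     using that h_pos[OF l] a by (intro mult_right_mono powr_mono2') auto
    finally show ?thesis .
   qed
   then show "ennreal (norm (?big x)) <= ennreal (h l powr (1 - a)) * ennreal (norm (f x) powr a)"
    by (auto simp flip: ennreal_mult')
  qed
  also have "\<dots> = ennreal (h l powr (1 - a)) * (\<integral>\<^sup>+x. ennreal (norm (f x) powr a) \<partial>M)"
   by (rule nn_integral_cmult) measurable
  also have "\<dots> <= ennreal (h l powr (1 - a)) * 1"
   by (intro mult_left_mono norm1) simp
  also have "h l powr (1 - a) = l / (2 * A)"
   using l A a by (simp add: h_def powr_powr powr_minus)
  finally have bigI: "(\<integral>\<^sup>+x. ennreal (norm (?big x)) \<partial>M) <= ennreal (l / (2 * A))" by simp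
  have bigl: "norm (T ?big y) <= l / 2" for y
  proof -
   have "ennreal (norm (T ?big y)) <= ennreal A * ennreal (l / (2 * A))"
    by (rule order_trans[OF big[OF h_pos[OF l]]]) (intro mult_left_mono bigI, simp)
   also have "\<dots> = ennreal (l / 2)" using A l by (simp flip: ennreal_mult')
   finally show ?thesis using l by simp
  qed
  have sub: "{y\<in>space M'. l < norm (T f y)} \<subseteq> {y\<in>space M'. (l/2)^2 <= (norm (T ?small y))^2}"
  proof safe
   fix y assume "l < norm (T f y)"
   also have "\<dots> <= norm (T ?big y) + norm (T ?small y)"
    unfolding split[OF h_pos[OF l], of y] by (rule norm_triangle_ineq)
   finally have "l / 2 <= norm (T ?small y)" using bigl[of y] by simp
   then show "(l/2)^2 <= (norm (T ?small y))^2" using l by (intro power_mono) auto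
  qed
  have "emeasure M' {y\<in>space M'. l < norm (T f y)} <= emeasure M' {y\<in>space M'. (l/2)^2 <= (norm (T ?small y))^2}"
   by (intro emeasure_mono sub) measurable
  also have "\<dots> = emeasure M' ({y\<in>space M'. 1 <= ennreal (4/l^2) * ennreal ((norm (T ?small y))^2)})"
   using l by (intro arg_cong2[where f=emeasure]) (auto simp: field_simps power_divide simp flip: ennreal_mult')
  also have "\<dots> <= ennreal (4/l^2) * (\<integral>\<^sup>+y. ennreal ((norm (T ?small y))^2) * indicator (space M') y \<partial>M')"
   using nn_integral_Markov_inequality[of "%y. ennreal ((norm (T ?small y))^2)" "space M'" M' "ennreal (4/l^2)"] by simp
  also have "(\<integral>\<^sup>+y. ennreal ((norm (T ?small y))^2) * indicator (space M') y \<partial>M') = (\<integral>\<^sup>+y. ennreal ((norm (T ?small y))^2) \<partial>M')"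
   by (intro nn_integral_cong) auto
  also have "ennreal (4/l^2) * \<dots> <= ennreal (4/l^2) * (\<integral>\<^sup>+x. ennreal ((norm (?small x))^2) \<partial>M)"
   by (intro mult_left_mono small h_pos l) simp
  finally show ?thesis .
 qed
 have inner: "(NN l. ennreal (b * l powr (b - 1)) * indicator {0<..} l * (ennreal (4 / l^2) * ennreal ((norm (if h l < norm (f x) then 0 else f x))^2)))
   <= ennreal (4 * b / (b - 2) * (2 * A) powr (b - 2)) * ennreal (norm (f x) powr a)" for x
 proof (cases "f x = 0")
  case False
  \<comment> \<open>The largest level at which the value \<open>f x\<close> still belongs to the
    small part, so the integral over levels stops at \<open>m\<close>.\<close>
  define m where "m = 2 * A * norm (f x) powr (- (a - 1))"
  have m: "0 < m" using False A by (simp add: m_def)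
  have hl: "l <= m" if "0 < l" "norm (f x) <= h l" for l
  proof -
   have "norm (f x) powr (1 / (b - 1)) <= h l powr (1 / (b-1))"
    using that b by (intro powr_mono2) auto
   also have "\<dots> = 2 * A / l" using that A b by (simp add: h_def powr_powr)
   finally show ?thesis using that False A unfolding a(4) m_def
    by (simp add: powr_minus field_simps)
  qed
  have "(NN l. ennreal (b * l powr (b - 1)) * indicator {0<..} l * (ennreal (4 / l^2) * ennreal ((norm (if h l < norm (f x) then 0 else f x))^2)))
   <= (NN l. ennreal (4 * b / (b - 2) * (norm (f x))^2) * (ennreal ((b - 2) * l powr (b - 2 - 1)) * indicator {0<..m} l))"
  proof (intro nn_integral_mono)
   fix l :: real
   show "ennreal (b * l powr (b - 1)) * indicator {0<..} l * (ennreal (4 / l^2) * ennreal ((norm (if h l < norm (f x) then 0 else f x))^2))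
     <= ennreal (4 * b / (b - 2) * (norm (f x))^2) * (ennreal ((b - 2) * l powr (b - 2 - 1)) * indicator {0<..m} l)"
   proof (cases "0 < l \<and> norm (f x) <= h l")
    case True
    then have "l powr (b - 1) = l powr (b - 2 - 1) * l^2"
     by (simp add: powr_add[symmetric] flip: powr_numeral)
    moreover have "b * (l powr (b - 2 - 1) * l^2) * (4 / l^2 * (norm (f x))^2) =
      4 * b / (b - 2) * (norm (f x))^2 * ((b - 2) * l powr (b - 2 - 1))"
     using True b by simp
    ultimately have "ennreal (b * l powr (b - 1)) * (ennreal (4 / l^2) * ennreal ((norm (f x))^2)) =
      ennreal (4 * b / (b - 2) * (norm (f x))^2) * ennreal ((b - 2) * l powr (b - 2 - 1))"
     using b by (simp only: ennreal_mult[symmetric] zero_le_power2 zero_le_mult_iff powr_ge_zero) 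
       (simp add: ennreal_mult[symmetric])
    then show ?thesis using True hl[of l] by (simp add: indicator_def)
   qed (auto simp: indicator_def)
  qed
  also have "\<dots> = ennreal (4 * b / (b - 2) * (norm (f x))^2) * ennreal (m powr (b - 2))"
   using b m nn_integral_powr_0'[of "b - 2" m] by (subst nn_integral_cmult) auto
  also have "m powr (b - 2) = (2 * A) powr (b - 2) * norm (f x) powr (- (a - 1) * (b - 2))"
   using A by (simp add: m_def powr_mult powr_powr)
  also have "ennreal (4 * b / (b - 2) * (norm (f x))^2) * ennreal ((2 * A) powr (b - 2) * norm (f x) powr (- (a - 1) * (b - 2)))
    = ennreal (4 * b / (b - 2) * (2 * A) powr (b - 2) * ((norm (f x)) powr 2 * norm (f x) powr (- (a - 1) * (b - 2))))"
   using b False by (subst ennreal_mult'[symmetric]) (auto simp: ac_simps)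
  also have "(norm (f x)) powr 2 * norm (f x) powr (- (a - 1) * (b - 2)) = norm (f x) powr a"
   unfolding powr_add[symmetric] using a(5) by (simp only: mult_minus_left flip: diff_conv_add_uminus)
  also have "ennreal (4 * b / (b - 2) * (2 * A) powr (b - 2) * norm (f x) powr a) =
    ennreal (4 * b / (b - 2) * (2 * A) powr (b - 2)) * ennreal (norm (f x) powr a)"
   by (rule ennreal_mult'') simp
  finally show ?thesis .
 qed (simp cong: if_cong)
 have hm[measurable]: "bm h" by (simp add: h_def[abs_def])
 have "(\<integral>\<^sup>+y. ennreal (norm (T f y) powr b) \<partial>M') = (NN l. ennreal (b * l powr (b - 1)) * indicator {0<..} l * emeasure M' {y\<in>space M'. l < norm (T f y)})"
  using b by (intro M'.nn_integral_layer_cake) auto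
 also have "\<dots> <= (NN l. ennreal (b * l powr (b - 1)) * indicator {0<..} l * (ennreal (4 / l^2) * (\<integral>\<^sup>+x. ennreal ((norm (if h l < norm (f x) then 0 else f x))^2) \<partial>M)))"
  by (intro nn_integral_mono) (auto simp: indicator_def intro!: mult_left_mono weak)
 also have "\<dots> = (NN l. (\<integral>\<^sup>+x. ennreal (b * l powr (b - 1)) * indicator {0<..} l * (ennreal (4 / l^2) * ennreal ((norm (if h l < norm (f x) then 0 else f x))^2)) \<partial>M))"
  by (simp add: nn_integral_cmult)
 also have "\<dots> = (\<integral>\<^sup>+x. (NN l. ennreal (b * l powr (b - 1)) * indicator {0<..} l * (ennreal (4 / l^2) * ennreal ((norm (if h l < norm (f x) then 0 else f x))^2))) \<partial>M)"
  by (intro Fubini') measurable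
 also have "\<dots> <= (\<integral>\<^sup>+x. ennreal (4 * b / (b - 2) * (2 * A) powr (b - 2)) * ennreal (norm (f x) powr a) \<partial>M)"
  by (intro nn_integral_mono inner)
 also have "\<dots> = ennreal (4 * b / (b - 2) * (2 * A) powr (b - 2)) * (\<integral>\<^sup>+x. ennreal (norm (f x) powr a) \<partial>M)"
  by (rule nn_integral_cmult) measurable
 also have "\<dots> <= ennreal (4 * b / (b - 2) * (2 * A) powr (b - 2)) * 1"
  by (intro mult_left_mono norm1) simp
 finally show ?thesis by simp
qed

text \<open>The kernel is split at a distance \<open>R\<close>: nearby the truncation bounds the
  factor by \<open>x\<close>; far away Hoelder's inequality applies, since the \<open>b\<close>-th
  power of the kernel is \<open>abs (t - s) powr (- 2)\<close>, which is integrable at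
  infinity.\<close>

lemma nn_integral_riesz_truncated:
 fixes h :: "real => real"
 assumes b: "2 < b" "a = b / (b - 1)" "g = 2 / b" and h: "lpb lborel a h 1" "!!t. 0 <= h t" and x: "0 <= x"
 shows "(NN s. ennreal (abs (t - s) powr (- g) * min (h s) x)) <= ennreal ((2 / (1 - g) + 2 powr (1 / b)) * x powr (a - 1))"
proof (cases "x = 0")
 case False
 have g: "0 < g" "g < 1" and a: "1 < a" "1 / a + 1 / b = 1" "1 - a * (1 - g) = a - 1" "a / b = a - 1"
  using b(1) unfolding b(2,3) by (auto simp: divide_simps algebra_simps)
 \<comment> \<open>The distance at which both contributions scale like
   \<open>x powr (a - 1)\<close>.\<close>
 define R where "R = x powr (- a)"
 have R: "0 < R" using x False by (simp add: R_def)
 have [measurable]: "bm h" using h by (simp add: lpb_def)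
 let ?near = "%s. ennreal (abs (t - s) powr (- g)) * indicator {s. abs (t - s) < R} s"
 let ?far = "%s. abs (t - s) powr (- g) * indicator {s. R <= abs (t - s)} s"
 have "(NN s. ennreal (norm (?far s) powr b)) = (NN s. ennreal (abs (t - s) powr (- 2)) * indicator {s. R <= abs (t - s)} s)"
  using b by (intro nn_integral_cong) (auto simp: indicator_def powr_powr)
 also have "\<dots> = ennreal (((2 / R) powr (1 / b)) powr b)" unfolding nn_integral_riesz_far[OF R] powr_powr using b R by simp
 finally have "lpb lborel b ?far ((2 / R) powr (1 / b))" by (simp add: lpb_def)
 note H = lpb_holder[OF h(1) this]
 have "(2 / R) powr (1 / b) = 2 powr (1 / b) * x powr (a / b)"
  using x False by (simp add: R_def powr_minus powr_mult powr_powr divide_inverse)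
 with H a b(1) h(2) have far: "(NN s. ennreal (h s * ?far s)) <= ennreal (2 powr (1 / b) * x powr (a - 1))"
  by (simp add: abs_mult del: divide_powr_uminus)
 have "(NN s. ennreal (abs (t - s) powr (- g) * min (h s) x)) <= (NN s. ennreal x * ?near s + ennreal (h s * ?far s))"
  using x h(2) by (intro nn_integral_mono) (auto simp: indicator_def mult.commute[of _ "_ powr _"] simp flip: ennreal_mult' intro!: ennreal_leI mult_left_mono)
 also have "\<dots> = ennreal x * ennreal (2 / (1 - g) * R powr (1 - g)) + (NN s. ennreal (h s * ?far s))"
  by (simp add: nn_integral_add nn_integral_cmult nn_integral_riesz_near[OF g R])
 also have "\<dots> <= ennreal (2 / (1 - g) * x powr (a - 1)) + ennreal (2 powr (1 / b) * x powr (a - 1))"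
 proof (intro add_mono far)
  have "x * R powr (1 - g) = x powr (a - 1)"
   unfolding R_def powr_powr a(3)[symmetric] using x False by (simp add: powr_diff powr_minus_divide)
  from arg_cong[OF this, of "%y. ennreal (2 / (1 - g) * y)"]
  show "ennreal x * ennreal (2 / (1 - g) * R powr (1 - g)) <= ennreal (2 / (1 - g) * x powr (a - 1))"
   using x by (simp only: ennreal_mult'[symmetric] mult.left_commute order_refl)
 qed
 also have "\<dots> = ennreal ((2 / (1 - g) + 2 powr (1 / b)) * x powr (a - 1))" using g by (simp add: distrib_right flip: ennreal_plus)
 finally show ?thesis .
qed (use h in \<open>simp add: min_absorb2\<close>)

text \<open>Since \<open>f h <= f min h f + h min f h\<close>, only the Riesz potential of a truncation at the height of the other factor is needed.\<close>

lemma hardy_littlewood_sobolev: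
 fixes a b g :: real
 assumes b: "2 < b" "a = b / (b - 1)" "g = 2 / b"
 obtains C where "0 < C" and "!!f h A B. lpb lborel a f A ==> lpb lborel a h B ==>
   (NN t. (NN s. ennreal (abs (t - s) powr (- g) * abs (f s) * abs (h t)))) <= ennreal (C * A * B)"
proof -
 define C where "C = 2 / (1 - g) + 2 powr (1 / b)"
 have C: "0 < C" using b(1) unfolding C_def b(3) by (intro add_pos_pos) (auto simp: field_simps)
 have a: "1 < a" using b(1) unfolding b(2) by (simp add: field_simps)
 \<comment> \<open>Truncating at height \<open>h t\<close>, the inner integral is of order
   \<open>h t * h t powr (a - 1)\<close>, whose integral is that of the normalised
   \<open>a\<close>-th power.\<close>
 have half: "(NN t. (NN s. ennreal (h t * (abs (t - s) powr (- g) * min (f s) (h t))))) <= ennreal C"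
  if f: "lpb lborel a f 1" "!!s. 0 <= f s" and h: "lpb lborel a h 1" "!!s. 0 <= h s" for f h :: "real => real"
 proof -
  have [measurable]: "bm f" "bm h" using f h by (auto simp: lpb_def)
  have "(NN t. (NN s. ennreal (h t * (abs (t - s) powr (- g) * min (f s) (h t))))) <= (NN t. ennreal C * ennreal (norm (h t) powr a))"
  proof (intro nn_integral_mono)
   fix t
   have "(NN s. ennreal (h t * (abs (t - s) powr (- g) * min (f s) (h t)))) <= ennreal (h t) * ennreal (C * h t powr (a - 1))"
    using nn_integral_riesz_truncated[OF b f h(2)] h(2) by (simp add: ennreal_mult' nn_integral_cmult mult_left_mono C_def)
   also have "\<dots> = ennreal C * ennreal (norm (h t) powr a)"
    using h(2)[of t] C by (cases "h t = 0") (simp_all add: powr_diff mult.commute flip: ennreal_mult')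
   finally show "(NN s. ennreal (h t * (abs (t - s) powr (- g) * min (f s) (h t)))) <= ennreal C * ennreal (norm (h t) powr a)" .
  qed
  also have "\<dots> <= ennreal C * 1" using lpb_le[OF h(1)] by (subst nn_integral_cmult) (auto intro!: mult_left_mono simp del: mult_1_right real_norm_def)
  finally show ?thesis by simp
 qed
 have pos: "(NN t. (NN s. ennreal (abs (t - s) powr (- g) * abs (f s) * abs (h t)))) <= ennreal (2 * C * A * B)"
  if f: "lpb lborel a f A" and h: "lpb lborel a h B" and A: "0 < A" "0 < B" for f h :: "real => real" and A B
 proof -
  have [measurable]: "bm f" "bm h" using f h by (auto simp: lpb_def)
  define F H where "F s = abs (f s) / A" and "H s = abs (h s) / B" for s
  have F: "lpb lborel a F 1" "0 <= F s" and H: "lpb lborel a H 1" "0 <= H s" for s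
   using lpb_scale[OF f, of F "1 / A"] lpb_scale[OF h, of H "1 / B"] A by (auto simp: F_def[abs_def] H_def[abs_def])
  have [measurable]: "bm F" "bm H" using F H by (auto simp: lpb_def)
  let ?k = "%F H t s. ennreal (H t * (abs (t - s) powr (- g) * min (F s) (H t)))"
  have "(NN t. (NN s. ennreal (abs (t - s) powr (- g) * abs (f s) * abs (h t)))) <= (NN t. (NN s. ennreal (A * B) * (?k F H t s + ?k H F s t)))"
  proof (intro nn_integral_mono)
   fix t s
   have "abs (t - s) powr (- g) * abs (f s) * abs (h t) <= (A * B) * (H t * (abs (t - s) powr (- g) * min (F s) (H t)) + F s * (abs (s - t) powr (- g) * min (H t) (F s)))"
    using A by (auto simp: F_def H_def min_def abs_minus_commute field_simps)
   then show "ennreal (abs (t - s) powr (- g) * abs (f s) * abs (h t)) <= ennreal (A * B) * (?k F H t s + ?k H F s t)"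
    using A F(2) H(2) by (simp add: ennreal_leI flip: ennreal_mult' ennreal_plus)
  qed
  also have "\<dots> = ennreal (A * B) * ((NN t. (NN s. ?k F H t s)) + (NN t. (NN s. ?k H F s t)))"
   by (simp add: nn_integral_cmult nn_integral_add)
  also have "(NN t. (NN s. ?k H F s t)) = (NN s. (NN t. ?k H F s t))" by (rule lborel_pair.Fubini') measurable
  also have "ennreal (A * B) * ((NN t. (NN s. ?k F H t s)) + (NN s. (NN t. ?k H F s t))) <= ennreal (A * B) * (ennreal C + ennreal C)"
   by (intro mult_left_mono add_mono half F H) auto
  also have "\<dots> = ennreal (2 * C * A * B)" using A C by (simp add: ac_simps flip: ennreal_mult' ennreal_plus)
  finally show ?thesis .
 qed
 show ?thesis
 proof (rule that[of "2 * C"])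
  fix f h :: "real => real" and A B assume f: "lpb lborel a f A" and h: "lpb lborel a h B"
  let ?i = "%n. inverse (real (Suc n))"
  have "(%n. ennreal (2 * C * (A + ?i n) * (B + ?i n))) \<longlonglongrightarrow> ennreal (2 * C * (A + 0) * (B + 0))"
   by (intro tendsto_ennrealI tendsto_mult tendsto_add tendsto_const LIMSEQ_inverse_real_of_nat)
  then have "(NN t. (NN s. ennreal (abs (t - s) powr (- g) * abs (f s) * abs (h t)))) <= ennreal (2 * C * (A + 0) * (B + 0))"
   by (rule LIMSEQ_lower_bound)
     (use lpb_nonneg[OF f] lpb_nonneg[OF h] a in \<open>auto intro!: pos lpb_mono[OF f] lpb_mono[OF h] add_nonneg_pos\<close>)
  then show "(NN t. (NN s. ennreal (abs (t - s) powr (- g) * abs (f s) * abs (h t)))) <= ennreal (2 * C * A * B)" by simp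
 qed (use C in simp)
qed

section \<open>Gaussian kernels\<close>

lemma lborel_distr_reflect: "distr lborel borel (%y::'a::euclidean_space. x - y) = lborel"
proof -
 have "(lborel :: 'a measure) = density (distr lborel borel (%y. x + (-1) *\<^sub>R y)) (%_. ennreal (abs (- 1 :: real) ^ DIM('a)))"
  using lborel_affine[of "-1" x] by simp
 then show ?thesis by (simp add: density_1)
qed

lemma nn_integral_reflect:
 fixes f :: "'a::euclidean_space => ennreal"
 assumes [measurable]: "bm f"
 shows "(NN y. f (x - y)) = (NN y. f y)"
 by (subst (2) lborel_distr_reflect[of x, symmetric]) (simp add: nn_integral_distr)

lemma nn_integral_translate:
 fixes f :: "'a::euclidean_space => ennreal"
 assumes [measurable]: "bm f"
 shows "(NN y. f (x + y)) = (NN y. f y)"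
 by (subst (2) lborel_distr_plus[of x, symmetric]) (simp add: nn_integral_distr)

lemma integral_reflect_translate:
 fixes f :: "'a::euclidean_space => 'b::{banach,second_countable_topology}"
 assumes [measurable]: "bm f"
 shows "(LL y. f (x - y)) = (LL y. f y)"
 by (subst (2) lborel_distr_reflect[of x, symmetric]) (simp add: integral_distr)

lemma integral_translate:
 fixes f :: "'a::euclidean_space => 'b::{banach,second_countable_topology}"
 assumes [measurable]: "bm f"
 shows "(LL y. f (x + y)) = (LL y. f y)"
 by (subst (2) lborel_distr_plus[of x, symmetric]) (simp add: integral_distr)

lemma integrable_translate:
 fixes f :: "'a::euclidean_space => 'b::{banach,second_countable_topology}"
 assumes "integrable lborel f"
 shows "integrable lborel (%y. f (x + y))"
proof -
 have "integrable (distr lborel borel ((+) x)) f" unfolding lborel_distr_plus by fact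
 moreover have "bm f" using assms by auto
 ultimately show ?thesis by (subst (asm) integrable_distr_eq) auto
qed

text \<open>The mean value inequality makes \<open>w\<close> a majorant of all difference quotients,
  so dominated convergence applies along every sequence tending to \<open>z0\<close>.\<close>

lemma has_field_derivative_integral_dominated:
 fixes f f' :: "complex => 'a => complex"
 assumes r: "0 < r"
  and der: "!!z y. z \<in> ball z0 r ==> ((%z. f z y) has_field_derivative f' z y) (at z)"
  and bound: "!!z y. z \<in> ball z0 r ==> norm (f' z y) <= w y"
  and w: "integrable M w"
  and int: "!!z. z \<in> ball z0 r ==> integrable M (f z)"
  and meas: "f' z0 \<in> borel_measurable M"
 shows "((%z. LINT y|M. f z y) has_field_derivative (LINT y|M. f' z0 y)) (at z0)"
proof -
 have z0: "z0 \<in> ball z0 r" using r by simp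
 have "((%z. ((LINT y|M. f z y) - (LINT y|M. f z0 y)) / (z - z0)) \<longlongrightarrow> (LINT y|M. f' z0 y)) (at z0 within ball z0 r)"
  unfolding tendsto_at_iff_sequentially comp_def
 proof safe
  fix X assume X: "\<forall>i. X i \<in> ball z0 r - {z0}" and lim: "X \<longlonglongrightarrow> z0"
  have Xb: "X i \<in> ball z0 r" "X i \<noteq> z0" for i using X by auto
  have eq: "((LINT y|M. f (X i) y) - (LINT y|M. f z0 y)) / (X i - z0) = (LINT y|M. (f (X i) y - f z0 y) / (X i - z0))" for i
   using int[OF Xb(1)] int[OF z0] by simp
  show "(%i. ((LINT y|M. f (X i) y) - (LINT y|M. f z0 y)) / (X i - z0)) \<longlonglongrightarrow> (LINT y|M. f' z0 y)"
   unfolding eq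
  proof (rule integral_dominated_convergence[OF meas _ w])
   show "(%y. (f (X i) y - f z0 y) / (X i - z0)) \<in> borel_measurable M" for i
    using int[OF Xb(1)] int[OF z0] by measurable
   show "AE y in M. (%i. (f (X i) y - f z0 y) / (X i - z0)) \<longlonglongrightarrow> f' z0 y"
   proof (rule AE_I2)
    fix y
    have "((%z. (f z y - f z0 y) / (z - z0)) \<longlongrightarrow> f' z0 y) (at z0)"
     using der[OF z0, of y] by (simp add: has_field_derivative_iff)
    then show "(%i. (f (X i) y - f z0 y) / (X i - z0)) \<longlonglongrightarrow> f' z0 y"
     using Xb(2) lim unfolding tendsto_at_iff_sequentially comp_def by auto
   qed
   show "AE y in M. norm ((f (X i) y - f z0 y) / (X i - z0)) <= w y" for i
   proof (rule AE_I2)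
    fix y
    have "norm (f (X i) y - f z0 y) <= w y * norm (X i - z0)"
     by (rule field_differentiable_bound[of "ball z0 r" "%z. f z y" "%z. f' z y"])
       (use der bound Xb z0 in \<open>auto intro: has_field_derivative_at_within\<close>)
    then show "norm ((f (X i) y - f z0 y) / (X i - z0)) <= w y"
     using Xb(2)[of i] by (simp add: norm_divide field_simps)
   qed
  qed
 qed
 then show ?thesis using r by (simp add: has_field_derivative_iff at_within_open[of z0 "ball z0 r"])
qed

section \<open>Gaussians and heat kernels at complex time\<close>

definition gauss :: "real => 'a::euclidean_space => real" where
 "gauss c x = exp (- c * (norm x)^2)"

lemma gauss_pos: "0 < gauss c x" by (simp add: gauss_def)

lemma gauss_le_1: "0 <= c ==> gauss c x <= 1" by (simp add: gauss_def)

lemma measurable_gauss [measurable]: "bm (gauss c)"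
 unfolding gauss_def[abs_def] by measurable

lemma nn_integral_gauss:
 assumes c: "0 < c"
 shows "(NN x. ennreal (gauss c (x::'a::euclidean_space))) = ennreal ((pi / c) powr (DIM('a) / 2))"
proof -
 have 1: "(NN x. ennreal (exp (- c * (x::real)^2))) = ennreal (sqrt (pi / c))"
 proof -
  define s where "s = sqrt (1 / (2 * c))"
  have s: "0 < s" "s^2 = 1 / (2 * c)" using c by (auto simp: s_def)
  have "exp (- c * x^2) = sqrt (pi / c) * normal_density 0 s x" for x
   using c by (simp add: normal_density_def s(2) real_sqrt_divide field_simps)
  then have "(NN x. ennreal (exp (- c * (x::real)^2))) = (NN x. ennreal (sqrt (pi / c)) * ennreal (normal_density 0 s x))"
   using c by (simp add: ennreal_mult)
  also have "\<dots> = ennreal (sqrt (pi / c)) * (NN x. ennreal (normal_density 0 s x))"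
   by (intro nn_integral_cmult) simp
  also have "(NN x. ennreal (normal_density 0 s x)) = 1"
   using integral_normal_density[OF s(1), of 0] integrable_normal_density[OF s(1), of 0]
   by (subst nn_integral_eq_integral) auto
  finally show ?thesis by simp
 qed
 have "(norm x)^2 = (\<Sum>b\<in>Basis. (x \<bullet> b)^2)" for x :: 'a
  unfolding power2_norm_eq_inner by (subst euclidean_inner) (simp add: power2_eq_square)
 then have "gauss c x = (\<Prod>b\<in>Basis. exp (- c * (x \<bullet> b)^2))" for x :: 'a
  unfolding gauss_def exp_sum[OF finite_Basis, symmetric] by (simp add: sum_distrib_left)
 then have "(NN x. ennreal (gauss c (x::'a))) = (NN x. (\<Prod>b\<in>Basis. ennreal (exp (- c * ((x::'a) \<bullet> b)^2))))"
  by (simp add: prod_ennreal)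
 also have "\<dots> = (\<Prod>b\<in>(Basis::'a set). ennreal (sqrt (pi / c)))"
  using nn_integral_lborel_prod[of "%b x. ennreal (exp (- c * x^2))"] 1 by simp
 also have "\<dots> = ennreal (sqrt (pi / c) ^ DIM('a))" using c by (simp add: ennreal_power)
 also have "sqrt (pi / c) ^ DIM('a) = (pi / c) powr (DIM('a) / 2)"
  using c by (simp add: powr_half_sqrt[symmetric] powr_power)
 finally show ?thesis .
qed

lemma integrable_gauss: "0 < c ==> integrable lborel (gauss c)"
 using nn_integral_gauss[of c, where 'a='a] by (intro integrableI_nonneg) (auto simp: gauss_pos less_imp_le)

lemma integral_gauss: "0 < c ==> (LL x. gauss c (x::'a::euclidean_space)) = (pi / c) powr (DIM('a) / 2)"
 using nn_integral_gauss[of c, where 'a='a] by (intro integral_eq_nn_integral[THEN trans]) (auto simp: gauss_pos less_imp_le)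

text \<open>Half of the exponential rate pays for the quadratic factor.\<close>

lemma sq_mult_gauss_le:
 assumes "0 < c"
 shows "(norm x)^2 * gauss c x <= 2 / c * gauss (c/2) x"
proof -
 have "c / 2 * (norm x)^2 <= exp (c / 2 * (norm x)^2)"
  using exp_ge_add_one_self[of "c / 2 * (norm x)^2"] by linarith
 then have "(norm x)^2 * exp (- c * (norm x)^2) <= (2 / c * exp (c / 2 * (norm x)^2)) * exp (- c * (norm x)^2)"
  using assms by (intro mult_right_mono) (auto simp: field_simps)
 also have "\<dots> = 2 / c * gauss (c/2) x"
  by (simp add: gauss_def mult.assoc flip: exp_add)
 finally show ?thesis by (simp add: gauss_def)
qed

text \<open>The heat kernel at complex time \<open>z\<close>; formally the Schroedinger kernel is
  its value at \<open>\<i> * t\<close>. For \<open>0 < Re z\<close> the principal power is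
  holomorphic in \<open>z\<close> and the kernel is a Gaussian in \<open>x\<close>.\<close>

definition gker :: "complex => 'a::euclidean_space => complex" where
 "gker z x = (of_real (4 * pi) * z) powr (- of_real (DIM('a) / 2)) * exp (- of_real ((norm x)^2) / (4 * z))"

text \<open>The derivative in \<open>z\<close>, which is also the spatial Laplacian of the kernel,
  see \<open>sum_gk2\<close>.\<close>

definition gker_deriv :: "complex => 'a::euclidean_space => complex" where
 "gker_deriv z x = (of_real ((norm x)^2) / (4 * z^2) - of_real (DIM('a)) / (2 * z)) * gker z x"

lemma gker_minus [simp]: "gker z (- x) = gker z x" by (simp add: gker_def)

lemma measurable_gker [measurable]: "bm (gker z)"
 unfolding gker_def[abs_def] by measurable

lemma measurable_gker_deriv [measurable]: "bm (gker_deriv z)"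
 unfolding gker_deriv_def[abs_def] by measurable

text \<open>The rate of the Gaussian is the real part of \<open>1 / (4 * z)\<close>.\<close>

lemma norm_gker:
 assumes "0 < Re z"
 shows "norm (gker z (x::'a::euclidean_space)) = (4 * pi * norm z) powr (- (DIM('a) / 2)) * gauss (Re z / (4 * (norm z)^2)) x"
proof -
 have "Re (- of_real ((norm x)^2) / (4 * z)) = - (Re z / (4 * (norm z)^2)) * (norm x)^2"
 proof -
  define d where "d = (Re z)^2 + (Im z)^2"
  have d: "0 < d" using assms by (simp add: d_def add_pos_nonneg)
  have "(Re (4 * z))^2 + (Im (4 * z))^2 = 16 * d" by (simp add: d_def power_mult_distrib)
  then have "Re (- of_real ((norm x)^2) / (4 * z)) = - ((norm x)^2 * (4 * Re z)) / (16 * d)"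
   unfolding Re_divide by simp
  also have "\<dots> = - (Re z / (4 * d)) * (norm x)^2" using d by (simp add: field_simps)
  finally show ?thesis by (simp add: cmod_power2 d_def)
 qed
 moreover have "norm ((of_real (4 * pi) * z) powr (- of_real (DIM('a) / 2))) = (4 * pi * norm z) powr (- (DIM('a) / 2))"
  by (subst norm_powr_real_powr') (auto simp: norm_mult)
 ultimately show ?thesis by (simp only: gker_def gauss_def norm_mult norm_exp_eq_Re)
qed

lemma gker_of_real:
 assumes "0 < s"
 shows "gker (of_real s) (x::'a::euclidean_space) = of_real ((4 * pi * s) powr (- (DIM('a) / 2)) * gauss (1 / (4 * s)) x)"
proof -
 have "(of_real (4 * pi) * of_real s) powr (- of_real (DIM('a) / 2)) = (of_real ((4 * pi * s) powr (- (DIM('a) / 2))) :: complex)"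
  using assms by (subst powr_of_real[symmetric]) auto
 moreover have "exp (- of_real ((norm x)^2) / (4 * of_real s)) = (of_real (gauss (1 / (4 * s)) x) :: complex)"
  by (simp add: gauss_def exp_of_real[symmetric])
 ultimately show ?thesis by (simp only: gker_def of_real_mult)
qed

lemma integrable_gker: "0 < Re z ==> integrable lborel (gker z)"
proof -
 assume z: "0 < Re z"
 then have "z \<noteq> 0" by auto
 have "integrable lborel (%x::'a. norm (gker z x))"
  unfolding norm_gker[OF z] using z \<open>z \<noteq> 0\<close> by (intro integrable_mult_right integrable_gauss) auto
 then show ?thesis by (rule integrable_norm_cancel) simp
qed

lemma cnj_gker: "0 < Re z ==> cnj (gker z x) = gker (cnj z) x"
 by (simp add: gker_def cnj_powr exp_cnj)

lemma gker_has_field_derivative: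
 assumes "0 < Re z"
 shows "((%z. gker z x) has_field_derivative gker_deriv z (x::'a::euclidean_space)) (at z)"
proof -
 have z: "z \<noteq> 0" "of_real (4 * pi) * z \<notin> \<real>\<^sub>\<le>\<^sub>0"
  using assms by (auto simp: complex_nonpos_Reals_iff mult_le_0_iff not_le)
 have d1: "((%z. (of_real (4 * pi) * z) powr (- of_real (DIM('a) / 2))) has_field_derivative
   - of_real (DIM('a) / 2) * (of_real (4 * pi) * z) powr (- of_real (DIM('a) / 2) - 1) * of_real (4 * pi)) (at z)"
  using z by (auto intro!: derivative_eq_intros)
 have d2: "((%z. exp (- of_real ((norm x)^2) / (4 * z))) has_field_derivative
   exp (- of_real ((norm x)^2) / (4 * z)) * (of_real ((norm x)^2) / (4 * z^2))) (at z)"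
  using z by (auto intro!: derivative_eq_intros simp: field_simps power2_eq_square)
 note d = DERIV_mult[OF d1 d2]
 have p: "(of_real (4 * pi) * z) powr (- of_real (DIM('a) / 2) - 1) = (of_real (4 * pi) * z) powr (- of_real (DIM('a) / 2)) / (of_real (4 * pi) * z)"
  using z by (simp add: powr_diff)
 show ?thesis
  unfolding gker_def[abs_def] gker_deriv_def
  by (rule DERIV_cong[OF d], unfold p) (use z in \<open>simp add: algebra_simps\<close>)
qed

text \<open>One Gaussian serves all \<open>z\<close> with real part at least \<open>r\<close> and
  modulus at most \<open>m\<close>. This uniformity allows integration over bounded times and
  differentiation in \<open>z\<close>.\<close>

lemma gker_majorant:
 assumes r: "0 < r" "r <= Re z" "norm z <= m"
 shows "norm (gker z (x::'a::euclidean_space)) <= (4 * pi * r) powr (- (DIM('a) / 2)) * gauss (r / (4 * m^2)) x"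
proof -
 have z: "0 < Re z" "r <= norm z" "0 < norm z" using r complex_Re_le_cmod[of z] by auto
 have "r / (4 * m^2) <= Re z / (4 * (norm z)^2)"
  using r z by (intro frac_le mult_left_mono power_mono) auto
 then have "gauss (Re z / (4 * (norm z)^2)) x <= gauss (r / (4 * m^2)) x"
  using mult_right_mono[of "r / (4 * m^2)" "Re z / (4 * (norm z)^2)" "(norm x)^2"] by (simp add: gauss_def)
 moreover have "(4 * pi * norm z) powr (- (DIM('a) / 2)) <= (4 * pi * r) powr (- (DIM('a) / 2))"
  using r z by (intro powr_mono2') auto
 ultimately show ?thesis
  unfolding norm_gker[OF z(1)] by (intro mult_mono) (auto simp: gauss_pos less_imp_le)
qed

lemma poly_gker_majorant:
 assumes r: "0 < r" "r <= Re z" "norm z <= m" and p: "norm p <= P * (1 + (norm x)^2)" and P: "0 <= P"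
 shows "norm (p * gker z (x::'a::euclidean_space)) <= P * (1 + 8 * m^2 / r) * (4 * pi * r) powr (- (DIM('a) / 2)) * gauss (r / (8 * m^2)) x"
proof -
 define c where "c = r / (4 * m^2)"
 have m: "0 < m" using r complex_Re_le_cmod[of z] by linarith
 have c: "0 < c" "2 / c = 8 * m^2 / r" "c / 2 = r / (8 * m^2)" using r m by (simp_all add: c_def)
 define A where "A = (4 * pi * r) powr (- (DIM('a) / 2))"
 have A: "0 <= A" by (simp add: A_def)
 have "norm (p * gker z x) <= P * (1 + (norm x)^2) * (A * gauss c x)"
  unfolding norm_mult A_def c_def using P by (intro mult_mono p gker_majorant r) auto
 also have "\<dots> = P * A * (gauss c x + (norm x)^2 * gauss c x)" by (simp add: algebra_simps)
 also have "\<dots> <= P * A * (gauss (c/2) x + 2 / c * gauss (c/2) x)"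
  using P A c(1) by (intro mult_left_mono add_mono sq_mult_gauss_le) (auto simp: gauss_def)
 also have "\<dots> = P * (1 + 2 / c) * A * gauss (c/2) x" by (simp add: algebra_simps)
 finally show ?thesis by (simp add: A_def c(2,3))
qed

lemma norm_quadratic_le:
 fixes z p q :: complex
 assumes r: "0 < r" "r <= norm z" and p: "norm p <= P" "norm q <= P"
 shows "norm (p / (4 * z^2) - q / (2 * z)) <= (1 / (4 * r^2) + 1 / (2 * r)) * P"
proof -
 have "0 <= P" using p(1) order_trans[OF norm_ge_zero] by blast
 then have "norm p / (4 * (norm z)^2) + norm q / (2 * norm z) <= P / (4 * r^2) + P / (2 * r)"
  using r by (intro add_mono frac_le mult_left_mono power_mono p) auto
 then show ?thesis
  by (intro order_trans[OF norm_triangle_ineq4]) (simp add: norm_divide norm_mult norm_power distrib_right)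
qed

lemma norm_quadratic_coefficients:
 "norm (complex_of_real ((norm x)^2)) <= DIM('a) * (1 + (norm (x::'a::euclidean_space))^2)"
 "norm (of_real (DIM('a)) :: complex) <= DIM('a) * (1 + (norm x)^2)"
proof -
 have "1 * (norm x)^2 <= DIM('a) * (1 + (norm x)^2)" by (intro mult_mono) (auto simp: Suc_leI)
 then show "norm (complex_of_real ((norm x)^2)) <= DIM('a) * (1 + (norm x)^2)" by (simp del: of_real_power)
qed simp

lemma gker_deriv_majorant:
 assumes r: "0 < r" "0 < m"
 obtains A c where "0 < c" "0 <= A"
  "!!z x. r <= Re z ==> norm z <= m ==> norm (gker_deriv z (x::'a::euclidean_space)) <= A * gauss c x"
proof
 let ?P = "(1 / (4 * r^2) + 1 / (2 * r)) * DIM('a)"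
 show "0 < r / (8 * m^2)" "0 <= ?P * (1 + 8 * m^2 / r) * (4 * pi * r) powr (- (DIM('a) / 2))" using r by auto
 fix z and x :: 'a assume z: "r <= Re z" "norm z <= m"
 have "r <= norm z" using z complex_Re_le_cmod[of z] by linarith
 from norm_quadratic_le[OF r(1) this norm_quadratic_coefficients[of x]]
 show "norm (gker_deriv z x) <= ?P * (1 + 8 * m^2 / r) * (4 * pi * r) powr (- (DIM('a) / 2)) * gauss (r / (8 * m^2)) x"
  unfolding gker_deriv_def using r by (intro poly_gker_majorant z) (auto simp: mult.assoc)
qed

lemma holomorphic_gker_conv:
 assumes w: "0 < Re w"
 shows "(%z. LL y. gker z (x - y) * gker w (y::'a::euclidean_space)) holomorphic_on {z. 0 < Re z}"
proof (rule holomorphic_onI, rule field_differentiable_at_within)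
 fix z0 :: complex assume "z0 \<in> {z. 0 < Re z}"
 then have z0: "0 < Re z0" by simp
 define r where "r = Re z0 / 2"
 define m where "m = norm z0 + r"
 have r: "0 < r" using z0 by (simp add: r_def)
 have zb: "r <= Re z" "norm z <= m" if "z \<in> ball z0 r" for z
 proof -
  have *: "norm (z0 - z) < r" using that by (simp add: dist_norm)
  show "norm z <= m" using norm_triangle_ineq4[of z0 "z0 - z"] * by (simp add: m_def)
  show "r <= Re z" using complex_Re_le_cmod[of "z0 - z"] * by (simp add: r_def)
 qed
 have Rez: "0 < Re z" if "z \<in> ball z0 r" for z using zb[OF that] r by simp
 have "0 < m" using r by (simp add: m_def add_nonneg_pos)
 from gker_deriv_majorant[OF r this] obtain B c where c: "0 < c" and Bn: "0 <= B" and Bg: "!!z x. r <= Re z ==> norm z <= m ==> norm (gker_deriv z (x::'a)) <= B * gauss c x"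
  by metis
 have "((%z. LL y. gker z (x - y) * gker w y) has_field_derivative (LL y. gker_deriv z0 (x - y) * gker w y)) (at z0)"
 proof (rule has_field_derivative_integral_dominated[OF r, where w="%y. B * norm (gker w y)"])
  fix z y assume z: "z \<in> ball z0 r"
  show "((%z. gker z (x - y) * gker w y) has_field_derivative gker_deriv z (x - y) * gker w y) (at z)"
   by (intro DERIV_cmult_right gker_has_field_derivative Rez z)
  have "norm (gker_deriv z (x - y)) <= B * gauss c (x - y)" by (intro Bg zb z)
  also have "\<dots> <= B * 1" using c by (intro mult_left_mono gauss_le_1 Bn) auto
  finally show "norm (gker_deriv z (x - y) * gker w y) <= B * norm (gker w y)"
   by (simp add: norm_mult mult_right_mono)
 next
  show "integrable lborel (%y::'a. B * norm (gker w y))"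
   by (intro integrable_mult_right integrable_norm integrable_gker w)
  fix z assume z: "z \<in> ball z0 r"
  show "integrable lborel (%y. gker z (x - y) * gker w y)"
  proof (rule Bochner_Integration.integrable_bound)
   show "integrable lborel (%y::'a. (4 * pi * r) powr (- (DIM('a) / 2)) * norm (gker w y))"
    by (intro integrable_mult_right integrable_norm integrable_gker w)
   show "AE y in lborel. norm (gker z (x - y) * gker w y) <= norm ((4 * pi * r) powr (- (DIM('a) / 2)) * norm (gker w y))"
   proof (rule AE_I2)
    fix y
    have "norm (gker z (x - y)) <= (4 * pi * r) powr (- (DIM('a) / 2)) * gauss (r / (4 * m^2)) (x - y)"
     by (intro gker_majorant r zb z)
    also have "\<dots> <= (4 * pi * r) powr (- (DIM('a) / 2)) * 1"
     using r by (intro mult_left_mono gauss_le_1) auto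
    finally show "norm (gker z (x - y) * gker w y) <= norm ((4 * pi * r) powr (- (DIM('a) / 2)) * norm (gker w y))"
     by (simp add: norm_mult mult_right_mono)
   qed
  qed simp
 qed simp
 then show "(%z. LL y. gker z (x - y) * gker w y) field_differentiable at z0"
  by (auto simp: field_differentiable_def)
qed

lemma holomorphic_gker: "(%z. gker (z + w) x) holomorphic_on {z. 0 < Re z}" if "0 < Re w"
proof (rule holomorphic_onI, rule field_differentiable_at_within)
 fix z assume "z \<in> {z. 0 < Re z}"
 then have "((%u. gker u x) has_field_derivative gker_deriv (z + w) x) (at (z + w))"
  using that by (intro gker_has_field_derivative) simp
 then have "((%u. gker (u + w) x) has_field_derivative gker_deriv (z + w) x) (at z)"
  by (simp add: DERIV_shift)
 then show "(%z. gker (z + w) x) field_differentiable at z" by (auto simp: field_differentiable_def)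
qed

text \<open>Completing the square in \<open>y\<close>: the product is the Gaussian of time
  \<open>s + t\<close> in \<open>x\<close> times a Gaussian in \<open>y\<close> of time
  \<open>u\<close>, centred at \<open>c\<close> times \<open>x\<close>.\<close>

lemma gker_conv_real:
 assumes s: "0 < s" and t: "0 < t"
 shows "(LL y. gker (of_real s) (x - y) * gker (of_real t) (y::'a::euclidean_space)) = gker (of_real (s + t)) x"
proof -
 define c where "c = t / (s + t)"
 define u where "u = s * t / (s + t)"
 have st: "0 < s + t" "0 < u" using s t by (auto simp: u_def)
 have e: "gauss (1 / (4 * s)) (x - y) * gauss (1 / (4 * t)) y = gauss (1 / (4 * (s + t))) x * gauss (1 / (4 * u)) (y - c *\<^sub>R x)" for y
 proof -
  define p q v where "p = x \<bullet> x" and "q = x \<bullet> y" and "v = y \<bullet> y"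
  have 1: "(norm (x - y))^2 = p - 2 * q + v" "(norm y)^2 = v" "(norm x)^2 = p"
   by (simp_all add: power2_norm_eq_inner p_def q_def v_def inner_diff_left inner_diff_right inner_commute)
  have 2: "(norm (y - c *\<^sub>R x))^2 = v - 2 * c * q + c^2 * p"
   by (simp add: power2_norm_eq_inner p_def q_def v_def inner_diff_left inner_diff_right inner_commute)
     (simp add: power2_eq_square)
  have "- (1 / (4 * s)) * (p - 2 * q + v) + - (1 / (4 * t)) * v = - (1 / (4 * (s + t))) * p + - (1 / (4 * u)) * (v - 2 * c * q + c^2 * p)"
  proof -
   have u: "1 / (4 * u) = 1 / (4 * s) + 1 / (4 * t)" using s t st by (simp add: u_def field_simps)
   have "1 / (4 * u) * c = (s + t) * t / (4 * s * t * (s + t))" by (simp add: u_def c_def)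
   then have "1 / (4 * u) * c = 1 / (4 * s)" using s t st by simp
   moreover have "1 / (4 * (s + t)) + 1 / (4 * u) * c * c = 1 / (4 * s)" 
    unfolding calculation using s t st by (simp add: c_def divide_simps) (simp add: algebra_simps)
   moreover have "1 / (4 * u) * (v - 2 * c * q + c^2 * p) = 1 / (4 * u) * v - 2 * (1 / (4 * u) * c) * q + (1 / (4 * u) * c * c) * p"
    by (simp add: algebra_simps power2_eq_square add_divide_distrib)
   ultimately have "1 / (4 * u) * (v - 2 * c * q + c^2 * p) = (1 / (4 * s) + 1 / (4 * t)) * v - 2 * (1 / (4 * s)) * q + (1 / (4 * s) - 1 / (4 * (s + t))) * p"
    unfolding u[symmetric] by (metis add_diff_cancel_left')
   then show ?thesis by (simp add: algebra_simps add_divide_distrib)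
  qed
  then show ?thesis unfolding gauss_def 1 2 exp_add[symmetric] by simp
 qed
 have "(LL y. gker (of_real s) (x - y) * gker (of_real t) y) =
  (LL y. of_real ((4 * pi * s) powr (- (DIM('a) / 2)) * (4 * pi * t) powr (- (DIM('a) / 2)) * gauss (1 / (4 * (s + t))) x * gauss (1 / (4 * u)) (- (c *\<^sub>R x) + y)))"
  unfolding gker_of_real[OF s] gker_of_real[OF t] of_real_mult[symmetric]
 proof (intro Bochner_Integration.integral_cong refl arg_cong[where f=of_real])
  fix y
  show "(4 * pi * s) powr - (DIM('a) / 2) * gauss (1 / (4 * s)) (x - y) * ((4 * pi * t) powr - (DIM('a) / 2) * gauss (1 / (4 * t)) y)
   = (4 * pi * s) powr (- (DIM('a) / 2)) * (4 * pi * t) powr (- (DIM('a) / 2)) * gauss (1 / (4 * (s + t))) x * gauss (1 / (4 * u)) (- (c *\<^sub>R x) + y)"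
   using e[of y] by (simp add: algebra_simps)
 qed
 also have "\<dots> = of_real ((4 * pi * s) powr (- (DIM('a) / 2)) * (4 * pi * t) powr (- (DIM('a) / 2)) * gauss (1 / (4 * (s + t))) x * (LL y. gauss (1 / (4 * u)) (- (c *\<^sub>R x) + y :: 'a)))"
  by simp
 also have "(LL y. gauss (1 / (4 * u)) (- (c *\<^sub>R x) + y)) = (4 * pi * u) powr (DIM('a) / 2)"
  using st by (subst integral_translate) (auto simp: integral_gauss ac_simps)
 also have "(4 * pi * s) powr (- (DIM('a) / 2)) * (4 * pi * t) powr (- (DIM('a) / 2)) * gauss (1 / (4 * (s + t))) x * (4 * pi * u) powr (DIM('a) / 2)
   = (4 * pi * (s + t)) powr (- (DIM('a) / 2)) * gauss (1 / (4 * (s + t))) x"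
 proof -
  have "(4 * pi * s) powr (- (DIM('a) / 2)) * (4 * pi * t) powr (- (DIM('a) / 2)) = ((4 * pi * s) * (4 * pi * t)) powr (- (DIM('a) / 2))"
   using s t by (simp only: powr_mult)
  also have "(4 * pi * s) * (4 * pi * t) = (4 * pi * (s + t)) * (4 * pi * u)"
   using st by (simp add: u_def)
  also have "\<dots> powr (- (DIM('a) / 2)) = (4 * pi * (s + t)) powr (- (DIM('a) / 2)) * (4 * pi * u) powr (- (DIM('a) / 2))"
   using st by (simp only: powr_mult)
  finally have "(4 * pi * s) powr (- (DIM('a) / 2)) * (4 * pi * t) powr (- (DIM('a) / 2)) * (4 * pi * u) powr (DIM('a) / 2) = 
    (4 * pi * (s + t)) powr (- (DIM('a) / 2))"
   using st by (simp add: powr_minus)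
  from arg_cong[OF this, of "%v. v * gauss (1 / (4 * (s + t))) x"] show ?thesis by (simp only: ac_simps)
 qed
 finally show ?thesis unfolding gker_of_real[OF st(1)] by simp
qed

lemma positive_reals_islimpt: "(1::complex) islimpt (of_real ` {0<..})"
proof -
 have "(1::real) islimpt {0<..}" by (rule open_imp_islimpt) auto
 then obtain f where f: "!!n::nat. f n \<in> {0<..} - {1::real}" "f \<longlonglongrightarrow> 1"
  unfolding islimpt_sequential by auto
 have "(%n. complex_of_real (f n)) \<longlonglongrightarrow> complex_of_real 1" using f(2) by (rule tendsto_of_real)
 moreover have "complex_of_real (f n) \<in> of_real ` {0<..} - {1}" for n using f(1)[of n] by auto
 ultimately show ?thesis unfolding islimpt_sequential by (intro exI[of _ "%n. complex_of_real (f n)"]) auto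
qed

text \<open>For fixed \<open>w\<close> both sides are holomorphic in \<open>z\<close>, and they
  agree when both times are real. Continuation in the first variable, the symmetry of convolution
  and a second continuation reach all complex times.\<close>

lemma gker_conv:
 assumes z: "0 < Re z" and w: "0 < Re w"
 shows "(LL y. gker z (x - y) * gker w (y::'a::euclidean_space)) = gker (z + w) x"
proof -
 have half: "open {z::complex. 0 < Re z}" "connected {z::complex. 0 < Re z}"
  by (auto simp: open_halfspace_Re_gt convex_halfspace_Re_gt convex_connected)
 have cont: "(LL y. gker z (x - y) * gker w (y::'a)) = gker (z + w) x"
  if w: "0 < Re w" and eq: "!!s. 0 < s ==> (LL y. gker (of_real s) (x - y) * gker w (y::'a)) = gker (of_real s + w) x"
   and z: "0 < Re z" for z w
 proof -
  have "(%z. (LL y. gker z (x - y) * gker w (y::'a)) - gker (z + w) x) z = 0"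
   by (rule analytic_continuation[where S="{z. 0 < Re z}" and U="of_real ` {0<..}" and \<xi>=1])
     (use half z eq positive_reals_islimpt in \<open>auto intro!: holomorphic_intros holomorphic_gker_conv w holomorphic_gker\<close>)
  then show ?thesis by simp
 qed
 have 1: "(LL y. gker z (x - y) * gker (of_real t) (y::'a)) = gker (z + of_real t) x" if "0 < t" "0 < Re z" for z t
  by (rule cont) (use that gker_conv_real[of _ t x] in auto)
 have swap: "(LL y. gker z (x - y) * gker w (y::'a)) = (LL y. gker w (x - y) * gker z y)" for z w
  using integral_reflect_translate[of "%y::'a. gker z (x - y) * gker w y" x] by (simp add: mult.commute)
 have "(LL y. gker w (x - y) * gker z (y::'a)) = gker (w + z) x"
  by (rule cont[OF z _ w]) (subst swap, use 1[OF _ z] in \<open>simp add: add.commute\<close>)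
 then show ?thesis by (subst swap) (simp add: add.commute)
qed

section \<open>Convolution and dispersion\<close>

lemma norm_integral_le_nn_integral:
 fixes f :: "'a => 'b::{banach,second_countable_topology}"
 shows "ennreal (norm (LINT x|M. f x)) <= (\<integral>\<^sup>+x. ennreal (norm (f x)) \<partial>M)"
 by (cases "integrable M f") (auto simp: integral_norm_bound_ennreal not_integrable_integral_eq)

lemma integrable_pairI:
 fixes f :: "'a::euclidean_space => 'b::euclidean_space => 'c::{banach,second_countable_topology}"
 assumes [measurable]: "case_prod f \<in> borel_measurable lborel2"
  and fin: "(NN x. (NN y. ennreal (norm (f x y)))) < \<infinity>"
 shows "integrable lborel2 (case_prod f)"
proof (rule integrableI_bounded)
 have "(\<integral>\<^sup>+z. ennreal (norm (case_prod f z)) \<partial>lborel2) = (NN x. (NN y. ennreal (norm (f x y))))"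
  by (subst lborel.nn_integral_fst[symmetric]) auto
 then show "(\<integral>\<^sup>+z. ennreal (norm (case_prod f z)) \<partial>lborel2) < \<infinity>" using fin by simp
qed simp

lemma fubini_pair:
 fixes f :: "'a::euclidean_space => 'b::euclidean_space => 'c::{banach,second_countable_topology}"
 assumes meas: "case_prod f \<in> borel_measurable lborel2"
  and fin: "(NN x. (NN y. ennreal (norm (f x y)))) < \<infinity>"
 shows "(LL x. LL y. f x y) = (LL y. LL x. f x y)"
  and "integrable lborel (%x. LL y. f x y)"
  and "integrable lborel (%y. LL x. f x y)"
 using lborel_pair.Fubini_integral[OF integrable_pairI[OF assms]]
  lborel_pair.integrable_fst[OF integrable_pairI[OF assms]]
  lborel_pair.integrable_snd[OF integrable_pairI[OF assms]] by auto

lemma lpb_integrable_mult: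
 fixes f g :: "'a => 'b::{real_normed_field,banach,second_countable_topology}"
 assumes f: "lpb M p f A" and g: "lpb M q g B" and pq: "1 < p" "1 < q" "1/p + 1/q = 1"
 shows "integrable M (%x. f x * g x)" and "norm (LINT x|M. f x * g x) <= A * B"
proof -
 have [measurable]: "f \<in> borel_measurable M" "g \<in> borel_measurable M" using f g by (auto simp: lpb_def)
 have le: "(\<integral>\<^sup>+x. ennreal (norm (f x * g x)) \<partial>M) <= ennreal (A * B)"
  using lpb_holder[OF f g pq] by (simp add: norm_mult)
 then show "integrable M (%x. f x * g x)"
  by (intro integrableI_bounded) (auto simp: top.not_eq_extremum[symmetric] top_unique)
 show "norm (LINT x|M. f x * g x) <= A * B"
  using order_trans[OF norm_integral_le_nn_integral le] lpb_nonneg[OF f] lpb_nonneg[OF g] by simp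
qed

lemma lpb_2_integrable_mult:
 fixes f g :: "'a => 'b::{real_normed_field,banach,second_countable_topology}"
 assumes "lpb M 2 f A" "lpb M 2 g B"
 shows "integrable M (%x. f x * g x)" and "norm (LINT x|M. f x * g x) <= A * B"
 using lpb_integrable_mult[OF assms] by simp_all

lemma measurable_cnj [measurable]: "bm cnj"
 by (intro borel_measurable_continuous_onI continuous_intros)

lemma lpb_2_iff:
 "lpb M 2 f B \<longleftrightarrow> f \<in> borel_measurable M \<and> 0 <= B \<and> (\<integral>\<^sup>+x. ennreal ((norm (f x))^2) \<partial>M) <= ennreal (B^2)"
 by (auto simp: lpb_def)

text \<open>A Gaussian majorant puts the kernel in every L^p, so its convolution with an L^2
  function converges absolutely. For the flow kernels \<open>A\<close> and \<open>c\<close>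
  degenerate as the real part of the time tends to 0, so they serve to justify manipulations and
  must stay out of the uniform estimates.\<close>

definition gbd :: "real => real => ('a::euclidean_space => complex) => bool" where
 "gbd A c k \<longleftrightarrow> 0 < c \<and> 0 <= A \<and> k \<in> borel_measurable borel \<and> (\<forall>x. norm (k x) <= A * gauss c x)"

text \<open>\<open>gL1\<close> and \<open>gL2\<close> are the L^1 and L^2 norms of
  \<open>gauss c\<close>; the type argument carries the dimension.\<close>

definition gL1 :: "'a::euclidean_space itself => real => real" where
 "gL1 _ c = (pi / c) powr (DIM('a) / 2)"

definition gL2 :: "'a::euclidean_space itself => real => real" where
 "gL2 _ c = sqrt ((pi / (2 * c)) powr (DIM('a) / 2))"

lemma gL1_nonneg: "0 <= gL1 T c" and gL2_nonneg: "0 <= gL2 T c"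
 by (auto simp: gL1_def gL2_def)

lemma gbd_nn_integral_le:
 fixes k :: "'a::euclidean_space => complex"
 assumes "gbd A c k"
 shows "(NN x. ennreal (norm (k x))) <= ennreal (A * gL1 TYPE('a) c)"
proof -
 have c: "0 < c" "0 <= A" and le: "!!x. norm (k x) <= A * gauss c x" using assms by (auto simp: gbd_def)
 have "(NN x. ennreal (norm (k x))) <= (NN x. ennreal A * ennreal (gauss c (x::'a)))"
  by (intro nn_integral_mono) (use c le in \<open>simp add: ennreal_mult'[symmetric] ennreal_leI\<close>)
 also have "\<dots> = ennreal A * (NN x. ennreal (gauss c (x::'a)))" by (rule nn_integral_cmult) simp
 also have "\<dots> = ennreal (A * gL1 TYPE('a) c)"
  using c by (simp add: nn_integral_gauss gL1_def ennreal_mult)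
 finally show ?thesis .
qed

lemma gbd_lpb_2:
 fixes k :: "'a::euclidean_space => complex"
 assumes "gbd A c k"
 shows "l2b (%y. k (x - y)) (A * gL2 TYPE('a) c)"
proof -
 have c: "0 < c" "0 <= A" and le: "!!x. norm (k x) <= A * gauss c x"
  and [measurable]: "bm k" using assms by (auto simp: gbd_def)
 have "(NN y. ennreal ((norm (k (x - y)))^2)) = (NN y. ennreal ((norm (k y))^2))"
  by (rule nn_integral_reflect) measurable
 also have "\<dots> <= (NN y. ennreal (A^2) * ennreal (gauss (2 * c) (y::'a)))"
 proof (intro nn_integral_mono)
  fix y
  have "(norm (k y))^2 <= (A * gauss c y)^2" by (intro power_mono le) simp
  also have "\<dots> = A^2 * gauss (2 * c) y"
   by (simp add: power_mult_distrib gauss_def power2_eq_square flip: exp_add)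
  finally show "ennreal ((norm (k y))^2) <= ennreal (A^2) * ennreal (gauss (2 * c) y)"
   by (simp add: ennreal_mult'[symmetric] ennreal_leI)
 qed
 also have "\<dots> = ennreal (A^2) * (NN x. ennreal (gauss (2 * c) (x::'a)))" by (rule nn_integral_cmult) simp
 also have "\<dots> = ennreal ((A * gL2 TYPE('a) c)^2)"
  using c by (simp add: nn_integral_gauss gL2_def power_mult_distrib ennreal_mult)
 finally show ?thesis using c gL2_nonneg[of "TYPE('a)" c] by (simp add: lpb_2_iff)
qed

lemma gbd_gker:
 assumes "0 < r" "r <= Re z" "norm z <= m"
 shows "gbd ((4 * pi * r) powr (- (DIM('a) / 2))) (r / (4 * m^2)) (gker z :: 'a::euclidean_space => complex)"
proof -
 have "0 < m" using assms complex_Re_le_cmod[of z] by linarith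
 then show ?thesis using assms gker_majorant[OF assms] by (auto simp: gbd_def)
qed

lemma gbd_gker_ex: "0 < Re z ==> \<exists>A c. gbd A c (gker z :: 'a::euclidean_space => complex)"
 using gbd_gker[of "Re z" z "norm z"] by blast

definition cv :: "('a::euclidean_space => complex) => ('a => complex) => 'a => complex" where
 "cv k f x = (LL y. k (x - y) * f y)"

lemma measurable_cv [measurable]:
 assumes [measurable]: "bm k" "bm f"
 shows "bm (cv k f)"
proof -
 have "(%x. LL y. k (x - y) * f y) \<in> borel_measurable lborel" by measurable
 then show ?thesis by (simp add: cv_def[abs_def])
qed

lemma cv_integrable:
 fixes k :: "'a::euclidean_space => complex"
 assumes k: "gbd A c k" and f: "l2b f B"
 shows "integrable lborel (%y. k (x - y) * f y)"
  and "norm (cv k f x) <= A * gL2 TYPE('a) c * B"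
 using lpb_2_integrable_mult[OF gbd_lpb_2[OF k] f] by (auto simp: cv_def)

lemma cv_add:
 assumes "gbd A c k" "l2b f B" "l2b g B'"
 shows "cv k (%y. f y + g y) x = cv k f x + cv k g x"
 using cv_integrable(1)[OF assms(1,2)] cv_integrable(1)[OF assms(1,3)] by (simp add: cv_def distrib_left)

lemma cv_diff:
 assumes "gbd A c k" "l2b f B" "l2b g B'"
 shows "cv k (%y. f y - g y) x = cv k f x - cv k g x"
 using cv_integrable(1)[OF assms(1,2)] cv_integrable(1)[OF assms(1,3)] by (simp add: cv_def right_diff_distrib)

lemma cv_cmult: "cv k (%y. a * f y) x = a * cv k f x"
 unfolding cv_def by (simp add: mult.left_commute)

lemma cnj_cv: "cnj (cv k f x) = cv (%x. cnj (k x)) (%x. cnj (f x)) x"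
 unfolding cv_def using Bochner_Integration.integral_cnj[of lborel "%y. k (x - y) * f y"] by simp

text \<open>Hoelder's inequality with the weight \<open>norm (k (x - y))\<close> gives a pointwise
  bound, which Tonelli integrates. Positive constants come first; \<open>K = 0\<close> is reached by
  a limit.\<close>

lemma young_convolution:
 fixes k :: "'a::euclidean_space => complex"
 assumes [measurable]: "bm k" and k: "(NN x. ennreal (norm (k x))) <= ennreal K" and K: "0 <= K"
  and q: "1 <= q" and f: "lpb lborel q f B"
 shows "lpb lborel q (cv k f) (K * B)"
proof -
 have [measurable]: "bm f" using f by (auto simp: lpb_def)
 have B: "0 <= B" by (rule lpb_nonneg[OF f])
 let ?h = "%x y. norm (k (x - y)) * norm (f y) powr q"
 have pos: "lpb lborel q (cv k f) (K * B)" if k: "(NN x. ennreal (norm (k x))) <= ennreal K" and K: "0 < K" for K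
 proof -
  have pt: "ennreal (norm (cv k f x) powr q) <= ennreal (K powr (q - 1)) * (NN y. ennreal (?h x y))" for x
  proof (cases "NN y. ennreal (?h x y)")
   case (real W)
   have kx: "(NN y. ennreal (norm (k (x - y)))) <= ennreal K"
    by (subst nn_integral_reflect[of "%y. ennreal (norm (k y))"]) (auto intro: k)
   have "(NN y. ennreal (norm (k (x - y)) * norm (f y))) <= ennreal (W powr (1/q) * K powr (1 - 1/q))"
   proof (cases "q = 1")
    case False
    have "(NN y. ennreal (?h x y powr (1/q) * norm (k (x - y)) powr (1 - 1/q))) <= ennreal (W powr (1/q) * K powr (1 - 1/q))"
     by (rule nn_integral_geometric_mean) (use real K kx q False in auto)
    moreover have "?h x y powr (1/q) * norm (k (x - y)) powr (1 - 1/q) = norm (k (x - y)) powr (1/q + (1 - 1/q)) * norm (f y)" for y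
     using q unfolding powr_add by (simp add: powr_mult powr_powr)
    ultimately show ?thesis by simp
   qed (use real K in simp)
   then have "ennreal (norm (cv k f x)) <= ennreal (W powr (1/q) * K powr (1 - 1/q))"
    unfolding cv_def by (intro order_trans[OF norm_integral_le_nn_integral]) (simp add: norm_mult)
   then have "norm (cv k f x) powr q <= (W powr (1/q) * K powr (1 - 1/q)) powr q"
    using q by (intro powr_mono2) auto
   also have "\<dots> = K powr (q - 1) * W" using q real by (simp add: powr_mult powr_powr left_diff_distrib)
   finally show ?thesis unfolding real(2) by (simp add: ennreal_mult'[symmetric] ennreal_leI)
  qed (use K in \<open>simp add: ennreal_mult_top\<close>)
  have "(NN x. ennreal (norm (cv k f x) powr q)) <= (NN x. ennreal (K powr (q - 1)) * (NN y. ennreal (?h x y)))"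
   by (intro nn_integral_mono pt)
  also have "\<dots> = ennreal (K powr (q - 1)) * (NN x. (NN y. ennreal (?h x y)))"
   by (rule nn_integral_cmult) measurable
  also have "(NN x. (NN y. ennreal (?h x y))) = (NN y. (NN x. ennreal (?h x y)))"
   by (rule lborel_pair.Fubini'[symmetric]) measurable
  also have "\<dots> <= (NN y. ennreal K * ennreal (norm (f y) powr q))"
  proof (intro nn_integral_mono)
   fix y
   have "(NN x. ennreal (norm (k (- y + x)))) = (NN x. ennreal (norm (k x)))"
    by (rule nn_integral_translate) measurable
   then show "(NN x. ennreal (?h x y)) <= ennreal K * ennreal (norm (f y) powr q)"
    using k by (simp add: ennreal_mult' nn_integral_multc mult_right_mono)
  qed
  also have "\<dots> <= ennreal K * ennreal (B powr q)" by (subst nn_integral_cmult) (auto intro!: mult_left_mono lpb_le[OF f])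
  also have "ennreal (K powr (q - 1)) * (ennreal K * ennreal (B powr q)) = ennreal ((K * B) powr q)"
   using K B by (simp add: powr_mult powr_diff flip: ennreal_mult')
  finally show ?thesis using K B by (simp add: lpb_def mult_left_mono)
 qed
 show ?thesis
 proof (rule lpb_limit)
  fix e :: real assume e: "0 < e"
  have "lpb lborel q (cv k f) ((K + e / (B + 1)) * B)"
   using e B K by (intro pos order_trans[OF k] ennreal_leI) (auto intro!: add_nonneg_pos)
  then show "lpb lborel q (cv k f) (K * B + e)"
   by (rule lpb_mono) (use e B q in \<open>auto simp: field_simps\<close>)
 qed (use K B q in auto)
qed

lemma gbd_young:
 fixes k :: "'a::euclidean_space => complex"
 assumes k: "gbd A c k" and "1 <= q" "lpb lborel q f B"
 shows "lpb lborel q (cv k f) (A * gL1 TYPE('a) c * B)"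
 using assms by (intro young_convolution gbd_nn_integral_le[OF k] mult_nonneg_nonneg gL1_nonneg) (auto simp: gbd_def)

lemma gbd_norm: "gbd A c k ==> gbd A c (%x. of_real (norm (k x)))"
 by (auto simp: gbd_def)

text \<open>Young's inequality for absolute values makes the double integral finite, which is the
  Fubini hypothesis for the transposition and for the semigroup law on functions.\<close>

lemma cv_pairing_finite:
 fixes k :: "'a::euclidean_space => complex"
 assumes k: "gbd A c k" and f: "l2b f B" and g: "l2b g B'"
 shows "(NN x. (NN y. ennreal (norm (k (x - y) * f y * g x)))) <= ennreal (A * gL1 TYPE('a) c * B * B')"
proof -
 have [measurable]: "bm k" "bm f" "bm g"
  using k f g by (auto simp: lpb_def gbd_def)
 define F where "F = cv (%x. of_real (norm (k x))) (%x. of_real (norm (f x)))"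
 have f': "l2b (%x. complex_of_real (norm (f x))) B"
  using lpb_cong_norm[OF f, of "%x. complex_of_real (norm (f x))"] by simp
 have F: "l2b F (A * gL1 TYPE('a) c * B)"
  unfolding F_def by (intro gbd_young gbd_norm k f') simp
 have Fx: "(NN y. ennreal (norm (k (x - y)) * norm (f y))) = ennreal (norm (F x))" for x
 proof -
  have int: "integrable lborel (%y. norm (k (x - y)) * norm (f y))"
   using integrable_norm[OF cv_integrable(1)[OF k f, of x]] by (simp add: norm_mult)
  have "F x = of_real (LL y. norm (k (x - y)) * norm (f y))"
   unfolding F_def cv_def by (simp flip: of_real_mult)
  then have "norm (F x) = (LL y. norm (k (x - y)) * norm (f y))"
   by (simp add: integral_nonneg_AE)
  then show ?thesis using int by (subst nn_integral_eq_integral) auto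
 qed
 have "(NN x. (NN y. ennreal (norm (k (x - y) * f y * g x)))) = (NN x. ennreal (norm (F x) * norm (g x)))"
 proof (intro nn_integral_cong)
  fix x
  have "(NN y. ennreal (norm (k (x - y) * f y * g x))) = (NN y. ennreal (norm (k (x - y)) * norm (f y)) * ennreal (norm (g x)))"
   by (simp add: norm_mult ennreal_mult'')
  also have "\<dots> = ennreal (norm (F x)) * ennreal (norm (g x))"
   unfolding Fx[symmetric] by (rule nn_integral_multc) measurable
  finally show "(NN y. ennreal (norm (k (x - y) * f y * g x))) = ennreal (norm (F x) * norm (g x))"
   by (simp add: ennreal_mult)
 qed
 also have "\<dots> <= ennreal (A * gL1 TYPE('a) c * B * B')"
  by (rule lpb_holder[OF F g]) auto
 finally show ?thesis .
qed

lemma cv_pairing: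
 fixes k :: "'a::euclidean_space => complex"
 assumes k: "gbd A c k" and f: "l2b f B" and g: "l2b g B'"
 shows "(LL x. cv k f x * g x) = (LL y. f y * cv (%x. k (- x)) g y)"
proof -
 have [measurable]: "bm k" "bm f" "bm g"
  using k f g by (auto simp: lpb_def gbd_def)
 have "(LL x. cv k f x * g x) = (LL x. LL y. k (x - y) * f y * g x)"
  by (simp add: cv_def)
 also have "\<dots> = (LL y. LL x. k (x - y) * f y * g x)"
  by (rule fubini_pair) (measurable, use cv_pairing_finite[OF k f g] in \<open>auto simp: top.not_eq_extremum[symmetric] top_unique\<close>)
 also have "\<dots> = (LL y. f y * cv (%x. k (- x)) g y)"
  unfolding cv_def by (simp add: mult.assoc mult.left_commute flip: integral_mult_right_zero)
 finally show ?thesis .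
qed

lemma cv_gker_gker:
 fixes f :: "'a::euclidean_space => complex"
 assumes z: "0 < Re z" and w: "0 < Re w" and f: "l2b f B"
 shows "cv (gker z) (cv (gker w) f) x = cv (gker (z + w)) f x"
proof -
 have [measurable]: "bm f" using f by (auto simp: lpb_def)
 obtain A c where kz: "gbd A c (gker z :: 'a => complex)" using gbd_gker_ex[OF z] by blast
 obtain A' c' where kw: "gbd A' c' (gker w :: 'a => complex)" using gbd_gker_ex[OF w] by blast
 note g = gbd_lpb_2[OF kz, of x]
 have "cv (gker z) (cv (gker w) f) x = (LL y. LL v. gker w (y - v) * f v * gker z (x - y))"
  unfolding cv_def by (simp add: mult.commute)
 also have "\<dots> = (LL v. LL y. gker w (y - v) * f v * gker z (x - y))"
  by (rule fubini_pair) (measurable, use cv_pairing_finite[OF kw f g] in \<open>auto simp: top.not_eq_extremum[symmetric] top_unique\<close>)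
 also have "\<dots> = (LL v. gker (z + w) (x - v) * f v)"
 proof (intro Bochner_Integration.integral_cong refl)
  fix v
  have "(LL y. gker w (y - v) * f v * gker z (x - y)) = (LL y. gker z (x - y) * gker w (y - v)) * f v"
   by (simp add: mult_ac flip: integral_mult_left_zero)
  also have "(LL y. gker z (x - y) * gker w (y - v)) = (LL y. gker z (x - (v + y)) * gker w (v + y - v))"
   by (rule integral_translate[symmetric]) measurable
  also have "\<dots> = (LL y. gker z ((x - v) - y) * gker w y)" by (simp add: diff_diff_add)
  also have "\<dots> = gker (z + w) (x - v)" by (rule gker_conv[OF z w])
  finally show "(LL y. gker w (y - v) * f v * gker z (x - y)) = gker (z + w) (x - v) * f v" .
 qed
 finally show ?thesis by (simp add: cv_def)
qed

lemma nn_integral_heat_kernel: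
 assumes "0 < s"
 shows "(NN x. ennreal (norm (gker (of_real s) (x::'a::euclidean_space)))) = 1"
proof -
 have "(NN x. ennreal (norm (gker (of_real s) (x::'a)))) =
  (NN x. ennreal ((4 * pi * s) powr (- (DIM('a) / 2))) * ennreal (gauss (1 / (4 * s)) (x::'a)))"
  unfolding gker_of_real[OF assms] norm_of_real
  by (intro nn_integral_cong) (simp add: ennreal_mult'[symmetric] abs_mult gauss_pos less_imp_le)
 also have "\<dots> = ennreal ((4 * pi * s) powr (- (DIM('a) / 2))) * ennreal ((pi / (1 / (4 * s))) powr (DIM('a) / 2))"
  using assms by (subst nn_integral_cmult) (auto simp: nn_integral_gauss)
 also have "\<dots> = ennreal ((4 * pi * s) powr (- (DIM('a) / 2)) * (4 * pi * s) powr (DIM('a) / 2))"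
  by (simp add: ennreal_mult' ac_simps)
 also have "\<dots> = 1" unfolding powr_add[symmetric] using assms by simp
 finally show ?thesis .
qed

lemma lpb_heat:
 fixes f :: "'a::euclidean_space => complex"
 assumes "0 < s" "1 <= q" "lpb lborel q f B"
 shows "lpb lborel q (cv (gker (of_real s)) f) B"
 using young_convolution[of "gker (of_real s)" 1 q f B] nn_integral_heat_kernel[OF assms(1), where 'a='a] assms by simp

lemma l2b_self_pairing:
 assumes v: "l2b v X" and le: "norm (LL x. v x * cnj (v x)) <= B^2" and B: "0 <= B"
 shows "l2b v B"
proof -
 have "(LL x. v x * cnj (v x)) = of_real (LL x. (norm (v x))^2)"
  by (simp only: complex_norm_square[symmetric] integral_complex_of_real)
 then have "(LL x. (norm (v x))^2) <= B^2" using le by simp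
 moreover have "integrable lborel (%x. (norm (v x))^2)"
  using integrable_norm[OF lpb_2_integrable_mult(1)[OF v v]] by (simp add: norm_mult power2_eq_square)
 ultimately show ?thesis using lpb_measurable[OF v] B by (simp add: lpb_2_iff nn_integral_eq_integral ennreal_leI)
qed

text \<open>The square of the L^2 norm is the pairing of \<open>cnj f\<close> with the flow of
  \<open>f\<close> for the time \<open>cnj z + z = 2 * Re z\<close>. That is a real heat flow, whose
  kernel is positive with mass one. The bound is therefore uniform in \<open>z\<close>, whereas
  Young's inequality for the kernel itself blows up as \<open>Re z\<close> tends to 0.\<close>

lemma lpb_2_cv_gker:
 fixes f :: "'a::euclidean_space => complex"
 assumes z: "0 < Re z" and f: "l2b f B"
 shows "l2b (cv (gker z) f) B"
proof -
 have [measurable]: "bm f" using f by (auto simp: lpb_def)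
 obtain A c where kz: "gbd A c (gker z :: 'a => complex)" using gbd_gker_ex[OF z] by blast
 define v where "v = cv (gker z) f"
 have v: "l2b v (A * gL1 TYPE('a) c * B)" unfolding v_def by (intro gbd_young kz f) simp
 have cf: "l2b (%x. cnj (f x)) B" by (rule lpb_cong_norm[OF f]) simp_all
 have cv': "l2b (%x. cnj (v x)) (A * gL1 TYPE('a) c * B)" using lpb_cong_norm[OF v, of "%x. cnj (v x)"] v by (auto simp: lpb_def)
 have czz: "cnj z + z = of_real (2 * Re z)" by (simp add: complex_eq_iff)
 have "(LL x. v x * cnj (v x)) = (LL x. cv (gker (cnj z)) (%x. cnj (f x)) x * v x)"
  unfolding v_def cnj_cv cnj_gker[OF z] by (simp add: mult.commute)
 also have "\<dots> = (LL y. cnj (f y) * cv (gker (cnj z)) v y)"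
 proof -
  obtain A' c' where "gbd A' c' (gker (cnj z) :: 'a => complex)" using gbd_gker_ex[of "cnj z"] z by auto
  from cv_pairing[OF this cf v] show ?thesis by simp
 qed
 also have "\<dots> = (LL y. cnj (f y) * cv (gker (of_real (2 * Re z))) f y)"
  unfolding v_def using z f by (simp only: cv_gker_gker[of "cnj z" z, OF _ z f] complex_cnj czz cnj.simps)
 finally have "norm (LL x. v x * cnj (v x)) <= B * B"
  using lpb_2_integrable_mult(2)[OF cf lpb_heat[of "2 * Re z" 2 f B]] z f by simp
 then show ?thesis using l2b_self_pairing[OF v _ lpb_nonneg[OF f]] by (simp add: v_def power2_eq_square)
qed

text \<open>The modulus of \<open>z\<close> is at least that of \<open>Im z\<close>, so the decay is
  that of the Schroedinger kernel, uniformly in the regularisation.\<close>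

lemma norm_cv_gker_L1:
 fixes f :: "'a::euclidean_space => complex"
 assumes z: "0 < Re z" "Im z \<noteq> 0" and [measurable]: "bm f"
 shows "ennreal (norm (cv (gker z) f x)) <= ennreal ((4 * pi * abs (Im z)) powr (- (DIM('a) / 2))) * (NN y. ennreal (norm (f y)))"
proof -
 have le: "norm (gker z (y::'a)) <= (4 * pi * abs (Im z)) powr (- (DIM('a) / 2))" for y
 proof -
  have "norm (gker z y) <= (4 * pi * norm z) powr (- (DIM('a) / 2)) * 1"
   unfolding norm_gker[OF z(1)] using z by (intro mult_left_mono gauss_le_1) auto
  also have "\<dots> <= (4 * pi * abs (Im z)) powr (- (DIM('a) / 2))"
   using z abs_Im_le_cmod[of z] by (simp, intro powr_mono2') auto
  finally show ?thesis .
 qed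
 have "ennreal (norm (cv (gker z) f x)) <= (NN y. ennreal (norm (gker z (x - y) * f y)))"
  unfolding cv_def by (rule norm_integral_le_nn_integral)
 also have "\<dots> <= (NN y. ennreal ((4 * pi * abs (Im z)) powr (- (DIM('a) / 2))) * ennreal (norm (f y)))"
  by (intro nn_integral_mono) (simp add: norm_mult ennreal_mult'[symmetric] le mult_right_mono)
 also have "\<dots> = ennreal ((4 * pi * abs (Im z)) powr (- (DIM('a) / 2))) * (NN y. ennreal (norm (f y)))"
  by (rule nn_integral_cmult) measurable
 finally show ?thesis .
qed

lemma lpb_2_nn_integral: 
 assumes "lpb M 2 f B" "!!B. lpb M 2 f B ==> lpb M' 2 g B"
 shows "(\<integral>\<^sup>+x. ennreal ((norm (g x))^2) \<partial>M') <= (\<integral>\<^sup>+x. ennreal ((norm (f x))^2) \<partial>M)"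
proof -
 have "(\<integral>\<^sup>+x. ennreal ((norm (f x))^2) \<partial>M) < \<infinity>" using assms(1) by (auto simp: lpb_2_iff top.not_eq_extremum[symmetric] top_unique)
 then obtain W where W: "(\<integral>\<^sup>+x. ennreal ((norm (f x))^2) \<partial>M) = ennreal W" "0 <= W"
  by (cases "(\<integral>\<^sup>+x. ennreal ((norm (f x))^2) \<partial>M)") auto
 have "lpb M 2 f (sqrt W)" using assms(1) W by (simp add: lpb_2_iff)
 from assms(2)[OF this] show ?thesis using W by (simp add: lpb_2_iff)
qed

lemma lpb_mult_limit:
 assumes "!!A'. A < A' ==> lpb M p f (C * A')" "0 <= A" "0 < C" "0 < p"
 shows "lpb M p f (C * A)"
proof (rule lpb_limit)
 fix e :: real assume "0 < e"
 then have "lpb M p f (C * (A + e / C))" using assms by (intro assms(1)) auto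
 then show "lpb M p f (C * A + e)" using assms(3) by (simp add: distrib_left)
qed (use assms in auto)

text \<open>The decay rate is \<open>2 / b\<close> exactly for \<open>b = 2 + 4 / N\<close>.\<close>

lemma dispersive_estimate:
 fixes dummy :: "'a::euclidean_space itself"
 assumes b: "b = 2 + 4 / DIM('a)" "a = b / (b - 1)"
 obtains C where "0 < C" and "!!z (f::'a => complex) A B. 0 < Re z ==> Im z \<noteq> 0 ==> l2b f B ==> lpb lborel a f A ==>
   lpb lborel b (cv (gker z) f) (C * abs (Im z) powr (- 2 / b) * A)"
proof -
 have N: "0 < real DIM('a)" by simp
 have b2: "2 < b" and bb: "(b - 2) / b * (- (DIM('a) / 2)) = - 2 / b" using N unfolding b(1) by (auto simp: field_simps)
 have a1: "1 < a" using b2 unfolding b(2) by (simp add: field_simps)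
 \<comment> \<open>The \<open>b\<close>-th root of the interpolation constant, with the factor
   \<open>4 * pi\<close> of the kernel bound separated from the power of \<open>abs (Im z)\<close>
   by means of \<open>bb\<close>.\<close>
 define C where "C = (4 * b / (b - 2)) powr (1 / b) * 2 powr ((b - 2) / b) * (4 * pi) powr (- 2 / b)"
 have C0: "0 < C" using b2 by (simp add: C_def)
 have main: "lpb lborel b (cv (gker z) f) (C * abs (Im z) powr (- 2 / b) * A)"
  if z: "0 < Re z" "Im z \<noteq> 0" and f2: "l2b f B" and fa: "lpb lborel a f A" and A: "0 < A"
  for z A B and f :: "'a => complex"
 proof -
  define f' where "f' y = of_real (1 / A) * f y" for y
  have f'2: "l2b f' (norm (complex_of_real (1 / A)) * B)" unfolding f'_def by (rule lpb_cmult[OF f2])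
  have [measurable]: "bm f'" using f'2 by (auto simp: lpb_def)
  have fa': "lpb lborel a f' 1" using lpb_cmult[OF fa, of "of_real (1 / A)"] A by (simp add: f'_def[abs_def] norm_divide)
  define A0 where "A0 = (4 * pi * abs (Im z)) powr (- (DIM('a) / 2))"
  have A0: "0 < A0" using z by (simp add: A0_def)
  obtain Ak ck where kz: "gbd Ak ck (gker z :: 'a => complex)" using gbd_gker_ex[OF z(1)] by blast
  \<comment> \<open>Both cuts of the normalised function lie in L^2, where the convolution converges
    and is additive.\<close>
  have 2: "l2b (%x. if h < norm (f' x) then f' x else 0) (norm (complex_of_real (1 / A)) * B)"
   "l2b (%x. if h < norm (f' x) then 0 else f' x) (norm (complex_of_real (1 / A)) * B)" for h
   by (rule lpb_dominated[OF f'2]; simp)+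
  have "(NN y. ennreal (norm (cv (gker z) f' y) powr b)) <= ennreal (4 * b / (b - 2) * (2 * A0) powr (b - 2))"
  proof (rule marcinkiewicz_L1_Linfinity[OF lborel.sigma_finite_measure_axioms lborel.sigma_finite_measure_axioms, where a=a and T="cv (gker z)" and f=f' and A=A0])
   show "(NN x. ennreal (norm (f' x) powr a)) <= 1" using fa' by (simp add: lpb_def)
   fix h :: real
   show "cv (gker z) f' y = cv (gker z) (%x. if h < norm (f' x) then f' x else 0) y + cv (gker z) (%x. if h < norm (f' x) then 0 else f' x) y" for y
    by (subst cv_add[OF kz 2(1)[of h] 2(2)[of h], symmetric]) (auto intro!: arg_cong[where f="%f. cv (gker z) f y"])
   show "ennreal (norm (cv (gker z) (%x. if h < norm (f' x) then f' x else 0) y)) <= ennreal A0 * (NN x. ennreal (norm (if h < norm (f' x) then f' x else 0)))" for y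
    unfolding A0_def by (rule norm_cv_gker_L1[OF z]) measurable
   show "(NN y. ennreal ((norm (cv (gker z) (%x. if h < norm (f' x) then 0 else f' x) y))^2)) <= (NN x. ennreal ((norm (if h < norm (f' x) then 0 else f' x))^2))"
    by (rule lpb_2_nn_integral[OF 2(2)[of h]]) (rule lpb_2_cv_gker[OF z(1)])
  qed (use b b2 A0 in auto)
  also have "4 * b / (b - 2) * (2 * A0) powr (b - 2) = (C * abs (Im z) powr (- 2 / b)) powr b"
  proof -
   have "A0 powr ((b - 2) / b) = (4 * pi) powr (- 2 / b) * abs (Im z) powr (- 2 / b)"
    unfolding A0_def powr_powr mult.commute[of "- (real DIM('a) / 2)"] bb by (simp add: powr_mult)
   then have "C * abs (Im z) powr (- 2 / b) = (4 * b / (b - 2)) powr (1 / b) * (2 powr ((b - 2) / b) * A0 powr ((b - 2) / b))"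
    by (simp add: C_def)
   also have "\<dots> = (4 * b / (b - 2)) powr (1 / b) * (2 * A0) powr ((b - 2) / b)"
    using A0 by (simp add: powr_mult)
   finally show ?thesis using b2 A0 by (simp add: powr_mult powr_powr)
  qed
  finally have "lpb lborel b (cv (gker z) f') (C * abs (Im z) powr (- 2 / b))"
   using C0 by (auto simp: lpb_def)
  from lpb_cmult[OF this, of "of_real A"] have "lpb lborel b (%x. of_real A * cv (gker z) f' x) (A * (C * abs (Im z) powr (- 2 / b)))"
   using A by simp
  moreover have "of_real A * cv (gker z) f' x = cv (gker z) f x" for x
   unfolding f'_def cv_cmult using A by simp
  ultimately show ?thesis by (simp add: ac_simps)
 qed
 show ?thesis
 proof (rule that[OF C0])
  fix z :: complex and f :: "'a => complex" and A B
  assume z: "0 < Re z" "Im z \<noteq> 0" and f2: "l2b f B" and fa: "lpb lborel a f A"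
  show "lpb lborel b (cv (gker z) f) (C * abs (Im z) powr (- 2 / b) * A)"
  proof (rule lpb_mult_limit)
   fix A' assume "A < A'"
   then show "lpb lborel b (cv (gker z) f) (C * abs (Im z) powr (- 2 / b) * A')"
    using lpb_nonneg[OF fa] a1 by (intro main[OF z f2] lpb_mono[OF fa]) auto
  qed (use C0 z b2 lpb_nonneg[OF fa] in auto)
 qed
qed

section \<open>Strichartz estimates\<close>

lemma measurable_lborel_pair [simp]:
 "borel_measurable lborel2 = borel_measurable (borel \<Otimes>\<^sub>M borel)"
 by (rule measurable_cong_sets) (auto intro!: sets_pair_measure_cong)

lemma measurable_curried:
 assumes "jm k" "f \<in> M \<rightarrow>\<^sub>M borel" "g \<in> M \<rightarrow>\<^sub>M borel"
 shows "(%w. k (f w) (g w)) \<in> borel_measurable M"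
 using measurable_compose[OF measurable_Pair[OF assms(2,3)] assms(1)] by simp

section \<open>Space-time norms and kernel families\<close>

definition xpb :: "real => (real => 'a::euclidean_space => complex) => real => bool" where
 "xpb p F A \<longleftrightarrow> lpb lborel2 p (case_prod F) A"

lemma xpb_iff:
 "xpb p F A \<longleftrightarrow> jm F \<and> 0 <= A \<and>
   (NN t. (NN x. ennreal (norm (F t x) powr p))) <= ennreal (A powr p)"
proof (cases "jm F")
 case True
 then have "(\<integral>\<^sup>+z. ennreal (norm (case_prod F z) powr p) \<partial>lborel2) =
   (NN t. (NN x. ennreal (norm (F t x) powr p)))"
  by (subst lborel.nn_integral_fst[symmetric]) auto
 then show ?thesis using True by (simp add: xpb_def lpb_def)
qed (simp add: xpb_def lpb_def)

text \<open>Qualitative control: bounded in L^2 over bounded times. It makes time integrals converge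
  and justifies Fubini; the uniform estimates are carried by \<open>xpb\<close>.\<close>

definition locL2 :: "(real => 'a::euclidean_space => complex) => bool" where
 "locL2 F \<longleftrightarrow> jm F \<and> (\<forall>T. \<exists>B. \<forall>t. abs t <= T --> l2b (F t) B)"

lemma locL2_measurable: "locL2 F ==> jm F"
 by (simp add: locL2_def)

lemma locL2_slice: "locL2 F ==> \<exists>B. l2b (F t) B"
 unfolding locL2_def by (metis order_refl)

text \<open>One Gaussian majorant per bounded time interval. At fixed regularisation the flow
  kernel, its first and second derivatives and its Laplacian all qualify.\<close>

definition kfam :: "(real => 'a::euclidean_space => complex) => bool" where
 "kfam k \<longleftrightarrow> jm k \<and> (\<forall>T. \<exists>A c. \<forall>t. abs t <= T --> gbd A c (k t))"

lemma kfam_measurable: "kfam k ==> jm k"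
 by (simp add: kfam_def)

lemma kfam_slice: "kfam k ==> \<exists>A c. gbd A c (k t)"
 unfolding kfam_def by (metis order_refl)

lemma measurable_slice:
 assumes "jm F"
 shows "bm (F t)"
 using measurable_curried[OF assms, of "%_. t" borel "%x. x"] by simp

text \<open>Cauchy-Schwarz over the time support, an interval of length \<open>2 * T\<close>,
  followed by Tonelli gives the L^2 bound; the pairing statements are Fubini under the same
  control.\<close>

lemma time_integral:
 fixes h :: "real => 'a::euclidean_space => complex"
 assumes meas: "jm h" and T: "0 <= T" and b: "0 <= b"
  and bd: "!!s. abs s <= T ==> l2b (h s) b"
  and zero: "!!s x. T < abs s ==> h s x = 0"
 shows lpb_time_integral: "l2b (%x. LL s. h s x) (2 * T * b)"
  and time_integral_pairing: "l2b g B ==> (LL x. (LL s. h s x) * g x) = (LL s. LL x. h s x * g x)"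
  and time_integral_pairing_integrable: "l2b g B ==> integrable lborel (%s. LL x. h s x * g x)"
proof -
 note [measurable] = measurable_curried[OF meas]
 have pt: "ennreal ((norm (LL s. h s x))^2) <= ennreal (2 * T) * (NN s. ennreal ((norm (h s x))^2))" for x
 proof -
  have "ennreal (norm (LL s. h s x)) <= (NN s. ennreal (norm (h s x)))" by (rule norm_integral_le_nn_integral)
  also have "\<dots> = (NN s. indicator {-T..T} s * ennreal (norm (h s x)))"
   using zero by (intro nn_integral_cong) (force simp: indicator_def not_le[symmetric])
  finally have "ennreal (norm (LL s. h s x))^2 <= (NN s. indicator {-T..T} s * ennreal (norm (h s x)))^2"
   by (rule power_mono) simp
  also have "\<dots> <= (NN s. (indicator {-T..T} s)^2) * (NN s. ennreal (norm (h s x))^2)"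
   by (rule Cauchy_Schwarz_nn_integral) measurable
  finally show ?thesis using T by (simp add: power2_eq_square ennreal_mult flip: indicator_inter_arith)
 qed
 have "(NN x. ennreal ((norm (LL s. h s x))^2)) <= ennreal (2 * T) * (NN x. (NN s. ennreal ((norm (h s x))^2)))"
  by (subst nn_integral_cmult[symmetric]) (auto intro!: nn_integral_mono pt)
 also have "(NN x. (NN s. ennreal ((norm (h s x))^2))) = (NN s. (NN x. ennreal ((norm (h s x))^2)))"
  by (rule lborel_pair.Fubini') measurable
 also have "\<dots> <= (NN s. ennreal (b^2) * indicator {-T..T} s)"
 proof (intro nn_integral_mono)
  fix s
  show "(NN x. ennreal ((norm (h s x))^2)) <= ennreal (b^2) * indicator {-T..T} s"
  proof (cases "abs s <= T")
   case True
   then show ?thesis using bd[OF True] by (auto simp: lpb_2_iff indicator_def)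
  qed (simp add: zero)
 qed
 also have "\<dots> = ennreal (b^2 * (2 * T))" using T by (simp add: nn_integral_cmult ennreal_mult')
 also have "ennreal (2 * T) * \<dots> = ennreal ((2 * T * b)^2)"
  using T by (simp add: power2_eq_square ac_simps flip: ennreal_mult')
 finally show "l2b (%x. LL s. h s x) (2 * T * b)"
  using T b by (simp add: lpb_2_iff mult_left_mono)
 assume g: "l2b g B"
 then have [measurable]: "bm g" by (simp add: lpb_def)
 have "(NN x. (NN s. ennreal (norm (h s x * g x)))) = (NN s. (NN x. ennreal (norm (h s x * g x))))"
  by (rule lborel_pair.Fubini') measurable
 also have "\<dots> <= (NN s. ennreal (b * B) * indicator {-T..T} s)"
 proof (intro nn_integral_mono)
  fix s
  show "(NN x. ennreal (norm (h s x * g x))) <= ennreal (b * B) * indicator {-T..T} s"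
  proof (cases "abs s <= T")
   case True
   then show ?thesis using lpb_holder[OF bd[OF True] g] by (auto simp: indicator_def norm_mult)
  qed (simp add: zero)
 qed
 also have "\<dots> < \<infinity>" using T by (simp add: nn_integral_cmult ennreal_mult_less_top)
 finally have fin: "(NN x. (NN s. ennreal (norm (h s x * g x)))) < \<infinity>" .
 have m: "(%(x, s). h s x * g x) \<in> borel_measurable lborel2" by measurable
 from fubini_pair[OF m fin] show "(LL x. (LL s. h s x) * g x) = (LL s. LL x. h s x * g x)"
  and "integrable lborel (%s. LL x. h s x * g x)" by simp_all
qed

text \<open>\<open>n s\<close> represents the norm of the slice at time \<open>s\<close>. Where that
  norm is infinite \<open>enn2real\<close> returns 0, which concerns a null set of times
  only.\<close>

lemma slice_norm:
 fixes F :: "real => 'a::euclidean_space => complex"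
 assumes F: "xpb a F A" and a: "1 < a"
 obtains n where "lpb lborel a n A" "!!s. 0 <= n s" "AE s in lborel. lpb lborel a (F s) (n s)"
proof -
 have meas: "jm F" using F by (simp add: xpb_iff)
 note [measurable] = measurable_curried[OF meas]
 define J where "J s = (NN x. ennreal (norm (F s x) powr a))" for s
 have "J \<in> borel_measurable lborel" unfolding J_def by measurable
 then have Jm[measurable]: "bm J" by simp
 have Jint: "(NN s. J s) <= ennreal (A powr a)" using F by (simp add: xpb_iff J_def)
 define n where "n s = enn2real (J s) powr (1 / a)" for s
 have na: "n s powr a = enn2real (J s)" for s using a by (simp add: n_def powr_powr)
 have fin: "AE s in lborel. J s \<noteq> \<infinity>"
  using Jint by (intro nn_integral_noteq_infinite) (auto simp: top_unique)
 show ?thesis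
 proof (rule that)
  have "(NN s. ennreal (norm (n s) powr a)) <= (NN s. J s)"
  proof (intro nn_integral_mono)
   fix s
   have "norm (n s) powr a = enn2real (J s)" using na[of s] by (simp add: n_def)
   then show "ennreal (norm (n s) powr a) <= J s" by (simp add: ennreal_enn2real_if)
  qed
  then show "lpb lborel a n A" using Jint F by (auto simp: lpb_def xpb_iff n_def[abs_def])
  show "0 <= n s" for s by (simp add: n_def)
  show "AE s in lborel. lpb lborel a (F s) (n s)"
   using fin
  proof (rule eventually_mono)
   fix s assume s: "J s \<noteq> \<infinity>"
   have "ennreal (n s powr a) = J s" unfolding na using s by (simp add: ennreal_enn2real_if)
   then show "lpb lborel a (F s) (n s)"
    using measurable_slice[OF meas, of s] by (simp add: lpb_def J_def n_def)
  qed
 qed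
qed

lemma measurable_gker_family [measurable]:
 assumes "0 < e"
 shows "jm (%t x. gker (Complex e t) x)"
proof -
 have "continuous_on UNIV (%(t, x::'a). gker (Complex e t) x)"
  unfolding gker_def Complex_eq case_prod_beta
  by (intro continuous_intros) (use assms in \<open>auto simp: complex_nonpos_Reals_iff complex_eq_iff mult_le_0_iff not_le\<close>)
 then have "bm (%(t, x::'a). gker (Complex e t) x)" by (rule borel_measurable_continuous_onI)
 then show ?thesis by (simp add: borel_prod)
qed

lemma kfam_gker: 
 assumes "0 < e"
 shows "kfam (%t. gker (Complex e t) :: 'a::euclidean_space => complex)"
 unfolding kfam_def
proof (intro conjI allI)
 show "jm (%t x. gker (Complex e t) x)"
  by (rule measurable_gker_family[OF assms])
 fix T
 have "norm (Complex e t) <= e + abs T" if "abs t <= T" for t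
  using cmod_le[of "Complex e t"] that assms by auto
 then have "gbd ((4 * pi * e) powr (- (DIM('a) / 2))) (e / (4 * (e + abs T)^2)) (gker (Complex e t) :: 'a => complex)" if "abs t <= T" for t
  using that assms by (intro gbd_gker) auto
 then show "\<exists>A c. \<forall>t. abs t <= T --> gbd A c (gker (Complex e t) :: 'a => complex)" by blast
qed

lemma kfam_minus: "kfam k ==> kfam (%t. k (c + s * t))"
 unfolding kfam_def
proof safe
 assume k: "jm k"
 note [measurable] = measurable_curried[OF k]
 show "jm (%t y. k (c + s * t) y)" by measurable
next
 fix T assume "\<forall>T. \<exists>A c. \<forall>t. abs t <= T --> gbd A c (k t)"
 then obtain A c' where "!!t. abs t <= abs c + abs s * abs T ==> gbd A c' (k t)" by metis
 moreover have "abs (c + s * t) <= abs c + abs s * abs T" if "abs t <= T" for t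
 proof -
  have "abs (s * t) <= abs s * abs T" using that by (auto simp: abs_mult intro!: mult_left_mono)
  then show ?thesis by linarith
 qed
 ultimately show "\<exists>A c'. \<forall>t. abs t <= T --> gbd A c' (k (c + s * t))" by blast
qed

lemma measurable_cv_family:
 assumes "jm k" "jm F"
 shows "(%(t, s, x). cv (k t) (F s) x) \<in> borel_measurable (borel \<Otimes>\<^sub>M borel \<Otimes>\<^sub>M borel)"
proof -
 note [measurable] = measurable_curried[OF assms(1)] measurable_curried[OF assms(2)]
 show ?thesis unfolding cv_def by measurable
qed

lemma measurable_cv_comp:
 assumes k: "jm k" and F: "jm F"
  and [measurable]: "f \<in> M \<rightarrow>\<^sub>M borel" "g \<in> M \<rightarrow>\<^sub>M borel" "h \<in> M \<rightarrow>\<^sub>M borel"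
 shows "(%w. cv (k (f w)) (F (g w)) (h w)) \<in> borel_measurable M"
proof -
 have "(%w. (f w, g w, h w)) \<in> M \<rightarrow>\<^sub>M borel \<Otimes>\<^sub>M borel \<Otimes>\<^sub>M borel" by measurable
 from measurable_compose[OF this measurable_cv_family[OF k F]] show ?thesis by simp
qed

text \<open>For each pair of times the dispersive estimate leaves the kernel
  \<open>abs (t - s) powr (- 2 / b)\<close>, and the Hardy-Littlewood-Sobolev inequality integrates
  it. The complex time \<open>z t s\<close> is kept free because its real part is twice the
  regularisation in the TT* argument and once in the Duhamel integral.\<close>

lemma bilinear_strichartz:
 fixes dummy :: "'a::euclidean_space itself"
 assumes b: "b = 2 + 4 / DIM('a)" "a = b / (b - 1)"
 obtains C where "0 < C" and "!!z (F :: real => 'a => complex) G A B.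
   (!!t s. 0 < Re (z t s)) ==> (!!t s. abs (Im (z t s)) = abs (t - s)) ==>
   locL2 F ==> locL2 G ==> xpb a F A ==> xpb a G B ==>
   (NN t. (NN s. ennreal (norm (LL x. cv (gker (z t s)) (F s) x * G t x)))) <= ennreal (C * A * B)"
proof -
 have b2: "2 < b" unfolding b(1) by simp
 have a1: "1 < a" "1 / b + 1 / a = 1" using b2 unfolding b(2) by (auto simp: field_simps)
 obtain C1 where C1: "0 < C1" and disp: "!!z (f::'a => complex) A B. 0 < Re z ==> Im z \<noteq> 0 ==> l2b f B ==> lpb lborel a f A ==>
   lpb lborel b (cv (gker z) f) (C1 * abs (Im z) powr (- 2 / b) * A)"
  using dispersive_estimate[OF b] by blast
 obtain C2 where C2: "0 < C2" and hls: "!!f h A B. lpb lborel a f A ==> lpb lborel a h B ==>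
   (NN t. (NN s. ennreal (abs (t - s) powr (- (2 / b)) * abs (f s) * abs (h t)))) <= ennreal (C2 * A * B)"
  using hardy_littlewood_sobolev[OF b2 b(2) refl] by blast
 show ?thesis
 proof (rule that)
  show "0 < C1 * C2" using C1 C2 by simp
  fix z :: "real => real => complex" and F G :: "real => 'a => complex" and A B
  assume z: "!!t s. 0 < Re (z t s)" "!!t s. abs (Im (z t s)) = abs (t - s)"
   and F2: "locL2 F" and G2: "locL2 G" and F: "xpb a F A" and G: "xpb a G B"
  obtain n where n: "lpb lborel a n A" "!!s. 0 <= n s" "AE s in lborel. lpb lborel a (F s) (n s)"
   using slice_norm[OF F a1(1)] by blast
  obtain m where m: "lpb lborel a m B" "!!s. 0 <= m s" "AE s in lborel. lpb lborel a (G s) (m s)"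
   using slice_norm[OF G a1(1)] by blast
  have nm: "bm n" "bm m" using n m by (auto simp: lpb_def)
  note [measurable] = nm
  have pt: "norm (LL x. cv (gker (z t s)) (F s) x * G t x) <= C1 * (abs (t - s) powr (- (2 / b)) * abs (n s) * abs (m t))"
   if "lpb lborel a (F s) (n s)" "lpb lborel a (G t) (m t)" "s \<noteq> t" for s t
  proof -
   obtain B' where "l2b (F s) B'" using locL2_slice[OF F2] by blast
   from disp[OF z(1)[of t s] _ this that(1)] that(3) z(2)[of t s]
   have "lpb lborel b (cv (gker (z t s)) (F s)) (C1 * abs (t - s) powr (- 2 / b) * n s)" by auto
   from lpb_holder[OF this that(2)] b2 a1
   have "(NN x. ennreal (norm (cv (gker (z t s)) (F s) x * G t x))) <= ennreal (C1 * abs (t - s) powr (- 2 / b) * n s * m t)"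
    by (simp add: norm_mult)
   then have "ennreal (norm (LL x. cv (gker (z t s)) (F s) x * G t x)) <= ennreal (C1 * abs (t - s) powr (- 2 / b) * n s * m t)"
    by (rule order_trans[OF norm_integral_le_nn_integral])
   then show ?thesis using C1 n(2)[of s] m(2)[of t] by (simp add: mult.assoc)
  qed
  have "(NN t. (NN s. ennreal (norm (LL x. cv (gker (z t s)) (F s) x * G t x))))
   <= (NN t. (NN s. ennreal C1 * ennreal (abs (t - s) powr (- (2 / b)) * abs (n s) * abs (m t))))"
  proof (rule nn_integral_mono_AE, use m(3) in eventually_elim)
   fix t assume t: "lpb lborel a (G t) (m t)"
   show "(NN s. ennreal (norm (LL x. cv (gker (z t s)) (F s) x * G t x))) <= (NN s. ennreal C1 * ennreal (abs (t - s) powr (- (2 / b)) * abs (n s) * abs (m t)))"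
   proof (rule nn_integral_mono_AE, use n(3) AE_lborel_singleton[of t] in eventually_elim)
    fix s assume "lpb lborel a (F s) (n s)" "s \<noteq> t"
    from pt[OF this(1) t this(2)] show "ennreal (norm (LL x. cv (gker (z t s)) (F s) x * G t x)) <= ennreal C1 * ennreal (abs (t - s) powr (- (2 / b)) * abs (n s) * abs (m t))"
     using C1 by (simp add: ennreal_mult'[symmetric] ennreal_leI)
   qed
  qed
  also have "\<dots> = (NN t. ennreal C1 * (NN s. ennreal (abs (t - s) powr (- (2 / b)) * abs (n s) * abs (m t))))"
   by (intro nn_integral_cong nn_integral_cmult) measurable
  also have "\<dots> = ennreal C1 * (NN t. (NN s. ennreal (abs (t - s) powr (- (2 / b)) * abs (n s) * abs (m t))))"
   by (rule nn_integral_cmult) measurable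
  also have "\<dots> <= ennreal C1 * ennreal (C2 * A * B)" by (intro mult_left_mono hls n m) simp
  also have "\<dots> = ennreal (C1 * C2 * A * B)" using C1 by (simp add: mult.assoc flip: ennreal_mult')
  finally show "(NN t. (NN s. ennreal (norm (LL x. cv (gker (z t s)) (F s) x * G t x)))) <= ennreal (C1 * C2 * A * B)" .
 qed
qed

text \<open>Converse of Hoelder's inequality: the test function
  \<open>norm v powr (p - 2) * cnj v\<close>, cut to \<open>E n\<close>, yields
  \<open>j <= C * j powr (1 / q)\<close> for the integral \<open>j\<close> over \<open>E n\<close>.
  Since \<open>j\<close> is finite it may be divided out, and \<open>E n\<close> then exhausts the
  space.\<close>

lemma lpb_dual:
 fixes v :: "'a => complex"
 assumes p: "1 < p" "q = p / (p - 1)" and [measurable]: "v \<in> borel_measurable M" "!!n::nat. E n \<in> sets M"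
  and E: "incseq E" "!!x. x \<in> space M ==> \<exists>n. x \<in> E n"
  and fin: "!!n. (\<integral>\<^sup>+x. ennreal (norm (v x) powr p) * indicator (E n) x \<partial>M) < \<infinity>"
  and bd: "!!n G A. lpb M q G A ==> (!!x. norm (G x) = norm (v x) powr (p - 1) * indicator (E n) x) ==>
    integrable M (%x. v x * G x) ==> norm (LINT x|M. v x * G x) <= C * A"
  and C: "0 <= C"
 shows "lpb M p v C"
proof -
 have q: "1 < q" "(p - 1) * q = p" "1 - 1 / q = 1 / p" using p(1) unfolding p(2) by (auto simp: field_simps)
 let ?w = "%n x. norm (v x) powr p * indicator (E n) x"
 have le: "(\<integral>\<^sup>+x. ennreal (?w n x) \<partial>M) <= ennreal (C powr p)" for n
 proof -
  define G where "G x = indicator (E n) x * of_real (norm (v x) powr (p - 2)) * cnj (v x)" for x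
  have [measurable]: "G \<in> borel_measurable M" by (simp add: G_def[abs_def])
  have "(\<integral>\<^sup>+x. ennreal (?w n x) \<partial>M) < \<infinity>" using fin[of n] by (simp add: ennreal_mult'' ennreal_indicator)
  then obtain j where j: "(\<integral>\<^sup>+x. ennreal (?w n x) \<partial>M) = ennreal j" "0 <= j"
   by (cases "\<integral>\<^sup>+x. ennreal (?w n x) \<partial>M") auto
  have pw: "norm (v x) powr (p - 1) = norm (v x) powr (p - 2) * norm (v x)" "norm (v x) powr p = norm (v x) powr (p - 2) * (norm (v x))^2" for x
   using powr_add[of "norm (v x)" "p - 2" 1] powr_add[of "norm (v x)" "p - 2" 2] by simp_all
  have nG: "norm (G x) = norm (v x) powr (p - 1) * indicator (E n) x" for x
   unfolding pw by (simp add: G_def norm_mult indicator_def)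
  have vG: "v x * G x = of_real (?w n x)" for x
   unfolding pw of_real_mult complex_norm_square by (simp add: G_def indicator_def mult_ac)
  have "(\<integral>\<^sup>+x. ennreal (norm (G x) powr q) \<partial>M) = (\<integral>\<^sup>+x. ennreal (?w n x) \<partial>M)"
   unfolding nG using q by (intro nn_integral_cong) (auto simp: indicator_def powr_powr)
  then have Gq: "lpb M q G (j powr (1 / q))" using j q by (simp add: lpb_def powr_powr)
  have "integrable M (?w n)" using j by (intro integrableI_nonneg) auto
  then have "integrable M (%x. v x * G x)" unfolding vG by (rule integrable_of_real)
  from bd[OF Gq nG this] have "norm (LINT x|M. v x * G x) <= C * j powr (1 / q)" .
  moreover have "(LINT x|M. v x * G x) = of_real (LINT x|M. ?w n x)" unfolding vG by (rule integral_complex_of_real)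
  moreover have "(LINT x|M. ?w n x) = j" using j by (subst integral_eq_nn_integral) auto
  ultimately have jle: "j <= C * j powr (1 / q)" using j by simp
  have "j <= C powr p"
  proof (cases "j = 0")
   case False
   then have j0: "0 < j" using j by simp
   have "j powr (1 / q) * j powr (1 / p) = j" unfolding powr_add[symmetric] q(3)[symmetric] using j0 by simp
   then have "j powr (1 / q) * j powr (1 / p) <= j powr (1 / q) * C" using jle by (simp add: mult.commute)
   then have "(j powr (1 / p)) powr p <= C powr p" using p j0 by (intro powr_mono2) auto
   then show ?thesis using j0 p by (simp add: powr_powr)
  qed simp
  then show ?thesis unfolding j(1) by (rule ennreal_leI)
 qed
 have "(\<integral>\<^sup>+x. ennreal (norm (v x) powr p) \<partial>M) = (\<integral>\<^sup>+x. (SUP n. ennreal (?w n x)) \<partial>M)"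
 proof (rule nn_integral_cong)
  fix x assume "x \<in> space M"
  then obtain m where m: "x \<in> E m" using E(2) by blast
  show "ennreal (norm (v x) powr p) = (SUP n. ennreal (?w n x))"
   using m by (intro antisym SUP_upper2[of m] SUP_least) (auto simp: indicator_def)
 qed
 also have "\<dots> = (SUP n. \<integral>\<^sup>+x. ennreal (?w n x) \<partial>M)"
  by (intro nn_integral_monotone_convergence_SUP)
    (use E(1) in \<open>auto simp: incseq_def le_fun_def indicator_def\<close>)
 also have "\<dots> <= ennreal (C powr p)" by (intro SUP_least le)
 finally show ?thesis using C by (simp add: lpb_def)
qed

text \<open>The signed indicator of the interval between \<open>0\<close> and \<open>t\<close>: it turns the oriented integral from \<open>0\<close> to \<open>t\<close> into an integral over the line.\<close>

definition tsg :: "real => real => complex" where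
 "tsg t s = (if 0 < s \<and> s < t then 1 else if t < s \<and> s < 0 then -1 else 0)"

lemma norm_tsg_le: "norm (tsg t s) <= 1" by (simp add: tsg_def)

lemma tsg_zero: "abs t <= abs s ==> tsg t s = 0" by (auto simp: tsg_def)

lemma measurable_tsg [measurable]: "jm tsg"
 unfolding tsg_def by measurable

lemmas measurable_tsg_comp [measurable] = measurable_curried[OF measurable_tsg]

text \<open>The Duhamel integral from 0 to \<open>t\<close>, for either sign of \<open>t\<close>.
  All factors in front of the forcing, the imaginary unit included, are part of
  \<open>F\<close>.\<close>

definition duh :: "(real => 'a::euclidean_space => complex) => (real => 'a => complex) => real => 'a => complex" where
 "duh k F t x = (LL s. tsg t s * cv (k (t - s)) (F s) x)"

lemma cv_zero [simp]: "cv k (%y. 0) x = 0" by (simp add: cv_def)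

context
 fixes k F :: "real => 'a::euclidean_space => complex"
 assumes k: "kfam k" and F: "locL2 F"
begin

private lemma integrand_measurable:
 "jm (%s x. tsg t s * cv (k (t - s)) (F s) x)"
proof -
 note [measurable] = measurable_cv_comp[OF kfam_measurable[OF k] locL2_measurable[OF F]]
 show ?thesis by measurable
qed

private lemma integrand_bounds:
 obtains A c B where "0 <= A" "0 <= B" "!!t s. abs t <= T ==> abs s <= abs t ==> gbd A c (k (t - s))" "!!s. abs s <= T ==> l2b (F s) B"
proof -
 obtain A c where 1: "!!t. abs t <= 2 * abs T ==> gbd A c (k t)" using k unfolding kfam_def by metis
 obtain B where 2: "!!t. abs t <= abs T ==> l2b (F t) B" using F unfolding locL2_def by metis
 have "0 <= A" "0 <= B" using 1[of 0] 2[of 0] by (auto simp: gbd_def lpb_def)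
 then show ?thesis by (rule that[of A B c]) (use 1 2 in auto)
qed

lemma measurable_duh: "jm (duh k F)"
proof -
 note [measurable] = measurable_cv_comp[OF kfam_measurable[OF k] locL2_measurable[OF F]]
 show ?thesis unfolding duh_def by measurable
qed

private lemma integrand_l2b:
 "\<exists>b\<ge>0. \<forall>t s. abs t <= T --> abs s <= abs t --> l2b (%x. tsg t s * cv (k (t - s)) (F s) x) b"
proof -
 obtain A c B where AB: "0 <= A" "0 <= B" "!!t s. abs t <= T ==> abs s <= abs t ==> gbd A c (k (t - s))" "!!s. abs s <= T ==> l2b (F s) B"
  by (rule integrand_bounds[of T], rule that, assumption+)
 have "l2b (%x. tsg t s * cv (k (t - s)) (F s) x) (A * gL1 TYPE('a) c * B)" if "abs t <= T" "abs s <= abs t" for t s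
 proof (rule lpb_dominated)
  show y: "l2b (cv (k (t - s)) (F s)) (A * gL1 TYPE('a) c * B)" using AB that by (intro gbd_young) auto
  show "(%x. tsg t s * cv (k (t - s)) (F s) x) \<in> borel_measurable lborel" using lpb_measurable[OF y] by simp
 qed (auto simp: norm_mult tsg_def)
 then show ?thesis using AB(1,2) by (intro exI[of _ "A * gL1 TYPE('a) c * B"]) (auto simp: gL1_nonneg)
qed

private lemma integrand_zero: "abs t < abs s ==> tsg t s * cv (k (t - s)) (F s) x = 0" by (simp add: tsg_zero)

lemma duh_pairing:
 assumes g: "l2b g B'"
 shows "(LL x. duh k F t x * g x) = (LL s. tsg t s * (LL x. cv (k (t - s)) (F s) x * g x))"
  and "integrable lborel (%s. tsg t s * (LL x. cv (k (t - s)) (F s) x * g x))"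
proof -
 obtain b where b: "0 <= b" "!!s. abs s <= abs t ==> l2b (%x. tsg t s * cv (k (t - s)) (F s) x) b"
  using integrand_l2b[of "abs t"] by auto
 note tp = integrand_measurable abs_ge_zero b integrand_zero g
 show "(LL x. duh k F t x * g x) = (LL s. tsg t s * (LL x. cv (k (t - s)) (F s) x * g x))"
  "integrable lborel (%s. tsg t s * (LL x. cv (k (t - s)) (F s) x * g x))"
  unfolding duh_def using time_integral_pairing[OF tp] time_integral_pairing_integrable[OF tp] by (simp_all add: mult.assoc)
qed

lemma locL2_duh: "locL2 (duh k F)"
 unfolding locL2_def
proof (intro conjI allI measurable_duh)
 fix T
 obtain b where b: "0 <= b" "!!t s. abs t <= T ==> abs s <= abs t ==> l2b (%x. tsg t s * cv (k (t - s)) (F s) x) b"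
  using integrand_l2b[of T] by auto
 have "l2b (duh k F t) (2 * abs T * b)" if t: "abs t <= T" for t
  unfolding duh_def[abs_def]
  by (rule lpb_mono[OF lpb_time_integral[OF integrand_measurable abs_ge_zero b(1) b(2)[OF t] integrand_zero]]) (use t b in \<open>auto intro!: mult_right_mono\<close>)
 then show "\<exists>B. \<forall>t. abs t <= T --> l2b (duh k F t) B" by blast
qed

lemma duh_integrable: "integrable lborel (%s. tsg t s * cv (k (t - s)) (F s) x)"
 and duh_bounded_at: "\<exists>B. \<forall>t x. abs t <= T --> norm (duh k F t x) <= B"
proof -
 have bd: "\<exists>C. \<forall>t x. abs t <= T --> (NN s. ennreal (norm (tsg t s * cv (k (t - s)) (F s) x))) <= ennreal C" for T
 proof -
  obtain A c B where AB: "0 <= A" "0 <= B" "!!t s. abs t <= T ==> abs s <= abs t ==> gbd A c (k (t - s))" "!!s. abs s <= T ==> l2b (F s) B"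
   by (rule integrand_bounds[of T], rule that, assumption+)
  let ?b = "A * gL2 TYPE('a) c * B"
  have "(NN s. ennreal (norm (tsg t s * cv (k (t - s)) (F s) x))) <= ennreal (?b * (2 * abs T))" if t: "abs t <= T" for t x
  proof -
   have "(NN s. ennreal (norm (tsg t s * cv (k (t - s)) (F s) x))) <= (NN s. ennreal ?b * indicator {-abs T..abs T} s)"
   proof (intro nn_integral_mono)
    fix s
    have "norm (tsg t s * cv (k (t - s)) (F s) x) <= ?b" if s: "abs s <= abs t"
    proof -
     have "l2b (F s) B" using s t by (intro AB(4)) simp
     from cv_integrable(2)[OF AB(3)[OF t s] this, of x] show ?thesis
      by (intro order_trans[OF norm_mult_ineq] order_trans[OF mult_left_le_one_le[OF _ _ norm_tsg_le]]) auto
    qed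
    then show "ennreal (norm (tsg t s * cv (k (t - s)) (F s) x)) <= ennreal ?b * indicator {-abs T..abs T} s"
     using t integrand_zero[of t s x] by (cases "abs s <= abs t") (auto simp: indicator_def ennreal_leI)
   qed
   also have "\<dots> = ennreal (?b * (2 * abs T))" by (simp add: nn_integral_cmult ennreal_mult'')
   finally show ?thesis .
  qed
  then show ?thesis by blast
 qed
 note [measurable] = measurable_cv_comp[OF kfam_measurable[OF k] locL2_measurable[OF F]]
 show "integrable lborel (%s. tsg t s * cv (k (t - s)) (F s) x)"
 proof (rule integrableI_bounded)
  obtain C where "(NN s. ennreal (norm (tsg t s * cv (k (t - s)) (F s) x))) <= ennreal C" using bd[of "abs t"] by auto
  then show "(NN s. ennreal (norm (tsg t s * cv (k (t - s)) (F s) x))) < \<infinity>" by (rule order.strict_trans1) simp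
 qed measurable
 obtain C where C: "!!t x. abs t <= T ==> (NN s. ennreal (norm (tsg t s * cv (k (t - s)) (F s) x))) <= ennreal C" using bd[of T] by auto
 have "norm (duh k F t x) <= max C 0" if t: "abs t <= T" for t x
  using order_trans[OF norm_integral_le_nn_integral C[OF t, of x]] unfolding duh_def by (auto simp: ennreal_le_iff2)
 then show "\<exists>B. \<forall>t x. abs t <= T --> norm (duh k F t x) <= B" by blast
qed

end

lemma locL2_dominated:
 assumes F: "locL2 F" and G: "jm G"
  and le: "!!t x. norm (G t x) <= norm (F t x)"
 shows "locL2 G"
 unfolding locL2_def
proof (intro conjI G allI)
 fix T
 obtain B where B: "\<forall>t. abs t <= T --> l2b (F t) B" using F unfolding locL2_def by metis
 have "l2b (G t) B" if "abs t <= T" for t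
  by (rule lpb_dominated[OF B[rule_format, OF that]]) (use measurable_slice[OF G] le in auto)
 then show "\<exists>B. \<forall>t. abs t <= T --> l2b (G t) B" by blast
qed

lemma xpb_dominated:
 assumes F: "xpb p F A" and G: "jm G"
  and le: "!!t x. norm (G t x) <= norm (F t x)" and p: "0 <= p"
 shows "xpb p G A"
 unfolding xpb_def by (rule lpb_dominated[OF F[unfolded xpb_def]]) (use G p le in auto)

lemma lpb_indicator_cball:
 assumes "0 <= b" "0 < p"
 shows "lpb lborel p (%x. indicator (cball (z::'a::euclidean_space) r) x * b :: real) (b * measure lborel (cball z r) powr (1 / p))"
proof -
 have [measurable]: "cball z r \<in> sets borel" by simp
 let ?c = "measure lborel (cball z r)"
 have "(NN x. ennreal (norm (indicator (cball z r) x * b) powr p)) = (NN x. ennreal (b powr p) * indicator (cball z r) x)"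
  using assms by (intro nn_integral_cong) (auto simp: indicator_def)
 also have "\<dots> = ennreal (b powr p) * ennreal ?c"
  by (simp add: nn_integral_cmult_indicator emeasure_eq_ennreal_measure less_imp_neq[OF emeasure_lborel_cball_finite, simplified])
 also have "\<dots> = ennreal ((b * ?c powr (1 / p)) powr p)" using assms by (simp add: powr_mult powr_powr ennreal_mult)
 finally show ?thesis using assms by (simp add: lpb_def, measurable)
qed

lemma locL2_boundedI:
 fixes G :: "real => 'a::euclidean_space => complex"
 assumes G: "jm G" and le: "!!t x. norm (G t x) <= b * indicator (cball 0 r) x"
 shows "locL2 G"
 unfolding locL2_def
proof (intro conjI G allI)
 have "norm (G t x) <= norm (indicator (cball 0 r) x * abs b)" for t x
  using le[of t x] by (auto simp: indicator_def split: if_splits)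
 then have "l2b (G t) (abs b * measure lborel (cball (0::'a) r) powr (1 / 2))" for t
  using measurable_slice[OF G] by (intro lpb_dominated[OF lpb_indicator_cball]) auto
 then show "\<exists>B. \<forall>t. abs t <= T --> l2b (G t) B" for T by blast
qed

definition sol :: "(real => 'a::euclidean_space => complex) => ('a => complex) => (real => 'a => complex) => real => 'a => complex" where
 "sol k f F t x = cv (k t) f x + duh k F t x"

lemma measurable_free:
 assumes "kfam k" and [measurable]: "bm f"
 shows "jm (%t x. cv (k t) f x)"
proof -
 have "jm (%(s::real) x. f x)" by measurable
 note [measurable] = measurable_cv_comp[OF kfam_measurable[OF assms(1)] this, of _ _ "%_. 0"]
 show ?thesis by measurable
qed

lemma locL2_free:
 fixes k :: "real => 'a::euclidean_space => complex"
 assumes k: "kfam k" and f: "l2b f B"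
 shows "locL2 (%t. cv (k t) f)"
  and free_bounded_at: "\<exists>b. \<forall>t x. abs t <= T --> norm (cv (k t) f x) <= b"
proof -
 have fm: "bm f" using f by (simp add: lpb_def)
 have "\<exists>B'. \<forall>t. abs t <= T --> l2b (cv (k t) f) B'" for T
 proof -
  obtain A c where "\<forall>t. abs t <= T --> gbd A c (k t)" using k unfolding kfam_def by metis
  then have "\<forall>t. abs t <= T --> l2b (cv (k t) f) (A * gL1 TYPE('a) c * B)"
   by (auto intro!: gbd_young f)
  then show ?thesis by blast
 qed
 then show "locL2 (%t. cv (k t) f)" unfolding locL2_def using measurable_free[OF k fm] by auto
 obtain A c where "\<forall>t. abs t <= T --> gbd A c (k t)" using k unfolding kfam_def by metis
 then have "\<forall>t x. abs t <= T --> norm (cv (k t) f x) <= A * gL2 TYPE('a) c * B"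
  by (auto intro!: cv_integrable(2)[OF _ f])
 then show "\<exists>b. \<forall>t x. abs t <= T --> norm (cv (k t) f x) <= b" by blast
qed

text \<open>The exhausting sets are bounded space-time boxes, on which \<open>v\<close> is bounded.
  The dual test function is therefore bounded with bounded support, hence an admissible
  \<open>G\<close>.\<close>

lemma xpb_dual:
 fixes v :: "real => 'a::euclidean_space => complex"
 assumes p: "1 < p" "q = p / (p - 1)" and v: "jm v"
  and bdd: "!!T. \<exists>b. \<forall>t x. abs t <= T --> norm (v t x) <= b"
  and bd: "!!G T A. locL2 G ==> 0 <= T ==> (!!t x. T < abs t ==> G t x = 0) ==> xpb q G A ==>
    norm (LL t. LL x. v t x * G t x) <= C * A"
  and C: "0 <= C"
 shows "xpb p v C"
 unfolding xpb_def
proof -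
 let ?E = "%n. {- real n..real n} \<times> cball (0::'a) (real n)"
 have q: "1 < q" using p(1) unfolding p(2) by (auto simp: field_simps)
 show "lpb lborel2 p (case_prod v) C"
 proof (rule lpb_dual[where E="?E" and q=q])
  show "case_prod v \<in> borel_measurable lborel2" using v by simp
  show E: "?E n \<in> sets lborel2" for n by simp
  show "incseq ?E" by (auto simp: incseq_def)
  show "\<exists>n. z \<in> ?E n" for z
  proof -
   obtain n :: nat where "max (abs (fst z)) (norm (snd z)) <= real n" using real_arch_simple by blast
   then show ?thesis by (intro exI[of _ n]) (auto simp: mem_Times_iff)
  qed
  fix n :: nat
  obtain b where b: "!!t x. abs t <= real n ==> norm (v t x) <= b" using bdd[of "real n"] by blast
  have "(\<integral>\<^sup>+z. ennreal (norm (case_prod v z) powr p) * indicator (?E n) z \<partial>lborel2)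
   <= (\<integral>\<^sup>+z. ennreal (b powr p) * indicator (?E n) z \<partial>lborel2)"
   using b p by (intro nn_integral_mono) (auto simp: indicator_def intro!: ennreal_leI powr_mono2)
  also have "\<dots> = ennreal (b powr p) * (ennreal (2 * real n) * emeasure lborel (cball (0::'a) (real n)))"
   by (subst nn_integral_cmult_indicator[OF E], subst lborel.emeasure_pair_measure_Times) auto
  also have "\<dots> < \<infinity>" using emeasure_lborel_cball_finite[of "0::'a" "real n"] by (simp add: ennreal_mult_less_top)
  finally show "(\<integral>\<^sup>+z. ennreal (norm (case_prod v z) powr p) * indicator (?E n) z \<partial>lborel2) < \<infinity>" .
  fix A g
  assume gq: "lpb lborel2 q g A" and ng: "!!z. norm (g z) = norm (case_prod v z) powr (p - 1) * indicator (?E n) z"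
   and int: "integrable lborel2 (%z. case_prod v z * g z)"
  define G where "G t x = g (t, x)" for t x
  have g: "g = case_prod G" by (auto simp: G_def)
  have Gq: "xpb q G A" using gq by (simp add: xpb_def g)
  have nG: "norm (G t x) = norm (v t x) powr (p - 1) * indicator (?E n) (t, x)" for t x
   using ng[of "(t, x)"] by (simp add: G_def)
  have "norm (G t x) <= b powr (p - 1) * indicator (cball 0 (real n)) x" for t x
   unfolding nG using b p by (auto simp: indicator_def intro!: powr_mono2)
  from locL2_boundedI[OF _ this] have GL: "locL2 G" using Gq by (simp add: xpb_iff)
  have supp: "G t x = 0" if "real n < abs t" for t x
  proof -
   have "(t, x) \<notin> ?E n" using that by auto
   then show ?thesis using nG[of t x] by simp
  qed
  have "(LINT z|lborel2. case_prod v z * g z) = (LL t. LL x. v t x * G t x)"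
   using lborel_pair.integral_fst[of "%t x. v t x * G t x"] int by (simp add: g case_prod_beta')
  then show "norm (LINT z|lborel2. case_prod v z * g z) <= C * A"
   using bd[of G "real n" A, OF GL _ supp Gq] by simp
 qed (use p C in auto)
qed

context
 fixes a b C :: real and dummy :: "'a::euclidean_space itself"
 assumes b: "b = 2 + 4 / DIM('a)" "a = b / (b - 1)" and C: "0 < C"
  and bilinear: "!!z (F :: real => 'a => complex) G A B.
   (!!t s. 0 < Re (z t s)) ==> (!!t s. abs (Im (z t s)) = abs (t - s)) ==>
   locL2 F ==> locL2 G ==> xpb a F A ==> xpb a G B ==>
   (NN t. (NN s. ennreal (norm (LL x. cv (gker (z t s)) (F s) x * G t x)))) <= ennreal (C * A * B)"
begin

private lemma exponents: "2 < b" "1 < a" "0 <= a"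
proof -
 show "2 < b" unfolding b(1) by simp
 then show "1 < a" "0 <= a" unfolding b(2) by (simp_all add: field_simps)
qed

lemma cv_cutoff:
 fixes F :: "real => 'a => complex"
 assumes k: "!!s. k s = gker (z s)" "kfam k" "!!s. 0 < Re (z s)" and F: "locL2 F" and T: "0 <= T" "!!s x. T < abs s ==> F s x = 0"
 obtains B where "0 <= B" "jm (%s. cv (k s) (F s))" "!!s. l2b (cv (k s) (F s)) B" "!!s x. T < abs s ==> cv (k s) (F s) x = 0"
proof -
 note [measurable] = measurable_cv_comp[OF kfam_measurable[OF k(2)] locL2_measurable[OF F]]
 obtain B where B: "!!s. abs s <= T ==> l2b (F s) B" using F unfolding locL2_def by metis
 have B0: "0 <= B" using B[of 0] T by (simp add: lpb_def)
 have 0: "cv (k s) (F s) = (%x. 0)" if "T < abs s" for s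
  using T(2)[OF that] by (simp add: cv_def fun_eq_iff)
 show ?thesis
 proof (rule that[OF B0])
  show "l2b (cv (k s) (F s)) B" for s
   using 0[of s] B[of s] k B0 by (cases "T < abs s") (auto intro: lpb_2_cv_gker)
 qed (use 0 in auto)
qed

text \<open>TT*: the square of the L^2 norm expands into the bilinear form with complex time
  \<open>cnj (z s) + z s'\<close>, whose real part is \<open>2 * e\<close> and whose imaginary part
  is the time difference up to sign. The parameters cover two uses: \<open>c = 0\<close> with
  \<sigma> = 1 is the adjoint of the free flow, \<open>c = t\<close> with \<sigma> = -1 the Duhamel
  integral at time \<open>t\<close>.\<close>

lemma strichartz_dual:
 fixes F :: "real => 'a => complex"
 assumes e: "0 < e" and sg: "abs \<sigma> = 1" and T: "0 <= T" and F: "locL2 F" and supp: "!!s x. T < abs s ==> F s x = 0" and FA: "xpb a F A"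
 shows "l2b (%x. LL s. cv (gker (Complex e (c + \<sigma> * s))) (F s) x) (sqrt C * A)"
proof -
 define z where "z s = Complex e (c + \<sigma> * s)" for s
 have Rez: "0 < Re (z s)" "0 < Re (cnj (z s))" for s using e by (auto simp: z_def)
 have k: "kfam (%s. gker (z s) :: 'a => complex)" unfolding z_def by (rule kfam_minus[OF kfam_gker[OF e]])
 define h where "h s = cv (gker (z s)) (F s)" for s
 obtain B where B0: "0 <= B" and hm: "jm h" and h2: "!!s. l2b (h s) B" and h0: "!!s x. T < abs s ==> h s x = 0"
  by (rule cv_cutoff[OF refl k Rez(1) F T supp, folded h_def], assumption, rule that, assumption+)
 define V where "V x = (LL s. h s x)" for x
 have V: "l2b V (2 * T * B)" unfolding V_def[abs_def] by (rule lpb_time_integral[OF hm T B0 h2 h0])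
 note [measurable] = measurable_curried[OF hm] measurable_curried[OF locL2_measurable[OF F]]
 have ch: "jm (%s x. cnj (h s x))" and cF: "jm (%s x. cnj (F s x))" by measurable
 have ch2: "l2b (%x. cnj (h s x)) B" for s
  using measurable_slice[OF ch, of s] by (intro lpb_cong_norm[OF h2[of s]]) simp_all
 have key: "(LL x. h s' x * cnj (h s x)) = (LL x. cv (gker (cnj (z s) + z s')) (F s') x * cnj (F s x))" for s s'
 proof -
  obtain B1 where B1: "l2b (F s) B1" using locL2_slice[OF F] by blast
  have B1': "l2b (%x. cnj (F s x)) B1" 
   using lpb_measurable[OF B1] by (intro lpb_cong_norm[OF B1]) simp_all
  obtain B2 where B2: "l2b (F s') B2" using locL2_slice[OF F] by blast
  obtain A' c' where kb: "gbd A' c' (gker (cnj (z s)) :: 'a => complex)" using gbd_gker_ex[OF Rez(2)] by blast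
  have "(LL x. h s' x * cnj (h s x)) = (LL x. cv (gker (cnj (z s))) (%x. cnj (F s x)) x * h s' x)"
   by (simp add: h_def cnj_cv cnj_gker[OF Rez(1)] mult.commute)
  also have "\<dots> = (LL y. cnj (F s y) * cv (gker (cnj (z s) + z s')) (F s') y)"
   using cv_pairing[OF kb B1' h2] by (simp add: h_def cv_gker_gker[OF Rez(2) Rez(1) B2])
  finally show ?thesis by (simp add: mult.commute)
 qed
 have "(LL x. V x * cnj (V x)) = (LL x. (LL s. cnj (h s x)) * V x)" by (simp add: V_def mult.commute)
 also have "\<dots> = (LL s. LL x. cnj (h s x) * V x)"
  by (rule time_integral_pairing[OF ch T B0 ch2 _ V]) (simp add: h0)
 also have "\<dots> = (LL s. LINT s'|lborel. LL x. h s' x * cnj (h s x))"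
 proof (intro Bochner_Integration.integral_cong refl)
  fix s show "(LL x. cnj (h s x) * V x) = (LINT s'|lborel. LL x. h s' x * cnj (h s x))"
   using time_integral_pairing[OF hm T B0 h2 h0 ch2[of s]] by (simp add: V_def mult.commute)
 qed
 finally have VV: "(LL x. V x * cnj (V x)) = (LL s. LINT s'|lborel. LL x. cv (gker (cnj (z s) + z s')) (F s') x * cnj (F s x))" unfolding key .
 have "ennreal (norm (LL x. V x * cnj (V x))) <= 
   (\<integral>\<^sup>+s. (\<integral>\<^sup>+s'. ennreal (norm (LL x. cv (gker (cnj (z s) + z s')) (F s') x * cnj (F s x))) \<partial>lborel) \<partial>lborel)"
  unfolding VV by (rule order_trans[OF norm_integral_le_nn_integral]) (intro nn_integral_mono norm_integral_le_nn_integral)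
 also have "\<dots> <= ennreal (C * A * A)"
 proof (rule bilinear[OF _ _ F _ FA])
  show "locL2 (%s x. cnj (F s x))" by (rule locL2_dominated[OF F cF]) simp
  show "xpb a (%s x. cnj (F s x)) A" by (rule xpb_dominated[OF FA cF]) (use exponents in simp_all)
  show "0 < Re (cnj (z t) + z s)" for t s using e by (simp add: z_def)
  have "Im (cnj (z t) + z s) = - \<sigma> * (t - s)" for t s by (simp add: z_def algebra_simps)
  then show "abs (Im (cnj (z t) + z s)) = abs (t - s)" for t s using sg by (simp add: abs_mult)
 qed
 finally have "ennreal (norm (LL x. V x * cnj (V x))) <= ennreal (C * A * A)" .
 moreover have A: "0 <= A" using FA by (simp add: xpb_def lpb_def)
 moreover have "C * A * A = (sqrt C * A)^2" using C by (simp add: power_mult_distrib power2_eq_square)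
 ultimately have "norm (LL x. V x * cnj (V x)) <= (sqrt C * A)^2" by (simp add: ennreal_le_iff)
 from l2b_self_pairing[OF V this] C A show ?thesis unfolding V_def[abs_def] h_def z_def by simp
qed

lemma strichartz_free_X:
 fixes f :: "'a => complex"
 assumes e: "0 < e" and f: "l2b f B"
 shows "xpb b (%t. cv (gker (Complex e t)) f) (sqrt C * B)"
proof (rule xpb_dual[OF _ b(2)])
 note k = kfam_gker[OF e, where 'a='a]
 show "jm (%t. cv (gker (Complex e t)) f)" using locL2_measurable[OF locL2_free(1)[OF k f]] by simp
 show "\<exists>b. \<forall>t x. abs t <= T --> norm (cv (gker (Complex e t)) f x) <= b" for T
  by (rule free_bounded_at[OF k f])
 fix G :: "real => 'a => complex" and T A
 assume G: "locL2 G" and T: "0 <= T" and supp: "!!t x. T < abs t ==> G t x = 0" and GA: "xpb a G A"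
 obtain B' where B': "0 <= B'" "jm (%s. cv (gker (Complex e s)) (G s))" "!!s. l2b (cv (gker (Complex e s)) (G s)) B'"
  "!!s x. T < abs s ==> cv (gker (Complex e s)) (G s) x = 0"
  using cv_cutoff[OF refl k _ G T supp] e by auto
 have "(LL t. LL x. cv (gker (Complex e t)) f x * G t x) = (LL t. LL y. cv (gker (Complex e t)) (G t) y * f y)"
 proof (rule Bochner_Integration.integral_cong[OF refl])
  fix t
  obtain A' c' where "gbd A' c' (gker (Complex e t) :: 'a => complex)" using kfam_slice[OF k] by blast
  moreover obtain B1 where "l2b (G t) B1" using locL2_slice[OF G] by blast
  ultimately show "(LL x. cv (gker (Complex e t)) f x * G t x) = (LL y. cv (gker (Complex e t)) (G t) y * f y)"
   using cv_pairing[OF _ f] by (simp add: mult.commute)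
 qed
 also have "\<dots> = (LL y. (LL t. cv (gker (Complex e t)) (G t) y) * f y)"
  by (rule time_integral_pairing[OF B'(2) T B'(1,3,4) f, symmetric])
 also have "norm \<dots> <= sqrt C * A * B"
  using lpb_2_integrable_mult(2)[OF strichartz_dual[OF e _ T G supp GA, of 1 0] f] by simp
 finally show "norm (LL t. LL x. cv (gker (Complex e t)) f x * G t x) <= sqrt C * B * A" by (simp add: ac_simps)
qed (use exponents C lpb_nonneg[OF f] in auto)

context
 fixes e A :: real and F :: "real => 'a => complex"
 assumes e: "0 < e" and F: "locL2 F" and FA: "xpb a F A"
begin

text \<open>The bilinear estimate bounds an absolute double integral, so restricting
  \<open>s\<close> to the times between 0 and \<open>t\<close> costs nothing.\<close>

lemma strichartz_duh_X: "xpb b (duh (%t. gker (Complex e t)) F) (C * A)"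
proof (rule xpb_dual[OF _ b(2)])
 let ?d = "duh (%t. gker (Complex e t)) F"
 note k = kfam_gker[OF e, where 'a='a]
 show "jm ?d" by (rule measurable_duh[OF k F])
 show "\<exists>b. \<forall>t x. abs t <= T --> norm (?d t x) <= b" for T by (rule duh_bounded_at[OF k F])
 show A0: "0 <= C * A" using FA C by (simp add: xpb_def lpb_def)
 fix G :: "real => 'a => complex" and T A'
 assume G: "locL2 G" and T: "0 <= T" and supp: "!!t x. T < abs t ==> G t x = 0" and GA: "xpb a G A'"
 have A'0: "0 <= A'" using GA by (simp add: xpb_def lpb_def)
 have "ennreal (norm (LL t. LL x. ?d t x * G t x)) <= (NN t. ennreal (norm (LL x. ?d t x * G t x)))"
  by (rule norm_integral_le_nn_integral)
 also have "\<dots> <= (NN t. (NN s. ennreal (norm (LL x. cv (gker (Complex e (t - s))) (F s) x * G t x))))"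
 proof (intro nn_integral_mono)
  fix t
  obtain B1 where B1: "l2b (G t) B1" using locL2_slice[OF G] by blast
  have "ennreal (norm (LL x. ?d t x * G t x)) <= (NN s. ennreal (norm (tsg t s * (LL x. cv (gker (Complex e (t - s))) (F s) x * G t x))))"
   unfolding duh_pairing(1)[OF k F B1] by (rule norm_integral_le_nn_integral)
  also have "\<dots> <= (NN s. ennreal (norm (LL x. cv (gker (Complex e (t - s))) (F s) x * G t x)))"
   by (intro nn_integral_mono ennreal_leI) (simp add: norm_mult tsg_def)
  finally show "ennreal (norm (LL x. ?d t x * G t x)) <= (NN s. ennreal (norm (LL x. cv (gker (Complex e (t - s))) (F s) x * G t x)))" .
 qed
 also have "\<dots> <= ennreal (C * A * A')" by (rule bilinear[OF _ _ F G FA GA]) (use e in simp_all)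
 finally show "norm (LL t. LL x. ?d t x * G t x) <= C * A * A'" using A0 A'0 by (subst (asm) ennreal_le_iff) auto
qed (use exponents in auto)

text \<open>Multiplying the forcing by \<open>tsg t s\<close> does not increase its norm and turns
  the value at the fixed time \<open>t\<close> into an instance of the dual estimate.\<close>

lemma strichartz_duh_l2b: "l2b (duh (%t. gker (Complex e t)) F t) (sqrt C * A)"
proof -
 note [measurable] = measurable_curried[OF locL2_measurable[OF F]]
 have m: "jm (%s x. tsg t s * F s x)" by measurable
 have le: "norm (tsg t s * F s x) <= norm (F s x)" for s x by (simp add: norm_mult tsg_def)
 have "l2b (%x. LL s. cv (gker (Complex e (t + (-1) * s))) (%x. tsg t s * F s x) x) (sqrt C * A)"
  by (rule strichartz_dual[OF e _ abs_ge_zero[of t] locL2_dominated[OF F m le] _ xpb_dominated[OF FA m le exponents(3)]]) (auto simp: tsg_zero)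
 then show ?thesis by (simp add: duh_def[abs_def] cv_cmult)
qed

end

end

lemma strichartz:
 fixes dummy :: "'a::euclidean_space itself"
 assumes b: "b = 2 + 4 / DIM('a)" "a = b / (b - 1)"
 obtains C where "1 <= C" and "!!e (F :: real => 'a => complex) f A B. 0 < e ==> locL2 F ==> xpb a F A ==> l2b f B ==>
    xpb b (sol (%t. gker (Complex e t)) f F) (C * (B + A))"
  and "!!e t (F :: real => 'a => complex) f A B. 0 < e ==> locL2 F ==> xpb a F A ==> l2b f B ==>
    l2b (sol (%t. gker (Complex e t)) f F t) (C * (B + A))"
proof -
 have b2: "2 < b" unfolding b(1) by simp
 obtain K where K: "0 < K" and bl: "!!z (F :: real => 'a => complex) G A B.
   (!!t s. 0 < Re (z t s)) ==> (!!t s. abs (Im (z t s)) = abs (t - s)) ==>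
   locL2 F ==> locL2 G ==> xpb a F A ==> xpb a G B ==>
   (NN t. (NN s. ennreal (norm (LL x. cv (gker (z t s)) (F s) x * G t x)))) <= ennreal (K * A * B)"
  using bilinear_strichartz[OF b] by blast
 \<comment> \<open>1 is the constant of the L^2 contraction, \<open>K\<close> that of the Duhamel
   part in space-time, and \<open>sqrt K\<close> that of the two estimates which come from
   TT*.\<close>
 define C where "C = max 1 (max K (sqrt K))"
 have C: "1 <= C" "K <= C" "sqrt K <= C" by (auto simp: C_def)
 show ?thesis
 proof (rule that[OF C(1)])
  fix e A B :: real and F :: "real => 'a => complex" and f :: "'a => complex"
  assume e: "0 < e" and F: "locL2 F" and FA: "xpb a F A" and f: "l2b f B"
  have AB: "0 <= A" "0 <= B" using FA f by (auto simp: xpb_def lpb_def)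
  then have le: "sqrt K * B + K * A <= C * (B + A)" "B + sqrt K * A <= C * (B + A)"
   using C mult_right_mono[OF C(1) AB(2)] by (auto simp: distrib_left intro!: add_mono mult_right_mono)
  have "lpb lborel2 b (%z. (case z of (t, x) => cv (gker (Complex e t)) f x) + case_prod (duh (%t. gker (Complex e t)) F) z) (sqrt K * B + K * A)"
   using b2 strichartz_free_X[OF b K bl e f] strichartz_duh_X[OF b K bl e F FA] by (intro lpb_add) (auto simp: xpb_def)
  from lpb_mono[OF this le(1)] show "xpb b (sol (%t. gker (Complex e t)) f F) (C * (B + A))"
   using b2 by (simp add: xpb_def sol_def[abs_def] case_prod_beta')
  fix t
  have "l2b (%x. cv (gker (Complex e t)) f x + duh (%t. gker (Complex e t)) F t x) (B + sqrt K * A)"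
   by (intro lpb_add strichartz_duh_l2b[OF b K bl e F FA] lpb_2_cv_gker f) (use e in auto)
  from lpb_mono[OF this le(2)] show "l2b (sol (%t. gker (Complex e t)) f F t) (C * (B + A))"
   by (simp add: sol_def[abs_def])
 qed
qed

section \<open>The heat semigroup as an approximate identity\<close>

text \<open>The substitution moves \<open>s\<close> from the kernel into the argument of
  \<open>f\<close>, against the fixed probability density \<open>gker 1\<close>. The limit of small
  \<open>s\<close> becomes a matter of dominated convergence.\<close>

lemma cv_heat_rescale:
 fixes f :: "'a::euclidean_space => complex"
 assumes s: "0 < s" and [measurable]: "bm f"
 shows "cv (gker (of_real s)) f x = (LL y. gker 1 y * f (x + sqrt s *\<^sub>R y))"
proof -
 have "gker 1 y = of_real (sqrt s ^ DIM('a)) * gker (of_real s) (x - (x + sqrt s *\<^sub>R y))" for y :: 'a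
 proof -
  have "gauss (1 / (4 * s)) (sqrt s *\<^sub>R y) = gauss (1 / 4) y" using s by (simp add: gauss_def power_mult_distrib)
  moreover have "sqrt s ^ DIM('a) * (4 * pi * s) powr (- (DIM('a) / 2)) = (4 * pi) powr (- (DIM('a) / 2))"
   using s by (simp add: powr_mult powr_half_sqrt[symmetric] powr_realpow[symmetric] powr_powr powr_minus)
  ultimately have "sqrt s ^ DIM('a) * ((4 * pi * s) powr (- (DIM('a) / 2)) * gauss (1 / (4 * s)) (sqrt s *\<^sub>R y)) = (4 * pi) powr (- (DIM('a) / 2)) * gauss (1 / 4) y"
   by (metis mult.assoc)
  moreover have "x - (x + sqrt s *\<^sub>R y) = - (sqrt s *\<^sub>R y)" by simp
  ultimately show ?thesis using gker_of_real[OF s, of "sqrt s *\<^sub>R y"] gker_of_real[OF zero_less_one, of y]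
   by (simp only: gker_minus of_real_mult[symmetric] of_real_1 mult_1_right)
 qed
 then have "(LL y. gker 1 y * f (x + sqrt s *\<^sub>R y)) = (LL y. of_real (sqrt s ^ DIM('a)) * (gker (of_real s) (x - (x + sqrt s *\<^sub>R y)) * f (x + sqrt s *\<^sub>R y)))"
  by (simp add: mult.assoc)
 also have "\<dots> = cv (gker (of_real s)) f x" unfolding cv_def using s
  by (subst (2) lborel_affine[of "sqrt s" x]) (simp_all add: integral_density integral_distr scaleR_conv_of_real)
 finally show ?thesis by simp
qed

lemma heat_kernel:
 "integrable lborel (gker 1 :: 'a::euclidean_space => complex)" "(LL x. gker 1 (x::'a)) = 1" "(LL x. norm (gker 1 (x::'a))) = 1"
proof -
 show i: "integrable lborel (gker 1 :: 'a => complex)" by (rule integrable_gker) simp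
 have "ennreal (LL x. norm (gker 1 (x::'a))) = 1"
  using nn_integral_heat_kernel[of 1, where 'a='a] i by (simp add: nn_integral_eq_integral)
 then show n: "(LL x. norm (gker 1 (x::'a))) = 1" by simp
 have "gker 1 x = of_real (norm (gker 1 (x::'a)))" for x using gker_of_real[of 1 x] by (simp add: abs_mult gauss_def norm_mult)
 then have "(LL x. gker 1 (x::'a)) = of_real (LL x. norm (gker 1 (x::'a)))" by (simp only: integral_complex_of_real[symmetric])
 then show "(LL x. gker 1 (x::'a)) = 1" by (simp add: n)
qed

lemma nn_integral_powr_tendsto_0_dominated:
 fixes f :: "nat => 'a => 'b::{real_normed_vector,second_countable_topology}"
 assumes [measurable]: "!!n. f n \<in> borel_measurable M" and w: "lpb M q w A" and q: "0 < q"
  and le: "!!n. AE x in M. norm (f n x) <= norm (w x)" and lim: "AE x in M. (%n. f n x) \<longlonglongrightarrow> 0"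
 shows "(%n. \<integral>\<^sup>+x. ennreal (norm (f n x) powr q) \<partial>M) \<longlonglongrightarrow> 0"
proof -
 have [measurable]: "w \<in> borel_measurable M" using w by (simp add: lpb_def)
 have "(%n. \<integral>\<^sup>+x. ennreal (norm (f n x) powr q) \<partial>M) \<longlonglongrightarrow> (\<integral>\<^sup>+x. 0 \<partial>M)"
 proof (rule nn_integral_dominated_convergence[where w="%x. ennreal (norm (w x) powr q)"])
  show "(\<integral>\<^sup>+x. ennreal (norm (w x) powr q) \<partial>M) < \<infinity>" using w by (auto simp: lpb_def order.strict_trans1[OF _ ennreal_less_top])
  show "AE x in M. ennreal (norm (f n x) powr q) <= ennreal (norm (w x) powr q)" for n
   using le by eventually_elim (use q in \<open>auto intro!: ennreal_leI powr_mono2\<close>)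
  show "AE x in M. (%n. ennreal (norm (f n x) powr q)) \<longlonglongrightarrow> 0"
   using lim by eventually_elim (use q in \<open>auto intro!: tendsto_eq_intros tendsto_ennrealI[of _ 0, simplified] tendsto_zero_powrI\<close>)
 qed measurable
 then show ?thesis by simp
qed

text \<open>Pointwise convergence is dominated convergence against \<open>gker 1\<close>. As the
  flow does not increase the L^1 norm, Scheffe's lemma upgrades it to L^1, and the uniform bound
  \<open>2 * m\<close> on the difference carries it on to L^q.\<close>

lemma heat_tendsto_continuous:
 fixes g :: "'a::euclidean_space => complex"
 assumes s: "!!k. 0 < s k" "s \<longlonglongrightarrow> 0" and g: "continuous_on UNIV g" "!!x. norm (g x) <= m" and q: "1 <= q" and i: "lpb lborel 1 g A"
 shows "(%k. NN x. ennreal (norm (g x - cv (gker (of_real (s k))) g x) powr q)) \<longlonglongrightarrow> 0"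
proof -
 have [measurable]: "bm g" using g(1) by (rule borel_measurable_continuous_onI)
 have m: "0 <= m" by (rule order_trans[OF norm_ge_zero g(2)])
 let ?h = "%k. cv (gker (of_real (s k))) g"
 have "(%k. ?h k x) \<longlonglongrightarrow> (LL y. gker 1 (y::'a) * g x)" for x
  unfolding cv_heat_rescale[OF s(1) \<open>g \<in> borel_measurable borel\<close>]
 proof (rule integral_dominated_convergence[where w="%y::'a. norm (gker 1 y) * m"])
  have "(%k. g (x + sqrt (s k) *\<^sub>R y)) \<longlonglongrightarrow> g (x + sqrt 0 *\<^sub>R y)" for y
   by (intro continuous_on_tendsto_compose[OF g(1)] tendsto_intros s) auto
  then show "AE y in lborel. (%k. gker 1 y * g (x + sqrt (s k) *\<^sub>R y)) \<longlonglongrightarrow> gker 1 y * g x" by (auto intro!: tendsto_mult)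
 qed (use g(2) in \<open>auto simp: norm_mult heat_kernel intro!: mult_left_mono\<close>)
 then have pt: "(%k. ?h k x) \<longlonglongrightarrow> g x" for x by (simp add: heat_kernel)
 have bd: "norm (?h k x) <= m" for k x
 proof -
  have "norm (?h k x) <= (LL y. norm (gker 1 (y::'a)) * m)" unfolding cv_heat_rescale[OF s(1) \<open>g \<in> borel_measurable borel\<close>]
   by (intro order_trans[OF integral_norm_bound integral_mono']) (use g(2) m in \<open>auto simp: norm_mult heat_kernel intro!: mult_left_mono\<close>)
  then show ?thesis by (simp add: heat_kernel)
 qed
 have "(%k. NN x. ennreal (norm (?h k x - g x))) \<longlonglongrightarrow> 0"
 proof (rule Scheffe_lemma2)
  show "integrable lborel g" using i by (intro integrableI_bounded) (auto simp: lpb_def order.strict_trans1[OF _ ennreal_less_top])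
  then have "lpb lborel 1 g (LL x. norm (g x))" by (auto simp: lpb_def nn_integral_eq_integral)
  from lpb_le[OF lpb_heat[OF s(1) _ this]] \<open>integrable lborel g\<close>
  show "(NN x. ennreal (norm (?h k x))) <= (NN x. ennreal (norm (g x)))" for k by (simp add: nn_integral_eq_integral)
 qed (use pt in auto)
 from ennreal_tendsto_cmult[OF _ this, of "ennreal ((2 * m) powr (q - 1))"]
 have "(%k. ennreal ((2 * m) powr (q - 1)) * (NN x. ennreal (norm (?h k x - g x)))) \<longlonglongrightarrow> 0" by simp
 then show ?thesis
 proof (rule tendsto_sandwich[OF _ _ tendsto_const, rotated 2])
  have "ennreal (norm (g x - ?h k x) powr q) <= ennreal ((2 * m) powr (q - 1)) * ennreal (norm (?h k x - g x))" for k x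
  proof -
   have "norm (g x - ?h k x) powr (q - 1) <= (2 * m) powr (q - 1)"
    using q norm_triangle_ineq4[of "g x" "?h k x"] g(2)[of x] bd[of k x] by (intro powr_mono2) auto
   from mult_right_mono[OF this, of "norm (g x - ?h k x)"]
   have "norm (g x - ?h k x) powr q <= (2 * m) powr (q - 1) * norm (g x - ?h k x)"
    using powr_mult_base[OF norm_ge_zero, of "g x - ?h k x" "q - 1"] by (simp add: mult.commute)
   then show ?thesis by (simp add: norm_minus_commute ennreal_leI flip: ennreal_mult')
  qed
  then show "eventually (%k. (NN x. ennreal (norm (g x - ?h k x) powr q)) <= ennreal ((2 * m) powr (q - 1)) * (NN x. ennreal (norm (?h k x - g x)))) sequentially"
   by (subst nn_integral_cmult[symmetric]) (auto intro!: nn_integral_mono always_eventually)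
 qed auto
qed

text \<open>Truncate \<open>f\<close>, then take an almost everywhere limit of continuous functions, cut off to obey the same bounds.\<close>

lemma lpb_approx_continuous:
 fixes f :: "'a::euclidean_space => complex"
 assumes f: "lpb lborel q f A" and q: "1 <= q" and e: "0 < e"
 obtains g m B B' where "continuous_on UNIV g" "!!x. norm (g x) <= m" "lpb lborel 1 g B" "l2b g B'" "lpb lborel q (%x. f x - g x) e"
proof -
 have small: "\<exists>n. lpb lborel q (h n) (e / 2)"
  if "!!n::nat. h n \<in> borel_measurable borel" "(%n. NN x. ennreal (norm (h n x) powr q)) \<longlonglongrightarrow> 0" for h :: "nat => 'a => complex"
 proof -
  have "eventually (%n. (NN x. ennreal (norm (h n x) powr q)) < ennreal ((e / 2) powr q)) sequentially"
   using that(2) e by (intro order_tendstoD) auto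
  then show ?thesis using that(1) e by (auto simp: eventually_sequentially lpb_def intro!: less_imp_le)
 qed
 have [measurable]: "bm f" using f by (simp add: lpb_def)
 let ?t = "%m x. if norm (f x) <= real m \<and> norm x <= real m then f x else 0"
 have "\<exists>m. lpb lborel q (%x. f x - ?t m x) (e / 2)"
 proof (rule small)
  show "(%m. NN x. ennreal (norm (f x - ?t m x) powr q)) \<longlonglongrightarrow> 0"
  proof (rule nn_integral_powr_tendsto_0_dominated[OF _ f])
   show "AE x in lborel. (%m. f x - ?t m x) \<longlonglongrightarrow> 0"
   proof (intro AE_I2 tendsto_eventually)
    fix x
    obtain n0 where "max (norm (f x)) (norm x) <= real n0" using real_arch_simple by blast
    then show "eventually (%m. f x - ?t m x = 0) sequentially" by (intro eventually_sequentiallyI[of n0]) auto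
   qed
  qed (use q in auto)
 qed measurable
 then obtain m where m: "lpb lborel q (%x. f x - ?t m x) (e / 2)" by blast
 have "?t m measurable_on UNIV" by (rule lebesgue_measurable_imp_measurable_on[OF measurable_completion]) simp_all
 then obtain N h where N: "negligible N" and h: "!!n. continuous_on UNIV (h n)" "!!x. x \<notin> N ==> (%n. h n x) \<longlonglongrightarrow> ?t m x"
  unfolding measurable_on_def by auto
 \<comment> \<open>\<open>c\<close> is 1 where \<open>f\<close> was kept and 0 beyond radius
   \<open>m + 1\<close>. Together with the projection of values onto the ball of radius
   \<open>m\<close> it makes \<open>g n\<close> continuous, bounded and compactly supported without
   changing the limit.\<close>
 define c :: "'a => real" where "c x = max 0 (min 1 (real m + 1 - norm x))" for x
 define g where "g n x = c x *\<^sub>R closest_point (cball 0 (real m)) (h n x)" for n x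
 have [measurable]: "cball (0::'a) (real m + 1) \<in> sets borel" by simp
 let ?w = "%x. indicator (cball (0::'a) (real m + 1)) x * real m :: real"
 note w = lpb_indicator_cball[where b="real m" and z="0::'a" and r="real m + 1", OF of_nat_0_le_iff]
 have gc: "continuous_on UNIV (g n)" for n unfolding g_def c_def
  by (intro continuous_intros continuous_on_compose2[OF continuous_on_closest_point h(1)]) auto
 have [measurable]: "bm (g n)" for n by (rule borel_measurable_continuous_onI[OF gc])
 have gw: "norm (g n x) <= norm (?w x)" for n x
 proof -
  have "norm (closest_point (cball 0 (real m)) (h n x)) <= real m" using closest_point_in_set[of "cball 0 (real m)" "h n x"] by simp
  moreover have "0 <= c x" "c x <= indicator (cball 0 (real m + 1)) x" by (auto simp: c_def indicator_def)
  ultimately show ?thesis using mult_mono[of "c x" "indicator (cball 0 (real m + 1)) x" "norm (closest_point (cball 0 (real m)) (h n x))" "real m"] by (simp add: g_def)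
 qed
 have gp: "\<exists>B. lpb lborel p (g n) B" if p: "1 <= p" for p n
  using lpb_dominated[OF w, of p "g n"] gw p by auto
 have "\<exists>n. lpb lborel q (%x. ?t m x - g n x) (e / 2)"
 proof (rule small)
  have "0 < q" using q by simp
  note 2 = lpb_add[OF q w[OF this] w[OF this]]
  show "(%n. NN x. ennreal (norm (?t m x - g n x) powr q)) \<longlonglongrightarrow> 0"
  proof (rule nn_integral_powr_tendsto_0_dominated[OF _ 2])
   have t: "norm (?t m x) <= norm (?w x)" for x by (auto simp: indicator_def)
   show "AE x in lborel. norm (?t m x - g n x) <= norm (?w x + ?w x)" for n
    by (intro AE_I2 order_trans[OF norm_triangle_ineq4] order_trans[OF add_mono[OF t gw]]) simp
   have "(%n. ?t m x - g n x) \<longlonglongrightarrow> ?t m x - c x *\<^sub>R closest_point (cball 0 (real m)) (?t m x)" if "x \<notin> N" for x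
    unfolding g_def using h(2)[OF that]
    by (intro tendsto_intros continuous_on_tendsto_compose[OF continuous_on_closest_point[where t=UNIV]]) auto
   moreover have "?t m x - c x *\<^sub>R closest_point (cball 0 (real m)) (?t m x) = 0" for x
    by (auto simp: c_def closest_point_self)
   ultimately have l: "(%n. ?t m x - g n x) \<longlonglongrightarrow> 0" if "x \<notin> N" for x using that by metis
   have "AE x in lebesgue. x \<notin> N" using N by (simp add: AE_not_in negligible_iff_null_sets)
   then have "AE x in lebesgue. (%n. ?t m x - g n x) \<longlonglongrightarrow> 0" by eventually_elim (rule l)
   then show "AE x in lborel. (%n. ?t m x - g n x) \<longlonglongrightarrow> 0" by (simp add: AE_completion_iff)
  qed (use q in auto)
 qed measurable
 then obtain n where n: "lpb lborel q (%x. ?t m x - g n x) (e / 2)" by blast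
 from lpb_add[OF q m n] have "lpb lborel q (%x. f x - g n x) e" by simp
 moreover obtain B B' where "lpb lborel 1 (g n) B" "l2b (g n) B'" using gp[of 1 n] gp[of 2 n] by auto
 moreover have "norm (g n x) <= real m" for x by (rule order_trans[OF gw]) (simp add: indicator_def)
 ultimately show ?thesis using that gc by blast
qed

text \<open>Three-term splitting through a continuous approximant; the heat flow is an L^q
  contraction, so the approximation error is paid twice.\<close>

lemma heat_approximate_identity_seq:
 fixes f :: "'a::euclidean_space => complex"
 assumes s: "!!k. 0 < s k" "s \<longlonglongrightarrow> 0" and q: "1 <= q" and f2: "l2b f B" and f: "lpb lborel q f A" and e: "0 < e"
 shows "eventually (%k. lpb lborel q (%x. f x - cv (gker (of_real (s k))) f x) e) sequentially"
proof -
 have e3: "0 < e / 3" using e by simp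
 obtain g m C C' where g: "continuous_on UNIV g" "!!x. norm (g x) <= m" "lpb lborel 1 g C" "l2b g C'" and fg: "lpb lborel q (%x. f x - g x) (e / 3)"
  by (rule lpb_approx_continuous[OF f q e3], rule that, assumption+)
 have [measurable]: "bm g" using g(4) by (simp add: lpb_def)
 have "eventually (%k. (NN x. ennreal (norm (g x - cv (gker (of_real (s k))) g x) powr q)) < ennreal ((e/3) powr q)) sequentially"
  using heat_tendsto_continuous[OF s g(1,2) q g(3)] e by (intro order_tendstoD) auto
 then show ?thesis
 proof eventually_elim
  fix k
  let ?c = "cv (gker (of_real (s k)))"
  assume "(NN x. ennreal (norm (g x - ?c g x) powr q)) < ennreal ((e/3) powr q)"
  then have gl: "lpb lborel q (%x. g x - ?c g x) (e/3)" using e by (simp add: lpb_def)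
  obtain Ak ck where "gbd Ak ck (gker (of_real (s k)) :: 'a => complex)" using gbd_gker_ex[of "of_real (s k)"] s(1) by auto
  note d = cv_diff[OF this f2 g(4)]
  have "lpb lborel q (%x. ((f x - g x) + (g x - ?c g x)) - ?c (%x. f x - g x) x) (e/3 + e/3 + e/3)"
   by (intro lpb_add lpb_diff fg gl lpb_heat[OF s(1) q fg] q)
  then show "lpb lborel q (%x. f x - ?c f x) e" by (simp add: d)
 qed
qed

text \<open>Turns statements along sequences, the form dominated convergence supplies, into a
  threshold for all small times.\<close>

lemma sequential_threshold:
 assumes "!!s. (!!k. 0 < s k) ==> s \<longlonglongrightarrow> 0 ==> eventually (%k::nat. P (s k)) sequentially"
 shows "\<exists>t0>0. \<forall>t::real. 0 < t \<and> t <= t0 --> P t"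
proof (rule ccontr)
 assume "\<not> ?thesis"
 then have "\<exists>t. 0 < t \<and> t <= inverse (real (Suc k)) \<and> \<not> P t" for k
  by (metis inverse_positive_iff_positive of_nat_0_less_iff zero_less_Suc)
 then obtain s where s: "!!k. 0 < s k" "!!k. s k <= inverse (real (Suc k))" "!!k. \<not> P (s k)" by metis
 have "s \<longlonglongrightarrow> 0"
  by (rule tendsto_sandwich[OF _ _ tendsto_const LIMSEQ_inverse_real_of_nat]) (use s in \<open>auto intro!: always_eventually less_imp_le\<close>)
 from assms[OF s(1) this] s(3) show False by (auto simp: eventually_sequentially)
qed

lemma heat_approximate_identity:
 fixes f :: "'a::euclidean_space => complex"
 assumes "1 <= q" "l2b f B" "lpb lborel q f A" "0 < e"
 shows "\<exists>t0>0. \<forall>t. 0 < t \<and> t <= t0 --> lpb lborel q (%x. f x - cv (gker (of_real t)) f x) e"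
 by (rule sequential_threshold) (rule heat_approximate_identity_seq[OF _ _ assms])

lemma measurable_heat_slices:
 assumes "jm F"
 shows "jm (%t x. cv (gker z) (F t) x)"
proof -
 have "jm (%(t::real) x. gker z x)" by measurable
 note [measurable] = measurable_cv_comp[OF this assms, of "%_. 0"]
 show ?thesis by measurable
qed

lemma xpb_heat:
 fixes F :: "real => 'a::euclidean_space => complex"
 assumes s: "0 < s" and q: "1 < q" and F: "xpb q F A"
 shows "xpb q (%t. cv (gker (of_real s)) (F t)) A"
proof -
 obtain n where n: "lpb lborel q n A" "!!s. 0 <= n s" "AE s in lborel. lpb lborel q (F s) (n s)"
  using slice_norm[OF F q] by blast
 have "(NN t. (NN x. ennreal (norm (cv (gker (of_real s)) (F t) x) powr q))) <= (NN t. ennreal (norm (n t) powr q))"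
 proof (rule nn_integral_mono_AE, use n(3) in eventually_elim)
  fix t assume "lpb lborel q (F t) (n t)"
  from lpb_heat[OF s _ this] q n(2)[of t]
  show "(NN x. ennreal (norm (cv (gker (of_real s)) (F t) x) powr q)) <= ennreal (norm (n t) powr q)"
   by (simp add: lpb_def)
 qed
 also have "\<dots> <= ennreal (A powr q)" by (rule lpb_le[OF n(1)])
 finally show ?thesis using measurable_heat_slices[of F "of_real s"] F by (auto simp: xpb_iff)
qed

text \<open>The slices converge for almost every time, and twice the slice norm is a majorant in
  time.\<close>

lemma xpb_heat_approximate_identity:
 fixes F :: "real => 'a::euclidean_space => complex"
 assumes q: "1 < q" and F2: "locL2 F" and F: "xpb q F A" and e: "0 < e"
 shows "\<exists>t0>0. \<forall>t. 0 < t \<and> t <= t0 --> xpb q (%u x. F u x - cv (gker (of_real t)) (F u) x) e"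
proof (rule sequential_threshold)
 fix s :: "nat => real" assume s: "!!k. 0 < s k" "s \<longlonglongrightarrow> 0"
 obtain n where n: "lpb lborel q n A" "!!s. 0 <= n s" "AE s in lborel. lpb lborel q (F s) (n s)"
  using slice_norm[OF F q] by blast
 have nm: "bm n" using n by (simp add: lpb_def)
 note [measurable] = nm measurable_curried[OF locL2_measurable[OF F2]]
 have hm: "jm (%u x. cv (gker (of_real (s k))) (F u) x)" for k
  by (rule measurable_heat_slices[OF locL2_measurable[OF F2]])
 note [measurable] = measurable_curried[OF hm]
 let ?J = "%k u. NN x. ennreal (norm (F u x - cv (gker (of_real (s k))) (F u) x) powr q)"
 have "(%k. NN u. ?J k u) \<longlonglongrightarrow> (\<integral>\<^sup>+u. 0 \<partial>(lborel :: real measure))"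
 proof (rule nn_integral_dominated_convergence[where w="%u. ennreal ((2 * n u) powr q)"])
  have "(NN u. ennreal ((2 * n u) powr q)) = (NN u. ennreal (2 powr q) * ennreal (norm (n u) powr q))"
   using n(2) by (intro nn_integral_cong) (simp add: powr_mult ennreal_mult)
  also have "\<dots> = ennreal (2 powr q) * (NN u. ennreal (norm (n u) powr q))" by (rule nn_integral_cmult) measurable
  also have "\<dots> < \<infinity>" using n(1) by (auto simp: lpb_def ennreal_mult_less_top order.strict_trans1[OF _ ennreal_less_top])
  finally show "(NN u. ennreal ((2 * n u) powr q)) < \<infinity>" .
  show "AE u in lborel. ?J k u <= ennreal ((2 * n u) powr q)" for k
   using n(3)
  proof eventually_elim
   fix u assume u: "lpb lborel q (F u) (n u)"
   have q1: "1 <= q" using q by simp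
   from lpb_le[OF lpb_diff[OF q1 u lpb_heat[OF s(1)[of k] q1 u]]]
   show "?J k u <= ennreal ((2 * n u) powr q)" by (simp only: mult_2)
  qed
  show "AE u in lborel. (%k. ?J k u) \<longlonglongrightarrow> 0"
   using n(3)
  proof eventually_elim
   fix u assume u: "lpb lborel q (F u) (n u)"
   obtain B where B: "l2b (F u) B" using locL2_slice[OF F2] by blast
   show "(%k. ?J k u) \<longlonglongrightarrow> 0"
   proof (rule order_tendstoI)
    fix a :: ennreal assume a: "0 < a"
    obtain r where r: "0 < r" "ennreal (r powr q) < a"
    proof (cases a)
     case (real r)
     then have "ennreal (((r/2) powr (1/q)) powr q) < a" using a q by (auto simp: powr_powr intro!: ennreal_lessI)
     then show ?thesis using that[of "(r/2) powr (1/q)"] real a by simp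
    qed (use that[of 1] in auto)
    have "eventually (%k. lpb lborel q (%x. F u x - cv (gker (of_real (s k))) (F u) x) r) sequentially"
     using q by (intro heat_approximate_identity_seq[OF s _ B u r(1)]) auto
    then show "eventually (%k. ?J k u < a) sequentially"
     by eventually_elim (use r(2) in \<open>auto simp: lpb_def\<close>)
   qed simp
  qed
 qed measurable
 then have "eventually (%k. (NN u. ?J k u) < ennreal (e powr q)) sequentially"
  using e by (intro order_tendstoD) auto
 then show "eventually (%k. xpb q (%u x. F u x - cv (gker (of_real (s k))) (F u) x) e) sequentially"
 proof eventually_elim
  case (elim k)
  have "jm (%u x. F u x - cv (gker (of_real (s k))) (F u) x)" by measurable
  then show ?case using elim e by (simp add: xpb_iff less_imp_le)
 qed
qed

section \<open>Derivatives of the smoothed flow\<close>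

text \<open>A derivative along lines, at every point: the form in which the fundamental theorem of
  calculus and integration by parts use derivatives, and which convolution transports from kernel to
  result.\<close>

definition dird :: "'a::euclidean_space => ('a => complex) => ('a => complex) => bool" where
 "dird e f f' \<longleftrightarrow> (\<forall>x. ((%h. f (x + h *\<^sub>R e)) has_vector_derivative f' x) (at 0))"

lemma dird_line:
 assumes "dird e f f'"
 shows "((%h. f (x + h *\<^sub>R e)) has_vector_derivative f' (x + t *\<^sub>R e)) (at t within S)"
proof -
 have "((%h. f ((x + t *\<^sub>R e) + h *\<^sub>R e)) has_vector_derivative f' (x + t *\<^sub>R e)) (at (t - t))"
  using assms by (simp add: dird_def)
 then have "((%h. f ((x + t *\<^sub>R e) + h *\<^sub>R e)) \<circ> (%h. h - t) has_vector_derivative 1 *\<^sub>R f' (x + t *\<^sub>R e)) (at t)"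
  by (intro vector_diff_chain_at) (auto intro!: derivative_eq_intros)
 then have "((%h. f (x + h *\<^sub>R e)) has_vector_derivative f' (x + t *\<^sub>R e)) (at t)"
  by (simp add: comp_def scaleR_left_diff_distrib)
 then show ?thesis by (rule has_vector_derivative_at_within)
qed

lemma dird_line_continuous: "dird e f f' ==> continuous_on S (%h. f (x + h *\<^sub>R e))"
 by (rule continuous_on_vector_derivative) (rule dird_line)

lemma dird_unique: "dird e f g ==> dird e f h ==> g = h"
 by (auto simp: dird_def fun_eq_iff intro: vector_derivative_unique_at)

lemma dird_mult:
 assumes "dird e f f'" "dird e g g'"
 shows "dird e (%x. f x * g x) (%x. f x * g' x + f' x * g x)"
 unfolding dird_def
proof
 fix x
 have "((%h. f (x + h *\<^sub>R e) * g (x + h *\<^sub>R e)) has_vector_derivative f (x + 0 *\<^sub>R e) * g' x + f' x * g (x + 0 *\<^sub>R e)) (at 0)"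
  using assms unfolding dird_def by (intro has_vector_derivative_mult) auto
 then show "((%h. f (x + h *\<^sub>R e) * g (x + h *\<^sub>R e)) has_vector_derivative f x * g' x + f' x * g x) (at 0)" by simp
qed

lemma dird_reflect:
 assumes "dird e k k'"
 shows "dird e (%y. k (x - y)) (%y. - k' (x - y))"
 unfolding dird_def
proof
 fix y
 have "((%h. k ((x - y) + h *\<^sub>R e)) \<circ> uminus has_vector_derivative (-1) *\<^sub>R k' (x - y)) (at 0)"
  using assms unfolding dird_def by (intro vector_diff_chain_at) (auto intro!: derivative_eq_intros)
 then show "((%h. k (x - (y + h *\<^sub>R e))) has_vector_derivative - k' (x - y)) (at 0)"
  by (simp add: comp_def algebra_simps)
qed

lemma has_vector_derivative_at_0_iff:
 fixes f :: "real => complex"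
 shows "(f has_vector_derivative D) (at 0) \<longleftrightarrow> ((%t. (f t - f 0) /\<^sub>R t) \<longlongrightarrow> D) (at 0)"
proof -
 have "norm (f t - f 0 - t *\<^sub>R D) / norm t = norm ((f t - f 0) /\<^sub>R t - D)" if "t \<noteq> 0" for t
 proof -
  have "(f t - f 0) /\<^sub>R t - D = (f t - f 0 - t *\<^sub>R D) /\<^sub>R t" using that by (simp add: scaleR_right_diff_distrib)
  then show ?thesis by (simp add: divide_inverse mult.commute)
 qed
 then have "((%t. norm (f t - f 0 - t *\<^sub>R D) / norm t) \<longlongrightarrow> 0) (at 0) \<longleftrightarrow> ((%t. norm ((f t - f 0) /\<^sub>R t - D)) \<longlongrightarrow> 0) (at 0)"
  by (rule LIM_equal[OF allI, OF impI])
 then show ?thesis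
  by (simp add: has_vector_derivative_def has_derivative_at bounded_linear_scaleR_left tendsto_norm_zero_iff LIM_zero_iff)
qed

lemma has_vector_derivative_integral_dominated:
 fixes f f' :: "real => 'b => complex"
 assumes r: "0 < r"
  and der: "!!t y. abs t < r ==> ((%t. f t y) has_vector_derivative f' t y) (at t)"
  and bound: "!!t y. abs t < r ==> norm (f' t y) <= w y"
  and w: "integrable M w"
  and int: "!!t. abs t < r ==> integrable M (f t)"
  and meas: "f' 0 \<in> borel_measurable M"
 shows "((%t. LINT y|M. f t y) has_vector_derivative (LINT y|M. f' 0 y)) (at 0)"
proof -
 have "((%t. ((LINT y|M. f t y) - (LINT y|M. f 0 y)) /\<^sub>R t) \<longlongrightarrow> (LINT y|M. f' 0 y)) (at 0 within ball 0 r)"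
  unfolding tendsto_at_iff_sequentially comp_def
 proof safe
  fix X :: "nat => real" assume X: "\<forall>i. X i \<in> ball 0 r - {0}" and lim: "X \<longlonglongrightarrow> 0"
  have Xb: "abs (X i) < r" "X i \<noteq> 0" for i using X by auto
  have eq: "((LINT y|M. f (X i) y) - (LINT y|M. f 0 y)) /\<^sub>R X i = (LINT y|M. (f (X i) y - f 0 y) /\<^sub>R X i)" for i
   using int[OF Xb(1)] int[of 0] r by simp
  show "(%i. ((LINT y|M. f (X i) y) - (LINT y|M. f 0 y)) /\<^sub>R X i) \<longlonglongrightarrow> (LINT y|M. f' 0 y)"
   unfolding eq
  proof (rule integral_dominated_convergence[OF meas _ w])
   show "(%y. (f (X i) y - f 0 y) /\<^sub>R X i) \<in> borel_measurable M" for i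
    using int[OF Xb(1)[of i]] int[of 0] r by (intro borel_measurable_scaleR borel_measurable_diff) auto
   have "((%t. (f t y - f 0 y) /\<^sub>R t) \<longlongrightarrow> f' 0 y) (at 0)" for y
    using der[of 0 y] r by (simp add: has_vector_derivative_at_0_iff)
   then show "AE y in M. (%i. (f (X i) y - f 0 y) /\<^sub>R X i) \<longlonglongrightarrow> f' 0 y"
    using Xb(2) lim unfolding tendsto_at_iff_sequentially comp_def by auto
   have "norm (f (X i) y - f 0 y) <= w y * norm (X i - 0)" for i y
   proof (rule differentiable_bound[of "ball 0 r" "%t. f t y" "%t h. h *\<^sub>R f' t y"])
    fix t assume "t \<in> ball (0::real) r"
    then have t: "abs t < r" by simp
    show "((%t. f t y) has_derivative (%h. h *\<^sub>R f' t y)) (at t within ball 0 r)"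
     using der[OF t, of y] by (auto simp: has_vector_derivative_def intro: has_derivative_at_withinI)
    show "onorm (%h. h *\<^sub>R f' t y) <= w y"
     using bound[OF t, of y] by (intro onorm_le) (simp add: mult.commute mult_left_mono)
   qed (use Xb r in auto)
   then show "AE y in M. norm ((f (X i) y - f 0 y) /\<^sub>R X i) <= w y" for i
    using Xb(2)[of i] by (simp add: divide_simps mult.commute)
  qed
 qed
 then show ?thesis
  using r by (simp add: has_vector_derivative_at_0_iff at_within_open[of 0 "ball 0 r"])
qed

text \<open>One Gaussian of half the rate dominates all translates by vectors of norm at most one,
  so it can serve as majorant of a directional derivative.\<close>

lemma gauss_shift_le:
 assumes c: "0 < c" and e: "norm e <= 1" and t: "abs t <= 1"
 shows "gauss c (x + t *\<^sub>R e) <= exp c * gauss (c/2) x"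
proof -
 have "norm x <= norm (x + t *\<^sub>R e) + norm (t *\<^sub>R e)" by (metis add_diff_cancel norm_triangle_ineq4)
 also have "norm (t *\<^sub>R e) <= 1" using e t by (simp add: mult_le_one)
 finally have le: "norm x <= norm (x + t *\<^sub>R e) + 1" by simp
 have "(norm x)^2 <= (norm (x + t *\<^sub>R e) + 1)^2" using le by (intro power_mono) auto
 also have "\<dots> <= 2 * (norm (x + t *\<^sub>R e))^2 + 2"
  using zero_le_power2[of "norm (x + t *\<^sub>R e) - 1"] by (simp add: power2_eq_square algebra_simps)
 finally have "c * (norm x)^2 <= c * (2 * (norm (x + t *\<^sub>R e))^2 + 2)" using c by (intro mult_left_mono) auto
 then have "- c * (norm (x + t *\<^sub>R e))^2 <= c + - (c/2) * (norm x)^2" by (simp add: algebra_simps)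
 then show ?thesis unfolding gauss_def exp_add[symmetric] by simp
qed

text \<open>The derivative falls on the kernel, which is smooth; nothing but square integrability is
  asked of \<open>f\<close>.\<close>

lemma cv_dird:
 fixes k k' :: "'a::euclidean_space => complex"
 assumes k: "gbd A c k" and k': "gbd A' c' k'" and d: "dird e k k'" and e: "norm e <= 1" and f: "l2b f B"
 shows "dird e (cv k f) (cv k' f)"
 unfolding dird_def
proof
 fix x
 have [measurable]: "bm f" "bm k'" using f k' by (auto simp: lpb_def gbd_def)
 have c': "0 < c'" "0 <= A'" using k' by (auto simp: gbd_def)
 have maj: "gbd (A' * exp c') (c'/2) (%y. of_real (A' * exp c' * gauss (c'/2) y) :: complex)"
  using c' by (auto simp: gbd_def norm_mult abs_mult gauss_pos less_imp_le)
 have "((%t. LL y. k ((x - y) + t *\<^sub>R e) * f y) has_vector_derivative (LL y. k' ((x - y) + 0 *\<^sub>R e) * f y)) (at 0)"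
 proof (rule has_vector_derivative_integral_dominated[where r=1 and w="%y. norm (of_real (A' * exp c' * gauss (c'/2) (x - y)) * f y)"])
  fix t :: real and y assume t: "abs t < 1"
  show "((%t. k ((x - y) + t *\<^sub>R e) * f y) has_vector_derivative k' ((x - y) + t *\<^sub>R e) * f y) (at t)"
   by (intro has_vector_derivative_mult_left dird_line d)
  have "norm (k' ((x - y) + t *\<^sub>R e)) <= A' * gauss c' ((x - y) + t *\<^sub>R e)" using k' by (simp add: gbd_def)
  also have "\<dots> <= A' * (exp c' * gauss (c'/2) (x - y))" using c' e t by (intro mult_left_mono gauss_shift_le) auto
  finally show "norm (k' ((x - y) + t *\<^sub>R e) * f y) <= norm (of_real (A' * exp c' * gauss (c'/2) (x - y)) * f y)"
   using c' by (simp add: norm_mult abs_mult gauss_pos less_imp_le mult_right_mono)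
 next
  show "integrable lborel (%y. norm (of_real (A' * exp c' * gauss (c'/2) (x - y)) * f y))"
   by (intro integrable_norm cv_integrable(1)[OF maj f])
  fix t :: real
  have "integrable lborel (%y. k ((x + t *\<^sub>R e) - y) * f y)" by (rule cv_integrable(1)[OF k f])
  then show "integrable lborel (%y. k (x - y + t *\<^sub>R e) * f y)" by (simp add: algebra_simps)
 qed simp_all
 then show "((%h. cv k f (x + h *\<^sub>R e)) has_vector_derivative cv k' f x) (at 0)"
  by (simp add: cv_def algebra_simps)
qed

lemma duh_dird:
 fixes k k' :: "real => 'a::euclidean_space => complex"
 assumes k: "kfam k" and k': "kfam k'" and d: "!!t. dird e (k t) (k' t)" and e: "norm e <= 1" and F: "locL2 F"
 shows "dird e (duh k F t) (duh k' F t)"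
 unfolding dird_def
proof
 fix x
 obtain A c where Ac: "!!s. abs s <= 2 * abs t ==> gbd A c (k' s)" using k' unfolding kfam_def by metis
 obtain B where B: "!!s. abs s <= abs t ==> l2b (F s) B" using F unfolding locL2_def by metis
 have "((%h. LL s. tsg t s * cv (k (t - s)) (F s) (x + h *\<^sub>R e)) has_vector_derivative
   (LL s. tsg t s * cv (k' (t - s)) (F s) (x + 0 *\<^sub>R e))) (at 0)"
 proof (rule has_vector_derivative_integral_dominated[where r=1 and w="%s. indicator {-abs t..abs t} s * (A * gL2 TYPE('a) c * B)"])
  fix h s :: real
  obtain A1 c1 where 1: "gbd A1 c1 (k (t - s))" using kfam_slice[OF k] by blast
  obtain A2 c2 where 2: "gbd A2 c2 (k' (t - s))" using kfam_slice[OF k'] by blast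
  obtain B1 where 3: "l2b (F s) B1" using locL2_slice[OF F] by blast
  show "((%h. tsg t s * cv (k (t - s)) (F s) (x + h *\<^sub>R e)) has_vector_derivative tsg t s * cv (k' (t - s)) (F s) (x + h *\<^sub>R e)) (at h)"
   by (intro has_vector_derivative_mult_right dird_line cv_dird[OF 1 2 d e 3])
  show "norm (tsg t s * cv (k' (t - s)) (F s) (x + h *\<^sub>R e)) <= indicator {-abs t..abs t} s * (A * gL2 TYPE('a) c * B)"
  proof (cases "abs s <= abs t")
   case True
   then have "norm (cv (k' (t - s)) (F s) (x + h *\<^sub>R e)) <= A * gL2 TYPE('a) c * B"
    by (intro cv_integrable(2) Ac B) auto
   moreover have "norm (tsg t s * cv (k' (t - s)) (F s) (x + h *\<^sub>R e)) <= norm (cv (k' (t - s)) (F s) (x + h *\<^sub>R e))"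
    by (simp add: norm_mult tsg_def)
   ultimately show ?thesis using True by (simp add: indicator_def abs_le_iff)
  qed (use tsg_zero[of t s] in \<open>auto simp: indicator_def\<close>)
  show "integrable lborel (%s. tsg t s * cv (k (t - s)) (F s) (x + h *\<^sub>R e))"
   by (rule duh_integrable[OF k F])
 next
  show "(%s. tsg t s * cv (k' (t - s)) (F s) (x + 0 *\<^sub>R e)) \<in> borel_measurable lborel"
   by (rule borel_measurable_integrable[OF duh_integrable[OF k' F]])
 qed simp_all
 then show "((%h. duh k F t (x + h *\<^sub>R e)) has_vector_derivative duh k' F t x) (at 0)"
  by (simp add: duh_def)
qed

lemma dird_add: "dird e f f' ==> dird e g g' ==> dird e (%x. f x + g x) (%x. f' x + g' x)"
 unfolding dird_def by (auto intro: has_vector_derivative_add)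

lemma sol_dird:
 fixes k k' :: "real => 'a::euclidean_space => complex"
 assumes k: "kfam k" and k': "kfam k'" and d: "!!t. dird e (k t) (k' t)" and e: "norm e <= 1"
  and f: "l2b f B" and F: "locL2 F"
 shows "dird e (sol k f F t) (sol k' f F t)"
proof -
 obtain A1 c1 where 1: "gbd A1 c1 (k t)" using kfam_slice[OF k] by blast
 obtain A2 c2 where 2: "gbd A2 c2 (k' t)" using kfam_slice[OF k'] by blast
 show ?thesis unfolding sol_def[abs_def]
  by (intro dird_add cv_dird[OF 1 2 d e f] duh_dird assms)
qed

lemma locL2_add:
 assumes F: "locL2 F" and G: "locL2 G"
 shows "locL2 (%t x. F t x + G t x)"
 unfolding locL2_def
proof (intro conjI allI)
 note [measurable] = measurable_curried[OF locL2_measurable[OF F]] measurable_curried[OF locL2_measurable[OF G]]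
 show "jm (%t x. F t x + G t x)" by measurable
 fix T
 obtain A B where "\<forall>t. abs t <= T --> l2b (F t) A" "\<forall>t. abs t <= T --> l2b (G t) B"
  using F G unfolding locL2_def by metis
 then have "\<forall>t. abs t <= T --> l2b (%x. F t x + G t x) (A + B)" by (auto intro!: lpb_add)
 then show "\<exists>B. \<forall>t. abs t <= T --> l2b (%x. F t x + G t x) B" by blast
qed

lemma locL2_sol: "kfam k ==> l2b f B ==> locL2 F ==> locL2 (sol k f F)"
 unfolding sol_def[abs_def] by (intro locL2_add locL2_free(1) locL2_duh)

lemma sol_bounded:
 assumes "kfam k" "l2b f B" "locL2 F"
 shows "\<exists>b. \<forall>t x. abs t <= T --> norm (sol k f F t x) <= b"
proof -
 obtain b1 b2 where "\<forall>t x. abs t <= T --> norm (cv (k t) f x) <= b1" "\<forall>t x. abs t <= T --> norm (duh k F t x) <= b2"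
  using free_bounded_at[OF assms(1,2), of T] duh_bounded_at[OF assms(1,3), of T] by metis
 then have "\<forall>t x. abs t <= T --> norm (sol k f F t x) <= b1 + b2"
  by (auto simp: sol_def intro!: order_trans[OF norm_triangle_ineq] add_mono)
 then show ?thesis by blast
qed

section \<open>Spatial derivatives of the complex-time kernel\<close>

definition gk1 :: "'a::euclidean_space => complex => 'a => complex" where
 "gk1 e z x = - (of_real (x \<bullet> e) / (2 * z)) * gker z x"

definition gk2 :: "'a::euclidean_space => complex => 'a => complex" where
 "gk2 e z x = (of_real ((x \<bullet> e)^2) / (4 * z^2) - 1 / (2 * z)) * gker z x"

text \<open>The heat equation for the kernel, the Laplacian on the left and the derivative in
  \<open>z\<close> on the right. Along vertical lines in \<open>z\<close> it becomes the
  Schroedinger equation.\<close>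

lemma sum_gk2: "(\<Sum>e\<in>Basis. gk2 e z x) = gker_deriv z x"
proof -
 have "(norm x)^2 = (\<Sum>b\<in>Basis. (x \<bullet> b)^2)" 
  unfolding power2_norm_eq_inner by (subst euclidean_inner) (simp add: power2_eq_square)
 then show ?thesis unfolding gk2_def gker_deriv_def
  by (simp add: sum_distrib_right[symmetric] sum_subtractf sum_divide_distrib[symmetric])
qed

lemma dird_gker: "e \<in> Basis ==> dird e (gker z) (gk1 e z)"
 unfolding dird_def
proof
 fix x :: 'a assume e: "e \<in> Basis"
 have n: "(norm (x + h *\<^sub>R e))^2 = (norm x)^2 + 2 * h * (x \<bullet> e) + h^2" for h
  using e by (simp add: power2_norm_eq_inner inner_add_left inner_add_right inner_commute)
    (simp add: power2_eq_square algebra_simps)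
 have "((%h. - complex_of_real ((norm x)^2 + 2 * h * (x \<bullet> e) + h^2) / (4 * z)) has_vector_derivative - (of_real (2 * (x \<bullet> e)) / (4 * z))) (at 0)"
 proof -
  have "((%h. (norm x)^2 + 2 * h * (x \<bullet> e) + h^2) has_real_derivative 2 * (x \<bullet> e)) (at 0)"
   by (auto intro!: derivative_eq_intros)
  then have "((%h. complex_of_real ((norm x)^2 + 2 * h * (x \<bullet> e) + h^2)) has_vector_derivative of_real (2 * (x \<bullet> e))) (at 0)"
   by (rule has_vector_derivative_of_real)
  then have "((%h. complex_of_real ((norm x)^2 + 2 * h * (x \<bullet> e) + h^2) * (- (1 / (4 * z)))) has_vector_derivative of_real (2 * (x \<bullet> e)) * (- (1 / (4 * z)))) (at 0)"
   by (rule has_vector_derivative_mult_left)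
  then show ?thesis by (simp only: mult_minus_right mult_1_right times_divide_eq_right minus_divide_left)
 qed
 from field_vector_diff_chain_at[OF this DERIV_exp]
 have "((%h. exp (- complex_of_real ((norm (x + h *\<^sub>R e))^2) / (4 * z))) has_vector_derivative
   - (of_real (2 * (x \<bullet> e)) / (4 * z)) * exp (- of_real ((norm x)^2) / (4 * z))) (at 0)"
  unfolding n by (simp add: comp_def)
 then have "((%h. gker z (x + h *\<^sub>R e)) has_vector_derivative
   (of_real (4 * pi) * z) powr (- of_real (DIM('a) / 2)) * (- (of_real (2 * (x \<bullet> e)) / (4 * z)) * exp (- of_real ((norm x)^2) / (4 * z)))) (at 0)"
  unfolding gker_def by (rule has_vector_derivative_mult_right)
 then show "((%h. gker z (x + h *\<^sub>R e)) has_vector_derivative gk1 e z x) (at 0)"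
  by (simp add: gk1_def gker_def mult_ac)
qed

lemma dird_gk1: "e \<in> Basis ==> dird e (gk1 e z) (gk2 e z)"
proof -
 assume e: "e \<in> Basis"
 have "dird e (%x. - (of_real (x \<bullet> e) / (2 * z))) (%x. - (1 / (2 * z)))"
  unfolding dird_def
 proof
  fix x :: 'a
  have "((%h. x \<bullet> e + h) has_real_derivative 1) (at 0)" by (auto intro!: derivative_eq_intros)
  then have "((%h. complex_of_real (x \<bullet> e + h)) has_vector_derivative of_real 1) (at 0)"
   by (rule has_vector_derivative_of_real)
  then have "((%h. complex_of_real (x \<bullet> e + h) * (- (1 / (2 * z)))) has_vector_derivative of_real 1 * (- (1 / (2 * z)))) (at 0)"
   by (rule has_vector_derivative_mult_left)
  then show "((%h. - (of_real ((x + h *\<^sub>R e) \<bullet> e) / (2 * z))) has_vector_derivative - (1 / (2 * z))) (at 0)"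
   using e by (simp add: inner_add_left)
 qed
 from dird_mult[OF this dird_gker[OF e]]
 have "dird e (gk1 e z) (%x. - (of_real (x \<bullet> e) / (2 * z)) * gk1 e z x + - (1 / (2 * z)) * gker z x)"
  by (simp add: gk1_def[abs_def])
 moreover have "- (of_real (x \<bullet> e) / (2 * z)) * gk1 e z x + - (1 / (2 * z)) * gker z x = gk2 e z x" for x
  by (simp add: gk1_def gk2_def power2_eq_square algebra_simps)
 ultimately show ?thesis by simp
qed

lemma gbd_poly_gker:
 fixes p :: "'a::euclidean_space => complex"
 assumes r: "0 < r" "r <= Re z" "norm z <= m" and [measurable]: "bm p"
  and p: "!!x. norm (p x) <= P * (1 + (norm x)^2)" and P: "0 <= P"
 shows "gbd (P * (1 + 8 * m^2 / r) * (4 * pi * r) powr (- (DIM('a) / 2))) (r / (8 * m^2)) (%x. p x * gker z x)"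
 unfolding gbd_def
proof (intro conjI allI)
 have "0 < m" using r complex_Re_le_cmod[of z] by linarith
 then show "0 < r / (8 * m^2)" "0 <= P * (1 + 8 * m^2 / r) * (4 * pi * r) powr (- (DIM('a) / 2))" using P r by auto
qed (measurable, rule poly_gker_majorant[OF r p P])

lemma norm_le_one_plus_square: "norm x <= 1 + (norm x)^2"
proof -
 have "2 * norm x <= 1 + (norm x)^2"
  using zero_le_power2[of "norm x - 1"] by (simp add: power2_eq_square algebra_simps)
 then show ?thesis using norm_ge_zero[of x] by linarith
qed

text \<open>First derivatives, second derivatives and Laplacian of the kernel are all of this shape:
  a coefficient of at most quadratic growth times the Gaussian.\<close>

lemma kfam_quadratic_gker:
 fixes p q :: "'a::euclidean_space => complex"
 assumes r: "0 < r" and c: "continuous_on UNIV p" "continuous_on UNIV q"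
  and p: "!!x. norm (p x) <= P * (1 + (norm x)^2)" "!!x. norm (q x) <= P * (1 + (norm x)^2)" and P: "0 <= P"
 shows "kfam (%t x. (p x / (4 * (Complex r t)^2) - q x / (2 * Complex r t)) * gker (Complex r t) x)"
 unfolding kfam_def
proof (intro conjI allI)
 let ?p = "%t x. p x / (4 * (Complex r t)^2) - q x / (2 * Complex r t)"
 have n: "Complex r a \<noteq> 0" for a using r by (auto simp: complex_eq_iff)
 have "continuous_on UNIV (%x. Complex r (fst x :: real))"
  unfolding Complex_eq by (intro continuous_intros)
 then have "continuous_on UNIV (case_prod ?p)"
  unfolding case_prod_beta using n
  by (intro continuous_intros continuous_on_compose2[OF c(1)] continuous_on_compose2[OF c(2)]) auto
 then have pm: "jm ?p" using borel_measurable_continuous_onI by (auto simp: borel_prod)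
 note [measurable] = measurable_curried[OF pm] measurable_curried[OF kfam_measurable[OF kfam_gker[OF r]]]
 show "jm (%t x. ?p t x * gker (Complex r t) x)" by measurable
 have b: "norm (?p t x) <= ((1 / (4 * r^2) + 1 / (2 * r)) * P) * (1 + (norm x)^2)" for t x
 proof -
  have "r <= norm (Complex r t)" using complex_Re_le_cmod[of "Complex r t"] by simp
  from norm_quadratic_le[OF r this p] show ?thesis by (simp add: ac_simps)
 qed
 fix T
 have "norm (Complex r t) <= r + abs T" if "abs t <= T" for t
  using cmod_le[of "Complex r t"] that r by auto
 then have "gbd (((1 / (4 * r^2) + 1 / (2 * r)) * P) * (1 + 8 * (r + abs T)^2 / r) * (4 * pi * r) powr (- (DIM('a) / 2))) (r / (8 * (r + abs T)^2)) (%x. ?p t x * gker (Complex r t) x)" if "abs t <= T" for t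
  using that r P by (intro gbd_poly_gker measurable_slice[OF pm] b) auto
 then show "\<exists>A c. \<forall>t. abs t <= T --> gbd A c (%x. ?p t x * gker (Complex r t) x)" by blast
qed

lemma kfam_gk1:
 assumes "0 < r" "e \<in> Basis"
 shows "kfam (%t. gk1 e (Complex r t))"
proof -
 have "kfam (%t x. (0 / (4 * (Complex r t)^2) - of_real (x \<bullet> e) / (2 * Complex r t)) * gker (Complex r t) x)"
  by (rule kfam_quadratic_gker[OF assms(1), where P=1])
    (auto intro!: continuous_intros order_trans[OF Basis_le_norm[OF assms(2)] norm_le_one_plus_square])
 then show ?thesis by (simp add: gk1_def[abs_def])
qed

lemma kfam_gk2:
 assumes "0 < r" "e \<in> Basis"
 shows "kfam (%t. gk2 e (Complex r t))"
proof -
 have "kfam (%t x. (of_real ((x \<bullet> e)^2) / (4 * (Complex r t)^2) - 1 / (2 * Complex r t)) * gker (Complex r t) x)"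
 proof (rule kfam_quadratic_gker[OF assms(1), where P=1])
  show "norm (complex_of_real ((x \<bullet> e)^2)) <= 1 * (1 + (norm x)^2)" for x
   using Basis_le_norm[OF assms(2), of x] by (simp add: abs_le_square_iff[symmetric] add_increasing del: of_real_power)
 qed (auto intro!: continuous_intros)
 then show ?thesis by (simp add: gk2_def[abs_def])
qed

text \<open>The fundamental theorem of calculus over a unit step is integrated over space. By
  translation invariance the increments of \<open>h\<close> integrate to 0, while the other side is
  the full integral of \<open>h'\<close>. This is integration by parts for functions whose decay at
  infinity is known through integrability only.\<close>

lemma integral_dird_zero:
 fixes h h' :: "'a::euclidean_space => complex"
 assumes d: "dird e h h'" and cont: "!!x. continuous_on UNIV (%t. h' (x + t *\<^sub>R e))"
  and int: "integrable lborel h" "integrable lborel h'"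
 shows "(LL x. h' x) = 0"
proof -
 have "bm h" "bm h'" using int by auto
 note [measurable] = this
 have ftc: "(LL t. indicator {0..1::real} t *\<^sub>R h' (x + t *\<^sub>R e)) = h (e + x) - h x" for x
 proof -
  have "(LL t. indicator {0..1::real} t *\<^sub>R h' (x + t *\<^sub>R e)) = h (x + 1 *\<^sub>R e) - h (x + 0 *\<^sub>R e)"
   by (rule integral_FTC_atLeastAtMost[where F="%t. h (x + t *\<^sub>R e)"])
     (auto intro: dird_line[OF d] continuous_on_subset[OF cont])
  then show ?thesis by (simp add: add.commute)
 qed
 have "(NN x. (NN t. ennreal (norm (indicator {0..1::real} t *\<^sub>R h' (x + t *\<^sub>R e))))) =
  (NN t. (NN x. ennreal (norm (indicator {0..1::real} t *\<^sub>R h' (x + t *\<^sub>R e)))))"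
  by (rule lborel_pair.Fubini') measurable
 also have "\<dots> = (NN t. (NN x. ennreal (norm (h' x))) * indicator {0..1::real} t)"
 proof (intro nn_integral_cong)
  fix t :: real
  have "(NN x. ennreal (norm (h' (t *\<^sub>R e + x)))) = (NN x. ennreal (norm (h' x)))"
   by (rule nn_integral_translate) measurable
  then show "(NN x. ennreal (norm (indicator {0..1::real} t *\<^sub>R h' (x + t *\<^sub>R e)))) = (NN x. ennreal (norm (h' x))) * indicator {0..1::real} t"
   by (auto simp: indicator_def add.commute)
 qed
 also have "\<dots> = (NN x. ennreal (norm (h' x)))"
  by (subst nn_integral_cmult_indicator) auto
 also have "\<dots> < \<infinity>" using int(2) by (simp add: integrable_iff_bounded)
 finally have fin: "(NN x. (NN t. ennreal (norm (indicator {0..1::real} t *\<^sub>R h' (x + t *\<^sub>R e))))) < \<infinity>" .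
 have m: "(%(x, t). indicator {0..1::real} t *\<^sub>R h' (x + t *\<^sub>R e)) \<in> borel_measurable lborel2" by measurable
 have "(LL x. h (e + x) - h x) = 0"
  using integrable_translate[OF int(1), of e] int(1) integral_translate[of h e] by simp
 then have "0 = (LL x. LL t. indicator {0..1::real} t *\<^sub>R h' (x + t *\<^sub>R e))" unfolding ftc by simp
 also have "\<dots> = (LL t. LL x. indicator {0..1::real} t *\<^sub>R h' (x + t *\<^sub>R e))"
  by (rule fubini_pair(1)[OF m fin])
 also have "\<dots> = (LL t. indicator {0..1::real} t *\<^sub>R (LL x. h' x))"
 proof (rule Bochner_Integration.integral_cong[OF refl])
  fix t :: real
  show "(LL x. indicator {0..1::real} t *\<^sub>R h' (x + t *\<^sub>R e)) = indicator {0..1} t *\<^sub>R (LL x. h' x)"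
   using integral_translate[of h' "t *\<^sub>R e"] by (simp add: add.commute)
 qed
 also have "\<dots> = (LL x. h' x)" by simp
 finally show ?thesis by simp
qed

text \<open>A distributional derivative in the direction \<open>e\<close>, tested only against Gaussian kernels.\<close>

definition wd :: "'a::euclidean_space => ('a => complex) => ('a => complex) => bool" where
 "wd e f g \<longleftrightarrow> (\<forall>z x. 0 < Re z --> cv (gk1 e z) f x = cv (gker z) g x)"

lemma gbd_gk1_ex: "0 < Re z ==> e \<in> Basis ==> \<exists>A c. gbd A c (gk1 e z)"
 using kfam_slice[OF kfam_gk1[of "Re z" e], of "Im z"] by simp

lemma gbd_gk2_ex: "0 < Re z ==> e \<in> Basis ==> \<exists>A c. gbd A c (gk2 e z)"
 using kfam_slice[OF kfam_gk2[of "Re z" e], of "Im z"] by simp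

lemma wd_dird:
 fixes f g :: "'a::euclidean_space => complex"
 assumes e: "e \<in> Basis" and d: "dird e f g" and cont: "!!x. continuous_on UNIV (%t. g (x + t *\<^sub>R e))"
  and f: "l2b f A" and g: "l2b g B"
 shows "wd e f g"
 unfolding wd_def
proof (intro allI impI)
 fix z and x :: 'a assume z: "0 < Re z"
 obtain A1 c1 where 1: "gbd A1 c1 (gker z :: 'a => complex)" using gbd_gker_ex[OF z] by blast
 obtain A2 c2 where 2: "gbd A2 c2 (gk1 e z)" using gbd_gk1_ex[OF z e] by blast
 note i1 = cv_integrable(1)[OF 1 f, of x] and i2 = cv_integrable(1)[OF 1 g, of x] and i3 = cv_integrable(1)[OF 2 f, of x]
 have dh: "dird e (%y. gker z (x - y) * f y) (%y. gker z (x - y) * g y + - gk1 e z (x - y) * f y)"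
  by (rule dird_mult[OF dird_reflect[OF dird_gker[OF e]] d])
 have "(LL y. gker z (x - y) * g y + - gk1 e z (x - y) * f y) = 0"
 proof (rule integral_dird_zero[OF dh])
  show "continuous_on UNIV (%t. gker z (x - (w + t *\<^sub>R e)) * g (w + t *\<^sub>R e) + - gk1 e z (x - (w + t *\<^sub>R e)) * f (w + t *\<^sub>R e))" for w
   by (intro continuous_intros cont dird_line_continuous[OF d]
     dird_line_continuous[OF dird_reflect[OF dird_gker[OF e]]] dird_line_continuous[OF dird_reflect[OF dird_gk1[OF e]]])
  show "integrable lborel (%y. gker z (x - y) * f y)" by (rule i1)
  show "integrable lborel (%y. gker z (x - y) * g y + - gk1 e z (x - y) * f y)" using i2 i3 by simp
 qed
 then show "cv (gk1 e z) f x = cv (gker z) g x" unfolding cv_def using i2 i3 by simp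
qed

text \<open>Both sides are derivatives of one function,
  \<open>cv (gk1 e z) f = cv (gker z) g\<close>, and line derivatives are unique.\<close>

lemma wd_gk2:
 fixes f g :: "'a::euclidean_space => complex"
 assumes w: "wd e f g" and e: "e \<in> Basis" and z: "0 < Re z" and f: "l2b f A" and g: "l2b g B"
 shows "cv (gk2 e z) f x = cv (gk1 e z) g x"
proof -
 obtain A1 c1 where 1: "gbd A1 c1 (gker z :: 'a => complex)" using gbd_gker_ex[OF z] by blast
 obtain A2 c2 where 2: "gbd A2 c2 (gk1 e z)" using gbd_gk1_ex[OF z e] by blast
 obtain A3 c3 where 3: "gbd A3 c3 (gk2 e z)" using gbd_gk2_ex[OF z e] by blast
 have n: "norm e <= 1" using e by simp
 have eq: "cv (gk1 e z) f = cv (gker z) g" using w z by (auto simp: wd_def)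
 have "dird e (cv (gk1 e z) f) (cv (gk2 e z) f)" by (rule cv_dird[OF 2 3 dird_gk1[OF e] n f])
 moreover have "dird e (cv (gk1 e z) f) (cv (gk1 e z) g)" unfolding eq by (rule cv_dird[OF 1 2 dird_gker[OF e] n g])
 ultimately show ?thesis using dird_unique by metis
qed

abbreviation "K0 r \<equiv> %t. gker (Complex r t)"
abbreviation "K1 r e \<equiv> %t. gk1 e (Complex r t)"
abbreviation "K2 r e \<equiv> %t. gk2 e (Complex r t)"
abbreviation "KL r \<equiv> %t. gker_deriv (Complex r t)"

text \<open>Moves a derivative from the kernel to data and forcing: the derivative of a flow is
  again a flow, and the Strichartz estimates apply to it.\<close>

lemma sol_K1:
 assumes "0 < r" "wd e f g" "!!s. wd e (F s) (G s)"
 shows "sol (K1 r e) f F t x = sol (K0 r) g G t x"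
 using assms by (simp add: sol_def duh_def wd_def)

lemma sol_K2:
 assumes r: "0 < r" and e: "e \<in> Basis" and w: "wd e f g" "!!s. wd e (F s) (G s)"
  and f: "l2b f A" and g: "l2b g B" and F: "locL2 F" and G: "locL2 G"
 shows "sol (K2 r e) f F t x = sol (K1 r e) g G t x"
proof -
 have "cv (gk2 e (Complex r (t - s))) (F s) x = cv (gk1 e (Complex r (t - s))) (G s) x" for s
 proof -
  obtain A B where "l2b (F s) A" "l2b (G s) B" using locL2_slice[OF F] locL2_slice[OF G] by metis
  then show ?thesis using wd_gk2[OF w(2)[of s] e] r by simp
 qed
 moreover have "cv (gk2 e (Complex r t)) f x = cv (gk1 e (Complex r t)) g x"
  using wd_gk2[OF w(1) e _ f g] r by simp
 ultimately show ?thesis by (simp add: sol_def duh_def)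
qed

lemma kfam_KL:
 assumes "0 < r"
 shows "kfam (KL r :: real => 'a::euclidean_space => complex)"
proof -
 have "kfam (%t (x::'a). (of_real ((norm x)^2) / (4 * (Complex r t)^2) - of_real (DIM('a)) / (2 * Complex r t)) * gker (Complex r t) x)"
  by (rule kfam_quadratic_gker[OF assms _ _ norm_quadratic_coefficients]) (auto intro!: continuous_intros)
 then show ?thesis by (simp add: gker_deriv_def[abs_def])
qed

section \<open>The smoothed equation in integrated form in time\<close>

lemma tsg_interval: "(LL s. tsg t s * p s) = (LBINT s=0..t. p s)"
proof (cases "0 <= t")
 case True
 then show ?thesis
  by (auto simp: interval_lebesgue_integral_def set_lebesgue_integral_def zero_ereal_def tsg_def indicator_def intro!: Bochner_Integration.integral_cong)
next
 case False
 then have "(LL s. tsg t s * p s) = (LL s. - (indicator {t<..<0} s *\<^sub>R p s))"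
  by (intro Bochner_Integration.integral_cong) (auto simp: tsg_def indicator_def)
 then show ?thesis using False by (simp add: interval_lebesgue_integral_def set_lebesgue_integral_def zero_ereal_def)
qed

lemma tsg_FTC:
 assumes d: "!!s. (p has_vector_derivative p' s) (at s)" and c: "continuous_on UNIV p'"
 shows "(LL s. tsg t s * p' s) = p t - p 0"
 unfolding tsg_interval zero_ereal_def
 by (rule interval_integral_FTC_finite) (auto intro: has_vector_derivative_at_within d continuous_on_subset[OF c])

lemma gker_time_derivative:
 assumes r: "0 < r"
 shows "((%t. gker (Complex r t) x) has_vector_derivative \<i> * gker_deriv (Complex r t) x) (at t)"
  and "continuous_on UNIV (%t. gker_deriv (Complex r t) x)"
proof -
 have d: "((%t. gker (Complex r t) x) has_vector_derivative \<i> * gker_deriv (Complex r t) x) (at t)" for t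
 proof -
  have "((%t. of_real r + \<i> * complex_of_real t) has_vector_derivative 0 + \<i> * of_real 1) (at t)"
   by (intro has_vector_derivative_add has_vector_derivative_const has_vector_derivative_mult_right has_vector_derivative_of_real DERIV_ident)
  then have 1: "((%t. Complex r t) has_vector_derivative \<i>) (at t)" by (simp add: Complex_eq)
  have "((%z. gker z x) has_field_derivative gker_deriv (Complex r t) x) (at (Complex r t))"
   using r by (intro gker_has_field_derivative) simp
  from field_vector_diff_chain_at[OF 1 this] show ?thesis by (simp add: comp_def)
 qed
 then show "((%t. gker (Complex r t) x) has_vector_derivative \<i> * gker_deriv (Complex r t) x) (at t)" .
 have c: "continuous_on UNIV (%t. gker (Complex r t) x)"
  by (rule continuous_on_vector_derivative) (rule d[THEN has_vector_derivative_at_within])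
 have "complex_of_real r + \<i> * complex_of_real a \<noteq> 0"
  "2 * complex_of_real r + 2 * (\<i> * complex_of_real a) \<noteq> 0" for a using r by (auto simp: complex_eq_iff)
 then show "continuous_on UNIV (%t. gker_deriv (Complex r t) x)"
  using c unfolding gker_deriv_def Complex_eq by (intro continuous_intros) simp_all
qed

text \<open>The fundamental theorem in \<open>t\<close> for the kernel, whose time derivative is
  \<open>\<i> * gker_deriv\<close>, carried through the convolution by Fubini.\<close>

lemma free_time:
 fixes f :: "'a::euclidean_space => complex"
 assumes r: "0 < r" and f: "l2b f B"
 shows "cv (K0 r t) f x = cv (K0 r 0) f x + (LL s. tsg t s * (\<i> * cv (KL r s) f x))"
  and "integrable lborel (%s. tsg t s * (\<i> * cv (KL r s) f x))"
proof -
 note kL = kfam_KL[OF r, where 'a='a]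
 obtain A c where Ac: "!!s. abs s <= abs t ==> gbd A c (KL r s :: 'a => complex)" using kL unfolding kfam_def by metis
 have A0: "0 <= A" using Ac[of 0] by (simp add: gbd_def)
 obtain A0 c0 where k00: "gbd A0 c0 (K0 r 0 :: 'a => complex)" using kfam_slice[OF kfam_gker[OF r]] by blast
 obtain A1 c1 where k0t: "gbd A1 c1 (K0 r t :: 'a => complex)" using kfam_slice[OF kfam_gker[OF r]] by blast
 note [measurable] = measurable_curried[OF kfam_measurable[OF kL]]
 have hm: "jm (%s y. tsg t s * (\<i> * KL r s (x - y)))" by measurable
 have h2: "l2b (%y. tsg t s * (\<i> * KL r s (x - y))) (A * gL2 TYPE('a) c)" if "abs s <= abs t" for s
  by (rule lpb_dominated[OF gbd_lpb_2[OF Ac[OF that], of x]]) (auto simp: norm_mult tsg_def)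
 have h0: "tsg t s * (\<i> * KL r s (x - y)) = 0" if "abs t < abs s" for s y using that by (simp add: tsg_zero)
 note tp = hm abs_ge_zero mult_nonneg_nonneg[OF A0 gL2_nonneg] h2 h0 f
 have in1: "(LL y. tsg t s * (\<i> * KL r s (x - y)) * f y) = tsg t s * (\<i> * cv (KL r s) f x)" for s
  unfolding cv_def by (simp add: mult.assoc)
 have in2: "(LL s. tsg t s * (\<i> * KL r s (x - y))) = K0 r t (x - y) - K0 r 0 (x - y)" for y
  by (intro tsg_FTC gker_time_derivative r continuous_intros)
 show "integrable lborel (%s. tsg t s * (\<i> * cv (KL r s) f x))"
  using time_integral_pairing_integrable[OF tp] unfolding in1 .
 have "(LL s. tsg t s * (\<i> * cv (KL r s) f x)) = (LL y. (K0 r t (x - y) - K0 r 0 (x - y)) * f y)"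
  using time_integral_pairing[OF tp] unfolding in1 in2 by simp
 also have "\<dots> = cv (K0 r t) f x - cv (K0 r 0) f x"
  unfolding cv_def using cv_integrable(1)[OF k00 f, of x] cv_integrable(1)[OF k0t f, of x] by (simp add: left_diff_distrib)
 finally show "cv (K0 r t) f x = cv (K0 r 0) f x + (LL s. tsg t s * (\<i> * cv (KL r s) f x))" by simp
qed

text \<open>Both sides describe the same ordered triples, \<open>s\<close> between 0 and
  \<open>u\<close> and \<open>u\<close> between \<open>s\<close> and \<open>t\<close>, for either
  sign of \<open>t\<close>. This is the exchange of order in an iterated Duhamel integral.\<close>

lemma tsg_mult_shift: "tsg t s * tsg (t - s) (u - s) = tsg t u * tsg u s"
 unfolding tsg_def by auto

lemma tsg_integrable_bounded:
 fixes p :: "real => complex"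
 assumes [measurable]: "bm p" and b: "!!s. abs s <= abs t ==> norm (p s) <= b"
 shows "integrable lborel (%s. tsg t s * p s)"
proof (rule Bochner_Integration.integrable_bound)
 show "integrable lborel (%s. b * indicator {-abs t..abs t} s)" by (intro integrable_mult_right integrable_real_indicator) auto
 show "AE s in lborel. norm (tsg t s * p s) <= norm (b * indicator {- abs t..abs t} s)"
 proof (rule AE_I2)
  fix s show "norm (tsg t s * p s) <= norm (b * indicator {- abs t..abs t} s)"
  proof (cases "abs s <= abs t")
   case True
   then have "norm (tsg t s * p s) <= 1 * b" unfolding norm_mult by (intro mult_mono norm_tsg_le b) auto
   then show ?thesis using True by (auto simp: indicator_def abs_le_iff)
  qed (use tsg_zero[of t s] in simp)
 qed
qed measurable

text \<open>Each \<open>F s\<close> is followed by the free equation for the remaining time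
  \<open>t - s\<close>, and the two time integrals are exchanged. The forcing survives in the form
  smoothed by \<open>K0 r 0\<close>, the kernel at the moment of injection.\<close>

lemma duh_time:
 fixes F :: "real => 'a::euclidean_space => complex"
 assumes r: "0 < r" and F: "locL2 F"
 shows "duh (K0 r) F t x = (LL s. tsg t s * cv (K0 r 0) (F s) x) + (LL u. tsg t u * (\<i> * duh (KL r) F u x))"
proof -
 note k0 = kfam_gker[OF r, where 'a='a] and kL = kfam_KL[OF r, where 'a='a]
 obtain A c where Ac: "!!s. abs s <= 2 * abs t ==> gbd A c (KL r s :: 'a => complex)" using kL unfolding kfam_def by metis
 obtain A0 c0 where k00: "gbd A0 c0 (K0 r 0 :: 'a => complex)" using kfam_slice[OF k0] by blast
 obtain B where B: "!!s. abs s <= abs t ==> l2b (F s) B" using F unfolding locL2_def by metis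
 define W where "W = A * gL2 TYPE('a) c * B"
 note [measurable] = measurable_cv_comp[OF kfam_measurable[OF kL] locL2_measurable[OF F]]
 have m0: "bm (%s. cv (K0 r 0) (F s) x)"
 proof -
  note [measurable] = measurable_cv_comp[OF kfam_measurable[OF k0] locL2_measurable[OF F], of "%_. 0"]
  show ?thesis by measurable
 qed
 have i1: "integrable lborel (%s. tsg t s * cv (K0 r 0) (F s) x)"
  by (rule tsg_integrable_bounded[OF m0]) (rule cv_integrable(2)[OF k00 B])
 let ?f = "%s u. tsg t s * (tsg (t - s) (u - s) * (\<i> * cv (KL r (u - s)) (F s) x))"
 have fm: "(%(s, u). ?f s u) \<in> borel_measurable lborel2" by measurable
 have bd: "norm (?f s u) <= W * indicator {-abs t..abs t} s * indicator {-abs t..abs t} u" for s u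
 proof (cases "tsg t s = 0 \<or> tsg (t - s) (u - s) = 0")
  case False
  then have s: "abs s <= abs t" using tsg_zero[of t s] by linarith
  have "(0 < s \<and> s < t) \<or> (t < s \<and> s < 0)" "(0 < u - s \<and> u - s < t - s) \<or> (t - s < u - s \<and> u - s < 0)"
   using False by (auto simp: tsg_def split: if_splits)
  then have u: "abs u <= abs t" by linarith
  have "norm (?f s u) = norm (tsg t s) * (norm (tsg (t - s) (u - s)) * norm (cv (KL r (u - s)) (F s) x))" by (simp add: norm_mult)
  also have "\<dots> <= 1 * (1 * W)"
   unfolding W_def using s u by (intro mult_mono norm_tsg_le cv_integrable(2) Ac B) (auto intro!: mult_nonneg_nonneg)
  finally show ?thesis using s u by (auto simp: indicator_def abs_le_iff)
 qed (auto simp: indicator_def W_def intro!: mult_nonneg_nonneg gL2_nonneg lpb_nonneg[OF B[of 0]] Ac[of 0, unfolded gbd_def, THEN conjunct2, THEN conjunct1])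
 have W0: "0 <= W" unfolding W_def using Ac[of 0] B[of 0] by (auto simp: gbd_def lpb_def intro!: mult_nonneg_nonneg gL2_nonneg)
 have fin: "(NN s. (NN u. ennreal (norm (?f s u)))) < \<infinity>"
 proof -
  have "(NN s. (NN u. ennreal (norm (?f s u)))) <= (NN s. (NN u. (ennreal W * indicator {-abs t..abs t} s) * indicator {-abs t..abs t} u))"
   using order_trans[OF ennreal_leI[OF bd]] W0 by (intro nn_integral_mono) (auto simp: indicator_def split: if_splits)
  also have "\<dots> = ennreal W * ennreal (2 * abs t) * ennreal (2 * abs t)"
   by (simp add: nn_integral_multc nn_integral_cmult_indicator)
  also have "\<dots> < \<infinity>" by (simp add: ennreal_mult_less_top)
  finally show ?thesis .
 qed
 have "duh (K0 r) F t x = (LL s. tsg t s * cv (K0 r 0) (F s) x + (LL u. ?f s u))"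
  unfolding duh_def
 proof (rule Bochner_Integration.integral_cong[OF refl])
  fix s
  obtain B' where B': "l2b (F s) B'" using locL2_slice[OF F] by blast
  have "(LL v. tsg (t - s) v * (\<i> * cv (KL r v) (F s) x)) = (LL u. tsg (t - s) (- s + u) * (\<i> * cv (KL r (- s + u)) (F s) x))"
   by (rule integral_translate[symmetric]) measurable
  then show "tsg t s * cv (K0 r (t - s)) (F s) x = tsg t s * cv (K0 r 0) (F s) x + (LL u. ?f s u)"
   unfolding free_time(1)[OF r B', of "t - s"] by (simp add: distrib_left)
 qed
 also have "\<dots> = (LL s. tsg t s * cv (K0 r 0) (F s) x) + (LL s. LL u. ?f s u)"
  by (intro Bochner_Integration.integral_add i1 fubini_pair(2)[OF fm fin])
 also have "(LL s. LL u. ?f s u) = (LL u. LL s. ?f s u)" by (rule fubini_pair(1)[OF fm fin])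
 also have "\<dots> = (LL u. LL s. tsg t u * (\<i> * (tsg u s * cv (KL r (u - s)) (F s) x)))"
  by (simp add: mult.assoc[symmetric] tsg_mult_shift) (simp add: ac_simps)
 also have "\<dots> = (LL u. tsg t u * (\<i> * duh (KL r) F u x))" by (simp add: duh_def)
 finally show ?thesis .
qed

text \<open>The velocity of the smoothed flow: the imaginary unit times its Laplacian, plus the
  forcing smoothed by heat for the time \<open>r\<close>.\<close>

definition sol_rhs :: "real => ('a::euclidean_space => complex) => (real => 'a => complex) => real => 'a => complex" where
 "sol_rhs r f F s x = \<i> * sol (KL r) f F s x + cv (K0 r 0) (F s) x"

lemma locL2_sol_rhs:
 fixes F :: "real => 'a::euclidean_space => complex"
 assumes r: "0 < r" and f: "l2b f B" and F: "locL2 F"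
 shows "locL2 (sol_rhs r f F)"
proof -
 note kL = kfam_KL[OF r, where 'a='a]
 obtain A0 c0 where k00: "gbd A0 c0 (K0 r 0 :: 'a => complex)" using kfam_slice[OF kfam_gker[OF r]] by blast
 have s: "locL2 (sol (KL r) f F)" by (rule locL2_sol[OF kL f F])
 have s': "locL2 (%t x. \<i> * sol (KL r) f F t x)"
 proof (rule locL2_dominated[OF s])
  note [measurable] = measurable_curried[OF locL2_measurable[OF s]]
  show "jm (%t x. \<i> * sol (KL r) f F t x)" by measurable
 qed (simp add: norm_mult)
 have h: "locL2 (%t. cv (K0 r 0) (F t))"
  unfolding locL2_def
 proof (intro conjI allI measurable_heat_slices locL2_measurable[OF F])
  fix T
  obtain B where "\<forall>t. abs t <= T --> l2b (F t) B" using F unfolding locL2_def by metis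
  then have "\<forall>t. abs t <= T --> l2b (cv (K0 r 0) (F t)) (A0 * gL1 TYPE('a) c0 * B)"
   by (auto intro!: gbd_young[OF k00])
  then show "\<exists>B. \<forall>t. abs t <= T --> l2b (cv (K0 r 0) (F t)) B" by blast
 qed
 show "locL2 (sol_rhs r f F)" unfolding sol_rhs_def[abs_def] by (rule locL2_add[OF s' h])
qed

lemma sol_time:
 fixes F :: "real => 'a::euclidean_space => complex"
 assumes r: "0 < r" and f: "l2b f B" and F: "locL2 F"
 shows "sol (K0 r) f F t x = cv (K0 r 0) f x + (LL s. tsg t s * sol_rhs r f F s x)"
  and "integrable lborel (%s. tsg t s * sol_rhs r f F s x)"
proof -
 note kL = kfam_KL[OF r, where 'a='a]
 obtain A0 c0 where k00: "gbd A0 c0 (K0 r 0 :: 'a => complex)" using kfam_slice[OF kfam_gker[OF r]] by blast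
 have dm: "bm (%s. \<i> * duh (KL r) F s x)"
 proof -
  note [measurable] = measurable_curried[OF measurable_duh[OF kL F]]
  show ?thesis by measurable
 qed
 obtain b1 where b1: "\<forall>s x. abs s <= abs t --> norm (duh (KL r) F s x) <= b1" using duh_bounded_at[OF kL F] by metis
 have i1: "integrable lborel (%s. tsg t s * (\<i> * duh (KL r) F s x))"
  by (rule tsg_integrable_bounded[OF dm, where b=b1]) (use b1 in \<open>simp add: norm_mult\<close>)
 have m0: "bm (%s. cv (K0 r 0) (F s) x)"
 proof -
  note [measurable] = measurable_cv_comp[OF kfam_measurable[OF kfam_gker[OF r]] locL2_measurable[OF F], of "%_. 0"]
  show ?thesis by measurable
 qed
 obtain B' where B': "!!s. abs s <= abs t ==> l2b (F s) B'" using F unfolding locL2_def by metis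
 have i2: "integrable lborel (%s. tsg t s * cv (K0 r 0) (F s) x)"
  by (rule tsg_integrable_bounded[OF m0]) (rule cv_integrable(2)[OF k00 B'])
 note i3 = free_time(2)[OF r f, of t x]
 have e: "tsg t s * sol_rhs r f F s x = tsg t s * (\<i> * cv (KL r s) f x) + (tsg t s * cv (K0 r 0) (F s) x + tsg t s * (\<i> * duh (KL r) F s x))" for s
  by (simp add: sol_rhs_def sol_def algebra_simps)
 show "integrable lborel (%s. tsg t s * sol_rhs r f F s x)"
  unfolding e using i1 i2 i3 by simp
 show "sol (K0 r) f F t x = cv (K0 r 0) f x + (LL s. tsg t s * sol_rhs r f F s x)"
  unfolding e using i1 i2 i3 free_time(1)[OF r f, of t x] duh_time[OF r F, of t x] by (simp add: sol_def)
qed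

text \<open>The velocity is bounded in L^2 on bounded times. The constant \<open>L\<close> depends
  on \<open>r\<close>; it only has to make every single iterate continuous in time.\<close>

lemma sol_L2_lipschitz:
 fixes F :: "real => 'a::euclidean_space => complex"
 assumes r: "0 < r" and f: "l2b f B" and F: "locL2 F"
 shows "\<exists>L. \<forall>t t'. abs t <= T --> abs t' <= T --> l2b (%x. sol (K0 r) f F t' x - sol (K0 r) f F t x) (L * abs (t' - t))"
proof -
 define P where "P = sol_rhs r f F"
 have P: "locL2 P" unfolding P_def by (rule locL2_sol_rhs[OF r f F])
 obtain L where L: "!!t. abs t <= T ==> l2b (P t) L" using P unfolding locL2_def by metis
 have "l2b (%x. sol (K0 r) f F t' x - sol (K0 r) f F t x) ((2 * L) * abs (t' - t))"
  if t: "abs t <= T" and t': "abs t' <= T" for t t'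
 proof -
  \<comment> \<open>Time is recentred at the midpoint so that the integral between \<open>t\<close>
    and \<open>t'\<close> is supported in a symmetric interval, as \<open>lpb_time_integral\<close>
    expects.\<close>
  define m where "m = (t + t') / 2"
  define R where "R = abs (t' - t) / 2"
  define h where "h s x = (tsg t' (m + s) - tsg t (m + s)) * P (m + s) x" for s x
  note [measurable] = measurable_curried[OF locL2_measurable[OF P]]
  have hm: "jm h" unfolding h_def by measurable
  have L0: "0 <= 2 * L" using L[OF t] by (simp add: lpb_def)
  have h2: "l2b (h s) (2 * L)" if s: "abs s <= R" for s
  proof -
   have ms: "abs (m + s) <= T" using s t t' unfolding m_def R_def by (auto simp: field_simps abs_if split: if_splits)
   have "l2b (%x. 2 * P (m + s) x) (2 * L)" using lpb_cmult[OF L[OF ms], of 2] by simp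
   then show ?thesis
   proof (rule lpb_dominated)
    show "h s \<in> borel_measurable lborel" using measurable_slice[OF hm, of s] by simp
    show "AE x in lborel. norm (h s x) <= norm (2 * P (m + s) x)"
    proof (rule AE_I2)
     fix x
     have "norm (tsg t' (m + s) - tsg t (m + s)) <= 1 + 1"
      by (rule order_trans[OF norm_triangle_ineq4 add_mono[OF norm_tsg_le norm_tsg_le]])
     then show "norm (h s x) <= norm (2 * P (m + s) x)" by (simp add: h_def norm_mult mult_right_mono)
    qed
   qed simp
  qed
  have h0: "h s x = 0" if s: "R < abs s" for s x
  proof -
   have "m + s < min t t' \<or> max t t' < m + s" using s unfolding m_def R_def by (auto simp: field_simps abs_if min_def max_def split: if_splits)
   then have "tsg t' (m + s) = tsg t (m + s)" unfolding tsg_def by auto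
   then show ?thesis by (simp add: h_def)
  qed
  have R0: "0 <= R" by (simp add: R_def)
  have "l2b (%x. LL s. h s x) (2 * R * (2 * L))" by (rule lpb_time_integral[OF hm R0 L0 h2 h0])
  moreover have "(LL s. h s x) = sol (K0 r) f F t' x - sol (K0 r) f F t x" for x
  proof -
   have "(LL s. h s x) = (LL s. (tsg t' s - tsg t s) * P s x)"
    unfolding h_def by (rule integral_translate) measurable
   also have "\<dots> = (LL s. tsg t' s * P s x) - (LL s. tsg t s * P s x)"
    using sol_time(2)[OF r f F] by (simp add: left_diff_distrib P_def)
   finally show ?thesis unfolding sol_time(1)[OF r f F] P_def by simp
  qed
  ultimately show ?thesis by (simp add: R_def mult.commute)
 qed
 then show ?thesis by blast
qed

section \<open>The nonlinearity\<close>

definition nl :: "real => complex => complex" where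
 "nl \<alpha> z = of_real (norm z powr \<alpha>) * z"

text \<open>The real derivative of \<open>nl \<alpha>\<close>; \<open>z \<bullet> w\<close> is the
  real inner product of the plane. At \<open>z = 0\<close> every power of 0 is 0 by convention, and
  the formula gives the correct derivative 0.\<close>

definition dnl :: "real => complex => complex => complex" where
 "dnl \<alpha> z w = of_real (norm z powr \<alpha>) * w + of_real (\<alpha> * norm z powr (\<alpha> - 2) * (z \<bullet> w)) * z"

lemma measurable_nl [measurable]: "bm (nl \<alpha>)"
 unfolding nl_def by measurable

lemma measurable_dnl [measurable (raw)]:
 assumes [measurable]: "f \<in> borel_measurable M" "g \<in> borel_measurable M"
 shows "(%x. dnl \<alpha> (f x) (g x)) \<in> borel_measurable M"
 unfolding dnl_def by measurable

lemma norm_nl: "norm (nl \<alpha> z) = norm z powr \<alpha> * norm z"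
 by (simp add: nl_def norm_mult)

lemma dnl_0 [simp]: "dnl \<alpha> 0 w = 0" and dnl_0_right [simp]: "dnl \<alpha> z 0 = 0" and nl_0 [simp]: "nl \<alpha> 0 = 0"
 by (simp_all add: dnl_def nl_def)

lemma dnl_diff: "dnl \<alpha> z (w - w') = dnl \<alpha> z w - dnl \<alpha> z w'"
 by (simp add: dnl_def inner_diff_right algebra_simps)

lemma norm_dnl_le:
 assumes a: "0 <= \<alpha>"
 shows "norm (dnl \<alpha> z w) <= (1 + \<alpha>) * norm z powr \<alpha> * norm w"
proof (cases "z = 0")
 case False
 have "norm (dnl \<alpha> z w) <= norm z powr \<alpha> * norm w + \<alpha> * norm z powr (\<alpha> - 2) * abs (z \<bullet> w) * norm z"
  unfolding dnl_def by (rule order_trans[OF norm_triangle_ineq]) (use a in \<open>simp add: norm_mult abs_mult\<close>)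
 also have "\<dots> <= norm z powr \<alpha> * norm w + \<alpha> * norm z powr (\<alpha> - 2) * (norm z * norm w) * norm z"
  using a by (intro add_left_mono mult_right_mono mult_left_mono Cauchy_Schwarz_ineq2) auto
 also have "\<alpha> * norm z powr (\<alpha> - 2) * (norm z * norm w) * norm z = \<alpha> * (norm z powr (\<alpha> - 2) * norm z powr 2) * norm w"
  using False by (simp add: powr_numeral power2_eq_square)
 also have "norm z powr (\<alpha> - 2) * norm z powr 2 = norm z powr \<alpha>"
  using powr_add[of "norm z" "\<alpha> - 2" 2] by simp
 finally show ?thesis by (simp add: algebra_simps)
qed simp

lemma has_derivative_nl:
 assumes a: "0 < \<alpha>"
 shows "(nl \<alpha> has_derivative dnl \<alpha> z) (at z)"
proof (cases "z = 0")
 case True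
 have "((%h. norm (nl \<alpha> h) / norm h) \<longlongrightarrow> 0) (at (0::complex))"
 proof (rule Lim_transform_eventually)
  have "((%h. norm h powr \<alpha>) \<longlongrightarrow> norm (0::complex) powr \<alpha>) (at (0::complex))"
   using a by (intro tendsto_powr' tendsto_norm tendsto_ident_at tendsto_const) auto
  then show "((%h. norm h powr \<alpha>) \<longlongrightarrow> 0) (at (0::complex))" using a by simp
  show "\<forall>\<^sub>F h in at (0::complex). norm h powr \<alpha> = norm (nl \<alpha> h) / norm h"
   unfolding eventually_at by (rule exI[of _ 1]) (auto simp: norm_nl)
 qed
 then show ?thesis unfolding True has_derivative_at by (simp add: dnl_def[abs_def] bounded_linear_zero)
next
 case False
 have n0: "norm z \<noteq> 0" using False by simp
 have "(norm has_derivative (%h. h \<bullet> sgn z)) (at z)" 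
  using has_derivative_norm[OF False] by (simp add: inner_commute)
 then have "((%z. norm z powr \<alpha>) has_derivative (%h. norm z powr \<alpha> * (0 * ln (norm z) + (h \<bullet> sgn z) * \<alpha> / norm z))) (at z)"
  by (intro has_derivative_powr has_derivative_const) (use False in auto)
 then have "((%z. complex_of_real (norm z powr \<alpha>)) has_derivative (%h. of_real (norm z powr \<alpha> * (0 * ln (norm z) + (h \<bullet> sgn z) * \<alpha> / norm z)))) (at z)"
  by (rule has_derivative_of_real)
 from has_derivative_mult[OF this has_derivative_ident]
 have "((%z. complex_of_real (norm z powr \<alpha>) * z) has_derivative
  (%h. of_real (norm z powr \<alpha>) * h + of_real (norm z powr \<alpha> * (0 * ln (norm z) + (h \<bullet> sgn z) * \<alpha> / norm z)) * z)) (at z)" .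
 moreover have "norm z powr \<alpha> * (0 * ln (norm z) + (h \<bullet> sgn z) * \<alpha> / norm z) = \<alpha> * norm z powr (\<alpha> - 2) * (z \<bullet> h)" for h
 proof -
  have "norm z powr (\<alpha> - 2) = norm z powr \<alpha> / (norm z)^2"
   using False by (simp add: powr_diff powr_numeral)
  then show ?thesis using n0 by (simp add: sgn_div_norm inner_commute power2_eq_square divide_simps)
 qed
 ultimately show ?thesis unfolding nl_def[abs_def] dnl_def[abs_def] by (simp only:)
qed

lemma nl_diff_le:
 assumes a: "0 < \<alpha>"
 shows "norm (nl \<alpha> u - nl \<alpha> v) <= (1 + \<alpha>) * (norm u + norm v) powr \<alpha> * norm (u - v)"
proof (rule differentiable_bound[where S="cball 0 (norm u + norm v)" and f'="dnl \<alpha>"])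
 show "(nl \<alpha> has_derivative dnl \<alpha> z) (at z within cball 0 (norm u + norm v))" for z
  by (rule has_derivative_at_withinI[OF has_derivative_nl[OF a]])
 show "onorm (dnl \<alpha> z) <= (1 + \<alpha>) * (norm u + norm v) powr \<alpha>" if "z \<in> cball 0 (norm u + norm v)" for z
 proof (rule onorm_le)
  fix w
  have "norm (dnl \<alpha> z w) <= (1 + \<alpha>) * norm z powr \<alpha> * norm w" using a by (intro norm_dnl_le) simp
  also have "\<dots> <= (1 + \<alpha>) * (norm u + norm v) powr \<alpha> * norm w"
   using that a by (intro mult_right_mono mult_left_mono powr_mono2) auto
  finally show "norm (dnl \<alpha> z w) <= (1 + \<alpha>) * (norm u + norm v) powr \<alpha> * norm w" .
 qed
qed auto

text \<open>Separates the modulus of \<open>z\<close> from its direction, which have different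
  moduli of continuity near 0.\<close>

lemma dnl_eq_sgn: "dnl \<alpha> z w = of_real (norm z powr \<alpha>) * (w + of_real (\<alpha> * (sgn z \<bullet> w)) * sgn z)"
proof (cases "z = 0")
 case False
 have 1: "norm z powr (\<alpha> - 2) = norm z powr \<alpha> / (norm z)^2" using False by (simp add: powr_diff powr_numeral)
 have 2: "sgn z \<bullet> w = (z \<bullet> w) / norm z" by (simp add: sgn_div_norm divide_inverse inner_commute del: sgn_eq)
 have 3: "sgn z = z / of_real (norm z)" by (rule sgn_eq)
 show ?thesis unfolding dnl_def 1 2 unfolding 3 using False by (simp add: field_simps power2_eq_square)
qed simp

lemma norm_sgn_diff_le:
 fixes u v :: complex
 assumes "u \<noteq> 0" "v \<noteq> 0"
 shows "norm (sgn u - sgn v) <= 2 * norm (u - v) / norm u"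
proof -
 have "norm u *\<^sub>R (sgn u - sgn v) = (u - v) + (norm v - norm u) *\<^sub>R sgn v"
  using assms by (simp add: sgn_div_norm algebra_simps)
 then have "norm u * norm (sgn u - sgn v) <= norm (u - v) + abs (norm v - norm u) * norm (sgn v)"
  by (metis norm_triangle_ineq norm_scaleR abs_norm_cancel)
 also have "\<dots> <= norm (u - v) + norm (u - v)"
  using assms norm_triangle_ineq3[of v u] by (simp add: norm_sgn norm_minus_commute)
 finally show ?thesis using assms by (simp add: field_simps)
qed

text \<open>The difference is measured relative to the larger argument. For \<open>a <= 1\<close>
  this follows from \<open>y / x <= (y / x) powr a\<close>, for larger \<open>a\<close> from the
  mean value bound of \<open>nl (a - 1)\<close> on real arguments.\<close>

lemma powr_diff_le:
 fixes x y :: real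
 assumes a: "0 < a" and x: "0 < x" and y: "0 <= y" "y <= x"
 shows "abs (x powr a - y powr a) <= (1 + a * 2 powr a) * x powr a * (abs (x - y) / x)"
proof (cases "a <= 1")
 case True
 have "(y / x) powr 1 <= (y / x) powr a" using y x True by (intro powr_mono') auto
 then have "y / x <= y powr a / x powr a" using y x by (simp add: powr_divide)
 then have "x powr a * (y / x) <= y powr a" using x by (simp add: field_simps)
 then have "x powr a - y powr a <= 1 * (x powr a * ((x - y) / x))" using x by (simp add: field_simps)
 also have "\<dots> <= (1 + a * 2 powr a) * (x powr a * ((x - y) / x))" using a x y by (intro mult_right_mono) auto
 finally show ?thesis using powr_mono2[of a y x] a y by (simp add: mult.assoc)
next
 case False
 then have a1: "0 < a - 1" by simp
 have s: "t powr (a - 1) * t = t powr a" if "0 <= t" for t using that by (cases "t = 0") (auto simp: powr_diff)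
 have n: "nl (a - 1) (of_real t) = of_real (t powr a)" if "0 <= t" for t
  using that s[OF that] by (simp add: nl_def flip: of_real_mult)
 have "abs (x powr a - y powr a) = norm (nl (a - 1) (of_real x) - nl (a - 1) (of_real y))"
  using x y by (simp add: n flip: of_real_diff)
 also have "\<dots> <= (1 + (a - 1)) * (norm (complex_of_real x) + norm (complex_of_real y)) powr (a - 1) * norm (complex_of_real x - of_real y)"
  by (rule nl_diff_le[OF a1])
 also have "\<dots> = a * (x + y) powr (a - 1) * abs (x - y)" using x y by (simp flip: of_real_diff)
 also have "\<dots> <= a * (2 * x) powr (a - 1) * abs (x - y)"
  using x y a a1 by (intro mult_right_mono mult_left_mono powr_mono2) auto
 also have "\<dots> = a * 2 powr (a - 1) * x powr a * (abs (x - y) / x)"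
  using x by (simp add: powr_mult powr_diff)
 also have "\<dots> <= (1 + a * 2 powr a) * x powr a * (abs (x - y) / x)"
 proof -
  have "a * 2 powr (a - 1) <= a * 2 powr a" using a by (intro mult_left_mono powr_mono) auto
  then show ?thesis using x by (intro mult_right_mono) auto
 qed
 finally show ?thesis .
qed

lemma dnl_holder_aux:
 assumes a: "0 < \<alpha>" and uv: "norm v <= norm u" and u: "u \<noteq> 0"
 shows "norm (dnl \<alpha> u w - dnl \<alpha> v w) <= ((1 + \<alpha> * 2 powr \<alpha>) * (1 + \<alpha>) + 4 * \<alpha>) * (norm u powr \<alpha> * (norm (u - v) / norm u) * norm w)"
proof (cases "v = 0")
 case True
 have "norm (dnl \<alpha> u w) <= (1 + \<alpha>) * norm u powr \<alpha> * norm w" using a by (intro norm_dnl_le) simp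
 also have "\<dots> = (1 * (1 + \<alpha>) + 0) * (norm u powr \<alpha> * norm w)" by simp
 also have "\<dots> <= ((1 + \<alpha> * 2 powr \<alpha>) * (1 + \<alpha>) + 4 * \<alpha>) * (norm u powr \<alpha> * norm w)"
  using a by (intro mult_right_mono add_mono) auto
 finally show ?thesis using True u by simp
next
 case False
 define d where "d = norm (u - v) / norm u"
 have d0: "0 <= d" by (simp add: d_def)
 have s: "norm (sgn u - sgn v) <= 2 * d" using norm_sgn_diff_le[OF u False] by (simp add: d_def)
 have n1: "norm (sgn u) = 1" "norm (sgn v) = 1" using u False by (simp_all add: norm_sgn)
 have i1: "abs (sgn u \<bullet> w) <= norm w" using Cauchy_Schwarz_ineq2[of "sgn u" w] n1 by simp
 have i2: "abs ((sgn u - sgn v) \<bullet> w) <= 2 * d * norm w"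
  by (rule order_trans[OF Cauchy_Schwarz_ineq2]) (intro mult_right_mono s norm_ge_zero)
 \<comment> \<open>Three changes: of the modulus, of the direction outside the inner product, and of
   the direction inside it.\<close>
 have e: "dnl \<alpha> u w - dnl \<alpha> v w = of_real (norm u powr \<alpha> - norm v powr \<alpha>) * (w + of_real (\<alpha> * (sgn u \<bullet> w)) * sgn u)
   + of_real (norm v powr \<alpha> * \<alpha>) * (of_real (sgn u \<bullet> w) * (sgn u - sgn v) + of_real ((sgn u - sgn v) \<bullet> w) * sgn v)"
  unfolding dnl_eq_sgn inner_diff_left by (simp add: algebra_simps)
 have p1: "norm (complex_of_real (norm u powr \<alpha> - norm v powr \<alpha>)) <= (1 + \<alpha> * 2 powr \<alpha>) * (norm u powr \<alpha> * d)"
 proof -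
  have "abs (norm u - norm v) / norm u <= d" unfolding d_def using u by (intro divide_right_mono norm_triangle_ineq3) auto
  then have "(1 + \<alpha> * 2 powr \<alpha>) * norm u powr \<alpha> * (abs (norm u - norm v) / norm u) <= (1 + \<alpha> * 2 powr \<alpha>) * norm u powr \<alpha> * d"
   using a by (intro mult_left_mono) auto
  then show ?thesis using powr_diff_le[OF a, of "norm u" "norm v"] u uv by (simp add: mult.assoc del: of_real_diff)
 qed
 have p2: "norm (w + of_real (\<alpha> * (sgn u \<bullet> w)) * sgn u) <= (1 + \<alpha>) * norm w"
 proof -
  have "norm (w + of_real (\<alpha> * (sgn u \<bullet> w)) * sgn u) <= norm w + \<alpha> * abs (sgn u \<bullet> w)"
   using norm_triangle_ineq[of w "of_real (\<alpha> * (sgn u \<bullet> w)) * sgn u"] a by (simp add: norm_mult n1 abs_mult)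
  also have "\<dots> <= norm w + \<alpha> * norm w" using a by (intro add_left_mono mult_left_mono i1) simp
  finally show ?thesis by (simp add: algebra_simps)
 qed
 have p3: "norm (of_real (sgn u \<bullet> w) * (sgn u - sgn v) + of_real ((sgn u - sgn v) \<bullet> w) * sgn v) <= 4 * d * norm w"
 proof -
  have "norm (of_real (sgn u \<bullet> w) * (sgn u - sgn v)) <= norm w * (2 * d)"
   unfolding norm_mult using i1 s by (intro mult_mono) auto
  moreover have "norm (of_real ((sgn u - sgn v) \<bullet> w) * sgn v) <= 2 * d * norm w"
   unfolding norm_mult n1 using i2 by simp
  ultimately show ?thesis by (intro order_trans[OF norm_triangle_ineq]) (simp add: algebra_simps)
 qed
 have p4: "norm (complex_of_real (norm v powr \<alpha> * \<alpha>)) <= \<alpha> * norm u powr \<alpha>"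
  using mult_left_mono[OF powr_mono2[of \<alpha> "norm v" "norm u"], of \<alpha>] a uv unfolding norm_of_real by (simp add: abs_mult mult.commute)
 have "norm (dnl \<alpha> u w - dnl \<alpha> v w) <= ((1 + \<alpha> * 2 powr \<alpha>) * (norm u powr \<alpha> * d)) * ((1 + \<alpha>) * norm w) + (\<alpha> * norm u powr \<alpha>) * (4 * d * norm w)"
  unfolding e using a d0
  by (intro order_trans[OF norm_triangle_ineq] add_mono; unfold norm_mult; intro mult_mono p1 p2 p3 p4) auto
 then show ?thesis unfolding d_def[symmetric] by (simp add: algebra_simps)
qed

lemma le_powr_le_1:
 fixes x :: real
 assumes "0 <= x" "x <= 1" "b <= 1"
 shows "x <= x powr b"
 using powr_mono'[of b 1 x] assms by (cases "x = 0") auto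

text \<open>With \<open>norm v <= norm u\<close> the relative difference
  \<open>d = norm (u - v) / norm u\<close> is at most 2, hence
  \<open>d <= 2 * d powr \<beta>\<close>; this trades part of the factor
  \<open>norm u powr \<alpha>\<close> for a power of \<open>norm (u - v)\<close>. For \<alpha> below
  1 the derivative is not Lipschitz, so an exponent \<beta> is unavoidable.\<close>

lemma dnl_holder:
 assumes a: "0 < \<alpha>" and b: "0 < \<beta>" "\<beta> <= 1" "\<beta> <= \<alpha>"
 shows "\<exists>K>0. \<forall>u v w. norm (dnl \<alpha> u w - dnl \<alpha> v w) <= K * ((norm u + norm v) powr (\<alpha> - \<beta>) * norm (u - v) powr \<beta> * norm w)"
proof -
 define K0 where "K0 = (1 + \<alpha> * 2 powr \<alpha>) * (1 + \<alpha>) + 4 * \<alpha>"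
 have K0: "0 < K0" unfolding K0_def using a by (intro add_pos_pos mult_pos_pos) auto
 have *: "norm (dnl \<alpha> u w - dnl \<alpha> v w) <= 2 * K0 * ((norm u + norm v) powr (\<alpha> - \<beta>) * norm (u - v) powr \<beta> * norm w)"
  if uv: "norm v <= norm u" for u v w
 proof (cases "u = 0")
  case False
  define d where "d = norm (u - v) / norm u"
  have d0: "0 <= d" by (simp add: d_def)
  have "norm (u - v) <= 2 * norm u" using norm_triangle_ineq4[of u v] uv by linarith
  then have d2: "d <= 2" unfolding d_def using False by (simp add: field_simps)
  have "d / 2 <= (d / 2) powr \<beta>" using d0 d2 b by (intro le_powr_le_1) auto
  also have "\<dots> <= d powr \<beta>" using d0 b by (intro powr_mono2) auto
  finally have d: "d <= 2 * d powr \<beta>" by simp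
  have "norm u powr \<alpha> * d * norm w <= norm u powr \<alpha> * (2 * d powr \<beta>) * norm w"
   by (intro mult_right_mono mult_left_mono d) auto
  also have "\<dots> = 2 * (norm u powr (\<alpha> - \<beta>) * norm (u - v) powr \<beta> * norm w)"
   unfolding d_def using False by (simp add: powr_divide powr_diff)
  also have "\<dots> <= 2 * ((norm u + norm v) powr (\<alpha> - \<beta>) * norm (u - v) powr \<beta> * norm w)"
   using b by (intro mult_left_mono mult_right_mono powr_mono2) auto
  finally have "norm u powr \<alpha> * d * norm w <= 2 * ((norm u + norm v) powr (\<alpha> - \<beta>) * norm (u - v) powr \<beta> * norm w)" .
  from order_trans[OF dnl_holder_aux[OF a uv False, of w, folded K0_def d_def] mult_left_mono[OF this less_imp_le[OF K0]]]
  show ?thesis by (simp add: mult.assoc)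
 qed (use uv in simp)
 have "norm (dnl \<alpha> u w - dnl \<alpha> v w) <= 2 * K0 * ((norm u + norm v) powr (\<alpha> - \<beta>) * norm (u - v) powr \<beta> * norm w)" for u v w
  using *[of v u w] *[of u v w] by (cases "norm v <= norm u") (simp_all add: norm_minus_commute add.commute)
 then show ?thesis using K0 by (intro exI[of _ "2 * K0"]) auto
qed

lemma continuous_dnl:
 fixes f g :: "'a::t2_space => complex"
 assumes a: "0 < \<alpha>" and f: "continuous_on S f" and g: "continuous_on S g"
 shows "continuous_on S (%x. dnl \<alpha> (f x) (g x))"
 unfolding continuous_on_def
proof
 fix x assume x: "x \<in> S"
 define \<beta> where "\<beta> = min 1 \<alpha> / 2"
 have b: "0 < \<beta>" "\<beta> <= 1" "\<beta> <= \<alpha>" "0 < \<alpha> - \<beta>" using a by (auto simp: \<beta>_def min_def)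
 obtain K where K: "!!u v w. norm (dnl \<alpha> u w - dnl \<alpha> v w) <= K * ((norm u + norm v) powr (\<alpha> - \<beta>) * norm (u - v) powr \<beta> * norm w)"
  using dnl_holder[OF a b(1-3)] by metis
 have F: "(f \<longlongrightarrow> f x) (at x within S)" and G: "(g \<longlongrightarrow> g x) (at x within S)"
  using f g x by (auto simp: continuous_on_def)
 have "((%y. K * ((norm (f y) + norm (f x)) powr (\<alpha> - \<beta>) * norm (f y - f x) powr \<beta> * norm (g y))
   + (1 + \<alpha>) * norm (f x) powr \<alpha> * norm (g y - g x)) \<longlongrightarrow>
   K * ((norm (f x) + norm (f x)) powr (\<alpha> - \<beta>) * norm (f x - f x) powr \<beta> * norm (g x))
   + (1 + \<alpha>) * norm (f x) powr \<alpha> * norm (g x - g x)) (at x within S)"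
  using b by (intro tendsto_intros tendsto_powr' F G) auto
 then have 0: "((%y. K * ((norm (f y) + norm (f x)) powr (\<alpha> - \<beta>) * norm (f y - f x) powr \<beta> * norm (g y))
   + (1 + \<alpha>) * norm (f x) powr \<alpha> * norm (g y - g x)) \<longlongrightarrow> 0) (at x within S)" using b by simp
 have "((%y. dnl \<alpha> (f y) (g y) - dnl \<alpha> (f x) (g x)) \<longlongrightarrow> 0) (at x within S)"
 proof (rule Lim_null_comparison[OF always_eventually 0], rule allI)
  fix y
  have "dnl \<alpha> (f y) (g y) - dnl \<alpha> (f x) (g x) = (dnl \<alpha> (f y) (g y) - dnl \<alpha> (f x) (g y)) + dnl \<alpha> (f x) (g y - g x)"
   by (simp add: dnl_diff)
  also have "norm \<dots> <= K * ((norm (f y) + norm (f x)) powr (\<alpha> - \<beta>) * norm (f y - f x) powr \<beta> * norm (g y))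
   + (1 + \<alpha>) * norm (f x) powr \<alpha> * norm (g y - g x)"
   by (intro order_trans[OF norm_triangle_ineq] add_mono K norm_dnl_le) (use a in simp)
  finally show "norm (dnl \<alpha> (f y) (g y) - dnl \<alpha> (f x) (g x)) <= \<dots>" .
 qed
 then show "((%x. dnl \<alpha> (f x) (g x)) \<longlongrightarrow> dnl \<alpha> (f x) (g x)) (at x within S)" by (rule LIM_zero_cancel)
qed

lemma dird_nl:
 assumes a: "0 < \<alpha>" and d: "dird e u w"
 shows "dird e (%x. c * nl \<alpha> (u x)) (%x. c * dnl \<alpha> (u x) (w x))"
 unfolding dird_def
proof
 fix x
 have "((%h. u (x + h *\<^sub>R e)) has_derivative (%h. h *\<^sub>R w x)) (at 0)"
  using d unfolding dird_def has_vector_derivative_def by blast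
 moreover have "(nl \<alpha> has_derivative dnl \<alpha> (u x)) (at (u (x + 0 *\<^sub>R e)))"
  using has_derivative_nl[OF a, of "u x"] by simp
 ultimately have "((%h. nl \<alpha> (u (x + h *\<^sub>R e))) has_derivative (%h. dnl \<alpha> (u x) (h *\<^sub>R w x))) (at 0)"
  by (rule has_derivative_compose)
 moreover have "dnl \<alpha> (u x) (h *\<^sub>R w x) = h *\<^sub>R dnl \<alpha> (u x) (w x)" for h
  unfolding dnl_def inner_scaleR_right by (simp add: scaleR_conv_of_real algebra_simps)
 ultimately have "((%h. nl \<alpha> (u (x + h *\<^sub>R e))) has_vector_derivative dnl \<alpha> (u x) (w x)) (at 0)"
  by (simp add: has_vector_derivative_def)
 then show "((%h. c * nl \<alpha> (u (x + h *\<^sub>R e))) has_vector_derivative c * dnl \<alpha> (u x) (w x)) (at 0)"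
  by (rule has_vector_derivative_mult_right)
qed

text \<open>Hoelder's inequality with weights \<alpha> / (\<alpha> + 1) and 1 / (\<alpha> + 1): the
  product is the power \<alpha> + 1 of a geometric mean, which stays in the L^p of its
  factors.\<close>

lemma lpb_powr_mult:
 assumes f: "lpb M p f A" and h: "lpb M p h D" and a: "0 < \<alpha>" and p: "p = q * (\<alpha> + 1)"
 shows "lpb M q (%x. norm (f x) powr \<alpha> * norm (h x)) (A powr \<alpha> * D)"
proof -
 define \<theta> where "\<theta> = \<alpha> / (\<alpha> + 1)"
 have th: "0 < \<theta>" "\<theta> < 1" "\<theta> * (\<alpha> + 1) = \<alpha>" "(1 - \<theta>) * (\<alpha> + 1) = 1" using a by (auto simp: \<theta>_def field_simps)
 note nn = lpb_nonneg[OF f] lpb_nonneg[OF h]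
 have e: "(x powr \<theta> * y powr (1 - \<theta>)) powr (\<alpha> + 1) = x powr \<alpha> * y" if "0 <= x" "0 <= y" for x y :: real
  using that by (simp add: powr_mult powr_powr th)
 have "lpb M q (%x. norm (norm (f x) powr \<theta> * norm (h x) powr (1 - \<theta>)) powr (\<alpha> + 1)) ((A powr \<theta> * D powr (1 - \<theta>)) powr (\<alpha> + 1))"
  by (rule lpb_powr[OF lpb_geometric_mean[OF f h th(1,2)] _ p]) (use a in simp)
 then show ?thesis using nn by (simp add: e abs_mult)
qed

lemma lpb_powr_mult3:
 assumes f: "lpb M p f A" and g: "lpb M p g B" and h: "lpb M p h D" and b: "0 < \<beta>" "\<beta> < \<alpha>" and p: "p = q * (\<alpha> + 1)"
 shows "lpb M q (%x. norm (f x) powr (\<alpha> - \<beta>) * norm (g x) powr \<beta> * norm (h x)) (A powr (\<alpha> - \<beta>) * B powr \<beta> * D)"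
proof -
 define \<theta> where "\<theta> = (\<alpha> - \<beta>) / \<alpha>"
 have th: "0 < \<theta>" "\<theta> < 1" "\<theta> * \<alpha> = \<alpha> - \<beta>" "(1 - \<theta>) * \<alpha> = \<beta>" using b by (auto simp: \<theta>_def field_simps)
 note nn = lpb_nonneg[OF f] lpb_nonneg[OF g]
 have e: "(x powr \<theta> * y powr (1 - \<theta>)) powr \<alpha> = x powr (\<alpha> - \<beta>) * y powr \<beta>" if "0 <= x" "0 <= y" for x y :: real
  using that by (simp add: powr_mult powr_powr th)
 have "lpb M q (%x. norm (norm (f x) powr \<theta> * norm (g x) powr (1 - \<theta>)) powr \<alpha> * norm (h x)) ((A powr \<theta> * B powr (1 - \<theta>)) powr \<alpha> * D)"
  by (rule lpb_powr_mult[OF lpb_geometric_mean[OF f g th(1,2)] h _ p]) (use b in simp)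
 then show ?thesis using nn by (simp add: e abs_mult)
qed

section \<open>The smoothed iteration\<close>

text \<open>With \<sigma> the square root of \<rho>, the differences divided by
  \<open>\<sigma> ^ n\<close> still have summable integrals of p-th powers. Finiteness of the sum
  almost everywhere bounds the differences pointwise by a multiple of
  \<open>\<sigma> ^ n\<close>.\<close>

lemma AE_convergent_geometric:
 fixes f :: "nat => 'a => complex"
 assumes m[measurable]: "!!n. f n \<in> borel_measurable M" and d: "!!n. lpb M p (%x. f (Suc n) x - f n x) (K * \<rho> ^ n)"
  and r: "0 < \<rho>" "\<rho> < 1" and p: "1 <= p"
 shows "AE x in M. convergent (%n. f n x)"
proof -
 define \<sigma> where "\<sigma> = sqrt \<rho>"
 have s: "0 < \<sigma>" "\<sigma> < 1" "\<rho> ^ n = \<sigma> ^ n * \<sigma> ^ n" for n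
  using r by (auto simp: \<sigma>_def simp flip: power_mult_distrib)
 have K: "0 <= K" using lpb_nonneg[OF d[of 0]] by simp
 define g where "g n x = ennreal (norm ((f (Suc n) x - f n x) / of_real (\<sigma> ^ n)) powr p)" for n x
 have [measurable]: "g n \<in> borel_measurable M" for n unfolding g_def by measurable
 have gi: "(\<integral>\<^sup>+x. g n x \<partial>M) <= ennreal (K powr p * (\<sigma> powr p) ^ n)" for n
 proof -
  have e: "norm (1 / complex_of_real (\<sigma> ^ n)) * (K * \<rho> ^ n) = K * \<sigma> ^ n"
   using s by (simp add: norm_divide norm_power)
  have L: "lpb M p (%x. (1 / of_real (\<sigma> ^ n)) * (f (Suc n) x - f n x)) (K * \<sigma> ^ n)"
   unfolding e[symmetric] by (rule lpb_cmult[OF d])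
  from lpb_le[OF L] have "(\<integral>\<^sup>+x. g n x \<partial>M) <= ennreal ((K * \<sigma> ^ n) powr p)"
   unfolding g_def by simp
  also have "(K * \<sigma> ^ n) powr p = K powr p * (\<sigma> powr p) ^ n"
   using K s by (simp add: powr_mult powr_realpow[symmetric] powr_powr mult.commute)
  finally show ?thesis .
 qed
 have "(\<integral>\<^sup>+x. (\<Sum>n. g n x) \<partial>M) = (\<Sum>n. (\<integral>\<^sup>+x. g n x \<partial>M))" by (rule nn_integral_suminf) simp
 also have "\<dots> <= (\<Sum>n. ennreal (K powr p * (\<sigma> powr p) ^ n))"
  by (intro suminf_le gi) auto
 also have "\<dots> = ennreal (\<Sum>n. K powr p * (\<sigma> powr p) ^ n)"
 proof (rule suminf_ennreal2)
  have "\<sigma> powr p < 1" using s p powr_less_mono2[of p \<sigma> 1] by simp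
  then show "summable (%n. K powr p * (\<sigma> powr p) ^ n)" by (intro summable_mult summable_geometric) simp
 qed simp
 finally have "(\<integral>\<^sup>+x. (\<Sum>n. g n x) \<partial>M) \<noteq> \<infinity>" by (auto simp: top_unique)
 then have "AE x in M. (\<Sum>n. g n x) \<noteq> \<infinity>" by (intro nn_integral_noteq_infinite) auto
 then show ?thesis
 proof eventually_elim
  fix x assume fin: "(\<Sum>n. g n x) \<noteq> \<infinity>"
  define S where "S = enn2real (\<Sum>n. g n x)"
  have b: "norm (f (Suc n) x - f n x) <= S powr (1 / p) * \<sigma> ^ n" for n
  proof -
   have "g n x = (\<Sum>i\<in>{n}. g i x)" by simp
   also have "\<dots> <= (\<Sum>n. g n x)" by (rule sum_le_suminf) auto
   also have "\<dots> = ennreal S" unfolding S_def using fin by (simp add: less_top)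
   finally have "norm ((f (Suc n) x - f n x) / of_real (\<sigma> ^ n)) powr p <= S"
    unfolding g_def by (subst (asm) ennreal_le_iff) (simp_all add: S_def)
   then have "(norm ((f (Suc n) x - f n x) / of_real (\<sigma> ^ n)) powr p) powr (1 / p) <= S powr (1 / p)"
    using p by (intro powr_mono2) auto
   then have "norm ((f (Suc n) x - f n x) / of_real (\<sigma> ^ n)) <= S powr (1 / p)" using p by (simp add: powr_powr)
   then show ?thesis using s by (simp add: norm_divide norm_power field_simps)
  qed
  have "summable (%n. f (Suc n) x - f n x)"
   by (rule summable_comparison_test'[of "%n. S powr (1 / p) * \<sigma> ^ n" 0])
     (use s b in \<open>auto intro!: summable_mult summable_geometric\<close>)
  then have "convergent (%n. \<Sum>i<n. f (Suc i) x - f i x)" by (simp add: summable_iff_convergent)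
  then have "convergent (%n. f n x - f 0 x)" by (simp add: sum_lessThan_telescope[of "%n. f n x"])
  then show "convergent (%n. f n x)" by (simp add: convergent_diff_const_right_iff)
 qed
qed

text \<open>The limit is the pointwise \<open>lim\<close>, hence the same function in every norm in
  which the sequence converges; Fatou's lemma passes the telescoped bound on to it.\<close>

lemma lpb_geometric_limit:
 fixes f :: "nat => 'a => complex"
 assumes m[measurable]: "!!n. f n \<in> borel_measurable M" and d: "!!n. lpb M p (%x. f (Suc n) x - f n x) (K * \<rho> ^ n)"
  and r: "0 < \<rho>" "\<rho> < 1" and p: "1 <= p"
 shows "lpb M p (%x. lim (%n. f n x) - f n x) (K / (1 - \<rho>) * \<rho> ^ n)"
proof (rule lpb_Fatou[where f="%k x. f (n + k) x - f n x"])
 have K: "0 <= K" using lpb_nonneg[OF d[of 0]] by simp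
 fix k
 have "lpb M p (%x. f (n + k) x - f n x) (\<Sum>i<k. K * \<rho> ^ (n + i))"
 proof (induction k)
  case (Suc k)
  have "lpb M p (%x. (f (Suc (n + k)) x - f (n + k) x) + (f (n + k) x - f n x)) (K * \<rho> ^ (n + k) + (\<Sum>i<k. K * \<rho> ^ (n + i)))"
   by (rule lpb_add[OF p d Suc])
  then show ?case by (simp add: add.commute)
 qed (use p in simp)
 moreover have "(\<Sum>i<k. K * \<rho> ^ (n + i)) <= K / (1 - \<rho>) * \<rho> ^ n"
 proof -
  have "(\<Sum>i<k. K * \<rho> ^ (n + i)) = K * \<rho> ^ n * (\<Sum>i<k. \<rho> ^ i)" by (simp add: sum_distrib_left power_add mult_ac)
  also have "(\<Sum>i<k. \<rho> ^ i) <= 1 / (1 - \<rho>)" using r by (simp add: sum_gp_strict field_simps)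
  finally show ?thesis using K r by (simp add: mult_left_mono)
 qed
 ultimately show "lpb M p (%x. f (n + k) x - f n x) (K / (1 - \<rho>) * \<rho> ^ n)"
  by (rule lpb_mono) (use p in simp)
next
 show "(%x. lim (%n. f n x) - f n x) \<in> borel_measurable M"
  by (intro borel_measurable_diff borel_measurable_lim_metric m)
 show "AE x in M. (%k. f (n + k) x - f n x) \<longlonglongrightarrow> lim (%n. f n x) - f n x"
  using AE_convergent_geometric[OF m d r p]
 proof eventually_elim
  fix x assume "convergent (%n. f n x)"
  then have "(%n. f n x) \<longlonglongrightarrow> lim (%n. f n x)" by (simp add: convergent_LIMSEQ_iff)
  then show "(%k. f (n + k) x - f n x) \<longlonglongrightarrow> lim (%n. f n x) - f n x"
   using LIMSEQ_ignore_initial_segment[of "%n. f n x" _ n] by (intro tendsto_diff) (auto simp: add.commute)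
 qed
qed (use p in simp)

lemma locL2_heat:
 assumes s: "0 < s" and F: "locL2 F"
 shows "locL2 (%t. cv (gker (of_real s)) (F t))"
 unfolding locL2_def
proof (intro conjI allI measurable_heat_slices locL2_measurable[OF F])
 fix T
 obtain B where "\<forall>t. abs t <= T --> l2b (F t) B" using F unfolding locL2_def by metis
 then show "\<exists>B. \<forall>t. abs t <= T --> l2b (cv (gker (of_real s)) (F t)) B" by (auto intro!: lpb_heat[OF s])
qed

lemma lpb_le_cmult:
 fixes f :: "'a => 'b::{real_normed_vector,second_countable_topology}" and g :: "'a => 'c::{real_normed_vector,second_countable_topology}"
 assumes f: "lpb M p f B" and g: "g \<in> borel_measurable M" and le: "!!x. norm (g x) <= c * norm (f x)" and c: "0 <= c" and p: "0 <= p"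
 shows "lpb M p g (c * B)"
proof (rule lpb_dominated[OF lpb_scale[where g="%x. c * norm (f x)"]])
 show "lpb M p (%x. norm (f x)) B" using f by (rule lpb_norm)
 have [measurable]: "f \<in> borel_measurable M" using f by (rule lpb_measurable)
 show "(%x. c * norm (f x)) \<in> borel_measurable M" by measurable
 show "AE x in M. norm (g x) <= norm (c * norm (f x))" using le c by (intro AE_I2) simp
qed (use assms in auto)

lemma locL2_mult_bounded:
 assumes F: "locL2 F" and G: "jm G"
  and le: "!!T. \<exists>K. \<forall>t x. abs t <= T --> norm (G t x) <= K * norm (F t x)"
 shows "locL2 G"
 unfolding locL2_def
proof (intro conjI allI G)
 fix T
 obtain B where B: "\<forall>t. abs t <= T --> l2b (F t) B" using F unfolding locL2_def by metis
 obtain K where K: "\<forall>t x. abs t <= T --> norm (G t x) <= K * norm (F t x)" using le by metis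
 have "l2b (G t) (abs K * B)" if t: "abs t <= T" for t
 proof (rule lpb_le_cmult)
  show "l2b (F t) B" using B t by blast
  show "G t \<in> borel_measurable lborel" using measurable_slice[OF G] by simp
  fix x
  have "norm (G t x) <= K * norm (F t x)" using K t by blast
  also have "\<dots> <= abs K * norm (F t x)" by (intro mult_right_mono) auto
  finally show "norm (G t x) <= abs K * norm (F t x)" .
 qed auto
 then show "\<exists>B. \<forall>t. abs t <= T --> l2b (G t) B" by blast
qed

lemma locL2_cmult:
 assumes F: "locL2 F"
 shows "locL2 (%t x. c * F t x)"
proof (rule locL2_mult_bounded[OF F])
 note [measurable] = measurable_curried[OF locL2_measurable[OF F]]
 show "jm (%t x. c * F t x)" by measurable
 show "\<exists>K. \<forall>t x. abs t <= T --> norm (c * F t x) <= K * norm (F t x)" for T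
  by (rule exI[of _ "norm c"]) (simp add: norm_mult)
qed

lemma locL2_diff: "locL2 F ==> locL2 G ==> locL2 (%t x. F t x - G t x)"
 using locL2_add[of F "%t x. -1 * G t x"] locL2_cmult[of G "-1"] by simp

lemma sol_diff:
 assumes k: "kfam k" and f: "l2b f A" and g: "l2b g B" and F: "locL2 F" and G: "locL2 G"
 shows "sol k (%x. f x - g x) (%t x. F t x - G t x) t x = sol k f F t x - sol k g G t x"
proof -
 have 1: "cv (k t) (%x. f x - g x) x = cv (k t) f x - cv (k t) g x" for t
 proof -
  obtain A c where "gbd A c (k t)" using kfam_slice[OF k] by blast
  then show ?thesis by (rule cv_diff[OF _ f g])
 qed
 have 2: "cv (k (t - s)) (%x. F s x - G s x) x = cv (k (t - s)) (F s) x - cv (k (t - s)) (G s) x" for s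
 proof -
  obtain A c where k: "gbd A c (k (t - s))" using kfam_slice[OF k] by blast
  obtain A B where "l2b (F s) A" "l2b (G s) B" using locL2_slice[OF F] locL2_slice[OF G] by metis
  then show ?thesis by (rule cv_diff[OF k])
 qed
 show ?thesis unfolding sol_def duh_def 1 2 right_diff_distrib
  by (subst Bochner_Integration.integral_diff) (use duh_integrable[OF k F] duh_integrable[OF k G] in simp_all)
qed

text \<open>The semigroup law in the real direction: regularisation \<open>e\<close> is the weaker
  regularisation \<open>e'\<close> of data and forcing smoothed by heat for the time
  \<open>e - e'\<close>. It makes flows with different parameters comparable.\<close>

lemma sol_smoothing:
 assumes e: "0 < e'" "e' < e" and f: "l2b f A" and F: "locL2 F"
 shows "sol (K0 e) f F t x = sol (K0 e') (cv (gker (of_real (e - e'))) f) (%t. cv (gker (of_real (e - e'))) (F t)) t x"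
proof -
 have 1: "cv (gker (Complex e' s)) (cv (gker (of_real (e - e'))) g) x = cv (gker (Complex e s)) g x" if "l2b g A" for s g A x
  using cv_gker_gker[of "Complex e' s" "of_real (e - e')" g A x] e that by (simp add: complex_of_real_def complex_add)
 have 2: "cv (gker (Complex e' (t - s))) (cv (gker (of_real (e - e'))) (F s)) x = cv (gker (Complex e (t - s))) (F s) x" for s
  using locL2_slice[OF F, of s] 1 by blast
 show ?thesis unfolding sol_def duh_def using 1[OF f, of t x] 2 by simp
qed

lemma lpb_nl_diff:
 assumes f: "lpb M (\<alpha> + 2) f X" and g: "lpb M (\<alpha> + 2) g Y" and d: "lpb M (\<alpha> + 2) (%x. f x - g x) D"
  and \<alpha>: "0 < \<alpha>" and q: "1 < q" "\<alpha> + 2 = q * (\<alpha> + 1)"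
 shows "lpb M q (%x. nl \<alpha> (f x) - nl \<alpha> (g x)) ((1 + \<alpha>) * ((X + Y) powr \<alpha> * D))"
proof (rule lpb_le_cmult)
 have [measurable]: "f \<in> borel_measurable M" "g \<in> borel_measurable M" using f g by (auto simp: lpb_def)
 show "lpb M q (%x. norm (norm (f x) + norm (g x)) powr \<alpha> * norm (f x - g x)) ((X + Y) powr \<alpha> * D)"
  using \<alpha> by (intro lpb_powr_mult[OF lpb_add d \<alpha> q(2)] lpb_norm f g) auto
 show "norm (nl \<alpha> (f x) - nl \<alpha> (g x)) <= (1 + \<alpha>) * norm (norm (norm (f x) + norm (g x)) powr \<alpha> * norm (f x - g x))" for x
  using nl_diff_le[OF \<alpha>, of "f x" "g x"] by (simp add: abs_mult mult.assoc)
 show "(%x. nl \<alpha> (f x) - nl \<alpha> (g x)) \<in> borel_measurable M" by measurable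
qed (use q \<alpha> in auto)

text \<open>\<open>S1\<close> and \<open>S2\<close> are the Strichartz estimates, uniform in the
  regularisation. In \<open>small\<close>, \<open>4 * C * A\<close> is the sum of the bounds
  \<open>2 * C * A\<close> of two iterates, and \<open>1 / 4\<close> limits the Duhamel part to a
  quarter of the data. Only the L^2 bound \<open>A\<close> is asked to be small; \<open>B\<close>
  bounds the gradient.\<close>

locale small_data =
 fixes \<alpha> lam C A B :: real and \<phi> :: "'a::euclidean_space => complex" and \<phi>' :: "'a => 'a => complex"
 assumes \<alpha>: "0 < \<alpha>"
  and S1: "!!e X Y f (F :: real => 'a => complex). 0 < e ==> locL2 F ==> xpb ((\<alpha> + 2) / (\<alpha> + 1)) F X ==> l2b f Y ==>
    xpb (\<alpha> + 2) (sol (K0 e) f F) (C * (Y + X))"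
  and S2: "!!e t X Y f (F :: real => 'a => complex). 0 < e ==> locL2 F ==> xpb ((\<alpha> + 2) / (\<alpha> + 1)) F X ==> l2b f Y ==>
    l2b (sol (K0 e) f F t) (C * (Y + X))"
  and C: "1 <= C"
  and small: "abs lam * (1 + \<alpha>) * (4 * C * A) powr \<alpha> * (2 * C^2) <= 1 / 4"
  and \<phi>: "l2b \<phi> A" and \<phi>': "!!e. e \<in> Basis ==> l2b (\<phi>' e) B"
  and wd\<phi>: "!!e. e \<in> Basis ==> wd e \<phi> (\<phi>' e)"
begin

definition q :: real where "q = (\<alpha> + 2) / (\<alpha> + 1)"
text \<open>Lipschitz constant of the forcing \<open>nF\<close>, from the space-time norm with
  exponent \<alpha> + 2 to the dual one, on the ball of radius \<open>2 * C * A\<close>.\<close>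

definition \<kappa> :: real where "\<kappa> = abs lam * (1 + \<alpha>) * (4 * C * A) powr \<alpha>"
definition nF :: "(real => 'a => complex) => real => 'a => complex" where "nF U t x = (\<i> * of_real lam) * nl \<alpha> (U t x)"
definition dnF :: "(real => 'a => complex) => (real => 'a => complex) => real => 'a => complex" where
 "dnF U W t x = (\<i> * of_real lam) * dnl \<alpha> (U t x) (W t x)"

lemma q: "1 < q" "\<alpha> + 2 = q * (\<alpha> + 1)" "0 < q"
 using \<alpha> by (auto simp: q_def field_simps)

lemma A0: "0 <= A" using lpb_nonneg[OF \<phi>] .

lemma B0: "0 <= B" using lpb_nonneg[OF \<phi>'[of "SOME e. e \<in> Basis"]] some_in_eq[of "Basis :: 'a set"] nonempty_Basis by auto

lemma \<kappa>0: "0 <= \<kappa>" using \<alpha> by (simp add: \<kappa>_def)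

lemma \<kappa>_small: "C * \<kappa> * (2 * C) <= 1 / 4" "C * \<kappa> <= 1 / 8" "\<kappa> <= 1 / 8"
proof -
 show 1: "C * \<kappa> * (2 * C) <= 1 / 4" using small by (simp add: \<kappa>_def power2_eq_square ac_simps)
 have "(C * \<kappa>) * 2 <= (C * \<kappa>) * (2 * C)" using \<kappa>0 C by (intro mult_left_mono) auto
 then show 2: "C * \<kappa> <= 1 / 8" using 1 by linarith
 have "1 * \<kappa> <= C * \<kappa>" using \<kappa>0 C by (intro mult_right_mono) auto
 then show "\<kappa> <= 1 / 8" using 2 by linarith
qed

lemma xpb_slices: "xpb p U X ==> jm U" "xpb p U X ==> 0 <= X"
 by (simp_all add: xpb_iff)

lemma nF_diff_bound:
 assumes "lpb M (\<alpha> + 2) f X" "lpb M (\<alpha> + 2) g Y" "lpb M (\<alpha> + 2) (%x. f x - g x) D"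
 shows "lpb M q (%x. (\<i> * of_real lam) * nl \<alpha> (f x) - (\<i> * of_real lam) * nl \<alpha> (g x)) (abs lam * ((1 + \<alpha>) * ((X + Y) powr \<alpha> * D)))"
 using lpb_cmult[OF lpb_nl_diff[OF assms \<alpha> q(1,2)], of "\<i> * of_real lam"] by (simp add: norm_mult right_diff_distrib)

lemma nF_xpb:
 assumes U: "xpb (\<alpha> + 2) U X" "X <= 4 * C * A"
 shows "xpb q (nF U) (\<kappa> * X)"
proof -
 have "lpb lborel2 (\<alpha> + 2) (%z::real \<times> 'a. 0::complex) 0" using \<alpha> by simp
 from nF_diff_bound[OF U(1)[unfolded xpb_def] this] U(1)
 have "xpb q (nF U) (abs lam * ((1 + \<alpha>) * (X powr \<alpha> * X)))"
  by (simp add: xpb_def nF_def[abs_def] case_prod_unfold)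
 moreover have "abs lam * ((1 + \<alpha>) * (X powr \<alpha> * X)) <= \<kappa> * X"
  unfolding \<kappa>_def using xpb_slices(2)[OF U(1)] U(2) \<alpha> by (simp add: mult.assoc mult_left_mono mult_right_mono powr_mono2)
 ultimately show ?thesis unfolding xpb_def by (rule lpb_mono) (use q in simp)
qed

lemma xpb_sum_norm:
 assumes U: "xpb (\<alpha> + 2) U X" "xpb (\<alpha> + 2) V Y"
 shows "lpb lborel2 (\<alpha> + 2) (%z. norm (case_prod U z) + norm (case_prod V z)) (X + Y)"
 using U \<alpha> unfolding xpb_def by (intro lpb_add lpb_norm) auto

lemma nF_diff_xpb:
 assumes U: "xpb (\<alpha> + 2) U (2 * C * A)" "xpb (\<alpha> + 2) V (2 * C * A)" and d: "xpb (\<alpha> + 2) (%t x. V t x - U t x) X"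
 shows "xpb q (%t x. nF V t x - nF U t x) (\<kappa> * X)"
 using nF_diff_bound[OF U(2,1)[unfolded xpb_def]] d
 by (simp add: xpb_def nF_def \<kappa>_def case_prod_unfold ac_simps)

lemma dnF_xpb:
 assumes U: "xpb (\<alpha> + 2) U (2 * C * A)" and W: "xpb (\<alpha> + 2) W Y"
 shows "xpb q (dnF U W) (\<kappa> * Y)"
proof -
 note [measurable] = measurable_curried[OF xpb_slices(1)[OF U]] measurable_curried[OF xpb_slices(1)[OF W]]
 have "lpb lborel2 q (%z. norm (case_prod U z) powr \<alpha> * norm (case_prod W z)) ((2 * C * A) powr \<alpha> * Y)"
  using U W unfolding xpb_def by (intro lpb_powr_mult[OF _ _ \<alpha> q(2)])
 then have "lpb lborel2 q (case_prod (dnF U W)) ((abs lam * (1 + \<alpha>)) * ((2 * C * A) powr \<alpha> * Y))"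
 proof (rule lpb_le_cmult)
  fix z :: "real \<times> 'a"
  obtain t x where z: "z = (t, x)" by (cases z)
  have "norm (dnF U W t x) <= abs lam * ((1 + \<alpha>) * norm (U t x) powr \<alpha> * norm (W t x))"
   unfolding dnF_def norm_mult using \<alpha> by (simp add: mult_left_mono norm_dnl_le)
  then show "norm (case_prod (dnF U W) z) <= (abs lam * (1 + \<alpha>)) * norm (norm (case_prod U z) powr \<alpha> * norm (case_prod W z))"
   unfolding z by (simp add: abs_mult ac_simps)
  show "case_prod (dnF U W) \<in> borel_measurable lborel2" unfolding dnF_def by measurable
 qed (use q \<alpha> in auto)
 moreover have "(abs lam * (1 + \<alpha>)) * ((2 * C * A) powr \<alpha> * Y) <= \<kappa> * Y"
 proof -
  have "(2 * C * A) powr \<alpha> <= (4 * C * A) powr \<alpha>" using A0 C \<alpha> by (intro powr_mono2 mult_right_mono) auto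
  then have "(abs lam * (1 + \<alpha>)) * (2 * C * A) powr \<alpha> * Y <= (abs lam * (1 + \<alpha>)) * (4 * C * A) powr \<alpha> * Y"
   using \<alpha> xpb_slices(2)[OF W] by (intro mult_right_mono mult_left_mono) auto
  then show ?thesis by (simp add: \<kappa>_def ac_simps)
 qed
 ultimately show ?thesis unfolding xpb_def by (rule lpb_mono) (use q in simp)
qed

text \<open>At most 1, as \<open>dnl_holder\<close> demands, and strictly below \<alpha>, so that
  the factor with exponent \<open>\<alpha> - \<beta>\<close> takes part in Hoelder's
  inequality.\<close>

definition \<beta> :: real where "\<beta> = min 1 \<alpha> / 2"

lemma \<beta>: "0 < \<beta>" "\<beta> <= 1" "\<beta> < \<alpha>" "\<beta> <= 1 / 2"
 using \<alpha> by (auto simp: \<beta>_def min_def)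

lemma dnF_holder_xpb:
 obtains K where "0 <= K" "!!U V W X. xpb (\<alpha> + 2) U (2 * C * A) ==> xpb (\<alpha> + 2) V (2 * C * A) ==> xpb (\<alpha> + 2) (%t x. V t x - U t x) X ==>
   xpb (\<alpha> + 2) W (2 * C * B) ==> xpb q (%t x. dnF V W t x - dnF U W t x) (K * X powr \<beta>)"
proof -
 obtain K0 where K0: "0 < K0" and K: "!!u v w. norm (dnl \<alpha> u w - dnl \<alpha> v w) <= K0 * ((norm u + norm v) powr (\<alpha> - \<beta>) * norm (u - v) powr \<beta> * norm w)"
  using dnl_holder[OF \<alpha> \<beta>(1,2)] \<beta> by (metis less_imp_le)
 have "xpb q (%t x. dnF V W t x - dnF U W t x) ((abs lam * K0 * (2 * C * A + 2 * C * A) powr (\<alpha> - \<beta>) * (2 * C * B)) * X powr \<beta>)"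
  if U: "xpb (\<alpha> + 2) U (2 * C * A)" "xpb (\<alpha> + 2) V (2 * C * A)" and d: "xpb (\<alpha> + 2) (%t x. V t x - U t x) X"
   and W: "xpb (\<alpha> + 2) W (2 * C * B)" for U V W X
 proof -
  note [measurable] = U[THEN xpb_slices(1), THEN measurable_curried] measurable_curried[OF xpb_slices(1)[OF W]]
  have "lpb lborel2 q (%z. norm (norm (case_prod V z) + norm (case_prod U z)) powr (\<alpha> - \<beta>) * norm (case_prod (%t x. V t x - U t x) z) powr \<beta> * norm (case_prod W z))
    ((2 * C * A + 2 * C * A) powr (\<alpha> - \<beta>) * X powr \<beta> * (2 * C * B))"
   using d W unfolding xpb_def by (intro lpb_powr_mult3[OF xpb_sum_norm[OF U(2,1)] _ _ \<beta>(1,3) q(2)])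
  then have "lpb lborel2 q (case_prod (%t x. dnF V W t x - dnF U W t x)) ((abs lam * K0) * ((2 * C * A + 2 * C * A) powr (\<alpha> - \<beta>) * X powr \<beta> * (2 * C * B)))"
  proof (rule lpb_le_cmult)
   fix z :: "real \<times> 'a"
   obtain t x where z: "z = (t, x)" by (cases z)
   have "norm (dnF V W t x - dnF U W t x) = abs lam * norm (dnl \<alpha> (V t x) (W t x) - dnl \<alpha> (U t x) (W t x))"
    by (simp add: dnF_def norm_mult flip: right_diff_distrib)
   also have "\<dots> <= abs lam * (K0 * ((norm (V t x) + norm (U t x)) powr (\<alpha> - \<beta>) * norm (V t x - U t x) powr \<beta> * norm (W t x)))"
    by (intro mult_left_mono K) simp
   finally show "norm (case_prod (%t x. dnF V W t x - dnF U W t x) z) <=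
    (abs lam * K0) * norm (norm (norm (case_prod V z) + norm (case_prod U z)) powr (\<alpha> - \<beta>) * norm (case_prod (%t x. V t x - U t x) z) powr \<beta> * norm (case_prod W z))"
    unfolding z by (simp add: abs_mult ac_simps)
   show "case_prod (%t x. dnF V W t x - dnF U W t x) \<in> borel_measurable lborel2" unfolding dnF_def by measurable
  qed (use q K0 in auto)
  then show ?thesis unfolding xpb_def by (simp add: ac_simps)
 qed
 moreover have "0 <= abs lam * K0 * (2 * C * A + 2 * C * A) powr (\<alpha> - \<beta>) * (2 * C * B)"
  using K0 C B0 by (intro mult_nonneg_nonneg) auto
 ultimately show ?thesis using that by blast
qed

end

context small_data
begin

text \<open>The invariant of the iteration, for an iterate \<open>U\<close> and its gradient
  \<open>W\<close> together. Boundedness on bounded times puts the nonlinear forcing into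
  \<open>locL2\<close>; continuity of \<open>W e\<close> along lines is what integration by parts
  asks for.\<close>

definition adm :: "(real => 'a => complex) => ('a => real => 'a => complex) => bool" where
 "adm U W \<longleftrightarrow> locL2 U \<and> (\<forall>T. \<exists>b. \<forall>t x. abs t <= T --> norm (U t x) <= b) \<and> xpb (\<alpha> + 2) U (2 * C * A) \<and>
   (\<forall>e\<in>Basis. locL2 (W e) \<and> xpb (\<alpha> + 2) (W e) (2 * C * B) \<and>
    (\<forall>t. dird e (U t) (W e t)) \<and> (\<forall>t x. continuous_on UNIV (%s. W e t (x + s *\<^sub>R e))))"

lemma adm_zero: "adm (%t x. 0) (%e t x. 0)"
proof -
 have z: "locL2 (%t (x::'a). 0)" unfolding locL2_def by (auto intro!: exI[of _ 0])
 have "xpb (\<alpha> + 2) (%t (x::'a). 0) (2 * C * A)" "xpb (\<alpha> + 2) (%t (x::'a). 0) (2 * C * B)"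
  using \<alpha> A0 B0 C by (simp_all add: xpb_iff)
 then show ?thesis unfolding adm_def using z by (auto simp: dird_def intro!: exI[of _ 0])
qed

lemma locL2_bounded_mult:
 assumes U: "locL2 U" "!!T. \<exists>b. \<forall>t x. abs t <= T --> norm (U t x) <= b" and W: "locL2 W"
 shows "locL2 (dnF U W)"
proof (rule locL2_mult_bounded[OF W])
 note [measurable] = measurable_curried[OF locL2_measurable[OF U(1)]] measurable_curried[OF locL2_measurable[OF W]]
 show "jm (dnF U W)" unfolding dnF_def by measurable
 fix T
 obtain b where b: "\<forall>t x. abs t <= T --> norm (U t x) <= b" using U(2) by blast
 have ub: "norm (U t x) <= abs b" if "abs t <= T" for t x using b that abs_ge_self[of b] by (meson order_trans)
 have "norm (dnF U W t x) <= (abs lam * ((1 + \<alpha>) * abs b powr \<alpha>)) * norm (W t x)" if "abs t <= T" for t x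
 proof -
  have "norm (dnF U W t x) <= abs lam * ((1 + \<alpha>) * norm (U t x) powr \<alpha> * norm (W t x))"
   unfolding dnF_def norm_mult using \<alpha> by (simp add: mult_left_mono norm_dnl_le)
  also have "\<dots> <= abs lam * ((1 + \<alpha>) * abs b powr \<alpha> * norm (W t x))"
   using ub[OF that] \<alpha> by (intro mult_left_mono mult_right_mono powr_mono2) auto
  finally show ?thesis by (simp add: ac_simps)
 qed
 then show "\<exists>K. \<forall>t x. abs t <= T --> norm (dnF U W t x) <= K * norm (W t x)" by blast
qed

lemma locL2_nF:
 assumes U: "locL2 U" "!!T. \<exists>b. \<forall>t x. abs t <= T --> norm (U t x) <= b"
 shows "locL2 (nF U)"
proof (rule locL2_mult_bounded[OF U(1)])
 note [measurable] = measurable_curried[OF locL2_measurable[OF U(1)]]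
 show "jm (nF U)" unfolding nF_def by measurable
 fix T
 obtain b where b: "\<forall>t x. abs t <= T --> norm (U t x) <= b" using U(2) by blast
 have ub: "norm (U t x) <= abs b" if "abs t <= T" for t x using b that abs_ge_self[of b] by (meson order_trans)
 have "norm (nF U t x) <= (abs lam * abs b powr \<alpha>) * norm (U t x)" if "abs t <= T" for t x
 proof -
  have "norm (nF U t x) = abs lam * (norm (U t x) powr \<alpha> * norm (U t x))"
   by (simp add: nF_def norm_mult norm_nl)
  also have "\<dots> <= abs lam * (abs b powr \<alpha> * norm (U t x))"
   using ub[OF that] \<alpha> by (intro mult_left_mono mult_right_mono powr_mono2) auto
  finally show ?thesis by (simp add: ac_simps)
 qed
 then show "\<exists>K. \<forall>t x. abs t <= T --> norm (nF U t x) <= K * norm (U t x)" by blast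
qed

lemma admD:
 assumes "adm U W"
 shows adm_locL2: "locL2 U" and adm_bdd: "!!T. \<exists>b. \<forall>t x. abs t <= T --> norm (U t x) <= b"
  and adm_xpb: "xpb (\<alpha> + 2) U (2 * C * A)"
  and adm_locL2': "!!e. e \<in> Basis ==> locL2 (W e)" and adm_xpb': "!!e. e \<in> Basis ==> xpb (\<alpha> + 2) (W e) (2 * C * B)"
  and adm_dird: "!!e t. e \<in> Basis ==> dird e (U t) (W e t)"
  and adm_cont: "!!e t x. e \<in> Basis ==> continuous_on UNIV (%s. W e t (x + s *\<^sub>R e))"
 using assms unfolding adm_def by simp_all

lemma adm_nF:
 assumes "adm U W"
 shows "locL2 (nF U)" "xpb q (nF U) (\<kappa> * (2 * C * A))"
  "!!e. e \<in> Basis ==> locL2 (dnF U (W e))" "!!e. e \<in> Basis ==> xpb q (dnF U (W e)) (\<kappa> * (2 * C * B))"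
proof -
 show "locL2 (nF U)" by (intro locL2_nF adm_locL2[OF assms] adm_bdd[OF assms])
 have "2 * C * A <= 4 * C * A" using A0 C by (intro mult_right_mono) auto
 then show "xpb q (nF U) (\<kappa> * (2 * C * A))" by (intro nF_xpb adm_xpb[OF assms])
 show "locL2 (dnF U (W e))" if "e \<in> Basis" for e
  by (intro locL2_bounded_mult adm_locL2[OF assms] adm_bdd[OF assms] adm_locL2'[OF assms that])
 show "xpb q (dnF U (W e)) (\<kappa> * (2 * C * B))" if "e \<in> Basis" for e
  by (intro dnF_xpb adm_xpb[OF assms] adm_xpb'[OF assms that])
qed

lemma adm_wd:
 assumes a: "adm U W" and e: "e \<in> Basis"
 shows "wd e (nF U t) (dnF U (W e) t)"
proof -
 obtain X Y where X: "l2b (nF U t) X" and Y: "l2b (dnF U (W e) t) Y"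
  using locL2_slice[OF adm_nF(1)[OF a]] locL2_slice[OF adm_nF(3)[OF a e]] by metis
 show ?thesis
 proof (rule wd_dird[OF e _ _ X Y])
  show "dird e (nF U t) (dnF U (W e) t)"
   unfolding nF_def[abs_def] dnF_def[abs_def] by (rule dird_nl[OF \<alpha> adm_dird[OF a e]])
  show "continuous_on UNIV (%s. dnF U (W e) t (x + s *\<^sub>R e))" for x
   unfolding dnF_def
   by (intro continuous_on_mult continuous_on_const continuous_dnl[OF \<alpha>] dird_line_continuous[OF adm_dird[OF a e]] adm_cont[OF a e])
 qed
qed

definition step :: "real => (real => 'a => complex) => real => 'a => complex" where
 "step \<epsilon> U = sol (K0 \<epsilon>) \<phi> (nF U)"
definition step' :: "real => (real => 'a => complex) => ('a => real => 'a => complex) => 'a => real => 'a => complex" where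
 "step' \<epsilon> U W e = sol (K0 \<epsilon>) (\<phi>' e) (dnF U (W e))"

text \<open>Closes the ball: data of size \<open>X\<close> and a forcing of size
  \<open>\<kappa> * (2 * C * X)\<close> return a flow of size at most \<open>2 * C * X\<close>. It
  is used with \<open>A\<close> for iterates and with \<open>B\<close> for gradients.\<close>

lemma \<kappa>_step: "0 <= X ==> C * (X + \<kappa> * (2 * C * X)) <= 2 * C * X"
proof -
 assume X: "0 <= X"
 have "C * (X + \<kappa> * (2 * C * X)) = C * X + (C * \<kappa> * (2 * C)) * X" by (simp add: algebra_simps)
 also have "\<dots> <= C * X + 1 / 4 * X" using \<kappa>_small(1) X by (intro add_left_mono mult_right_mono)
 also have "\<dots> <= C * X + C * X" using C X by (intro add_left_mono mult_right_mono) auto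
 finally show ?thesis by simp
qed

lemma step_bounds:
 assumes a: "adm U W" and \<epsilon>: "0 < \<epsilon>"
 shows "xpb (\<alpha> + 2) (step \<epsilon> U) (2 * C * A)" "l2b (step \<epsilon> U t) (2 * C * A)"
  "!!e. e \<in> Basis ==> xpb (\<alpha> + 2) (step' \<epsilon> U W e) (2 * C * B)" "!!e. e \<in> Basis ==> l2b (step' \<epsilon> U W e t) (2 * C * B)"
proof -
 have p0: "0 <= \<alpha> + 2" using \<alpha> by simp
 show "xpb (\<alpha> + 2) (step \<epsilon> U) (2 * C * A)"
  using S1[OF \<epsilon> adm_nF(1)[OF a] adm_nF(2)[OF a, unfolded q_def] \<phi>] \<kappa>_step[OF A0] p0
  unfolding step_def xpb_def by (rule lpb_mono)
 show "l2b (step \<epsilon> U t) (2 * C * A)"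
  using S2[OF \<epsilon> adm_nF(1)[OF a] adm_nF(2)[OF a, unfolded q_def] \<phi>] \<kappa>_step[OF A0]
  unfolding step_def by (rule lpb_mono) simp
 fix e :: 'a assume e: "e \<in> Basis"
 show "xpb (\<alpha> + 2) (step' \<epsilon> U W e) (2 * C * B)"
  using S1[OF \<epsilon> adm_nF(3)[OF a e] adm_nF(4)[OF a e, unfolded q_def] \<phi>'[OF e]] \<kappa>_step[OF B0] p0
  unfolding step'_def xpb_def by (rule lpb_mono)
 show "l2b (step' \<epsilon> U W e t) (2 * C * B)"
  using S2[OF \<epsilon> adm_nF(3)[OF a e] adm_nF(4)[OF a e, unfolded q_def] \<phi>'[OF e]] \<kappa>_step[OF B0]
  unfolding step'_def by (rule lpb_mono) simp
qed

text \<open>Differentiating the kernel shows that derivatives exist along lines; trading the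
  differentiated kernel for differentiated data shows that they are the flow \<open>step'\<close>,
  which obeys the same bounds.\<close>

lemma step_dird:
 assumes a: "adm U W" and \<epsilon>: "0 < \<epsilon>" and e: "e \<in> Basis"
 shows "dird e (step \<epsilon> U t) (step' \<epsilon> U W e t)" "dird e (step' \<epsilon> U W e t) (sol (K1 \<epsilon> e) (\<phi>' e) (dnF U (W e)) t)"
  "dird e (sol (K1 \<epsilon> e) (\<phi>' e) (dnF U (W e)) t) (sol (K2 \<epsilon> e) (\<phi>' e) (dnF U (W e)) t)"
  "sol (K2 \<epsilon> e) \<phi> (nF U) t x = sol (K1 \<epsilon> e) (\<phi>' e) (dnF U (W e)) t x"
proof -
 have n: "norm e <= 1" using e by simp
 note k0 = kfam_gker[OF \<epsilon>, where 'a='a] and k1 = kfam_gk1[OF \<epsilon> e] and k2 = kfam_gk2[OF \<epsilon> e]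
 have "dird e (sol (K0 \<epsilon>) \<phi> (nF U) t) (sol (K1 \<epsilon> e) \<phi> (nF U) t)"
  by (rule sol_dird[OF k0 k1 _ n \<phi> adm_nF(1)[OF a]]) (rule dird_gker[OF e])
 moreover have "sol (K1 \<epsilon> e) \<phi> (nF U) t = step' \<epsilon> U W e t"
  unfolding step'_def by (rule ext) (rule sol_K1[OF \<epsilon> wd\<phi>[OF e] adm_wd[OF a e]])
 ultimately show "dird e (step \<epsilon> U t) (step' \<epsilon> U W e t)" by (simp add: step_def)
 show "dird e (step' \<epsilon> U W e t) (sol (K1 \<epsilon> e) (\<phi>' e) (dnF U (W e)) t)"
  unfolding step'_def by (rule sol_dird[OF k0 k1 _ n \<phi>'[OF e] adm_nF(3)[OF a e]]) (rule dird_gker[OF e])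
 show "dird e (sol (K1 \<epsilon> e) (\<phi>' e) (dnF U (W e)) t) (sol (K2 \<epsilon> e) (\<phi>' e) (dnF U (W e)) t)"
  by (rule sol_dird[OF k1 k2 _ n \<phi>'[OF e] adm_nF(3)[OF a e]]) (rule dird_gk1[OF e])
 show "sol (K2 \<epsilon> e) \<phi> (nF U) t x = sol (K1 \<epsilon> e) (\<phi>' e) (dnF U (W e)) t x"
  by (rule sol_K2[OF \<epsilon> e wd\<phi>[OF e] adm_wd[OF a e] \<phi> \<phi>'[OF e] adm_nF(1)[OF a] adm_nF(3)[OF a e]])
qed

lemma adm_step:
 assumes a: "adm U W" and \<epsilon>: "0 < \<epsilon>"
 shows "adm (step \<epsilon> U) (step' \<epsilon> U W)"
 unfolding adm_def
proof (intro conjI ballI allI)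
 note k0 = kfam_gker[OF \<epsilon>, where 'a='a]
 show "locL2 (step \<epsilon> U)" unfolding step_def by (rule locL2_sol[OF k0 \<phi> adm_nF(1)[OF a]])
 show "\<exists>b. \<forall>t x. abs t <= T --> norm (step \<epsilon> U t x) <= b" for T
  unfolding step_def by (rule sol_bounded[OF k0 \<phi> adm_nF(1)[OF a]])
 show "xpb (\<alpha> + 2) (step \<epsilon> U) (2 * C * A)" by (rule step_bounds[OF a \<epsilon>])
 fix e :: 'a assume e: "e \<in> Basis"
 show "locL2 (step' \<epsilon> U W e)" unfolding step'_def by (rule locL2_sol[OF k0 \<phi>'[OF e] adm_nF(3)[OF a e]])
 show "xpb (\<alpha> + 2) (step' \<epsilon> U W e) (2 * C * B)" by (rule step_bounds(3)[OF a \<epsilon> e])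
 show "dird e (step \<epsilon> U t) (step' \<epsilon> U W e t)" for t by (rule step_dird(1)[OF a \<epsilon> e])
 show "continuous_on UNIV (%s. step' \<epsilon> U W e t (x + s *\<^sub>R e))" for t x
  by (rule dird_line_continuous[OF step_dird(2)[OF a \<epsilon> e]])
qed

text \<open>All smoothing times up to \<epsilon> are included because the one that will occur, the
  gap to the next parameter, is still unknown when \<epsilon> is chosen.\<close>

definition thr :: "nat => real => (real => 'a => complex) => ('a => real => 'a => complex) => bool" where
 "thr n \<epsilon> U W \<longleftrightarrow> (\<forall>\<tau>. 0 < \<tau> \<and> \<tau> <= \<epsilon> -->
   l2b (%x. \<phi> x - cv (gker (of_real \<tau>)) \<phi> x) ((1/2) ^ n) \<and>
   xpb q (%t x. nF U t x - cv (gker (of_real \<tau>)) (nF U t) x) ((1/2) ^ n) \<and>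
   (\<forall>e\<in>Basis. l2b (%x. \<phi>' e x - cv (gker (of_real \<tau>)) (\<phi>' e) x) ((1/2) ^ n) \<and>
    xpb q (%t x. dnF U (W e) t x - cv (gker (of_real \<tau>)) (dnF U (W e) t) x) ((1/2) ^ n)))"

lemma threshold_eventually:
 "(\<exists>t0>0. \<forall>t. 0 < t \<and> t <= t0 --> P t) \<longleftrightarrow> eventually P (at_right (0::real))"
proof
 assume "\<exists>t0>0. \<forall>t. 0 < t \<and> t <= t0 --> P t"
 then show "eventually P (at_right 0)" unfolding eventually_at_right_field by (metis less_imp_le)
next
 assume "eventually P (at_right 0)"
 then obtain b where "0 < b" "\<forall>y>0. y < b --> P y" unfolding eventually_at_right_field by blast
 then show "\<exists>t0>0. \<forall>t. 0 < t \<and> t <= t0 --> P t" by (intro exI[of _ "b / 2"]) auto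
qed

lemma thr_ex:
 assumes a: "adm U W" and \<epsilon>0: "0 < \<epsilon>0"
 shows "\<exists>\<epsilon>>0. \<epsilon> < \<epsilon>0 \<and> thr n \<epsilon> U W"
proof -
 have pn: "0 < (1/2::real) ^ n" by simp
 have "eventually (%\<tau>. l2b (%x. \<phi> x - cv (gker (of_real \<tau>)) \<phi> x) ((1/2) ^ n) \<and>
   xpb q (%t x. nF U t x - cv (gker (of_real \<tau>)) (nF U t) x) ((1/2) ^ n) \<and>
   (\<forall>e\<in>Basis. l2b (%x. \<phi>' e x - cv (gker (of_real \<tau>)) (\<phi>' e) x) ((1/2) ^ n) \<and>
    xpb q (%t x. dnF U (W e) t x - cv (gker (of_real \<tau>)) (dnF U (W e) t) x) ((1/2) ^ n))) (at_right 0)"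
  unfolding eventually_conj_iff
 proof (intro conjI eventually_ball_finite ballI)
  show "eventually (%\<tau>. l2b (%x. \<phi> x - cv (gker (of_real \<tau>)) \<phi> x) ((1/2) ^ n)) (at_right 0)"
   using heat_approximate_identity[OF _ \<phi> \<phi> pn] unfolding threshold_eventually by simp
  show "eventually (%\<tau>. xpb q (%t x. nF U t x - cv (gker (of_real \<tau>)) (nF U t) x) ((1/2) ^ n)) (at_right 0)"
   using xpb_heat_approximate_identity[OF q(1) adm_nF(1,2)[OF a] pn] unfolding threshold_eventually by simp
  fix e :: 'a assume e: "e \<in> Basis"
  show "eventually (%\<tau>. l2b (%x. \<phi>' e x - cv (gker (of_real \<tau>)) (\<phi>' e) x) ((1/2) ^ n) \<and>
    xpb q (%t x. dnF U (W e) t x - cv (gker (of_real \<tau>)) (dnF U (W e) t) x) ((1/2) ^ n)) (at_right 0)"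
   using heat_approximate_identity[OF _ \<phi>'[OF e] \<phi>'[OF e] pn] xpb_heat_approximate_identity[OF q(1) adm_nF(3,4)[OF a e] pn]
   unfolding threshold_eventually eventually_conj_iff by simp
 qed simp
 then obtain t0 where "0 < t0" "thr n t0 U W" unfolding threshold_eventually[symmetric] thr_def by blast
 then show ?thesis using \<epsilon>0 by (intro exI[of _ "min t0 (\<epsilon>0 / 2)"]) (auto simp: thr_def)
qed

text \<open>Dependent choice: the next iterate is built with the current parameter, and only then is
  the next parameter taken, below the current one and within the threshold of the new
  iterate.\<close>

lemma iteration_exists:
 "\<exists>\<epsilon> U W. \<forall>n::nat. 0 < \<epsilon> n \<and> \<epsilon> (Suc n) < \<epsilon> n \<and> adm (U n) (W n) \<and> thr n (\<epsilon> n) (U n) (W n) \<and>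
   U (Suc n) = step (\<epsilon> n) (U n) \<and> W (Suc n) = step' (\<epsilon> n) (U n) (W n)"
proof -
 define P where "P n s = (case s of (\<epsilon>, U, W) => 0 < \<epsilon> \<and> adm U W \<and> thr n \<epsilon> U W)" for n s
 define Q where "Q s s' = (case s of (\<epsilon>, U, W) => case s' of (\<epsilon>', U', W') => \<epsilon>' < \<epsilon> \<and> U' = step \<epsilon> U \<and> W' = step' \<epsilon> U W)" for s s'
 have "\<exists>f. \<forall>n. P n (f n) \<and> Q (f n) (f (Suc n))"
 proof (rule dependent_nat_choice)
  obtain \<epsilon> where "0 < \<epsilon>" "thr 0 \<epsilon> (%t x. 0) (%e t x. 0)" using thr_ex[OF adm_zero, of 1 0] by auto
  then show "\<exists>s. P 0 s"
   by (intro exI[of _ "(\<epsilon>, (%t x. 0), (%e t x. 0))"]) (simp add: adm_zero P_def)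
  fix s n assume s: "P n s"
  obtain \<epsilon> U W where seq: "s = (\<epsilon>, U, W)" by (cases s)
  then have e: "0 < \<epsilon>" and a: "adm U W" using s by (auto simp: P_def)
  obtain \<epsilon>' where "0 < \<epsilon>'" "\<epsilon>' < \<epsilon>" "thr (Suc n) \<epsilon>' (step \<epsilon> U) (step' \<epsilon> U W)"
   using thr_ex[OF adm_step[OF a e] e] by blast
  then show "\<exists>s'. P (Suc n) s' \<and> Q s s'"
   unfolding seq using adm_step[OF a e] by (intro exI[of _ "(\<epsilon>', step \<epsilon> U, step' \<epsilon> U W)"]) (simp add: P_def Q_def)
 qed
 then obtain f where f: "!!n. P n (f n)" "!!n. Q (f n) (f (Suc n))" by blast
 show ?thesis
  by (rule exI[of _ "%n. fst (f n)"], rule exI[of _ "%n. fst (snd (f n))"], rule exI[of _ "%n. snd (snd (f n))"])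
    (use f in \<open>simp add: case_prod_beta P_def Q_def\<close>)
qed

end

lemma powr_power_commute: "0 < (x::real) ==> (x ^ n) powr b = (x powr b) ^ n"
 by (simp add: powr_realpow[symmetric] powr_powr mult.commute)

lemma case_prod_add: "case_prod (%t x. F t x + G t x) = (%z. case_prod F z + case_prod G z)"
 and case_prod_diff: "case_prod (%t x. F' t x - G' t x) = (%z. case_prod F' z - case_prod G' z)"
 by auto

lemma xpb_add: "1 <= p ==> xpb p F A ==> xpb p G B ==> xpb p (%t x. F t x + G t x) (A + B)"
 unfolding xpb_def case_prod_add by (rule lpb_add)

lemma xpb_diff: "1 <= p ==> xpb p F A ==> xpb p G B ==> xpb p (%t x. F t x - G t x) (A + B)"
 unfolding xpb_def case_prod_diff by (rule lpb_diff)

lemma xpb_mono: "xpb p F A ==> A <= B ==> 0 <= p ==> xpb p F B"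
 unfolding xpb_def by (rule lpb_mono)

context small_data
begin

text \<open>Both flows are rewritten with the parameter \<open>e'\<close> by
  \<open>sol_smoothing\<close>. The smoothing error \<eta> then enters twice, through the data and
  through the forcing.\<close>

lemma sol_step_diff:
 fixes f :: "'a => complex" and F F' :: "real => 'a => complex"
 assumes e: "0 < e'" "e' < e" and f: "l2b f Y" and F: "locL2 F" and F': "locL2 F'"
  and D: "xpb q (%t x. F' t x - F t x) D"
  and h1: "l2b (%x. f x - cv (gker (of_real (e - e'))) f x) \<eta>"
  and h2: "xpb q (%t x. F t x - cv (gker (of_real (e - e'))) (F t) x) \<eta>"
 shows "xpb (\<alpha> + 2) (%t x. sol (K0 e') f F' t x - sol (K0 e) f F t x) (C * (D + 2 * \<eta>))"
  and "l2b (%x. sol (K0 e') f F' t x - sol (K0 e) f F t x) (C * (D + 2 * \<eta>))"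
proof -
 have s: "0 < e - e'" using e by simp
 define Hf where "Hf = cv (gker (of_real (e - e'))) f"
 define HF where "HF = (%t. cv (gker (of_real (e - e'))) (F t))"
 have Hf: "l2b Hf Y" unfolding Hf_def by (rule lpb_heat[OF s _ f]) simp
 have HF: "locL2 HF" unfolding HF_def by (rule locL2_heat[OF s F])
 have eq: "sol (K0 e') f F' t x - sol (K0 e) f F t x = sol (K0 e') (%x. f x - Hf x) (%t x. F' t x - HF t x) t x" for t x
  using sol_diff[OF kfam_gker[OF e(1)] f Hf F' HF, of t x] sol_smoothing[OF e f F, of t x] by (simp add: Hf_def HF_def)
 have "xpb q (%t x. (F' t x - F t x) + (F t x - HF t x)) (D + \<eta>)"
  using h2 unfolding HF_def by (intro xpb_add D) (use q in auto)
 then have X: "xpb ((\<alpha> + 2) / (\<alpha> + 1)) (%t x. F' t x - HF t x) (D + \<eta>)" by (simp add: q_def)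
 have c: "C * (\<eta> + (D + \<eta>)) = C * (D + 2 * \<eta>)" by simp
 note L = locL2_diff[OF F' HF]
 show "xpb (\<alpha> + 2) (%t x. sol (K0 e') f F' t x - sol (K0 e) f F t x) (C * (D + 2 * \<eta>))"
  using S1[OF e(1) L X h1[folded Hf_def]] unfolding eq c .
 show "l2b (%x. sol (K0 e') f F' t x - sol (K0 e) f F t x) (C * (D + 2 * \<eta>))"
  using S2[OF e(1) L X h1[folded Hf_def], of t] unfolding eq c .
qed

end

section \<open>Geometric convergence of iterates and gradients\<close>

locale iteration = small_data +
 fixes \<epsilon> :: "nat => real" and U :: "nat => real => 'a => complex" and W :: "nat => 'a => real => 'a => complex"
 assumes \<epsilon>: "!!n. 0 < \<epsilon> n" "!!n. \<epsilon> (Suc n) < \<epsilon> n" and adm: "!!n. adm (U n) (W n)" and thr: "!!n. thr n (\<epsilon> n) (U n) (W n)"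
  and U_Suc: "!!n. U (Suc n) = step (\<epsilon> n) (U n)" and W_Suc: "!!n. W (Suc n) = step' (\<epsilon> n) (U n) (W n)"
begin

lemma thr_gap:
 defines "\<tau> n \<equiv> complex_of_real (\<epsilon> n - \<epsilon> (Suc n))"
 shows "l2b (%x. \<phi> x - cv (gker (\<tau> n)) \<phi> x) ((1/2) ^ n)"
  "xpb q (%t x. nF (U n) t x - cv (gker (\<tau> n)) (nF (U n) t) x) ((1/2) ^ n)"
  "!!e. e \<in> Basis ==> l2b (%x. \<phi>' e x - cv (gker (\<tau> n)) (\<phi>' e) x) ((1/2) ^ n)"
  "!!e. e \<in> Basis ==> xpb q (%t x. dnF (U n) (W n e) t x - cv (gker (\<tau> n)) (dnF (U n) (W n e) t) x) ((1/2) ^ n)"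
proof -
 have "0 < \<epsilon> n - \<epsilon> (Suc n) \<and> \<epsilon> n - \<epsilon> (Suc n) <= \<epsilon> n" using \<epsilon>(1)[of "Suc n"] \<epsilon>(2)[of n] by simp
 note * = thr[of n, unfolded thr_def, rule_format, OF this]
 show "l2b (%x. \<phi> x - cv (gker (\<tau> n)) \<phi> x) ((1/2) ^ n)"
  "xpb q (%t x. nF (U n) t x - cv (gker (\<tau> n)) (nF (U n) t) x) ((1/2) ^ n)"
  "!!e. e \<in> Basis ==> l2b (%x. \<phi>' e x - cv (gker (\<tau> n)) (\<phi>' e) x) ((1/2) ^ n)"
  "!!e. e \<in> Basis ==> xpb q (%t x. dnF (U n) (W n e) t x - cv (gker (\<tau> n)) (dnF (U n) (W n e) t) x) ((1/2) ^ n)"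
  unfolding \<tau>_def using * by blast+
qed

lemma U_bounds:
 "xpb (\<alpha> + 2) (U n) (2 * C * A)" "l2b (U (Suc n) t) (2 * C * A)"
 and W_bounds: "e \<in> Basis ==> xpb (\<alpha> + 2) (W n e) (2 * C * B)" "e \<in> Basis ==> l2b (W (Suc n) e t) (2 * C * B)"
 using adm_xpb[OF adm] adm_xpb'[OF adm] step_bounds(2)[OF adm \<epsilon>(1)] step_bounds(4)[OF adm \<epsilon>(1)] by (simp_all add: U_Suc W_Suc)

lemma U_diff:
 assumes D: "xpb (\<alpha> + 2) (%t x. U (Suc n) t x - U n t x) D"
 shows "xpb (\<alpha> + 2) (%t x. U (Suc (Suc n)) t x - U (Suc n) t x) (C * (\<kappa> * D + 2 * (1/2) ^ n))"
  and "l2b (%x. U (Suc (Suc n)) t x - U (Suc n) t x) (C * (\<kappa> * D + 2 * (1/2) ^ n))"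
proof -
 note * = \<epsilon>(1)[of "Suc n"] \<epsilon>(2)[of n] \<phi> adm_nF(1)[OF adm] adm_nF(1)[OF adm] nF_diff_xpb[OF U_bounds(1) U_bounds(1) D] thr_gap(1,2)
 show "xpb (\<alpha> + 2) (%t x. U (Suc (Suc n)) t x - U (Suc n) t x) (C * (\<kappa> * D + 2 * (1/2) ^ n))"
  using sol_step_diff(1)[OF *] unfolding U_Suc[of "Suc n"] step_def U_Suc[of n] .
 show "l2b (%x. U (Suc (Suc n)) t x - U (Suc n) t x) (C * (\<kappa> * D + 2 * (1/2) ^ n))"
  using sol_step_diff(2)[OF *] unfolding U_Suc[of "Suc n"] step_def U_Suc[of n] .
qed

lemma W_diff:
 assumes e: "e \<in> Basis" and D: "xpb q (%t x. dnF (U (Suc n)) (W (Suc n) e) t x - dnF (U n) (W n e) t x) D"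
 shows "xpb (\<alpha> + 2) (%t x. W (Suc (Suc n)) e t x - W (Suc n) e t x) (C * (D + 2 * (1/2) ^ n))"
  and "l2b (%x. W (Suc (Suc n)) e t x - W (Suc n) e t x) (C * (D + 2 * (1/2) ^ n))"
proof -
 note * = \<epsilon>(1)[of "Suc n"] \<epsilon>(2)[of n] \<phi>'[OF e] adm_nF(3)[OF adm e] adm_nF(3)[OF adm e] D thr_gap(3,4)[OF e]
 show "xpb (\<alpha> + 2) (%t x. W (Suc (Suc n)) e t x - W (Suc n) e t x) (C * (D + 2 * (1/2) ^ n))"
  using sol_step_diff(1)[OF *] unfolding W_Suc[of "Suc n"] step'_def U_Suc[of n] W_Suc[of n] .
 show "l2b (%x. W (Suc (Suc n)) e t x - W (Suc n) e t x) (C * (D + 2 * (1/2) ^ n))"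
  using sol_step_diff(2)[OF *] unfolding W_Suc[of "Suc n"] step'_def U_Suc[of n] W_Suc[of n] .
qed

text \<open>\<open>4 * C * A\<close> covers the first difference. \<open>8 * C\<close> makes the
  smoothing error at most \<open>M / 8\<close>; with \<open>C * \<kappa> <= 1 / 8\<close> the
  induction step then produces \<open>M / 4\<close>, less than the required
  \<open>M / 2\<close>.\<close>

definition M :: real where "M = 4 * C * A + 8 * C"

lemma U_geometric:
 "xpb (\<alpha> + 2) (%t x. U (Suc (Suc n)) t x - U (Suc n) t x) (M * (1/2) ^ n)"
 "l2b (%x. U (Suc (Suc n)) t x - U (Suc n) t x) (M * (1/2) ^ n)"
proof -
 have p: "1 <= \<alpha> + 2" "0 <= \<alpha> + 2" using \<alpha> by auto
 have M0: "0 <= M" using A0 C by (simp add: M_def)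
 have "xpb (\<alpha> + 2) (%t x. U (Suc (Suc n)) t x - U (Suc n) t x) (M * (1/2) ^ n) \<and>
   (\<forall>t. l2b (%x. U (Suc (Suc n)) t x - U (Suc n) t x) (M * (1/2) ^ n))"
 proof (induction n)
  case 0
  have le: "2 * C * A + 2 * C * A <= M * (1/2) ^ 0" using C by (simp add: M_def)
  show ?case
   using xpb_mono[OF xpb_diff[OF p(1) U_bounds(1) U_bounds(1)] le p(2)] lpb_mono[OF lpb_diff[OF _ U_bounds(2) U_bounds(2)] le] by auto
 next
  case (Suc n)
  have "C * (\<kappa> * (M * (1/2) ^ n) + 2 * (1/2) ^ Suc n) = (C * \<kappa> * M + C) * (1/2) ^ n" by (simp add: algebra_simps)
  also have "\<dots> <= (1 / 8 * M + M / 8) * (1/2) ^ n"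
   using \<kappa>_small(2) M0 A0 C by (intro mult_right_mono add_mono) (auto simp: M_def)
  also have "\<dots> <= M * (1/2) ^ Suc n" using M0 by simp
  finally have le: "C * (\<kappa> * (M * (1/2) ^ n) + 2 * (1/2) ^ Suc n) <= M * (1/2) ^ Suc n" .
  show ?case
   using xpb_mono[OF U_diff(1) le p(2)] lpb_mono[OF U_diff(2) le] Suc by auto
 qed
 then show "xpb (\<alpha> + 2) (%t x. U (Suc (Suc n)) t x - U (Suc n) t x) (M * (1/2) ^ n)"
  "l2b (%x. U (Suc (Suc n)) t x - U (Suc n) t x) (M * (1/2) ^ n)" by auto
qed

definition \<rho> :: real where "\<rho> = (1/2) powr \<beta>"

lemma \<rho>: "1 / 2 <= \<rho>" "\<rho> < 1" "0 < \<rho>" "(1/2) ^ n <= \<rho> ^ n"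
proof -
 show 1: "1 / 2 <= \<rho>" unfolding \<rho>_def using le_powr_le_1[of "1/2" \<beta>] \<beta> by simp
 show "\<rho> < 1" unfolding \<rho>_def using powr_less_mono2[of \<beta> "1/2" 1] \<beta> by simp
 show "0 < \<rho>" "(1/2) ^ n <= \<rho> ^ n" using 1 by (auto intro: power_mono)
qed

text \<open>The forcing difference is split by changing \<open>U\<close> and \<open>W\<close> one at
  a time. Changing \<open>W\<close> is contractive with constant \<kappa>; changing \<open>U\<close>
  costs a multiple of \<open>(M * (1/2) ^ n) powr \<beta>\<close> by the Hoelder bound, and this
  sets the rate \<rho>.\<close>

lemma W_geometric:
 obtains M' where "M <= M'" "!!e n. e \<in> Basis ==> xpb (\<alpha> + 2) (%t x. W (Suc (Suc n)) e t x - W (Suc n) e t x) (M' * \<rho> ^ n)"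
  "!!e n t. e \<in> Basis ==> l2b (%x. W (Suc (Suc n)) e t x - W (Suc n) e t x) (M' * \<rho> ^ n)"
proof -
 have p: "1 <= \<alpha> + 2" "0 <= \<alpha> + 2" using \<alpha> by auto
 obtain K where K: "0 <= K" "!!U V W X. xpb (\<alpha> + 2) U (2 * C * A) ==> xpb (\<alpha> + 2) V (2 * C * A) ==> xpb (\<alpha> + 2) (%t x. V t x - U t x) X ==>
   xpb (\<alpha> + 2) W (2 * C * B) ==> xpb q (%t x. dnF V W t x - dnF U W t x) (K * X powr \<beta>)"
  using dnF_holder_xpb by blast
 have M0: "0 <= M" using A0 C by (simp add: M_def)
 \<comment> \<open>\<open>4 * C * B\<close> covers the first difference. The last summand bounds the
   Hoelder and smoothing terms by \<open>M' / 4\<close>; with \<open>M' / 8\<close> from the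
   contractive term the total stays below \<open>M' * \<rho>\<close>, since \<rho> is at least
   \<open>1 / 2\<close>.\<close>
 define M' where "M' = M + 4 * C * B + 4 * (C + C * K * M powr \<beta>)"
 have M'0: "0 <= M'" "4 * C * B <= M'" "C + C * K * M powr \<beta> <= M' / 4" "M <= M'"
  using M0 C B0 K by (auto simp: M'_def)
 have main: "xpb (\<alpha> + 2) (%t x. W (Suc (Suc n)) e t x - W (Suc n) e t x) (M' * \<rho> ^ n) \<and>
   (\<forall>t. l2b (%x. W (Suc (Suc n)) e t x - W (Suc n) e t x) (M' * \<rho> ^ n))" if e: "e \<in> Basis" for e n
 proof (induction n)
  case 0
  have le: "2 * C * B + 2 * C * B <= M' * \<rho> ^ 0" using M'0(2) by (simp add: ac_simps)
  show ?case
   using xpb_mono[OF xpb_diff[OF p(1) W_bounds(1)[OF e] W_bounds(1)[OF e]] le p(2)] lpb_mono[OF lpb_diff[OF _ W_bounds(2)[OF e] W_bounds(2)[OF e]] le] by auto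
 next
  case (Suc n)
  let ?n = "Suc n"
  have "xpb q (%t x. dnF (U (Suc ?n)) (W ?n e) t x - dnF (U ?n) (W ?n e) t x) (K * (M * (1/2) ^ n) powr \<beta>)"
   by (rule K(2)[OF U_bounds(1) U_bounds(1) U_geometric(1) W_bounds(1)[OF e]])
  moreover have "xpb q (dnF (U (Suc ?n)) (%t x. W (Suc ?n) e t x - W ?n e t x)) (\<kappa> * (M' * \<rho> ^ n))"
   by (rule dnF_xpb[OF U_bounds(1)]) (use Suc in blast)
  ultimately have "xpb q (%t x. (dnF (U (Suc ?n)) (W ?n e) t x - dnF (U ?n) (W ?n e) t x) + dnF (U (Suc ?n)) (%t x. W (Suc ?n) e t x - W ?n e t x) t x)
    (K * (M * (1/2) ^ n) powr \<beta> + \<kappa> * (M' * \<rho> ^ n))"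
   by (intro xpb_add) (use q in auto)
  then have D: "xpb q (%t x. dnF (U (Suc ?n)) (W (Suc ?n) e) t x - dnF (U ?n) (W ?n e) t x) (K * (M * (1/2) ^ n) powr \<beta> + \<kappa> * (M' * \<rho> ^ n))"
   by (simp add: dnF_def dnl_diff right_diff_distrib)
  have "C * ((K * (M * (1/2) ^ n) powr \<beta> + \<kappa> * (M' * \<rho> ^ n)) + 2 * (1/2) ^ ?n)
   = (C * K * M powr \<beta>) * \<rho> ^ n + (C * \<kappa>) * M' * \<rho> ^ n + C * (1/2) ^ n"
   using M0 by (simp add: powr_mult powr_power_commute \<rho>_def algebra_simps)
  also have "\<dots> <= (C * K * M powr \<beta>) * \<rho> ^ n + 1 / 8 * M' * \<rho> ^ n + C * \<rho> ^ n"
   using \<kappa>_small(2) M'0 C \<rho> by (intro add_mono mult_right_mono mult_left_mono order_refl) auto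
  also have "\<dots> = ((C + C * K * M powr \<beta>) + M' / 8) * \<rho> ^ n" by (simp add: algebra_simps)
  also have "\<dots> <= (M' / 4 + M' / 8) * \<rho> ^ n" using M'0 \<rho> by (intro mult_right_mono add_right_mono) auto
  also have "\<dots> <= (M' * \<rho>) * \<rho> ^ n"
  proof (intro mult_right_mono)
   have "M' * (1 / 2) <= M' * \<rho>" using M'0 \<rho> by (intro mult_left_mono) auto
   then show "M' / 4 + M' / 8 <= M' * \<rho>" using M'0 by simp
  qed (use \<rho> in auto)
  finally have le: "C * ((K * (M * (1/2) ^ n) powr \<beta> + \<kappa> * (M' * \<rho> ^ n)) + 2 * (1/2) ^ ?n) <= M' * \<rho> ^ ?n" by (simp add: ac_simps)
  show ?case
   using xpb_mono[OF W_diff(1)[OF e D] le p(2)] lpb_mono[OF W_diff(2)[OF e D] le] by auto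
 qed
 show ?thesis by (rule that[OF M'0(4)]) (use main in auto)
qed

text \<open>A pointwise limit, so that one jointly measurable function represents the limit both in
  space-time and at every single time. The index starts at 1 because the L^2 bound is known for
  outputs of \<open>step\<close>.\<close>

definition v :: "real => 'a => complex" where "v t x = lim (%n. U (Suc n) t x)"
definition w :: "'a => real => 'a => complex" where "w e t x = lim (%n. W (Suc n) e t x)"

lemma U_measurable: "jm (U n)" "bm (U n t)"
 and W_measurable: "e \<in> Basis ==> jm (W n e)" "e \<in> Basis ==> W n e t \<in> borel_measurable borel"
 using locL2_measurable[OF adm_locL2[OF adm]] locL2_measurable[OF adm_locL2'[OF adm]] measurable_slice by blast+

lemma v_limit:
 obtains R where "0 <= R" "!!n. xpb (\<alpha> + 2) (%t x. v t x - U (Suc n) t x) (R * \<rho> ^ n)"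
  "!!n t. l2b (%x. v t x - U (Suc n) t x) (R * \<rho> ^ n)"
  "!!e n. e \<in> Basis ==> xpb (\<alpha> + 2) (%t x. w e t x - W (Suc n) e t x) (R * \<rho> ^ n)"
  "!!e n t. e \<in> Basis ==> l2b (%x. w e t x - W (Suc n) e t x) (R * \<rho> ^ n)"
proof -
 have p: "1 <= \<alpha> + 2" "0 <= \<alpha> + 2" using \<alpha> by auto
 obtain M' where M': "M <= M'" "!!e n. e \<in> Basis ==> xpb (\<alpha> + 2) (%t x. W (Suc (Suc n)) e t x - W (Suc n) e t x) (M' * \<rho> ^ n)"
  "!!e n t. e \<in> Basis ==> l2b (%x. W (Suc (Suc n)) e t x - W (Suc n) e t x) (M' * \<rho> ^ n)"
  using W_geometric by blast
 have M0: "0 <= M" using A0 C by (simp add: M_def)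
 have le: "M * (1/2) ^ n <= M' * \<rho> ^ n" for n using M0 M' \<rho> by (intro mult_mono) auto
 have m2: "f \<in> borel_measurable lborel" if "bm f" for f :: "'a => complex" using that by simp
 have mx: "f \<in> borel_measurable lborel2" if "f \<in> borel_measurable (borel \<Otimes>\<^sub>M borel)" for f :: "real \<times> 'a => complex" using that by simp
 have xeq: "case_prod (%t x. F t x - G t x) = (%z. case_prod F z - case_prod G z)" for F G :: "real => 'a => complex" by auto
 show ?thesis
 proof (rule that[of "M' / (1 - \<rho>)"])
  show "0 <= M' / (1 - \<rho>)" using M0 M' \<rho> by simp
  fix n t
  have "lpb lborel2 (\<alpha> + 2) (%z. lim (%n. case_prod (U (Suc n)) z) - case_prod (U (Suc n)) z) (M' / (1 - \<rho>) * \<rho> ^ n)"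
   using xpb_mono[OF U_geometric(1) le p(2)] unfolding xpb_def xeq
   by (intro lpb_geometric_limit[where f="%n. case_prod (U (Suc n))"] mx U_measurable \<rho>(2,3) p(1))
  moreover have "(%z. lim (%n. case_prod (U (Suc n)) z) - case_prod (U (Suc n)) z) = case_prod (%t x. v t x - U (Suc n) t x)"
   by (auto simp: v_def)
  ultimately show "xpb (\<alpha> + 2) (%t x. v t x - U (Suc n) t x) (M' / (1 - \<rho>) * \<rho> ^ n)" unfolding xpb_def by simp
  show "l2b (%x. v t x - U (Suc n) t x) (M' / (1 - \<rho>) * \<rho> ^ n)"
   unfolding v_def using lpb_mono[OF U_geometric(2) le]
   by (intro lpb_geometric_limit[where f="%n. U (Suc n) t"] m2 U_measurable \<rho>(2,3)) auto
  fix e :: 'a assume e: "e \<in> Basis"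
  have "lpb lborel2 (\<alpha> + 2) (%z. lim (%n. case_prod (W (Suc n) e) z) - case_prod (W (Suc n) e) z) (M' / (1 - \<rho>) * \<rho> ^ n)"
   using M'(2)[OF e] unfolding xpb_def xeq
   by (intro lpb_geometric_limit[where f="%n. case_prod (W (Suc n) e)"] mx W_measurable e \<rho>(2,3) p(1))
  moreover have "(%z. lim (%n. case_prod (W (Suc n) e) z) - case_prod (W (Suc n) e) z) = case_prod (%t x. w e t x - W (Suc n) e t x)"
   by (auto simp: w_def)
  ultimately show "xpb (\<alpha> + 2) (%t x. w e t x - W (Suc n) e t x) (M' / (1 - \<rho>) * \<rho> ^ n)" unfolding xpb_def by simp
  show "l2b (%x. w e t x - W (Suc n) e t x) (M' / (1 - \<rho>) * \<rho> ^ n)"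
   unfolding w_def using M'(3)[OF e]
   by (intro lpb_geometric_limit[where f="%n. W (Suc n) e t"] m2 W_measurable e \<rho>(2,3)) auto
 qed
qed

end

section \<open>The limit of the iteration\<close>

lemma lpb_zero_AE:
 assumes f: "!!\<eta>. 0 < \<eta> ==> lpb M p f \<eta>" and p: "0 < p"
 shows "AE x in M. f x = 0"
proof -
 have [measurable]: "f \<in> borel_measurable M" using lpb_measurable[OF f[of 1]] by simp
 have "lpb M p f 0" by (rule lpb_limit) (use f p in auto)
 then have "(\<integral>\<^sup>+x. ennreal (norm (f x) powr p) \<partial>M) = 0" unfolding lpb_def using p by simp
 then have "AE x in M. ennreal (norm (f x) powr p) = 0" by (subst (asm) nn_integral_0_iff_AE) auto
 then show ?thesis by eventually_elim (auto simp: ennreal_eq_0_iff)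
qed

lemma lpb_pairing_diff:
 fixes f g \<psi> :: "'a => complex"
 assumes "lpb M 2 (%x. f x - g x) A" "lpb M 2 f X" "lpb M 2 g Y" "lpb M 2 \<psi> B"
 shows "norm ((LINT x|M. f x * \<psi> x) - (LINT x|M. g x * \<psi> x)) <= A * B"
proof -
 have "(LINT x|M. f x * \<psi> x) - (LINT x|M. g x * \<psi> x) = (LINT x|M. (f x - g x) * \<psi> x)"
  using lpb_2_integrable_mult(1)[OF assms(2,4)] lpb_2_integrable_mult(1)[OF assms(3,4)] by (simp add: left_diff_distrib)
 then show ?thesis using lpb_2_integrable_mult(2)[OF assms(1,4)] by simp
qed

text \<open>A uniform limit of locally Lipschitz curves is continuous; the Lipschitz constants may
  grow with \<open>n\<close>.\<close>

lemma L2_continuous_limit: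
 fixes V :: "nat => real => 'a::euclidean_space => complex"
 assumes lim: "!!n t. l2b (%x. v t x - V n t x) (r n)" and r: "r \<longlonglongrightarrow> 0"
  and lip: "!!n T. \<exists>L. \<forall>t t'. abs t <= T --> abs t' <= T --> l2b (%x. V n t' x - V n t x) (L * abs (t' - t))"
  and \<eta>: "0 < \<eta>"
 shows "\<exists>d>0. \<forall>s. abs (s - t) < d --> l2b (%x. v s x - v t x) \<eta>"
proof -
 obtain n where n: "r n < \<eta> / 3" using order_tendstoD(2)[OF r, of "\<eta> / 3"] \<eta> by (auto simp: eventually_sequentially)
 obtain L where L: "!!t' s. abs t' <= abs t + 1 ==> abs s <= abs t + 1 ==> l2b (%x. V n s x - V n t' x) (L * abs (s - t'))"
  using lip[of "abs t + 1" n] by metis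
 define d where "d = min 1 (\<eta> / (3 * (abs L + 1)))"
 have d: "0 < d" using \<eta> by (simp add: d_def)
 have "l2b (%x. v s x - v t x) \<eta>" if s: "abs (s - t) < d" for s
 proof -
  have st: "abs s <= abs t + 1" using s unfolding d_def min_less_iff_conj by linarith
  have "l2b (%x. ((v s x - V n s x) + (V n s x - V n t x)) - (v t x - V n t x)) ((r n + L * abs (s - t)) + r n)"
   using L[of t, OF _ st] by (intro lpb_diff lpb_add lim) auto
  moreover have "(r n + L * abs (s - t)) + r n <= \<eta>"
  proof -
   have "L * abs (s - t) <= abs L * d" using s by (intro mult_mono) auto
   also have "\<dots> <= (abs L + 1) * (\<eta> / (3 * (abs L + 1)))" using \<eta> d by (intro mult_mono) (auto simp: d_def)
   also have "\<dots> = \<eta> / 3" by (simp add: field_simps)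
   finally show ?thesis using n by simp
  qed
  ultimately have "l2b (%x. ((v s x - V n s x) + (V n s x - V n t x)) - (v t x - V n t x)) \<eta>" by (rule lpb_mono) simp
  then show ?thesis by (simp add: algebra_simps)
 qed
 then show ?thesis using d by blast
qed

text \<open>At each point the Gaussian tests are bounded functionals on L^2, so the relation is
  closed under L^2 limits.\<close>

lemma wd_limit:
 fixes f g :: "'a::euclidean_space => complex"
 assumes e: "e \<in> Basis" and f: "l2b f X" and g: "l2b g Y"
  and ap: "!!\<eta>. 0 < \<eta> ==> \<exists>f' g' X' Y'. wd e f' g' \<and> l2b f' X' \<and> l2b g' Y' \<and>
   l2b (%x. f x - f' x) \<eta> \<and> l2b (%x. g x - g' x) \<eta>"
 shows "wd e f g"
 unfolding wd_def
proof (intro allI impI)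
 fix z and x :: 'a assume z: "0 < Re z"
 obtain A1 c1 where 1: "gbd A1 c1 (gk1 e z)" using gbd_gk1_ex[OF z e] by blast
 obtain A2 c2 where 2: "gbd A2 c2 (gker z :: 'a => complex)" using gbd_gker_ex[OF z] by blast
 define S where "S = A1 * gL2 TYPE('a) c1 + A2 * gL2 TYPE('a) c2"
 have S0: "0 <= S" using 1 2 by (auto simp: S_def gbd_def gL2_nonneg)
 have "norm (cv (gk1 e z) f x - cv (gker z) g x) <= 0 + \<eta>" if \<eta>: "0 < \<eta>" for \<eta>
 proof -
  have "0 < \<eta> / (S + 1)" using \<eta> S0 by simp
  from ap[OF this] obtain f' g' X' Y' where w: "wd e f' g'" and f': "l2b f' X'" and g': "l2b g' Y'"
   and fd: "l2b (%x. f x - f' x) (\<eta> / (S + 1))" and gd: "l2b (%x. g x - g' x) (\<eta> / (S + 1))" by blast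
  have "cv (gk1 e z) f x - cv (gker z) g x = cv (gk1 e z) (%x. f x - f' x) x - cv (gker z) (%x. g x - g' x) x"
   unfolding cv_diff[OF 1 f f'] cv_diff[OF 2 g g'] using w z by (simp add: wd_def)
  also have "norm \<dots> <= A1 * gL2 TYPE('a) c1 * (\<eta> / (S + 1)) + A2 * gL2 TYPE('a) c2 * (\<eta> / (S + 1))"
   by (intro order_trans[OF norm_triangle_ineq4] add_mono cv_integrable(2)[OF 1 fd] cv_integrable(2)[OF 2 gd])
  also have "\<dots> = S / (S + 1) * \<eta>" by (simp add: S_def algebra_simps add_divide_distrib)
  also have "\<dots> <= 1 * \<eta>" using S0 \<eta> by (intro mult_right_mono) auto
  finally show ?thesis by simp
 qed
 then have "norm (cv (gk1 e z) f x - cv (gker z) g x) <= 0" by (rule field_le_epsilon)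
 then show "cv (gk1 e z) f x = cv (gker z) g x" by simp
qed

lemma locL2_pairing:
 fixes F :: "real => 'a::euclidean_space => complex"
 assumes F: "locL2 F" and g: "l2b g B"
 shows "integrable lborel (%s. tsg t s * (LL x. F s x * g x))"
  and "(LL x. (LL s. tsg t s * F s x) * g x) = (LL s. tsg t s * (LL x. F s x * g x))"
  and "\<exists>Y. l2b (%x. LL s. tsg t s * F s x) Y"
proof -
 note [measurable] = measurable_curried[OF locL2_measurable[OF F]]
 obtain b where b: "!!s. abs s <= abs t ==> l2b (F s) b" using F unfolding locL2_def by metis
 have b0: "0 <= b" using lpb_nonneg[OF b[of 0]] by simp
 have hm: "jm (%s x. tsg t s * F s x)" by measurable
 have h: "l2b (%x. tsg t s * F s x) b" if "abs s <= abs t" for s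
 proof (rule lpb_dominated[OF b[OF that]])
  show "(%x. tsg t s * F s x) \<in> borel_measurable lborel" by measurable
  show "AE x in lborel. norm (tsg t s * F s x) <= norm (F s x)"
   using norm_tsg_le[of t s] by (intro AE_I2) (simp add: norm_mult mult_left_le_one_le)
 qed simp
 have z: "tsg t s * F s x = 0" if "abs t < abs s" for s x using tsg_zero[of t s] that by auto
 note * = hm abs_ge_zero b0 h z
 have eq: "(LL x. tsg t s * F s x * g x) = tsg t s * (LL x. F s x * g x)" for s
  by (simp add: mult.assoc)
 show "integrable lborel (%s. tsg t s * (LL x. F s x * g x))"
  using time_integral_pairing_integrable[OF * g] unfolding eq .
 show "(LL x. (LL s. tsg t s * F s x) * g x) = (LL s. tsg t s * (LL x. F s x * g x))"
  using time_integral_pairing[OF * g] unfolding eq .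
 show "\<exists>Y. l2b (%x. LL s. tsg t s * F s x) Y" using lpb_time_integral[OF *] by blast
qed

lemma nn_integral_norm_tsg_le: "(NN s. ennreal (norm (tsg t s))) <= ennreal (2 * abs t)"
proof -
 have "(NN s. ennreal (norm (tsg t s))) <= (NN s. 1 * indicator {-abs t..abs t} s)"
 proof (intro nn_integral_mono)
  fix s show "ennreal (norm (tsg t s)) <= 1 * indicator {-abs t..abs t} s"
   using norm_tsg_le[of t s] by (cases "abs t <= abs s") (auto simp: tsg_zero indicator_def not_le)
 qed
 also have "\<dots> = ennreal (2 * abs t)" by (subst nn_integral_cmult_indicator) auto
 finally show ?thesis .
qed

text \<open>The test \<open>tsg t s * \<psi> x\<close> is a space-time function of norm at most
  \<open>(2 * abs t) powr (1 / p) * Y\<close>, so Hoelder's inequality is applied in both variables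
  at once. Slices of \<open>F\<close> are known to be integrable against \<psi> for almost every
  time only.\<close>

lemma xpb_pairing:
 fixes F :: "real => 'a::euclidean_space => complex"
 assumes F: "xpb q F X" and \<psi>: "lpb lborel p \<psi> Y" and pq: "1 < p" "1 < q" "1 / p + 1 / q = 1"
 shows "integrable lborel (%s. tsg t s * (LL x. F s x * \<psi> x))"
  and "norm (LL s. tsg t s * (LL x. F s x * \<psi> x)) <= X * ((2 * abs t) powr (1 / p) * Y)"
  and "AE s in lborel. tsg t s \<noteq> 0 --> integrable lborel (%x. F s x * \<psi> x)"
proof -
 note [measurable] = measurable_curried[OF F[unfolded xpb_iff, THEN conjunct1]]
 have [measurable]: "bm \<psi>" using lpb_measurable[OF \<psi>] by simp
 have Y0: "0 <= Y" using lpb_nonneg[OF \<psi>] .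
 define T where "T s x = tsg t s * \<psi> x" for s x
 have T: "lpb lborel2 p (case_prod T) ((2 * abs t) powr (1 / p) * Y)"
  unfolding xpb_def[symmetric] xpb_iff
 proof (intro conjI)
  show "jm T" unfolding T_def by measurable
  show "0 <= (2 * abs t) powr (1 / p) * Y" using Y0 by simp
  have "(NN s. (NN x. ennreal (norm (T s x) powr p))) <= (NN s. ennreal (norm (tsg t s)) * ennreal (Y powr p))"
  proof (intro nn_integral_mono)
   fix s
   have "(NN x. ennreal (norm (T s x) powr p)) = (NN x. ennreal (norm (tsg t s)) * ennreal (norm (\<psi> x) powr p))"
   proof (intro nn_integral_cong)
    fix x
    have "norm (tsg t s) powr p = norm (tsg t s)" using pq by (auto simp: tsg_def)
    then show "ennreal (norm (T s x) powr p) = ennreal (norm (tsg t s)) * ennreal (norm (\<psi> x) powr p)"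
     by (simp add: T_def norm_mult powr_mult ennreal_mult')
   qed
   also have "\<dots> = ennreal (norm (tsg t s)) * (NN x. ennreal (norm (\<psi> x) powr p))" by (rule nn_integral_cmult) measurable
   also have "\<dots> <= ennreal (norm (tsg t s)) * ennreal (Y powr p)" by (intro mult_left_mono lpb_le[OF \<psi>]) simp
   finally show "(NN x. ennreal (norm (T s x) powr p)) <= \<dots>" .
  qed
  also have "\<dots> = (NN s. ennreal (norm (tsg t s))) * ennreal (Y powr p)" by (rule nn_integral_multc) measurable
  also have "\<dots> <= ennreal (2 * abs t) * ennreal (Y powr p)" by (intro mult_right_mono nn_integral_norm_tsg_le) simp
  also have "\<dots> = ennreal (((2 * abs t) powr (1 / p) * Y) powr p)"
   using pq Y0 by (simp add: powr_mult powr_powr ennreal_mult')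
  finally show "(NN s. (NN x. ennreal (norm (T s x) powr p))) <= \<dots>" .
 qed
 have "(\<integral>\<^sup>+z. ennreal (norm (case_prod F z) * norm (case_prod T z)) \<partial>lborel2) <= ennreal (X * ((2 * abs t) powr (1 / p) * Y))"
  by (rule lpb_holder[OF F[unfolded xpb_def] T]) (use pq in \<open>auto simp: add.commute\<close>)
 also have "(\<integral>\<^sup>+z. ennreal (norm (case_prod F z) * norm (case_prod T z)) \<partial>lborel2) =
  (NN s. (NN x. ennreal (norm (F s x) * norm (T s x))))"
  unfolding T_def by (subst lborel.nn_integral_fst[symmetric]) (auto simp: case_prod_beta)
 finally have le: "(NN s. (NN x. ennreal (norm (F s x * T s x)))) <= ennreal (X * ((2 * abs t) powr (1 / p) * Y))"
  by (simp add: norm_mult)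
 have m: "(%(s, x). F s x * T s x) \<in> borel_measurable lborel2" unfolding T_def by measurable
 have fin: "(NN s. (NN x. ennreal (norm (F s x * T s x)))) < \<infinity>" using le by (rule order_le_less_trans) simp
 have eq: "(LL x. F s x * T s x) = tsg t s * (LL x. F s x * \<psi> x)" for s
  unfolding T_def mult.left_commute[of _ "tsg t s"] by simp
 show "integrable lborel (%s. tsg t s * (LL x. F s x * \<psi> x))"
  using fubini_pair(2)[OF m fin] unfolding eq .
 have "ennreal (norm (LL s. tsg t s * (LL x. F s x * \<psi> x))) <= (NN s. ennreal (norm (LL x. F s x * T s x)))"
  unfolding eq[symmetric] by (rule norm_integral_le_nn_integral)
 also have "\<dots> <= (NN s. (NN x. ennreal (norm (F s x * T s x))))"
  by (intro nn_integral_mono norm_integral_le_nn_integral)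
 also note le
 finally have le0: "ennreal (norm (LL s. tsg t s * (LL x. F s x * \<psi> x))) <= ennreal (X * ((2 * abs t) powr (1 / p) * Y))" .
 have "0 <= X" using F by (simp add: xpb_iff)
 then show "norm (LL s. tsg t s * (LL x. F s x * \<psi> x)) <= X * ((2 * abs t) powr (1 / p) * Y)"
  using le0 Y0 by (subst (asm) ennreal_le_iff) auto
 have "AE s in lborel. (NN x. ennreal (norm (F s x * T s x))) \<noteq> \<infinity>"
  using fin unfolding T_def by (intro nn_integral_PInf_AE) auto
 then show "AE s in lborel. tsg t s \<noteq> 0 --> integrable lborel (%x. F s x * \<psi> x)"
 proof eventually_elim
  fix s assume s: "(NN x. ennreal (norm (F s x * T s x))) \<noteq> \<infinity>"
  then have "integrable lborel (%x. F s x * T s x)" unfolding T_def by (intro integrableI_bounded) (auto simp: less_top)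
  then have "integrable lborel (%x. tsg t s * (F s x * \<psi> x))" by (simp add: T_def mult.left_commute)
  from integrable_mult_right[OF this, of "inverse (tsg t s)"]
  show "tsg t s \<noteq> 0 --> integrable lborel (%x. F s x * \<psi> x)" by (auto simp flip: mult.assoc)
 qed
qed

lemma sol_KL_sum:
 fixes f :: "'a::euclidean_space => complex"
 assumes r: "0 < r" and f: "l2b f B" and F: "locL2 F"
 shows "sol (KL r) f F t x = (\<Sum>e\<in>Basis. sol (K2 r e) f F t x)"
proof -
 have c: "cv (KL r s) g x = (\<Sum>e\<in>Basis. cv (K2 r e s) g x)" if g: "l2b g Y" for s g Y
 proof -
  have i: "integrable lborel (%y. gk2 e (Complex r s) (x - y) * g y)" if e: "e \<in> Basis" for e :: 'a
  proof -
   obtain A c where "gbd A c (gk2 e (Complex r s))" using kfam_slice[OF kfam_gk2[OF r e]] by blast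
   then show ?thesis by (rule cv_integrable(1)[OF _ g])
  qed
  show ?thesis unfolding cv_def sum_gk2[symmetric] sum_distrib_right by (rule Bochner_Integration.integral_sum) (rule i)
 qed
 have "duh (KL r) F t x = (\<Sum>e\<in>Basis. duh (K2 r e) F t x)"
 proof -
  have "duh (KL r) F t x = (LL s. (\<Sum>e\<in>Basis. tsg t s * cv (K2 r e (t - s)) (F s) x))"
   unfolding duh_def
  proof (rule Bochner_Integration.integral_cong[OF refl])
   fix s
   obtain Y where "l2b (F s) Y" using locL2_slice[OF F] by blast
   then show "tsg t s * cv (KL r (t - s)) (F s) x = (\<Sum>e\<in>Basis. tsg t s * cv (K2 r e (t - s)) (F s) x)"
    by (simp add: c sum_distrib_left)
  qed
  also have "\<dots> = (\<Sum>e\<in>Basis. duh (K2 r e) F t x)"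
   unfolding duh_def by (rule Bochner_Integration.integral_sum) (rule duh_integrable[OF kfam_gk2[OF r] F])
  finally show ?thesis .
 qed
 then show ?thesis using c[OF f] by (simp add: sol_def sum.distrib)
qed

lemma duh_at_0 [simp]: "duh k F 0 x = 0" by (simp add: duh_def tsg_zero)

lemma gker_pairing:
 fixes f g :: "'a::euclidean_space => complex"
 assumes z: "0 < Re z" and f: "l2b f X" and g: "l2b g Y"
 shows "(LL x. cv (gker z) f x * g x) = (LL x. f x * cv (gker z) g x)"
proof -
 obtain A c where k: "gbd A c (gker z :: 'a => complex)" using gbd_gker_ex[OF z] by blast
 show ?thesis using cv_pairing[OF k f g] by simp
qed

context iteration
begin

text \<open>Fixes one constant from \<open>v_limit\<close>, so that later statements can share
  it.\<close>

definition R :: real where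
 "R = (SOME R. 0 <= R \<and> (\<forall>n. xpb (\<alpha> + 2) (%t x. v t x - U (Suc n) t x) (R * \<rho> ^ n)) \<and>
  (\<forall>n t. l2b (%x. v t x - U (Suc n) t x) (R * \<rho> ^ n)) \<and>
  (\<forall>e\<in>Basis. \<forall>n t. l2b (%x. w e t x - W (Suc n) e t x) (R * \<rho> ^ n)))"

lemma R: "0 <= R" "!!n. xpb (\<alpha> + 2) (%t x. v t x - U (Suc n) t x) (R * \<rho> ^ n)"
 "!!n t. l2b (%x. v t x - U (Suc n) t x) (R * \<rho> ^ n)"
 "!!e n t. e \<in> Basis ==> l2b (%x. w e t x - W (Suc n) e t x) (R * \<rho> ^ n)"
proof -
 have "\<exists>R. 0 <= R \<and> (\<forall>n. xpb (\<alpha> + 2) (%t x. v t x - U (Suc n) t x) (R * \<rho> ^ n)) \<and>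
  (\<forall>n t. l2b (%x. v t x - U (Suc n) t x) (R * \<rho> ^ n)) \<and>
  (\<forall>e\<in>Basis. \<forall>n t. l2b (%x. w e t x - W (Suc n) e t x) (R * \<rho> ^ n))"
  by (rule v_limit) blast
 from someI_ex[OF this, folded R_def]
 show "0 <= R" "!!n. xpb (\<alpha> + 2) (%t x. v t x - U (Suc n) t x) (R * \<rho> ^ n)"
  "!!n t. l2b (%x. v t x - U (Suc n) t x) (R * \<rho> ^ n)"
  "!!e n t. e \<in> Basis ==> l2b (%x. w e t x - W (Suc n) e t x) (R * \<rho> ^ n)" by auto
qed

lemma \<rho>_small: "0 < \<eta> ==> \<exists>n. R' * \<rho> ^ n + S * (1/2) ^ n < \<eta>"
proof -
 assume "0 < \<eta>"
 have "(%n. R' * \<rho> ^ n + S * (1/2) ^ n) \<longlonglongrightarrow> R' * 0 + S * 0"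
  using \<rho> by (intro tendsto_intros LIMSEQ_realpow_zero) auto
 from order_tendstoD(2)[OF this, of \<eta>] \<open>0 < \<eta>\<close> show ?thesis by (auto simp: eventually_sequentially)
qed

lemma v_measurable: "jm v"
 and w_measurable: "e \<in> Basis ==> jm (w e)"
proof -
 have "case_prod v = (%z. lim (%n. case_prod (U (Suc n)) z))" by (auto simp: v_def)
 then show "jm v" by (simp add: borel_measurable_lim_metric U_measurable)
 have "case_prod (w e) = (%z. lim (%n. case_prod (W (Suc n) e) z))" by (auto simp: w_def)
 then show "e \<in> Basis ==> jm (w e)" by (simp add: borel_measurable_lim_metric W_measurable)
qed

lemma lpb_close:
 fixes f :: "'b => complex"
 assumes p: "1 <= p" and X: "0 <= X" and g: "!!n. lpb M' p (g n) X" and d: "!!n. lpb M' p (%x. f x - g n x) (R * \<rho> ^ n)"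
 shows "lpb M' p f X"
proof (rule lpb_limit)
 fix \<eta> :: real assume "0 < \<eta>"
 then obtain n where n: "R * \<rho> ^ n < \<eta>" using \<rho>_small[of \<eta> R 0] by auto
 have "lpb M' p (%x. g n x + (f x - g n x)) (X + R * \<rho> ^ n)" by (intro lpb_add p g d)
 then have "lpb M' p f (X + R * \<rho> ^ n)" by simp
 then show "lpb M' p f (X + \<eta>)" by (rule lpb_mono) (use n p in auto)
qed (use X p in auto)

lemma v_bounds: "l2b (v t) (2 * C * A)" "xpb (\<alpha> + 2) v (2 * C * A)"
 and w_bounds: "e \<in> Basis ==> l2b (w e t) (2 * C * B)"
proof -
 have nn: "0 <= 2 * C * A" "0 <= 2 * C * B" using C A0 B0 by auto
 show "l2b (v t) (2 * C * A)" by (rule lpb_close[OF _ nn(1) U_bounds(2) R(3)]) simp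
 show "e \<in> Basis ==> l2b (w e t) (2 * C * B)" by (rule lpb_close[OF _ nn(2) W_bounds(2) R(4)]) auto
 show "xpb (\<alpha> + 2) v (2 * C * A)"
  unfolding xpb_def
  by (rule lpb_close[OF _ nn(1) U_bounds(1)[unfolded xpb_def] R(2)[unfolded xpb_def case_prod_diff]]) (use \<alpha> in simp)
qed

lemma v_continuous: "0 < \<eta> ==> \<exists>d>0. \<forall>s. abs (s - t) < d --> l2b (%x. v s x - v t x) \<eta>"
 and w_continuous: "e \<in> Basis ==> 0 < \<eta> ==> \<exists>d>0. \<forall>s. abs (s - t) < d --> l2b (%x. w e s x - w e t x) \<eta>"
proof -
 have r: "(%n. R * \<rho> ^ n) \<longlonglongrightarrow> 0" using \<rho> by (intro tendsto_mult_right_zero LIMSEQ_realpow_zero) auto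
 show "\<exists>d>0. \<forall>s. abs (s - t) < d --> l2b (%x. v s x - v t x) \<eta>" if "0 < \<eta>"
 proof (rule L2_continuous_limit[OF R(3) r _ that])
  show "\<exists>L. \<forall>t t'. abs t <= T --> abs t' <= T --> l2b (%x. U (Suc n) t' x - U (Suc n) t x) (L * abs (t' - t))" for n T
   unfolding U_Suc step_def by (rule sol_L2_lipschitz[OF \<epsilon>(1) \<phi> adm_nF(1)[OF adm]])
 qed
 show "\<exists>d>0. \<forall>s. abs (s - t) < d --> l2b (%x. w e s x - w e t x) \<eta>" if e: "e \<in> Basis" and "0 < \<eta>"
 proof (rule L2_continuous_limit[OF R(4)[OF e] r _ that(2)])
  show "\<exists>L. \<forall>t t'. abs t <= T --> abs t' <= T --> l2b (%x. W (Suc n) e t' x - W (Suc n) e t x) (L * abs (t' - t))" for n T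
   unfolding W_Suc step'_def by (rule sol_L2_lipschitz[OF \<epsilon>(1) \<phi>'[OF e] adm_nF(3)[OF adm e]])
 qed
qed

lemma thr_\<epsilon>:
 "l2b (%x. \<phi> x - cv (K0 (\<epsilon> n) 0) \<phi> x) ((1/2) ^ n)"
 "xpb q (%t x. nF (U n) t x - cv (K0 (\<epsilon> n) 0) (nF (U n) t) x) ((1/2) ^ n)"
 using thr[of n, unfolded thr_def, rule_format, of "\<epsilon> n"] \<epsilon>(1)[of n] by (auto simp: complex_of_real_def)

text \<open>At time 0 the iterate is the data smoothed by heat for the time
  \<open>\<epsilon> n\<close>, which the threshold keeps within \<open>(1/2) ^ n\<close> of the
  data.\<close>

lemma v_initial: "AE x in lborel. v 0 x = \<phi> x"
proof -
 have "l2b (%x. v 0 x - \<phi> x) \<eta>" if \<eta>: "0 < \<eta>" for \<eta>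
 proof -
  obtain n where n: "R * \<rho> ^ n + 1 * (1/2) ^ n < \<eta>" using \<rho>_small[OF \<eta>] by blast
  have "l2b (%x. (v 0 x - U (Suc n) 0 x) - (\<phi> x - cv (K0 (\<epsilon> n) 0) \<phi> x)) (R * \<rho> ^ n + (1/2) ^ n)"
   by (intro lpb_diff R(3) thr_\<epsilon>) simp
  then have "l2b (%x. v 0 x - \<phi> x) (R * \<rho> ^ n + (1/2) ^ n)"
   by (simp add: U_Suc step_def sol_def)
  then show ?thesis by (rule lpb_mono) (use n in auto)
 qed
 then have "AE x in lborel. v 0 x - \<phi> x = 0" by (rule lpb_zero_AE) simp_all
 then show ?thesis by eventually_elim simp
qed

lemma U_dird:
 assumes e: "e \<in> Basis"
 shows "wd e (U (Suc n) t) (W (Suc n) e t)"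
 by (rule wd_dird[OF e adm_dird[OF adm e] adm_cont[OF adm e] U_bounds(2) W_bounds(2)[OF e]])

lemma v_wd:
 assumes e: "e \<in> Basis"
 shows "wd e (v t) (w e t)"
proof (rule wd_limit[OF e v_bounds(1) w_bounds[OF e]])
 fix \<eta> :: real assume "0 < \<eta>"
 then obtain n where n: "R * \<rho> ^ n <= \<eta>" using \<rho>_small[of \<eta> R 0] by (auto intro: less_imp_le)
 have "l2b (%x. v t x - U (Suc n) t x) \<eta>" "l2b (%x. w e t x - W (Suc n) e t x) \<eta>"
  using lpb_mono[OF R(3) n] lpb_mono[OF R(4)[OF e] n] by auto
 then show "\<exists>f' g' X' Y'. wd e f' g' \<and> l2b f' X' \<and> l2b g' Y' \<and>
   l2b (%x. v t x - f' x) \<eta> \<and> l2b (%x. w e t x - g' x) \<eta>"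
  using U_dird[OF e] U_bounds(2) W_bounds(2)[OF e] by blast
qed

lemma conjugate_exponents: "1 < \<alpha> + 2" "1 / (\<alpha> + 2) + 1 / q = 1"
 using \<alpha> by (auto simp: q_def field_simps)

lemma nF_v_xpb: "xpb q (nF v) (\<kappa> * (2 * C * A))"
 using A0 C by (intro nF_xpb v_bounds mult_right_mono) auto

text \<open>The Laplacian is integrated by parts once, onto a first derivative of the test function:
  gradients of the iterates converge, while their second derivatives have no bound uniform in
  \<open>n\<close>.\<close>

lemma step_equation:
 assumes \<psi>: "l2b \<psi> Y" "!!e. e \<in> Basis ==> l2b (\<psi>' e) Y" "!!e. e \<in> Basis ==> dird e \<psi> (\<psi>' e)"
  "!!e x. e \<in> Basis ==> continuous_on UNIV (%s. \<psi>' e (x + s *\<^sub>R e))"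
 shows "(LL x. U (Suc n) t x * \<psi> x) = (LL x. cv (K0 (\<epsilon> n) 0) \<phi> x * \<psi> x)
   - \<i> * (\<Sum>e\<in>Basis. LL s. tsg t s * (LL x. W (Suc n) e s x * \<psi>' e x))
   + (LL s. tsg t s * (LL x. cv (K0 (\<epsilon> n) 0) (nF (U n) s) x * \<psi> x))"
proof -
 define F where "F = nF (U n)"
 define r where "r = \<epsilon> n"
 have r: "0 < r" unfolding r_def by (rule \<epsilon>)
 have F: "locL2 F" unfolding F_def by (rule adm_nF(1)[OF adm])
 \<comment> \<open>Second derivatives of the new iterate, written as first derivatives of its
   gradient.\<close>
 define Z where "Z e = sol (K1 r e) (\<phi>' e) (dnF (U n) (W n e))" for e
 have Z: "locL2 (Z e)" if e: "e \<in> Basis" for e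
  unfolding Z_def by (rule locL2_sol[OF kfam_gk1[OF r e] \<phi>'[OF e] adm_nF(3)[OF adm e]])
 have W2: "locL2 (W (Suc n) e)" if e: "e \<in> Basis" for e by (rule adm_locL2'[OF adm e])
 have KL: "sol (KL r) \<phi> F s x = (\<Sum>e\<in>Basis. Z e s x)" for s x
  unfolding sol_KL_sum[OF r \<phi> F] unfolding Z_def F_def r_def by (intro sum.cong refl step_dird(4)[OF adm \<epsilon>(1)])
 have H: "locL2 (%s. cv (K0 r 0) (F s))"
  using locL2_heat[OF r F] by (simp add: complex_of_real_def)
 have zw: "(LL x. Z e s x * \<psi> x) = - (LL x. W (Suc n) e s x * \<psi>' e x)" if e: "e \<in> Basis" for e s
 proof -
  obtain X1 where X1: "l2b (Z e s) X1" using locL2_slice[OF Z[OF e]] by blast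
  note X2 = W_bounds(2)[OF e, of n s]
  have d: "dird e (%x. W (Suc n) e s x * \<psi> x) (%x. W (Suc n) e s x * \<psi>' e x + Z e s x * \<psi> x)"
   unfolding W_Suc Z_def r_def by (intro dird_mult step_dird(2)[OF adm \<epsilon>(1)] \<psi>(3) e)
  have c: "continuous_on UNIV (%t. W (Suc n) e s (x + t *\<^sub>R e) * \<psi>' e (x + t *\<^sub>R e) + Z e s (x + t *\<^sub>R e) * \<psi> (x + t *\<^sub>R e))" for x
  proof (intro continuous_on_add continuous_on_mult)
   show "continuous_on UNIV (%t. W (Suc n) e s (x + t *\<^sub>R e))" by (rule adm_cont[OF adm e])
   show "continuous_on UNIV (%t. \<psi>' e (x + t *\<^sub>R e))" by (rule \<psi>(4)[OF e])
   show "continuous_on UNIV (%t. \<psi> (x + t *\<^sub>R e))" by (rule dird_line_continuous[OF \<psi>(3)[OF e]])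
   show "continuous_on UNIV (%t. Z e s (x + t *\<^sub>R e))" unfolding Z_def r_def by (rule dird_line_continuous[OF step_dird(3)[OF adm \<epsilon>(1) e]])
  qed
  note i = lpb_2_integrable_mult(1)[OF X2 \<psi>(2)[OF e]] lpb_2_integrable_mult(1)[OF X1 \<psi>(1)] lpb_2_integrable_mult(1)[OF X2 \<psi>(1)]
  have "(LL x. W (Suc n) e s x * \<psi>' e x + Z e s x * \<psi> x) = 0"
   by (rule integral_dird_zero[OF d c i(3) Bochner_Integration.integrable_add[OF i(1,2)]])
  then show ?thesis using i by (simp add: add_eq_0_iff2)
 qed
 define P where "P = sol_rhs r \<phi> F"
 have P: "locL2 P" unfolding P_def by (rule locL2_sol_rhs[OF r \<phi> F])
 have Ps: "(LL x. P s x * \<psi> x) = - \<i> * (\<Sum>e\<in>Basis. LL x. W (Suc n) e s x * \<psi>' e x) + (LL x. cv (K0 r 0) (F s) x * \<psi> x)" for s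
 proof -
  have i1: "integrable lborel (%x. Z e s x * \<psi> x)" if e: "e \<in> Basis" for e
   using locL2_slice[OF Z[OF e], of s] lpb_2_integrable_mult(1)[OF _ \<psi>(1)] by blast
  have i2: "integrable lborel (%x. cv (K0 r 0) (F s) x * \<psi> x)"
   using locL2_slice[OF H, of s] lpb_2_integrable_mult(1)[OF _ \<psi>(1)] by blast
  have "(LL x. P s x * \<psi> x) = (LL x. \<i> * (\<Sum>e\<in>Basis. Z e s x * \<psi> x) + cv (K0 r 0) (F s) x * \<psi> x)"
   unfolding P_def sol_rhs_def KL by (simp add: distrib_right sum_distrib_right mult.assoc)
  also have "\<dots> = \<i> * (\<Sum>e\<in>Basis. LL x. Z e s x * \<psi> x) + (LL x. cv (K0 r 0) (F s) x * \<psi> x)"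
   using i1 i2 by simp
  also have "(\<Sum>e\<in>Basis. LL x. Z e s x * \<psi> x) = - (\<Sum>e\<in>Basis. LL x. W (Suc n) e s x * \<psi>' e x)"
   by (simp add: zw sum_negf)
  finally show ?thesis by simp
 qed
 obtain Y1 where Y1: "l2b (%x. LL s. tsg t s * P s x) Y1" using locL2_pairing(3)[OF P \<psi>(1)] by blast
 have Hp: "l2b (cv (K0 r 0) \<phi>) A" using lpb_heat[OF r _ \<phi>] by (simp add: complex_of_real_def)
 have "(LL x. U (Suc n) t x * \<psi> x) = (LL x. cv (K0 r 0) \<phi> x * \<psi> x + (LL s. tsg t s * P s x) * \<psi> x)"
  unfolding U_Suc step_def sol_time(1)[OF \<epsilon>(1) \<phi> adm_nF(1)[OF adm]] P_def r_def F_def by (simp add: distrib_right)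
 also have "\<dots> = (LL x. cv (K0 r 0) \<phi> x * \<psi> x) + (LL s. tsg t s * (LL x. P s x * \<psi> x))"
  using lpb_2_integrable_mult(1)[OF Hp \<psi>(1)] lpb_2_integrable_mult(1)[OF Y1 \<psi>(1)] locL2_pairing(2)[OF P \<psi>(1)] by simp
 also have "(LL s. tsg t s * (LL x. P s x * \<psi> x)) =
   (LL s. - \<i> * (\<Sum>e\<in>Basis. tsg t s * (LL x. W (Suc n) e s x * \<psi>' e x)) + tsg t s * (LL x. cv (K0 r 0) (F s) x * \<psi> x))"
  unfolding Ps by (simp add: distrib_left sum_distrib_left mult.left_commute)
 also have "\<dots> = - \<i> * (\<Sum>e\<in>Basis. LL s. tsg t s * (LL x. W (Suc n) e s x * \<psi>' e x)) + (LL s. tsg t s * (LL x. cv (K0 r 0) (F s) x * \<psi> x))"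
 proof -
  have "integrable lborel (%s. tsg t s * (LL x. W (Suc n) e s x * \<psi>' e x))" if "e \<in> Basis" for e
   by (rule locL2_pairing(1)[OF W2[OF that] \<psi>(2)[OF that]])
  then show ?thesis using locL2_pairing(1)[OF H \<psi>(1)] by simp
 qed
 finally show ?thesis by (simp add: r_def F_def)
qed

end

lemma norm_tsg_integral_le:
 fixes p :: "real => complex"
 assumes b: "!!s. norm (p s) <= b" and b0: "0 <= b"
 shows "norm (LL s. tsg t s * p s) <= 2 * abs t * b"
proof -
 have "ennreal (norm (LL s. tsg t s * p s)) <= (NN s. ennreal (norm (tsg t s * p s)))"
  by (rule norm_integral_le_nn_integral)
 also have "\<dots> <= (NN s. ennreal (norm (tsg t s)) * ennreal b)"
  using b b0 by (intro nn_integral_mono) (simp add: norm_mult mult_left_mono ennreal_mult''[symmetric] ennreal_leI)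
 also have "\<dots> = (NN s. ennreal (norm (tsg t s))) * ennreal b" by (rule nn_integral_multc) measurable
 also have "\<dots> <= ennreal (2 * abs t) * ennreal b" by (intro mult_right_mono nn_integral_norm_tsg_le) simp
 also have "\<dots> = ennreal (2 * abs t * b)" by (rule ennreal_mult''[symmetric, OF b0])
 finally have "ennreal (norm (LL s. tsg t s * p s)) <= ennreal (2 * abs t * b)" .
 then show ?thesis by (subst (asm) ennreal_le_iff) (use b0 in auto)
qed

lemma locL2_pairing_diff:
 fixes F G :: "real => 'a::euclidean_space => complex"
 assumes F: "locL2 F" and G: "locL2 G" and \<psi>: "l2b \<psi> Y" and d: "!!s. l2b (%x. F s x - G s x) D"
 shows "norm ((LL s. tsg t s * (LL x. F s x * \<psi> x)) - (LL s. tsg t s * (LL x. G s x * \<psi> x))) <= 2 * abs t * (D * Y)"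
proof -
 have "(LL s. tsg t s * (LL x. F s x * \<psi> x)) - (LL s. tsg t s * (LL x. G s x * \<psi> x))
   = (LL s. tsg t s * ((LL x. F s x * \<psi> x) - (LL x. G s x * \<psi> x)))"
  using locL2_pairing(1)[OF F \<psi>] locL2_pairing(1)[OF G \<psi>] by (simp add: right_diff_distrib)
 also have "norm \<dots> <= 2 * abs t * (D * Y)"
 proof (rule norm_tsg_integral_le)
  show "0 <= D * Y" using lpb_nonneg[OF d] lpb_nonneg[OF \<psi>] by simp
  fix s
  obtain X X' where "l2b (F s) X" "l2b (G s) X'" using locL2_slice[OF F] locL2_slice[OF G] by metis
  then show "norm ((LL x. F s x * \<psi> x) - (LL x. G s x * \<psi> x)) <= D * Y"
   by (rule lpb_pairing_diff[OF d _ _ \<psi>])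
 qed
 finally show ?thesis .
qed

lemma xpb_pairing_diff:
 fixes F G :: "real => 'a::euclidean_space => complex"
 assumes F: "xpb q F X" and G: "xpb q G X'" and d: "xpb q (%t x. F t x - G t x) D"
  and \<psi>: "lpb lborel p \<psi> Y" and pq: "1 < p" "1 < q" "1 / p + 1 / q = 1"
 shows "norm ((LL s. tsg t s * (LL x. F s x * \<psi> x)) - (LL s. tsg t s * (LL x. G s x * \<psi> x)))
   <= D * ((2 * abs t) powr (1 / p) * Y)"
proof -
 note i = xpb_pairing(1)[OF F \<psi> pq, of t] xpb_pairing(1)[OF G \<psi> pq, of t] xpb_pairing(1)[OF d \<psi> pq, of t]
 have "(LL s. tsg t s * (LL x. F s x * \<psi> x)) - (LL s. tsg t s * (LL x. G s x * \<psi> x))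
   = (LL s. tsg t s * (LL x. F s x * \<psi> x) - tsg t s * (LL x. G s x * \<psi> x))"
  using i by simp
 also have "\<dots> = (LL s. tsg t s * (LL x. (F s x - G s x) * \<psi> x))"
 proof (rule integral_cong_AE)
  show "AE s in lborel. tsg t s * (LL x. F s x * \<psi> x) - tsg t s * (LL x. G s x * \<psi> x) = tsg t s * (LL x. (F s x - G s x) * \<psi> x)"
   using xpb_pairing(3)[OF F \<psi> pq, of t] xpb_pairing(3)[OF G \<psi> pq, of t]
  proof eventually_elim
   fix s assume "tsg t s \<noteq> 0 --> integrable lborel (%x. F s x * \<psi> x)" "tsg t s \<noteq> 0 --> integrable lborel (%x. G s x * \<psi> x)"
   then show "tsg t s * (LL x. F s x * \<psi> x) - tsg t s * (LL x. G s x * \<psi> x) = tsg t s * (LL x. (F s x - G s x) * \<psi> x)"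
    by (cases "tsg t s = 0") (simp_all add: left_diff_distrib right_diff_distrib)
  qed
 qed (use i in auto)
 also have "norm \<dots> <= D * ((2 * abs t) powr (1 / p) * Y)" by (rule xpb_pairing(2)[OF d \<psi> pq])
 finally show ?thesis .
qed

lemma LIMSEQ_norm_diff_le:
 fixes a :: "nat => complex"
 assumes "!!n. norm (a n - l) <= r n" "r \<longlonglongrightarrow> 0"
 shows "a \<longlonglongrightarrow> l"
 using Lim_null_comparison[OF always_eventually[OF allI[OF assms(1)]] assms(2)] by (rule LIM_zero_cancel)

context iteration
begin

lemma locL2_w: "e \<in> Basis ==> locL2 (w e)"
 unfolding locL2_def using w_measurable w_bounds by blast

lemma heat_\<epsilon>: "l2b (cv (K0 (\<epsilon> n) 0) \<phi>) A" "locL2 (%s. cv (K0 (\<epsilon> n) 0) (nF (U n) s))"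
 "xpb q (%s. cv (K0 (\<epsilon> n) 0) (nF (U n) s)) (\<kappa> * (2 * C * A))"
 using lpb_heat[OF \<epsilon>(1) _ \<phi>, of n] locL2_heat[OF \<epsilon>(1) adm_nF(1)[OF adm], of n n] xpb_heat[OF \<epsilon>(1) q(1) adm_nF(2)[OF adm], of n n]
 by (simp_all add: complex_of_real_def)

text \<open>Data and gradient terms converge through L^2 pairings. The forcing converges in the
  space-time norm with exponent \<open>q\<close>, which is paired with the bound of \<psi> in the
  conjugate exponent.\<close>

lemma v_equation:
 assumes \<psi>: "l2b \<psi> Y" "!!e. e \<in> Basis ==> l2b (\<psi>' e) Y" "!!e. e \<in> Basis ==> dird e \<psi> (\<psi>' e)"
  "!!e x. e \<in> Basis ==> continuous_on UNIV (%s. \<psi>' e (x + s *\<^sub>R e))" and \<psi>p: "lpb lborel (\<alpha> + 2) \<psi> Y'"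
 shows "(LL x. v t x * \<psi> x) = (LL x. \<phi> x * \<psi> x) - \<i> * (\<Sum>e\<in>Basis. LL s. tsg t s * (LL x. w e s x * \<psi>' e x))
   + (LL s. tsg t s * (LL x. nF v s x * \<psi> x))"
proof -
 have r0: "(%n. K * (R * \<rho> ^ n + L * (1/2) ^ n)) \<longlonglongrightarrow> 0" for K L
  using \<rho> by (intro tendsto_mult_right_zero tendsto_add_zero LIMSEQ_realpow_zero) auto
 have k: "norm (a - b) <= X ==> norm (b - a) <= X" for a b :: complex and X by (simp add: norm_minus_commute)
 have "(%n. LL x. U (Suc (Suc n)) t x * \<psi> x) \<longlonglongrightarrow> (LL x. v t x * \<psi> x)"
  by (rule LIMSEQ_norm_diff_le[OF k[OF lpb_pairing_diff[OF R(3) v_bounds(1) U_bounds(2) \<psi>(1)]]])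
    (use r0[THEN LIMSEQ_Suc, of Y 0] in \<open>simp add: ac_simps\<close>)
 moreover have "(%n. LL x. cv (K0 (\<epsilon> (Suc n)) 0) \<phi> x * \<psi> x) \<longlonglongrightarrow> (LL x. \<phi> x * \<psi> x)"
  by (rule LIMSEQ_norm_diff_le[OF k[OF lpb_pairing_diff[OF thr_\<epsilon>(1) \<phi> heat_\<epsilon>(1) \<psi>(1)]]])
    (auto intro!: tendsto_mult_left_zero LIMSEQ_realpow_zero LIMSEQ_Suc)
 moreover have "(%n. LL s. tsg t s * (LL x. W (Suc (Suc n)) e s x * \<psi>' e x)) \<longlonglongrightarrow> (LL s. tsg t s * (LL x. w e s x * \<psi>' e x))"
  if e: "e \<in> Basis" for e
  by (rule LIMSEQ_norm_diff_le[OF k[OF locL2_pairing_diff[OF locL2_w[OF e] adm_locL2'[OF adm e] \<psi>(2)[OF e] R(4)[OF e]]]])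
    (use r0[THEN LIMSEQ_Suc, of "2 * abs t * Y" 0] in \<open>simp add: ac_simps\<close>)
 moreover have "(%n. LL s. tsg t s * (LL x. cv (K0 (\<epsilon> (Suc n)) 0) (nF (U (Suc n)) s) x * \<psi> x)) \<longlonglongrightarrow> (LL s. tsg t s * (LL x. nF v s x * \<psi> x))"
 proof (rule LIMSEQ_norm_diff_le[OF k])
  fix n
  note nF_diff_xpb[OF U_bounds(1) v_bounds(2) R(2), of n]
  from xpb_add[OF less_imp_le[OF q(1)] this thr_\<epsilon>(2)[of "Suc n"]]
  have "xpb q (%s x. nF v s x - cv (K0 (\<epsilon> (Suc n)) 0) (nF (U (Suc n)) s) x) (\<kappa> * (R * \<rho> ^ n) + (1/2) ^ Suc n)" by simp
  from xpb_pairing_diff[OF nF_v_xpb heat_\<epsilon>(3) this \<psi>p conjugate_exponents(1) q(1) conjugate_exponents(2)]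
  show "norm ((LL s. tsg t s * (LL x. nF v s x * \<psi> x)) - (LL s. tsg t s * (LL x. cv (K0 (\<epsilon> (Suc n)) 0) (nF (U (Suc n)) s) x * \<psi> x)))
    <= (\<kappa> * (R * \<rho> ^ n) + (1/2) ^ Suc n) * ((2 * abs t) powr (1 / (\<alpha> + 2)) * Y')" .
 qed (use \<rho> in \<open>auto intro!: tendsto_mult_left_zero tendsto_mult_right_zero tendsto_add_zero LIMSEQ_realpow_zero\<close>)
 ultimately have "(%n. LL x. U (Suc (Suc n)) t x * \<psi> x) \<longlonglongrightarrow> (LL x. \<phi> x * \<psi> x) - \<i> * (\<Sum>e\<in>Basis. LL s. tsg t s * (LL x. w e s x * \<psi>' e x))
   + (LL s. tsg t s * (LL x. nF v s x * \<psi> x))"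
  using step_equation[OF \<psi>(1-4)] by (simp only:) (intro tendsto_intros)
 then show ?thesis by (rule LIMSEQ_unique[rotated]) fact
qed

text \<open>The Duhamel part of \<open>v\<close> is a quarter of \<open>\<phi>\<close> in \<open>L\<^sup>2\<close>, uniformly in time.\<close>

lemma v_pairing:
 assumes e: "0 < e" and h: "l2b h H"
 shows "norm ((LL x. v t x * cv (gker (Complex e (- t))) h x) - (LL x. \<phi> x * cv (gker (of_real e)) h x)) <= A / 4 * H"
proof -
 let ?\<theta> = "cv (gker (Complex e (- t))) h"
 have \<theta>: "l2b ?\<theta> H" and he: "l2b (cv (gker (of_real e)) h) H" using e by (auto intro!: lpb_2_cv_gker h)
 have z: "l2b (%x::'a. 0::complex) 0" by simp
 have bd: "norm ((LL x. U (Suc n) t x * ?\<theta> x) - (LL x. cv (K0 (\<epsilon> n) 0) \<phi> x * cv (gker (of_real e)) h x)) <= A / 4 * H" for n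
 proof -
  \<comment> \<open>With zero data the flow is the Duhamel part alone.\<close>
  have "l2b (sol (K0 (\<epsilon> n)) (%x. 0) (nF (U n)) t) (C * (0 + \<kappa> * (2 * C * A)))"
   using S2[OF \<epsilon>(1) adm_nF(1)[OF adm] _ z] adm_nF(2)[OF adm] by (simp add: q_def)
  moreover have "C * (0 + \<kappa> * (2 * C * A)) <= A / 4" using mult_right_mono[OF \<kappa>_small(1) A0] by (simp add: ac_simps)
  ultimately have d: "l2b (%x. U (Suc n) t x - cv (K0 (\<epsilon> n) t) \<phi> x) (A / 4)"
   unfolding U_Suc step_def sol_def by (simp add: lpb_mono[of _ _ _ "C * (\<kappa> * (2 * C * A))"] sol_def[abs_def])
  have K: "l2b (cv (K0 (\<epsilon> n) t) \<phi>) A" by (rule lpb_2_cv_gker[OF _ \<phi>]) (simp add: \<epsilon>)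
  \<comment> \<open>The times \<open>Complex (\<epsilon> n) t\<close> and
    \<open>Complex e (- t)\<close> add up to a real heat time, so the pairing of the free part does
    not depend on \<open>t\<close>.\<close>
  have "cv (K0 (\<epsilon> n) t) ?\<theta> x = cv (gker (Complex (\<epsilon> n) 0)) (cv (gker (of_real e)) h) x" for x
   using e \<epsilon>(1)[of n] by (simp add: cv_gker_gker[OF _ _ h] complex_add complex_of_real_def)
  then have "(LL x. cv (K0 (\<epsilon> n) t) \<phi> x * ?\<theta> x) = (LL x. cv (K0 (\<epsilon> n) 0) \<phi> x * cv (gker (of_real e)) h x)"
   using \<epsilon>(1)[of n] by (simp add: gker_pairing[OF _ \<phi> \<theta>] gker_pairing[OF _ \<phi> he])
  then show ?thesis using lpb_pairing_diff[OF d U_bounds(2) K \<theta>] by simp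
 qed
 have "norm (((LL x. v t x * ?\<theta> x) - (LL x. \<phi> x * cv (gker (of_real e)) h x))) <= A / 4 * H + (R * \<rho> ^ n * H + (1/2) ^ n * H)" for n
  using norm_triangle_le_diff[OF order_refl, of "(LL x. v t x * ?\<theta> x) - (LL x. U (Suc n) t x * ?\<theta> x)"]
   lpb_pairing_diff[OF R(3) v_bounds(1) U_bounds(2) \<theta>, of t n] lpb_pairing_diff[OF thr_\<epsilon>(1) \<phi> heat_\<epsilon>(1) he, of n] bd[of n]
   norm_triangle_ineq[of "(LL x. v t x * ?\<theta> x) - (LL x. U (Suc n) t x * ?\<theta> x)" "(LL x. U (Suc n) t x * ?\<theta> x) - (LL x. cv (K0 (\<epsilon> n) 0) \<phi> x * cv (gker (of_real e)) h x)"]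
   norm_triangle_ineq4[of "(LL x. v t x * ?\<theta> x) - (LL x. cv (K0 (\<epsilon> n) 0) \<phi> x * cv (gker (of_real e)) h x)" "(LL x. \<phi> x * cv (gker (of_real e)) h x) - (LL x. cv (K0 (\<epsilon> n) 0) \<phi> x * cv (gker (of_real e)) h x)"]
  by simp
 moreover have "(%n. A / 4 * H + (R * \<rho> ^ n * H + (1/2) ^ n * H)) \<longlonglongrightarrow> A / 4 * H + (R * 0 * H + 0 * H)"
  using \<rho> by (intro tendsto_intros LIMSEQ_realpow_zero) auto
 ultimately show ?thesis by (intro LIMSEQ_le_const[of "%n. A / 4 * H + (R * \<rho> ^ n * H + (1/2) ^ n * H)"]) auto
qed

end

section \<open>A Gagliardo--Nirenberg inequality\<close>

lemma wd_cnj: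
 assumes "wd e f g"
 shows "wd e (%x. cnj (f x)) (%x. cnj (g x))"
proof -
 have "cv (gk1 e z) (%x. cnj (f x)) x = cv (gker z) (%x. cnj (g x)) x" if z: "0 < Re z" for z x
 proof -
  have "cv (gk1 e z) (%x. cnj (f x)) x = cnj (cv (gk1 e (cnj z)) f x)" "cv (gker z) (%x. cnj (g x)) x = cnj (cv (gker (cnj z)) g x)"
   unfolding cnj_cv using z by (simp_all add: gk1_def[abs_def] cnj_gker)
  then show ?thesis using assms z by (simp add: wd_def)
 qed
 then show ?thesis by (simp add: wd_def)
qed

section \<open>Energy along the heat flow and interpolation over dyadic times\<close>

lemma cv_pairing_product:
 fixes k :: "'a::euclidean_space => complex"
 assumes k: "gbd A c k" and f: "l2b f B" and g: "l2b g B'"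
 shows "integrable lborel2 (%(x, y). k (x - y) * f y * g x)"
  and "(LL x. cv k f x * g x) = (LINT p|lborel2. (case p of (x, y) => k (x - y) * f y * g x))"
proof -
 have [measurable]: "bm k" "bm f" "bm g"
  using k f g by (auto simp: lpb_def gbd_def)
 show i: "integrable lborel2 (%(x, y). k (x - y) * f y * g x)"
  using cv_pairing_finite[OF k f g] by (intro integrable_pairI) (auto simp: top.not_eq_extremum[symmetric] top_unique)
 show "(LL x. cv k f x * g x) = (LINT p|lborel2. (case p of (x, y) => k (x - y) * f y * g x))"
  using lborel_pair.integral_fst'[OF i] by (simp add: cv_def)
qed

lemma gker_pairing_derivative:
 fixes f g :: "'a::euclidean_space => complex"
 assumes z: "0 < Re z" and f: "l2b f B" and g: "l2b g B'"
 shows "((%z. LL x. cv (gker z) f x * g x) has_field_derivative (LL x. cv (gker_deriv z) f x * g x)) (at z)"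
proof -
 define r m where "r = Re z / 2" and "m = norm z + r"
 have r: "0 < r" using z by (simp add: r_def)
 have near: "r <= Re w" "norm w <= m" if "w \<in> ball z r" for w
  using that abs_Re_le_cmod[of "w - z"] norm_triangle_ineq2[of w z] by (auto simp: r_def m_def dist_norm norm_minus_commute)
 have "0 < m" using r by (simp add: m_def add_nonneg_pos)
 from gker_deriv_majorant[OF r this] obtain A c where "0 < c" "0 <= A" "!!w x. r <= Re w ==> norm w <= m ==> norm (gker_deriv w (x::'a)) <= A * gauss c x"
  by metis
 then have A: "gbd A c (gker_deriv w :: 'a => complex)" if "w \<in> ball z r" for w using near[OF that] by (auto simp: gbd_def)
 have A2: "norm (gker_deriv w (x::'a)) <= A * gauss c x" if "w \<in> ball z r" for w x using A[OF that] by (simp add: gbd_def)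
 have G: "gbd A c (%x::'a. of_real (A * gauss c x))" using A[of z] r by (auto simp: gbd_def norm_mult abs_of_pos gauss_pos)
 let ?h = "%k (x, y). k (x - y) * f y * g x"
 have k: "gbd A' c' (gker w :: 'a => complex) ==> integrable lborel2 (?h (gker w))" for w A' c' by (rule cv_pairing_product(1)[OF _ f g])
 have "((%w. LINT p|lborel2. ?h (gker w) p) has_field_derivative (LINT p|lborel2. ?h (gker_deriv z) p)) (at z)"
 proof (rule has_field_derivative_integral_dominated[OF r, where w="%p. norm (?h (%x. of_real (A * gauss c x)) p)"])
  fix w and p :: "'a \<times> 'a" assume w: "w \<in> ball z r"
  obtain x y where p: "p = (x, y)" by (cases p)
  show "((%w. ?h (gker w) p) has_field_derivative ?h (gker_deriv w) p) (at w)"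
   unfolding p using near(1)[OF w] r by (auto intro!: DERIV_cmult_right gker_has_field_derivative)
  show "norm (?h (gker_deriv w) p) <= norm (?h (%x. of_real (A * gauss c x)) p)"
   using A2[OF w, of "x - y"] A[OF w] gauss_pos[of c "x - y"]
   by (auto simp: p norm_mult gbd_def abs_mult intro!: mult_right_mono)
 next
  fix w assume "w \<in> ball z r"
  then have "0 < Re w" using near(1) r by fastforce
  then show "integrable lborel2 (?h (gker w))" using gbd_gker_ex k by blast
 qed (use cv_pairing_product(1)[OF G f g] cv_pairing_product(1)[OF A f g] r in auto)
 moreover have "(LINT p|lborel2. ?h (gker w) p) = (LL x. cv (gker w) f x * g x)" if "w \<in> ball z r" for w
 proof -
  have "0 < Re w" using near(1)[OF that] r by simp
  then obtain A' c' where "gbd A' c' (gker w :: 'a => complex)" using gbd_gker_ex by blast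
  from cv_pairing_product(2)[OF this f g] show ?thesis by simp
 qed
 ultimately show ?thesis
  using cv_pairing_product(2)[OF A f g] r by (auto intro: has_field_derivative_transform_within_open[of _ _ z "ball z r"])
qed

text \<open>The derivative of the quadratic form in the heat time is the pairing of \<open>u\<close>
  with its own Laplacian. Moving one derivative to each factor leaves, for every direction, the
  pairing of \<open>w e\<close> with its own flow, at most \<open>B^2\<close> by the L^2
  contraction.\<close>

lemma sobolev_energy:
 fixes u :: "'a::euclidean_space => complex" and a b B :: real
 assumes u: "l2b u A" and w: "!!e. e \<in> Basis ==> l2b (w e) B" "!!e. e \<in> Basis ==> wd e u (w e)"
  and a: "0 < a" and b: "0 < b"
 shows "norm ((LL x. cv (gker a) u x * cnj (u x)) - (LL x. cv (gker b) u x * cnj (u x))) <= DIM('a) * B^2 * abs (a - b)"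
proof -
 have c: "l2b (%x. cnj (f x)) X" if "l2b f X" for f :: "'a => complex" and X by (rule lpb_cong_norm[OF that]) (use lpb_measurable[OF that] in auto)
 have der: "norm (LL x. cv (gker_deriv z) u x * cnj (u x)) <= DIM('a) * B^2" if z: "0 < Re z" for z
 proof -
  have gk1: "l2b (cv (gk1 e z) (w e)) X ==> integrable lborel (%x. cv (gk1 e z) (w e) x * cnj (u x))" for e X
   by (rule lpb_2_integrable_mult(1)[OF _ c[OF u]])
  have e: "norm (LL x. cv (gk1 e z) (w e) x * cnj (u x)) <= B^2 \<and> integrable lborel (%x. cv (gk1 e z) (w e) x * cnj (u x))" if e: "e \<in> Basis" for e
  proof -
   obtain A1 c1 where 1: "gbd A1 c1 (gk1 e z)" using gbd_gk1_ex[OF z e] by blast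
   have "(LL x. cv (gk1 e z) (w e) x * cnj (u x)) = (LL x. w e x * cv (%y. - gk1 e z y) (%y. cnj (u y)) x)"
    unfolding cv_pairing[OF 1 w(1)[OF e] c[OF u]] by (simp add: gk1_def)
   also have "\<dots> = (LL x. w e x * - cv (gker z) (%y. cnj (w e y)) x)"
    using wd_cnj[OF w(2)[OF e]] z by (simp add: cv_def wd_def)
   finally have "norm (LL x. cv (gk1 e z) (w e) x * cnj (u x)) <= B * B"
    using lpb_2_integrable_mult(2)[OF w(1)[OF e] lpb_2_cv_gker[OF z c[OF w(1)[OF e]]]] by simp
   then show ?thesis using gk1[OF gbd_young[OF 1 _ w(1)[OF e]]] by (simp add: power2_eq_square)
  qed
  have "cv (gker_deriv z) u x = (\<Sum>e\<in>Basis. cv (gk1 e z) (w e) x)" for x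
  proof -
   have "integrable lborel (%y. gk2 e z (x - y) * u y)" if "e \<in> Basis" for e
    using gbd_gk2_ex[OF z that] cv_integrable(1)[OF _ u] by blast
   then show ?thesis using wd_gk2[OF w(2) _ z u w(1)]
    by (simp add: cv_def sum_gk2[symmetric] sum_distrib_right)
  qed
  then have "(LL x. cv (gker_deriv z) u x * cnj (u x)) = (\<Sum>e\<in>Basis. LL x. cv (gk1 e z) (w e) x * cnj (u x))"
   using e by (simp add: sum_distrib_right)
  also have "norm \<dots> <= (\<Sum>e\<in>(Basis::'a set). B^2)" using e by (intro order_trans[OF norm_sum] sum_mono) auto
  finally show ?thesis by simp
 qed
 have "norm ((LL x. cv (gker a) u x * cnj (u x)) - (LL x. cv (gker b) u x * cnj (u x))) <= DIM('a) * B^2 * norm (complex_of_real a - complex_of_real b)"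
  by (rule field_differentiable_bound[where S="{z. 0 < Re z}"])
    (use a b der gker_pairing_derivative[OF _ u c[OF u]] in \<open>auto intro: convex_halfspace_Re_gt has_field_derivative_at_within\<close>)
 then show ?thesis by (simp flip: of_real_diff)
qed

text \<open>By the semigroup law the square of the norm is the second difference of the energy
  \<open>h\<close> at the times \<open>2 * a\<close>, \<open>a + b\<close> and \<open>2 * b\<close>.
  A Lipschitz energy therefore gives the square root of \<open>abs (a - b)\<close>.\<close>

lemma heat_diff_L2:
 fixes u :: "'a::euclidean_space => complex" and a b B :: real
 assumes u: "l2b u A" and w: "!!e. e \<in> Basis ==> l2b (w e) B" "!!e. e \<in> Basis ==> wd e u (w e)" and B: "0 <= B"
  and a: "0 < a" and b: "0 < b"
 shows "l2b (%x. cv (gker a) u x - cv (gker b) u x) (sqrt (2 * DIM('a) * abs (a - b)) * B)"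
proof (rule l2b_self_pairing)
 have c: "l2b (%x. cnj (u x)) A" by (rule lpb_cong_norm[OF u]) (use lpb_measurable[OF u] in auto)
 have H: "l2b (cv (gker s) u) A" "l2b (%x. cnj (cv (gker s) u x)) A" if "0 < s" for s :: real
  using that lpb_2_cv_gker[OF _ u] lpb_2_cv_gker[OF _ c] by (simp_all add: cnj_cv cnj_gker)
 show "l2b (%x. cv (gker a) u x - cv (gker b) u x) (A + A)" by (intro lpb_diff H a b) simp
 define h where "h s = (LL x. cv (gker (complex_of_real s)) u x * cnj (u x))" for s
 have hh: "(LL x. cv (gker s) u x * cnj (cv (gker t) u x)) = h (s + t)" if "0 < s" "0 < t" for s t :: real
  using that gker_pairing[OF _ H(1)[OF that(1)] c, of "of_real t"]
  by (simp add: cnj_cv cnj_gker h_def cv_gker_gker[OF _ _ u] add.commute)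
 note i = lpb_2_integrable_mult(1)[OF H(1) H(2)]
 have "(LL x. (cv (gker a) u x - cv (gker b) u x) * cnj (cv (gker a) u x - cv (gker b) u x)) = (h (a + a) - h (a + b)) + (h (b + b) - h (a + b))"
  using a b i by (simp add: algebra_simps hh)
 also have "norm \<dots> <= DIM('a) * B^2 * abs ((a + a) - (a + b)) + DIM('a) * B^2 * abs ((b + b) - (a + b))"
  unfolding h_def using a b by (intro norm_triangle_mono sobolev_energy[OF u w]) auto
 also have "\<dots> = (sqrt (2 * DIM('a) * abs (a - b)) * B)^2" by (simp add: power_mult_distrib abs_minus_commute algebra_simps)
 finally show "norm (LL x. (cv (gker a) u x - cv (gker b) u x) * cnj (cv (gker a) u x - cv (gker b) u x)) <= (sqrt (2 * DIM('a) * abs (a - b)) * B)^2" .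
qed (use B in simp)

lemma norm_heat_le:
 fixes u :: "'a::euclidean_space => complex"
 assumes "0 < s" "l2b u A"
 shows "norm (cv (gker (of_real s)) u x) <= s powr (- (DIM('a) / 4)) * A"
proof -
 have "norm (cv (gker (of_real s)) u x) <= (4 * pi * s) powr (- (DIM('a) / 2)) * gL2 TYPE('a) (s / (4 * s^2)) * A"
  using cv_integrable(2)[OF gbd_gker[of s "of_real s" s] assms(2)] assms(1) by simp
 also have "(4 * pi * s) powr (- (DIM('a) / 2)) * gL2 TYPE('a) (s / (4 * s^2)) = (8 * pi * s) powr (- (DIM('a) / 4))"
 proof -
  have "pi / (2 * (s / (4 * s^2))) = 2 * pi * s" using assms(1) by (simp add: power2_eq_square field_simps)
  then have "gL2 TYPE('a) (s / (4 * s^2)) = (1 / (2 * pi * s)) powr (- (DIM('a) / 4))"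
   using assms(1) by (simp add: gL2_def powr_half_sqrt[symmetric] powr_powr powr_minus_divide powr_divide)
  moreover have "(4 * pi * s) powr (- (DIM('a) / 2)) = ((4 * pi * s)^2) powr (- (DIM('a) / 4))"
   using assms(1) by (simp add: powr_powr flip: powr_numeral)
  moreover have "(4 * pi * s)^2 * (1 / (2 * pi * s)) = 8 * pi * s" using assms(1) by (simp add: power2_eq_square)
  ultimately show ?thesis by (simp only: powr_mult[symmetric])
 qed
 also have "(8 * pi * s) powr (- (DIM('a) / 4)) <= s powr (- (DIM('a) / 4))"
  using assms(1) pi_gt3 by (intro powr_mono2') auto
 finally show ?thesis using lpb_nonneg[OF assms(2)] by (simp add: mult_right_mono)
qed

lemma lpb_interpolate_bounded:
 assumes f: "lpb M 2 f X" and b: "!!x. norm (f x) <= Y" and a: "0 < \<alpha>" and Z: "Y powr \<alpha> * X^2 <= Z powr (\<alpha> + 2)" "0 <= Z"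
 shows "lpb M (\<alpha> + 2) f Z"
proof -
 have [measurable]: "f \<in> borel_measurable M" using f by (simp add: lpb_def)
 have "(\<integral>\<^sup>+x. ennreal (norm (f x) powr (\<alpha> + 2)) \<partial>M) <= (\<integral>\<^sup>+x. ennreal (Y powr \<alpha>) * ennreal ((norm (f x))^2) \<partial>M)"
 proof (intro nn_integral_mono)
  fix x
  have "norm (f x) powr (\<alpha> + 2) <= Y powr \<alpha> * norm (f x) powr 2"
   unfolding powr_add using a b by (intro mult_right_mono powr_mono2) auto
  then show "ennreal (norm (f x) powr (\<alpha> + 2)) <= ennreal (Y powr \<alpha>) * ennreal ((norm (f x))^2)"
   by (simp add: ennreal_leI flip: ennreal_mult')
 qed
 also have "\<dots> <= ennreal (Y powr \<alpha>) * ennreal (X^2)"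
  using f by (simp add: nn_integral_cmult lpb_2_iff mult_left_mono)
 also have "\<dots> <= ennreal (Z powr (\<alpha> + 2))" using Z by (simp add: ennreal_leI flip: ennreal_mult')
 finally show ?thesis using Z by (simp add: lpb_def)
qed

text \<open>A Littlewood-Paley decomposition by heat times \<open>(1/2) ^ k\<close>: each difference
  is small in L^2 by the gradient bound and controlled in L^infinity by smoothing, and interpolation
  leaves the summable factor \<open>\<rho> ^ k\<close>. It supplies bounds in exponent \<alpha> + 2
  at every time, where the Strichartz bound only gives an integral over time.\<close>

lemma gagliardo_nirenberg:
 fixes u :: "'a::euclidean_space => complex" and \<alpha> A B :: real
 defines "\<rho> \<equiv> (1/2) powr (1 / 2 - 1 / (\<alpha> + 2))"
 assumes u: "l2b u A" and w: "!!e. e \<in> Basis ==> l2b (w e) B" "!!e. e \<in> Basis ==> wd e u (w e)" and B: "0 <= B"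
  and \<alpha>: "\<alpha> = 4 / DIM('a)"
 shows "lpb lborel (\<alpha> + 2) u (2 * sqrt DIM('a) * B / (1 - \<rho>) + A)"
proof -
 have a0: "0 < \<alpha>" "DIM('a) * \<alpha> = 4" by (auto simp: \<alpha>)
 define L where "L = 2 * sqrt DIM('a) * B"
 have L: "0 <= L" using B by (simp add: L_def)
 have \<gamma>: "0 < 1 / 2 - 1 / (\<alpha> + 2)" using a0 by (simp add: field_simps)
 have \<rho>: "0 < \<rho>" "\<rho> < 1" using powr_less_mono2[OF \<gamma>, of "1/2" 1] by (auto simp: \<rho>_def)
 define f where "f k = cv (gker (of_real ((1/2) ^ k))) u" for k
 define g where "g x = lim (%k. f k x)" for x
 have f: "l2b (f k) A" for k unfolding f_def by (rule lpb_2_cv_gker[OF _ u]) simp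
 then have fm: "f k \<in> borel_measurable lborel" for k by (simp add: lpb_def)
 have D: "l2b (%x. f (Suc k) x - f k x) (L * sqrt (1/2) ^ k) \<and> lpb lborel (\<alpha> + 2) (%x. f (Suc k) x - f k x) (L * \<rho> ^ k)" for k
 proof -
  \<comment> \<open>The flows at times \<open>2 * a\<close> and \<open>4 * a\<close> differ by the
    flow for time \<open>a\<close> of \<open>D\<close>, the difference at times \<open>a\<close> and
    \<open>3 * a\<close>. One time \<open>a\<close> is thus left for the smoothing into
    L^infinity.\<close>
  define a :: real where "a = (1/2) ^ k / 4"
  have a: "0 < a" "a <= (1/2) ^ k" by (auto simp: a_def)
  define D where "D x = cv (gker a) u x - cv (gker (3 * a)) u x" for x
  define X where "X = L * sqrt a"
  have X0: "0 <= X" using L a by (simp add: X_def)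
  have "l2b D X" using heat_diff_L2[OF u w B a(1), of "3 * a"] a by (simp add: D_def[abs_def] X_def L_def real_sqrt_mult ac_simps)
  then have D: "l2b (cv (gker a) D) X" "norm (cv (gker a) D x) <= a powr (- (DIM('a) / 4)) * X" for x
   using a by (auto intro: lpb_2_cv_gker norm_heat_le)
  obtain A1 c1 where 1: "gbd A1 c1 (gker a :: 'a => complex)" using gbd_gker_ex[of "of_real a"] a by auto
  have "cv (gker a) D x = cv (gker (a + a)) u x - cv (gker (a + 3 * a)) u x" for x
   using a cv_diff[OF 1 lpb_2_cv_gker[OF _ u] lpb_2_cv_gker[OF _ u], of "of_real a" "of_real (3 * a)" x]
   by (simp add: D_def[abs_def] cv_gker_gker[OF _ _ u])
  then have eq: "(%x. f (Suc k) x - f k x) = cv (gker a) D" by (auto simp: f_def a_def)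
  have X: "X <= L * sqrt (1/2) ^ k" using a L by (simp add: X_def mult_left_mono flip: real_sqrt_power)
  have "lpb lborel (\<alpha> + 2) (cv (gker a) D) (L * a powr (1 / 2 - 1 / (\<alpha> + 2)))"
  proof (rule lpb_interpolate_bounded[OF D a0(1)])
   \<comment> \<open>The dimension times \<alpha> is 4, so the smoothing factor becomes
     \<open>a powr (-1)\<close>, which the powers of \<open>X\<close> outweigh.\<close>
   have "(a powr (- (DIM('a) / 4)) * X) powr \<alpha> * X^2 = a powr (-1) * X powr (\<alpha> + 2)"
    using a0 X0 by (cases "X = 0") (auto simp: powr_mult powr_powr powr_add powr_numeral)
   also have "\<dots> = L powr (\<alpha> + 2) * a powr ((\<alpha> + 2) / 2 - 1)"
    using a L by (simp add: X_def powr_half_sqrt[symmetric] powr_mult powr_powr powr_diff powr_minus_divide)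
   also have "(\<alpha> + 2) / 2 - 1 = (1 / 2 - 1 / (\<alpha> + 2)) * (\<alpha> + 2)" using a0 by (simp add: field_simps)
   also have "L powr (\<alpha> + 2) * a powr ((1 / 2 - 1 / (\<alpha> + 2)) * (\<alpha> + 2)) = (L * a powr (1 / 2 - 1 / (\<alpha> + 2))) powr (\<alpha> + 2)"
    using a L by (simp add: powr_mult powr_powr)
   finally show "(a powr (- (DIM('a) / 4)) * X) powr \<alpha> * X^2 <= (L * a powr (1 / 2 - 1 / (\<alpha> + 2))) powr (\<alpha> + 2)" by simp
  qed (use L in simp)
  moreover have "L * a powr (1 / 2 - 1 / (\<alpha> + 2)) <= L * \<rho> ^ k"
   using a \<gamma> L unfolding \<rho>_def by (intro mult_left_mono) (simp_all add: powr_mono2 flip: powr_power_commute)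
  ultimately show ?thesis unfolding eq using a0 by (auto intro: lpb_mono[OF D(1) X] lpb_mono)
 qed
 have s: "0 < sqrt (1/2 :: real)" "sqrt (1/2 :: real) < 1" by auto
 have g2: "l2b (%x. g x - f n x) (L / (1 - sqrt (1/2)) * sqrt (1/2) ^ n)" for n
  unfolding g_def by (rule lpb_geometric_limit[OF fm _ s]) (use D in auto)
 have "l2b (%x. u x - g x) \<eta>" if \<eta>: "0 < \<eta>" for \<eta>
 proof -
  obtain t0 where t0: "0 < t0" "!!t. 0 < t ==> t <= t0 ==> l2b (%x. u x - cv (gker (of_real t)) u x) (\<eta> / 2)"
   using heat_approximate_identity[OF _ u u, of "\<eta> / 2"] \<eta> by auto
  have l: "(%n. (1/2::real) ^ n) \<longlonglongrightarrow> 0" "(%n. L / (1 - sqrt (1/2)) * sqrt (1/2) ^ n) \<longlonglongrightarrow> 0"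
   by (auto intro!: LIMSEQ_realpow_zero tendsto_mult_right_zero)
  have "eventually (%n. (1/2::real) ^ n < t0 \<and> L / (1 - sqrt (1/2)) * sqrt (1/2) ^ n < \<eta> / 2) sequentially"
   using t0 \<eta> by (intro eventually_conj order_tendstoD(2)[OF l(1)] order_tendstoD(2)[OF l(2)]) auto
  then obtain n where n: "(1/2::real) ^ n < t0" "L / (1 - sqrt (1/2)) * sqrt (1/2) ^ n < \<eta> / 2" by (auto simp: eventually_sequentially)
  then have "l2b (%x. (u x - f n x) - (g x - f n x)) (\<eta> / 2 + \<eta> / 2)"
   unfolding f_def[of n] by (intro lpb_diff t0(2) lpb_mono[OF g2[unfolded f_def]]) auto
  then show ?thesis by simp
 qed
 then have "AE x in lborel. u x - g x = 0" by (rule lpb_zero_AE) auto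
 moreover have "lpb lborel (\<alpha> + 2) (%x. (g x - f 0 x) + f 0 x) (L / (1 - \<rho>) * \<rho> ^ 0 + A)"
 proof (rule lpb_add)
  show "lpb lborel (\<alpha> + 2) (%x. g x - f 0 x) (L / (1 - \<rho>) * \<rho> ^ 0)"
   unfolding g_def by (rule lpb_geometric_limit[OF fm _ \<rho>]) (use D a0 in auto)
  show "lpb lborel (\<alpha> + 2) (f 0) A"
   by (rule lpb_interpolate_bounded[OF f _ a0(1)]) (use norm_heat_le[of 1, OF _ u] lpb_nonneg[OF u] in \<open>auto simp: f_def powr_add powr_numeral\<close>)
 qed (use a0 in simp)
 ultimately show ?thesis using lpb_measurable[OF u] by (auto simp: L_def intro: lpb_cong_AE elim: eventually_mono)
qed

section \<open>The equation and the lower bound\<close>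

lemma tsg_derivative:
 fixes p :: "real => complex"
 assumes c: "continuous_on UNIV p"
 shows "((%t. LL s. tsg t s * p s) has_vector_derivative p t) (at t)"
proof -
 have "((%u. LBINT y=0..u. p y) has_vector_derivative p t) (at t within {-abs t-1..abs t+1})"
  using interval_integral_FTC2[of "-abs t-1" 0 "abs t+1" p t] continuous_on_subset[OF c] by (simp add: zero_ereal_def)
 moreover have "at t within {-abs t-1..abs t+1} = at t" by (rule at_within_interior) (auto simp: abs_if)
 ultimately show ?thesis by (simp add: tsg_interval)
qed

lemma wd_diff:
 assumes "wd e f g" "wd e f' g'" and e: "e \<in> Basis" and b: "l2b f A" "l2b f' A" "l2b g B" "l2b g' B"
 shows "wd e (%x. f x - f' x) (%x. g x - g' x)"
 unfolding wd_def
proof (intro allI impI)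
 fix z and x :: 'a assume z: "0 < Re z"
 obtain A1 c1 A2 c2 where "gbd A1 c1 (gk1 e z)" "gbd A2 c2 (gker z :: 'a => complex)" using gbd_gk1_ex[OF z e] gbd_gker_ex[OF z] by blast
 then show "cv (gk1 e z) (%x. f x - f' x) x = cv (gker z) (%x. g x - g' x) x"
  using cv_diff[OF _ b(1,2)] cv_diff[OF _ b(3,4)] assms z by (auto simp: wd_def)
qed

lemma continuous_onI_small:
 fixes p :: "real => complex"
 assumes "!!t \<eta>. 0 < \<eta> ==> \<exists>d>0. \<forall>s. abs (s - t) < d --> norm (p s - p t) <= K * \<eta>" "0 <= K"
 shows "continuous_on UNIV p"
proof (rule continuous_at_imp_continuous_on, rule ballI, unfold continuous_at_eps_delta, intro allI impI)
 fix t and \<eta> :: real assume "0 < \<eta>"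
 then obtain d where d: "0 < d" "\<forall>s. abs (s - t) < d --> norm (p s - p t) <= K * (\<eta> / (K + 1))"
  using assms by (metis add_nonneg_pos divide_pos_pos zero_less_one)
 moreover have "K * (\<eta> / (K + 1)) < \<eta>" using assms(2) \<open>0 < \<eta>\<close> by (simp add: field_simps)
 ultimately show "\<exists>d>0. \<forall>s. dist s t < d --> dist (p s) (p t) < \<eta>" by (force simp: dist_norm)
qed

context iteration
begin

text \<open>The Gagliardo-Nirenberg bound applied to \<open>v t\<close> and to differences in time.
  One constant \<open>V\<close> serves as bound and as modulus of continuity.\<close>

lemma v_Lp:
 assumes \<alpha>': "\<alpha> = 4 / DIM('a)"
 obtains V where "!!t. lpb lborel (\<alpha> + 2) (v t) V"
  "!!t \<eta>. 0 < \<eta> ==> \<exists>d>0. \<forall>s. abs (s - t) < d --> lpb lborel (\<alpha> + 2) (%x. v s x - v t x) (V * \<eta>)"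
proof -
 define \<rho> where "\<rho> = (1/2) powr (1 / 2 - 1 / (\<alpha> + 2) :: real)"
 define k where "k = 2 * sqrt DIM('a) / (1 - \<rho>)"
 have "0 < 1 / 2 - 1 / (\<alpha> + 2)" using \<alpha> by (simp add: field_simps)
 then have "\<rho> < 1" using powr_less_mono2[of _ "1/2" 1] by (simp add: \<rho>_def)
 then have k: "0 <= k" by (simp add: k_def)
 have gn: "lpb lborel (\<alpha> + 2) u (k * Y + X)" if "l2b u X" "!!e. e \<in> Basis ==> l2b (w' e) Y" "!!e. e \<in> Basis ==> wd e u (w' e)" "0 <= Y" for u :: "'a => complex" and w' X Y
  using gagliardo_nirenberg[OF that \<alpha>'] by (simp add: k_def \<rho>_def)
 define V where "V = (k + 1) * (2 * C * A + 2 * C * B + 1)"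
 have nn: "0 <= 2 * C * A" "0 <= 2 * C * B" using C A0 B0 by auto
 have V: "k + 1 <= V" "k * (2 * C * B) + 2 * C * A <= V"
  using nn k by (auto simp: V_def distrib_left distrib_right add_nonneg_nonneg)
 show ?thesis
 proof (rule that)
  show "lpb lborel (\<alpha> + 2) (v t) V" for t
   by (rule lpb_mono[OF gn[OF v_bounds(1) w_bounds v_wd nn(2)] V(2)]) (use \<alpha> in auto)
  fix t and \<eta> :: real assume \<eta>: "0 < \<eta>"
  have "eventually (%s. l2b (%x. v s x - v t x) \<eta>) (at t)"
   using v_continuous[OF \<eta>, of t] unfolding eventually_at dist_real_def by blast
  moreover have "eventually (%s. \<forall>e\<in>Basis. l2b (%x. w e s x - w e t x) \<eta>) (at t)"
   using w_continuous[OF _ \<eta>, of _ t] by (intro eventually_ball_finite finite_Basis ballI) (unfold eventually_at dist_real_def, blast)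
  ultimately have "eventually (%s. l2b (%x. v s x - v t x) \<eta> \<and> (\<forall>e\<in>Basis. l2b (%x. w e s x - w e t x) \<eta>)) (at t)"
   by (rule eventually_conj)
  then obtain d where d: "0 < d" "!!s. abs (s - t) < d ==> s \<noteq> t ==> l2b (%x. v s x - v t x) \<eta> \<and> (\<forall>e\<in>Basis. l2b (%x. w e s x - w e t x) \<eta>)"
   unfolding eventually_at dist_real_def by blast
  have "lpb lborel (\<alpha> + 2) (%x. v s x - v t x) (V * \<eta>)" if "abs (s - t) < d" for s
  proof (cases "s = t")
   case False
   have "lpb lborel (\<alpha> + 2) (%x. v s x - v t x) (k * \<eta> + \<eta>)"
    using d(2)[OF that False] wd_diff[OF v_wd v_wd _ v_bounds(1) v_bounds(1) w_bounds w_bounds] \<eta>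
    by (intro gn[where w'="%e x. w e s x - w e t x"]) simp_all
   then show ?thesis by (rule lpb_mono) (use mult_right_mono[OF V(1), of \<eta>] \<eta> \<alpha> in \<open>auto simp: distrib_right\<close>)
  qed (use V k \<eta> \<alpha> in auto)
  then show "\<exists>d>0. \<forall>s. abs (s - t) < d --> lpb lborel (\<alpha> + 2) (%x. v s x - v t x) (V * \<eta>)" using d(1) by blast
 qed
qed

text \<open>In the integrated equation the integrands are continuous in time, so it can be
  differentiated at every time. Continuity of the nonlinear term is where the bound in exponent
  \<alpha> + 2 at each time enters.\<close>

lemma v_derivative:
 assumes \<alpha>': "\<alpha> = 4 / DIM('a)" and \<psi>: "l2b \<psi> Y" "!!e. e \<in> Basis ==> l2b (\<psi>' e) Y" "!!e. e \<in> Basis ==> dird e \<psi> (\<psi>' e)"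
  "!!e x. e \<in> Basis ==> continuous_on UNIV (%s. \<psi>' e (x + s *\<^sub>R e))" and \<psi>p: "lpb lborel (\<alpha> + 2) \<psi> Y'"
 shows "((%s. LL x. v s x * \<psi> x) has_vector_derivative (LL x. nF v t x * \<psi> x) - \<i> * (\<Sum>e\<in>Basis. LL x. w e t x * \<psi>' e x)) (at t)"
proof -
 obtain V where V: "!!t. lpb lborel (\<alpha> + 2) (v t) V"
  "!!t \<eta>. 0 < \<eta> ==> \<exists>d>0. \<forall>s. abs (s - t) < d --> lpb lborel (\<alpha> + 2) (%x. v s x - v t x) (V * \<eta>)" using v_Lp[OF \<alpha>'] by blast
 have Y: "0 <= Y" "0 <= Y'" "0 <= V" using lpb_nonneg \<psi>(1) \<psi>p V(1) by blast+
 have cw: "continuous_on UNIV (%s. LL x. w e s x * \<psi>' e x)" if e: "e \<in> Basis" for e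
 proof (rule continuous_onI_small[OF _ Y(1)])
  fix t and \<eta> :: real assume "0 < \<eta>"
  then obtain d where d: "0 < d" "!!s. abs (s - t) < d ==> l2b (%x. w e s x - w e t x) \<eta>" using w_continuous[OF e] by blast
  then show "\<exists>d>0. \<forall>s. abs (s - t) < d --> norm ((LL x. w e s x * \<psi>' e x) - (LL x. w e t x * \<psi>' e x)) <= Y * \<eta>"
   using lpb_pairing_diff[OF d(2) w_bounds[OF e] w_bounds[OF e] \<psi>(2)[OF e]] by (auto simp: mult.commute)
 qed
 let ?c = "(V + V) powr \<alpha>"
 have "lpb lborel q (nF v t) (abs lam * ((1 + \<alpha>) * ((V + 0) powr \<alpha> * V)))" for t
  using nF_diff_bound[OF V(1)[of t], of "%_. 0" 0 V] V(1)[of t] \<alpha> by (simp add: nF_def[abs_def])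
 moreover have qp: "1 / q + 1 / (\<alpha> + 2) = 1" using conjugate_exponents(2) by simp
 ultimately have i: "integrable lborel (%x. nF v t x * \<psi> x)" for t using lpb_integrable_mult(1)[OF _ \<psi>p q(1) conjugate_exponents(1)] by blast
 have cn: "continuous_on UNIV (%s. LL x. nF v s x * \<psi> x)"
 proof (rule continuous_onI_small[where K="abs lam * ((1 + \<alpha>) * (?c * V)) * Y'"])
  fix t and \<eta> :: real assume "0 < \<eta>"
  then obtain d where d: "0 < d" "!!s. abs (s - t) < d ==> lpb lborel (\<alpha> + 2) (%x. v s x - v t x) (V * \<eta>)" using V(2) by metis
  have "norm ((LL x. nF v s x * \<psi> x) - (LL x. nF v t x * \<psi> x)) <= abs lam * ((1 + \<alpha>) * (?c * V)) * Y' * \<eta>" if "abs (s - t) < d" for s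
  proof -
   have "(LL x. nF v s x * \<psi> x) - (LL x. nF v t x * \<psi> x) = (LL x. (nF v s x - nF v t x) * \<psi> x)"
    using i by (simp add: left_diff_distrib)
   then show ?thesis
    using lpb_integrable_mult(2)[OF nF_diff_bound[OF V(1) V(1) d(2)[OF that], folded nF_def] \<psi>p q(1) conjugate_exponents(1) qp] by (simp add: ac_simps)
  qed
  then show "\<exists>d>0. \<forall>s. abs (s - t) < d --> norm ((LL x. nF v s x * \<psi> x) - (LL x. nF v t x * \<psi> x)) <= abs lam * ((1 + \<alpha>) * (?c * V)) * Y' * \<eta>"
   using d(1) by blast
 qed (use Y \<alpha> in auto)
 let ?r = "%t. (LL x. \<phi> x * \<psi> x) - \<i> * (\<Sum>e\<in>Basis. LL s. tsg t s * (LL x. w e s x * \<psi>' e x)) + (LL s. tsg t s * (LL x. nF v s x * \<psi> x))"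
 have "(?r has_vector_derivative 0 - \<i> * (\<Sum>e\<in>Basis. LL x. w e t x * \<psi>' e x) + (LL x. nF v t x * \<psi> x)) (at t)"
  by (intro has_vector_derivative_add has_vector_derivative_diff has_vector_derivative_const has_vector_derivative_mult_right
    has_vector_derivative_sum tsg_derivative cw cn)
 moreover have "(%s. LL x. v s x * \<psi> x) = ?r" by (rule ext) (rule v_equation[OF \<psi> \<psi>p])
 ultimately show ?thesis by (simp add: add_diff_eq[symmetric] del: add_diff_eq)
qed

end

section \<open>Lower bound by duality with the free flow\<close>

lemma lpb_gker:
 assumes z: "0 < Re z" and p: "0 < p"
 shows "lpb lborel p (gker z :: 'a::euclidean_space => complex) ((4 * pi) powr (- (DIM('a) / 2)) * (4 * pi / (p * Re z)) powr (DIM('a) / (2 * p)) * norm z powr (DIM('a) * (1 / p - 1 / 2)))"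
proof -
 let ?n = "DIM('a) / 2" and ?c = "Re z / (4 * (norm z)^2)"
 have n: "0 < norm z" using z by auto
 have c: "0 < ?c * p" using z n p by simp
 have "(NN x. ennreal (norm (gker z (x::'a)) powr p)) = (NN x. ennreal ((4 * pi * norm z) powr (- ?n * p)) * ennreal (gauss (?c * p) (x::'a)))"
 proof (intro nn_integral_cong)
  fix x :: 'a
  have "gauss ?c x powr p = gauss (?c * p) x" by (simp add: gauss_def powr_def)
  then show "ennreal (norm (gker z x) powr p) = ennreal ((4 * pi * norm z) powr (- ?n * p)) * ennreal (gauss (?c * p) x)"
   by (simp add: norm_gker[OF z] powr_mult powr_powr ennreal_mult' abs_of_pos gauss_pos)
 qed
 also have "\<dots> = ennreal ((4 * pi * norm z) powr (- ?n * p) * (pi / (?c * p)) powr ?n)"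
  using c by (simp add: nn_integral_cmult nn_integral_gauss ennreal_mult')
 also have "pi / (?c * p) = (4 * pi / (p * Re z)) * norm z powr 2" using z p n by (simp add: powr_numeral ac_simps)
 also have "(4 * pi * norm z) powr (- ?n * p) * ((4 * pi / (p * Re z)) * norm z powr 2) powr ?n
  = ((4 * pi) powr (- ?n) * (4 * pi / (p * Re z)) powr (DIM('a) / (2 * p)) * norm z powr (DIM('a) * (1 / p - 1 / 2))) powr p"
  (is "?l = ?r powr p")
 proof -
  have e: "DIM('a) * (1 / p - 1 / 2) * p = - ?n * p + 2 * ?n" "DIM('a) / (2 * p) * p = ?n" using p by (auto simp: field_simps)
  have "?r powr p = (4 * pi) powr (- ?n * p) * (4 * pi / (p * Re z)) powr ?n * norm z powr (- ?n * p + 2 * ?n)"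
   using z p n by (simp only: powr_mult powr_powr e)
  also have "\<dots> = ?l" unfolding powr_add using z p n by (simp only: powr_mult powr_powr ac_simps)
  finally show ?thesis by simp
 qed
 finally show ?thesis by (simp add: lpb_def)
qed

lemma cv_commute:
 assumes "bm k" "bm h"
 shows "cv k h x = cv h k x"
 using integral_reflect_translate[of "%y. k y * h (x - y)" x] assms unfolding cv_def by (simp add: mult.commute)

context iteration
begin

text \<open>The test is \<open>cnj \<phi>\<close> cut to a ball, which puts it in L^1, and
  regularised by a real time \<open>e\<close>, which puts the kernel in every L^p; run with time
  \<open>- t\<close> it undoes the free evolution. Cut and smoothing together cost
  \<open>A^2 / 8\<close>, the Duhamel part \<open>A^2 / 4\<close>, and more than
  \<open>A^2 / 2\<close> remains. The family is the same for all \<open>p\<close>.\<close>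

lemma v_dual_lower_bound:
 assumes A: "0 < A" "(LL x. (norm (\<phi> x))^2) = A^2"
 obtains \<theta> where "!!t. \<theta> t \<in> borel_measurable borel" "!!t. A^2 / 2 <= norm (LL x. v t x * \<theta> t x)"
  "!!p. 1 <= p ==> p <= 2 ==> \<exists>K. \<forall>t\<ge>1. lpb lborel p (\<theta> t) (K * t powr (DIM('a) * (1 / p - 1 / 2)))"
proof -
 have [measurable]: "bm \<phi>" using \<phi> by (simp add: lpb_def)
 have c\<phi>: "l2b (%x. cnj (\<phi> x)) A" by (rule lpb_cong_norm[OF \<phi>]) auto
 let ?h = "%n x. indicator (ball 0 (real n)) x * cnj (\<phi> x)"
 have "(%n. NN x. ennreal (norm (cnj (\<phi> x) - ?h n x) powr 2)) \<longlonglongrightarrow> 0"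
 proof (rule nn_integral_powr_tendsto_0_dominated[OF _ \<phi>])
  show "AE x in lborel. (%n. cnj (\<phi> x) - ?h n x) \<longlonglongrightarrow> 0"
  proof (intro AE_I2 tendsto_eventually)
   fix x :: 'a
   obtain n0 where "norm x < real n0" using reals_Archimedean2 by blast
   then show "eventually (%n. cnj (\<phi> x) - ?h n x = 0) sequentially"
    by (intro eventually_sequentiallyI[of n0]) (auto simp: indicator_def)
  qed
 qed (auto simp: indicator_def)
 from order_tendstoD(2)[OF this, of "ennreal ((A / 16)^2)"] obtain n where "(NN x. ennreal (norm (cnj (\<phi> x) - ?h n x) powr 2)) < ennreal ((A / 16)^2)"
  using A by (auto simp: eventually_sequentially)
 moreover have [measurable]: "ball 0 (real n) \<in> sets (borel :: 'a measure)" by simp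
 have "bm (%x. cnj (\<phi> x) - ?h n x)" by measurable
 ultimately have d: "l2b (%x. cnj (\<phi> x) - ?h n x) (A / 16)" using A by (simp add: lpb_2_iff less_imp_le)
 define h where "h = ?h n"
 have [measurable]: "bm h" unfolding h_def by measurable
 have h: "l2b h A" by (rule lpb_dominated[OF \<phi>]) (auto simp: h_def indicator_def)
 obtain K1 where K1: "0 <= K1" "(NN x. ennreal (norm (h x))) <= ennreal K1"
 proof
  have "(NN x. ennreal ((norm (indicator (ball 0 (real n)) (x::'a) :: real))^2)) = (NN x. indicator (ball 0 (real n)) (x::'a))"
   by (intro nn_integral_cong) (auto simp: indicator_def)
  then have i: "l2b (%x::'a. indicator (ball 0 (real n)) x :: real) (sqrt (measure lborel (ball (0::'a) (real n))))"
   using emeasure_lborel_ball_finite[of "0::'a" "real n"] by (simp add: lpb_2_iff emeasure_eq_ennreal_measure less_top)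
  have "norm (h x) = norm (\<phi> x) * norm (indicator (ball 0 (real n)) x :: real)" for x by (auto simp: h_def indicator_def)
  then show "(NN x. ennreal (norm (h x))) <= ennreal (A * sqrt (measure lborel (ball (0::'a) (real n))))"
   using lpb_holder[OF \<phi> i] by simp
 qed (use A in auto)
 obtain e where e: "0 < e" "l2b (%x. h x - cv (gker (of_real e)) h x) (A / 16)"
  using heat_approximate_identity[OF _ h h, of "A / 16"] A by auto
 define \<theta> where "\<theta> t = cv (gker (Complex e (- t))) h" for t
 have [measurable]: "bm (\<theta> t)" for t unfolding \<theta>_def by measurable
 have he: "l2b (cv (gker (of_real e)) h) A" by (rule lpb_2_cv_gker[OF _ h]) (use e in simp)
 have "l2b (%x. (cnj (\<phi> x) - h x) + (h x - cv (gker (of_real e)) h x)) (A / 16 + A / 16)"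
  using d e by (intro lpb_add) (auto simp: h_def)
 then have "l2b (%x. cnj (\<phi> x) - cv (gker (of_real e)) h x) (A / 8)" by simp
 from lpb_pairing_diff[OF this c\<phi> he \<phi>]
 have "norm ((LL x. cnj (\<phi> x) * \<phi> x) - (LL x. \<phi> x * cv (gker (of_real e)) h x)) <= A^2 / 8"
  by (simp add: power2_eq_square mult.commute)
 moreover have "(LL x. cnj (\<phi> x) * \<phi> x) = of_real (A^2)"
  unfolding A(2)[symmetric] by (simp only: mult.commute[of "cnj _"] complex_norm_square[symmetric] integral_complex_of_real)
 moreover have "norm ((LL x. v t x * \<theta> t x) - (LL x. \<phi> x * cv (gker (of_real e)) h x)) <= A^2 / 4" for t
  using v_pairing[OF e(1) h, of t] by (simp add: \<theta>_def power2_eq_square)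
 moreover have "s / 2 <= norm z" if "norm (complex_of_real s - y) <= s / 8" "norm (z - y) <= s / 4" "0 <= s" for s and y z :: complex
  using that norm_triangle_ineq2[of "of_real s" y] norm_triangle_ineq2[of y z] by (simp add: norm_minus_commute)
 ultimately have low: "A^2 / 2 <= norm (LL x. v t x * \<theta> t x)" for t using zero_le_power2 by metis
 show ?thesis
 proof (rule that[of \<theta>])
  fix p :: real assume p: "1 <= p" "p <= 2"
  let ?n = "DIM('a) * (1 / p - 1 / 2)"
  define K where "K = (4 * pi) powr (- (DIM('a) / 2)) * (4 * pi / (p * e)) powr (DIM('a) / (2 * p))"
  have n: "0 <= ?n" using p by (simp add: field_simps)
  have "lpb lborel p (\<theta> t) (K1 * K * (1 + e) powr ?n * t powr ?n)" if t: "1 <= t" for t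
  proof -
   have "norm (Complex e (- t)) <= e + t" using cmod_le[of "Complex e (- t)"] t e by simp
   also have "\<dots> <= (1 + e) * t" using t e by (simp add: distrib_right)
   finally have "norm (Complex e (- t)) powr ?n <= ((1 + e) * t) powr ?n" by (intro powr_mono2 n) auto
   then have le: "K1 * (K * norm (Complex e (- t)) powr ?n) <= K1 * K * (1 + e) powr ?n * t powr ?n"
    using t e K1 by (simp add: powr_mult mult.assoc mult_left_mono K_def)
   \<comment> \<open>The roles in Young's inequality are exchanged: \<open>h\<close> supplies the
     L^1 norm and the kernel the L^p norm.\<close>
   have "lpb lborel p (cv h (gker (Complex e (- t)))) (K1 * (K * norm (Complex e (- t)) powr ?n))"
    using lpb_gker[of "Complex e (- t)" p] e p K1 by (intro young_convolution) (auto simp: K_def)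
   moreover have "cv h (gker (Complex e (- t))) = \<theta> t" unfolding \<theta>_def by (rule ext) (rule cv_commute; measurable)
   ultimately show ?thesis using lpb_mono[OF _ le, of lborel p "\<theta> t"] p by simp
  qed
  then show "\<exists>K. \<forall>t\<ge>1. lpb lborel p (\<theta> t) (K * t powr ?n)" by blast
 qed (use low in auto)
qed

end

section \<open>Test functions and weak derivatives\<close>

lemma partial_eq: "(f has_derivative f') (at x) ==> partial i f x = f' (axis i 1)"
 unfolding partial_def by (metis frechet_derivative_at)

lemma Ck_mono: "Ck (Suc k) f ==> Ck k f"
proof (induction k arbitrary: f)
 case 0
 then show ?case by (auto intro!: continuous_at_imp_continuous_on differentiable_imp_continuous_within)
qed simp

lemma Ck_const [simp]: "Ck k (%_. c)"
proof (induction k arbitrary: c)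
 case (Suc k)
 moreover have "partial i (%_. c) = (%_. 0)" for i :: 'a by (auto intro!: partial_eq)
 ultimately show ?case by simp
qed simp

lemma Ck_add: "Ck k f ==> Ck k g ==> Ck k (%x. f x + g x)"
proof (induction k arbitrary: f g)
 case (Suc k)
 then have d: "(f has_derivative frechet_derivative f (at x)) (at x)" "(g has_derivative frechet_derivative g (at x)) (at x)" for x
  by (auto simp: frechet_derivative_works)
 have "partial i (%x. f x + g x) = (%x. partial i f x + partial i g x)" for i
  using partial_eq[OF has_derivative_add[OF d]] by (auto simp: partial_def)
 then show ?case using Suc by simp
qed (auto intro: continuous_intros)

lemma Ck_mult: "Ck k f ==> Ck k g ==> Ck k (%x. f x * g x)"
proof (induction k arbitrary: f g)
 case (Suc k)
 then have d: "(f has_derivative frechet_derivative f (at x)) (at x)" "(g has_derivative frechet_derivative g (at x)) (at x)" for x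
  by (auto simp: frechet_derivative_works)
 have "partial i (%x. f x * g x) = (%x. f x * partial i g x + partial i f x * g x)" for i
  using partial_eq[OF has_derivative_mult[OF d]] by (auto simp: partial_def)
 then show ?case using Suc.prems Ck_mono[OF Suc.prems(1)] Ck_mono[OF Suc.prems(2)] by (auto intro!: Ck_add Suc.IH)
qed (auto intro: continuous_intros)

text \<open>A sequence in which each derivative is a smooth coefficient times the next member: one
  induction on \<open>k\<close> handles all members at once.\<close>

lemma Ck_family:
 assumes d: "!!m x. (g m has_derivative (%h. L x h * g (Suc m) x)) (at x)" and L: "!!k i. Ck k (%x. L x (axis i 1))"
 shows "Ck k (g m)"
proof (induction k arbitrary: m)
 case 0
 have "continuous (at x) (g m)" for x using d[of m x] by (rule has_derivative_continuous)
 then show ?case by (simp add: continuous_at_imp_continuous_on)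
next
 case (Suc k)
 have "partial i (g m) = (%x. L x (axis i 1) * g (Suc m) x)" for i by (rule ext) (rule partial_eq[OF d])
 moreover have "g m differentiable (at x)" for x using d unfolding differentiable_def by blast
 ultimately show ?case using Ck_mult[OF L Suc.IH] by simp
qed

lemma Ck_coordinate: "Ck k (%x. complex_of_real (c * (x $ i - a)))"
proof (cases k)
 case (Suc l)
 have d: "((%x. complex_of_real (c * (x $ i - a))) has_derivative (%h. of_real (c * (h $ i - 0)))) (at x)" for x
  by (intro has_derivative_of_real has_derivative_mult_right has_derivative_diff has_derivative_const bounded_linear_imp_has_derivative bounded_linear_vec_nth)
 have "partial j (%x. complex_of_real (c * (x $ i - a))) = (%x. of_real (c * (axis j 1 $ i - 0)))" for j
  by (rule ext) (rule partial_eq[OF d])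
 moreover have "(%x. complex_of_real (c * (x $ i - a))) differentiable (at x)" for x using d unfolding differentiable_def by blast
 ultimately show ?thesis by (simp add: Suc del: of_real_mult of_real_diff)
qed (auto intro!: continuous_intros)

text \<open>The standard smooth cut-off profile with all its derivatives: with
  \<open>Y = 1 / (1 - s)\<close>, whose derivative is \<open>Y^2\<close>, differentiation replaces
  the polynomial \<open>P\<close> by \<open>X^2\<close> times \<open>pderiv P - P\<close>.\<close>

definition bump :: "real poly => real => real" where
 "bump P s = (if s < 1 then poly P (1 / (1 - s)) * exp (- (1 / (1 - s))) else 0)"

lemma tendsto_poly_exp: "((%x::real. poly P x * exp (- x)) \<longlongrightarrow> 0) at_top"
proof -
 have "((%x. \<Sum>i\<le>degree P. coeff P i * (x ^ i / exp x)) \<longlongrightarrow> (\<Sum>i\<le>degree P. coeff P i * 0)) at_top"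
  by (intro tendsto_intros tendsto_power_div_exp_0)
 moreover have "poly P x * exp (- x) = (\<Sum>i\<le>degree P. coeff P i * (x ^ i / exp x))" for x
  by (simp add: poly_altdef sum_distrib_right sum_distrib_left exp_minus divide_inverse ac_simps)
 ultimately show ?thesis by simp
qed

lemma DERIV_bump: "(bump P has_real_derivative bump ([:0, 0, 1:] * (pderiv P - P)) s) (at s)"
proof -
 consider "s < 1" | "1 < s" | "s = 1" by linarith
 then show ?thesis
 proof cases
  case 1
  have "((%s. poly P (1 / (1 - s)) * exp (- (1 / (1 - s)))) has_real_derivative bump ([:0, 0, 1:] * (pderiv P - P)) s) (at s)"
   using 1 by (auto intro!: derivative_eq_intros simp: bump_def field_simps power2_eq_square) (simp add: diff_divide_distrib)
  then show ?thesis
   by (rule has_field_derivative_transform_within_open[where S="{..<1}"]) (use 1 in \<open>auto simp: bump_def\<close>)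
 next
  case 2
  have "((%s. 0) has_real_derivative bump ([:0, 0, 1:] * (pderiv P - P)) s) (at s)" using 2 by (simp add: bump_def)
  then show ?thesis
   by (rule has_field_derivative_transform_within_open[where S="{1<..}"]) (use 2 in \<open>auto simp: bump_def\<close>)
 next
  case 3
  \<comment> \<open>At the edge the left difference quotient is minus
    \<open>Y * poly P Y * exp (- Y)\<close> with \<open>Y = 1 / (1 - y)\<close>; the exponential
    wins as \<open>Y\<close> grows.\<close>
  have "((%y. - (poly ([:0, 1:] * P) (1 / (1 - y)) * exp (- (1 / (1 - y))))) \<longlongrightarrow> - 0) (at_left (1::real))"
  proof (intro tendsto_minus filterlim_compose[OF tendsto_poly_exp])
   show "LIM y at_left (1::real). 1 / (1 - y) :> at_top" by real_asymp
  qed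
  then have "((%y. (bump P y - bump P 1) / (y - 1)) \<longlongrightarrow> 0) (at_left 1)"
   by (auto elim!: Lim_transform_eventually simp: bump_def eventually_at_filter field_simps)
  moreover have "((%y. (bump P y - bump P 1) / (y - 1)) \<longlongrightarrow> 0) (at_right 1)"
   by (rule tendsto_eventually) (auto simp: bump_def eventually_at_filter)
  ultimately have "((%y. (bump P y - bump P 1) / (y - 1)) \<longlongrightarrow> 0) (at 1)" by (simp add: filterlim_at_split)
  then show ?thesis by (simp add: 3 has_field_derivative_iff bump_def)
 qed
qed

lemma bump_bounded: obtains M where "!!s. 0 <= s ==> abs (bump P s) <= M"
proof -
 have "continuous_on {0..1} (bump P)" by (intro continuous_at_imp_continuous_on ballI DERIV_isCont[OF DERIV_bump])
 then have "bounded (bump P ` {0..1})" by (intro compact_imp_bounded compact_continuous_image) auto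
 then obtain M where M: "!!s. 0 <= s ==> s <= 1 ==> abs (bump P s) <= M" unfolding bounded_iff by fastforce
 have "abs (bump P s) <= M" if "0 <= s" for s
  using M[of s] M[of 1] that by (cases "s <= 1") (auto simp: bump_def split: if_splits)
 then show ?thesis by (rule that)
qed

lemma has_derivative_cutoff:
 fixes x :: "real ^ 'n"
 shows "((%x. complex_of_real (bump P (c * (norm x)^2))) has_derivative
  (%h. of_real (2 * c * (x \<bullet> h)) * of_real (bump ([:0, 0, 1:] * (pderiv P - P)) (c * (norm x)^2)))) (at x)"
proof -
 have "((%x. c * (norm x)^2) has_derivative (%h. 2 * c * (x \<bullet> h))) (at x)"
  unfolding power2_norm_eq_inner by (auto intro!: derivative_eq_intros simp: inner_commute)
 from has_derivative_compose[OF this, of "bump P"] DERIV_bump[of P "c * (norm x)^2"]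
 have "((%x. bump P (c * (norm x)^2)) has_derivative (%h. bump ([:0, 0, 1:] * (pderiv P - P)) (c * (norm x)^2) * (2 * c * (x \<bullet> h)))) (at x)"
  by (simp add: has_field_derivative_def)
 from has_derivative_of_real[OF this] show ?thesis by (simp only: of_real_mult mult.commute)
qed

lemma Ck_cutoff: "Ck k (%x :: real ^ 'n. complex_of_real (bump P (c * (norm x)^2)))"
proof -
 define N where "N = (%P::real poly. [:0, 0, 1:] * (pderiv P - P))"
 define g where "g m = (%x :: real ^ 'n. complex_of_real (bump ((N ^^ m) P) (c * (norm x)^2)))" for m
 have "Ck k (g 0)"
 proof (rule Ck_family)
  show "(g m has_derivative (%h. of_real (2 * c * (x \<bullet> h)) * g (Suc m) x)) (at x)" for m x
   using has_derivative_cutoff[of "(N ^^ m) P" c x] by (simp only: g_def N_def[THEN fun_cong, symmetric] funpow.simps comp_def)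
  show "Ck k (%x. of_real (2 * c * (x \<bullet> axis i 1)))" for k i
   using Ck_coordinate[of k "2 * c" i 0] by (simp add: inner_axis)
 qed
 then show ?thesis by (simp add: g_def)
qed

lemma has_derivative_gker_reflect:
 fixes x y :: "real ^ 'n"
 shows "((%y. gker z (x - y)) has_derivative (%h. of_real ((x - y) \<bullet> h) * (1 / (2 * z)) * gker z (x - y))) (at y)"
proof -
 have "((%y. (norm (x - y))^2) has_derivative (%h. - (2 * ((x - y) \<bullet> h)))) (at y)"
  unfolding power2_norm_eq_inner by (auto intro!: derivative_eq_intros simp: inner_commute)
 then have "((%y. complex_of_real ((norm (x - y))^2) * (- 1 / (4 * z))) has_derivative (%h. complex_of_real (- (2 * ((x - y) \<bullet> h))) * (- 1 / (4 * z)))) (at y)"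
  by (intro has_derivative_mult_left has_derivative_of_real)
 from has_derivative_compose[OF this DERIV_exp[unfolded has_field_derivative_def]]
 have "((%y. exp (- complex_of_real ((norm (x - y))^2) / (4 * z))) has_derivative
   (%h. exp (- complex_of_real ((norm (x - y))^2) / (4 * z)) * (complex_of_real (- (2 * ((x - y) \<bullet> h))) * (- 1 / (4 * z))))) (at y)"
  by simp
 from has_derivative_mult_right[OF this, of "(of_real (4 * pi) * z) powr (- of_real (DIM(real ^ 'n) / 2))"]
 show ?thesis unfolding gker_def by (simp add: mult_ac)
qed

lemma Ck_gker_reflect: "Ck k (%y :: real ^ 'n. gker z (x - y))"
proof (rule Ck_family[where g="%_ y. gker z (x - y)" and L="%y h. of_real ((x - y) \<bullet> h) * (1 / (2 * z))"])
 show "Ck k (%y. of_real ((x - y) \<bullet> axis i 1) * (1 / (2 * z)))" for k i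
  using Ck_mult[OF Ck_coordinate[of k "-1" i "x $ i"] Ck_const[of k "1 / (2 * z)"]] by (simp add: inner_axis)
qed (rule has_derivative_gker_reflect)

text \<open>Gaussian kernels lack compact support, so they are multiplied by cut-offs of radius
  \<open>n + 1\<close>. The derivative of the cut-off is of order \<open>1 / (n + 1)\<close> and
  disappears in the limit by dominated convergence.\<close>

lemma weak_partial_wd:
 fixes f g :: "real ^ 'n => complex"
 assumes f: "l2b f A" and g: "l2b g B" and w: "weak_partial i f g"
 shows "wd (axis i 1) f g"
 unfolding wd_def
proof (intro allI impI)
 fix z and x :: "real ^ 'n" assume z: "0 < Re z"
 let ?e = "axis i 1 :: real ^ 'n"
 have e: "?e \<in> Basis" by (simp add: axis_in_Basis_iff)
 have [measurable]: "bm f" "bm g" using f g by (auto simp: lpb_def)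
 define Q :: "real poly" where "Q = [:0, 0, 1:] * (pderiv 1 - 1)"
 define c where "c n = (1 / real (Suc n))^2" for n
 define \<xi> where "\<xi> n y = complex_of_real (bump 1 (c n * (norm y)^2))" for n and y :: "real ^ 'n"
 define R where "R n y = complex_of_real (2 * c n * y $ i) * of_real (bump Q (c n * (norm y)^2))" for n and y :: "real ^ 'n"
 define \<psi> where "\<psi> n y = gker z (x - y) * \<xi> n y" for n y
 obtain M where M: "!!s. 0 <= s ==> abs (bump 1 s) <= M" using bump_bounded[of 1] by blast
 obtain M' where M': "!!s. 0 <= s ==> abs (bump Q s) <= M'" using bump_bounded[of Q] by blast
 have c0: "0 <= c n" for n by (simp add: c_def)
 have \<xi>b: "norm (\<xi> n y) <= M" for n y using M[of "c n * (norm y)^2"] c0 by (simp add: \<xi>_def)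
 have Rb: "norm (R n y) <= 2 * M' / real (Suc n)" for n y
 proof (cases "c n * (norm y)^2 < 1")
  case True
  then have "norm y < real (Suc n)"
   using power2_less_imp_less[of "norm y / real (Suc n)" 1] by (simp add: c_def power_divide del: of_nat_Suc)
  then have "abs (2 * c n * y $ i) <= 2 * c n * real (Suc n)"
   using component_le_norm_cart[of y i] c0[of n] by (simp add: abs_mult mult_left_mono del: of_nat_Suc)
  also have "\<dots> = 2 / real (Suc n)" by (simp add: c_def power2_eq_square del: of_nat_Suc)
  finally have "abs (2 * c n * y $ i) * abs (bump Q (c n * (norm y)^2)) <= 2 / real (Suc n) * M'"
   using c0 by (intro mult_mono M') auto
  then show ?thesis by (simp add: R_def norm_mult abs_mult)
 qed (use M'[of 0] in \<open>auto simp: R_def bump_def\<close>)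
 have d: "(\<psi> n has_derivative (%h. gker z (x - y) * (of_real (2 * c n * (y \<bullet> h)) * of_real (bump Q (c n * (norm y)^2)))
   + of_real ((x - y) \<bullet> h) * (1 / (2 * z)) * gker z (x - y) * \<xi> n y)) (at y)" for n y
  unfolding \<psi>_def \<xi>_def Q_def by (intro has_derivative_mult has_derivative_gker_reflect has_derivative_cutoff)
 have p: "partial i (\<psi> n) y = gker z (x - y) * R n y - gk1 ?e z (x - y) * \<xi> n y" for n y
  using partial_eq[OF d] by (simp add: R_def gk1_def inner_axis)
 have "\<psi> n \<in> test_functions" for n
 proof -
  have "{y. \<psi> n y \<noteq> 0} \<subseteq> cball 0 (real (Suc n))"
  proof
   fix y assume "y \<in> {y. \<psi> n y \<noteq> 0}"
   then have "(norm y)^2 < (real (Suc n))^2" by (auto simp: \<psi>_def \<xi>_def bump_def c_def power_divide split: if_splits)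
   then show "y \<in> cball 0 (real (Suc n))" using power2_less_imp_less[of "norm y" "real (Suc n)"] by simp
  qed
  then have "bounded {y. \<psi> n y \<noteq> 0}" by (rule bounded_subset[OF bounded_cball])
  then show ?thesis unfolding test_functions_def \<psi>_def \<xi>_def by (auto intro: Ck_mult Ck_gker_reflect Ck_cutoff)
 qed
 then have eq: "(LINT y|lebesgue. f y * partial i (\<psi> n) y) = - (LINT y|lebesgue. g y * \<psi> n y)" for n
  using w by (auto simp: weak_partial_def)
 have "bm (bump P)" for P
  by (intro borel_measurable_continuous_onI continuous_at_imp_continuous_on ballI DERIV_isCont[OF DERIV_bump])
 note [measurable] = this
 obtain A1 c1 where 1: "gbd A1 c1 (gk1 ?e z)" using gbd_gk1_ex[OF z e] by blast
 obtain A2 c2 where 2: "gbd A2 c2 (gker z :: real ^ 'n => complex)" using gbd_gker_ex[OF z] by blast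
 have [measurable]: "gk1 ?e z \<in> borel_measurable borel" using 1 by (simp add: gbd_def)
 have [measurable]: "bm (\<xi> n)" "bm (R n)" for n unfolding \<xi>_def R_def by measurable
 \<comment> \<open>The cut-offs tend to \<open>bump 1 0 = exp (- 1)\<close>, not to 1; the constant
   cancels at the end.\<close>
 have lim: "(%n. \<xi> n y) \<longlonglongrightarrow> of_real (bump 1 0)" "(%n. R n y) \<longlonglongrightarrow> 0" for y
 proof -
  have "c \<longlonglongrightarrow> 0^2" unfolding c_def by (intro tendsto_power lim_inverse_n'[THEN LIMSEQ_Suc])
  then have "(%n. c n * (norm y)^2) \<longlonglongrightarrow> 0" by (auto intro: tendsto_mult_left_zero)
  moreover have "isCont (bump 1) 0" by (rule DERIV_isCont[OF DERIV_bump])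
  ultimately show "(%n. \<xi> n y) \<longlonglongrightarrow> of_real (bump 1 0)" unfolding \<xi>_def by (intro tendsto_of_real isCont_tendsto_compose[of 0 "bump 1"])
  show "(%n. R n y) \<longlonglongrightarrow> 0"
   using Rb by (rule Lim_null_comparison[OF always_eventually[OF allI]])
    (use tendsto_mult_right_zero[OF lim_inverse_n'[THEN LIMSEQ_Suc], of "2 * M'"] in simp)
 qed
 note i = cv_integrable(1)[OF 1 f, of x] cv_integrable(1)[OF 2 f, of x] cv_integrable(1)[OF 2 g, of x]
 have L1: "(%n. LL y. f y * partial i (\<psi> n) y) \<longlonglongrightarrow> (LL y. f y * (gker z (x - y) * 0 - gk1 ?e z (x - y) * of_real (bump 1 0)))"
 proof (rule integral_dominated_convergence[where w="%y. 2 * M' * norm (gker z (x - y) * f y) + M * norm (gk1 ?e z (x - y) * f y)"])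
  show "AE y in lborel. norm (f y * partial i (\<psi> n) y) <= 2 * M' * norm (gker z (x - y) * f y) + M * norm (gk1 ?e z (x - y) * f y)" for n
  proof (rule AE_I2)
   fix y
   have "norm (R n y) <= 2 * M'" using M'[of 0] by (intro order_trans[OF Rb]) (simp add: divide_le_eq distrib_left)
   then have "norm (gker z (x - y) * R n y - gk1 ?e z (x - y) * \<xi> n y) <= norm (gker z (x - y)) * (2 * M') + norm (gk1 ?e z (x - y)) * M"
    using \<xi>b by (intro order_trans[OF norm_triangle_ineq4] add_mono) (auto simp: norm_mult intro: mult_left_mono)
   from mult_left_mono[OF this, of "norm (f y)"] show "norm (f y * partial i (\<psi> n) y) <= 2 * M' * norm (gker z (x - y) * f y) + M * norm (gk1 ?e z (x - y) * f y)"
    unfolding p norm_mult by (simp add: distrib_left ac_simps)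
  qed
  show "AE y in lborel. (%n. f y * partial i (\<psi> n) y) \<longlonglongrightarrow> f y * (gker z (x - y) * 0 - gk1 ?e z (x - y) * of_real (bump 1 0))"
   unfolding p by (intro AE_I2 tendsto_intros lim)
 qed (use i in \<open>auto simp: p\<close>)
 have L2: "(%n. LL y. g y * \<psi> n y) \<longlonglongrightarrow> (LL y. g y * (gker z (x - y) * of_real (bump 1 0)))"
 proof (rule integral_dominated_convergence[where w="%y. M * norm (gker z (x - y) * g y)"])
  show "AE y in lborel. norm (g y * \<psi> n y) <= M * norm (gker z (x - y) * g y)" for n
   using \<xi>b mult_right_mono[OF \<xi>b, of "norm (gker z (x - _) * g _)"] by (auto simp: \<psi>_def norm_mult ac_simps intro!: mult_left_mono)
  show "AE y in lborel. (%n. g y * \<psi> n y) \<longlonglongrightarrow> g y * (gker z (x - y) * of_real (bump 1 0))"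
   unfolding \<psi>_def by (intro AE_I2 tendsto_intros lim)
 qed (use i in \<open>auto simp: \<psi>_def\<close>)
 have "(LL y. f y * partial i (\<psi> n) y) = - (LL y. g y * \<psi> n y)" for n
  using eq[of n] by (simp add: p \<psi>_def integral_completion)
 with tendsto_minus[OF L2] have "(%n. LL y. f y * partial i (\<psi> n) y) \<longlonglongrightarrow> - (LL y. g y * (gker z (x - y) * of_real (bump 1 0)))" by simp
 note LIMSEQ_unique[OF L1 this]
 moreover have "(LL y. f y * (gker z (x - y) * 0 - gk1 ?e z (x - y) * of_real (bump 1 0))) = - of_real (bump 1 0) * cv (gk1 ?e z) f x"
  unfolding cv_def integral_mult_right_zero[symmetric] by (simp add: ac_simps)
 moreover have "(LL y. g y * (gker z (x - y) * of_real (bump 1 0))) = of_real (bump 1 0) * cv (gker z) g x"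
  unfolding cv_def integral_mult_right_zero[symmetric] by (simp add: ac_simps)
 moreover have "bump 1 0 \<noteq> 0" by (simp add: bump_def)
 ultimately show "cv (gk1 ?e z) f x = cv (gker z) g x" by simp
qed

text \<open>The relation determines the heat flow of \<open>g\<close> at every positive time, and
  \<open>g\<close> is the L^2 limit of that flow at time 0.\<close>

lemma wd_unique:
 assumes "wd e f g" "wd e f g'" and g: "l2b g B" and g': "l2b g' B'"
 shows "AE x in lborel. g x = g' x"
proof -
 have "l2b (%x. g x - g' x) \<eta>" if \<eta>: "0 < \<eta>" for \<eta>
 proof -
  obtain s1 s2 where s: "0 < s1" "0 < s2" "!!s. 0 < s ==> s <= s1 ==> l2b (%x. g x - cv (gker (of_real s)) g x) (\<eta> / 2)"
    "!!s. 0 < s ==> s <= s2 ==> l2b (%x. g' x - cv (gker (of_real s)) g' x) (\<eta> / 2)"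
   using heat_approximate_identity[OF _ g g, of "\<eta> / 2"] heat_approximate_identity[OF _ g' g', of "\<eta> / 2"] \<eta> by auto
  have "cv (gker (of_real (min s1 s2))) g = cv (gker (of_real (min s1 s2))) g'" using assms(1,2) s by (auto simp: wd_def fun_eq_iff)
  then show ?thesis using lpb_diff[OF _ s(3,4), of "min s1 s2" "min s1 s2"] s(1,2) by simp
 qed
 then have "AE x in lborel. g x - g' x = 0" by (rule lpb_zero_AE) auto
 then show ?thesis by eventually_elim simp
qed

lemma test_function:
 fixes \<psi> :: "real ^ 'n => complex"
 assumes \<psi>: "\<psi> \<in> test_functions"
 shows test_function_lpb: "0 < p ==> \<exists>Y. lpb lborel p \<psi> Y" and test_function_partial: "partial i \<psi> \<in> test_functions"
  and test_function_dird: "dird (axis i 1) \<psi> (partial i \<psi>)" and test_function_continuous: "continuous_on UNIV \<psi>"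
  and test_function_line: "continuous_on UNIV (%s. \<psi> (x + s *\<^sub>R e))"
proof -
 let ?S = "closure {x. \<psi> x \<noteq> 0}"
 have K: "compact ?S" using assms by (simp add: test_functions_def)
 have z: "x \<notin> ?S ==> \<psi> x = 0" for x using closure_subset[of "{x. \<psi> x \<noteq> 0}"] by auto
 have C: "Ck k \<psi>" "Ck k (partial i \<psi>)" for k i
  using assms Ck.simps(2)[of k \<psi>] by (auto simp: test_functions_def simp del: Ck.simps)
 show c: "continuous_on UNIV \<psi>" using C(1)[of 0] by simp
 show "continuous_on UNIV (%s. \<psi> (x + s *\<^sub>R e))" by (rule continuous_on_compose2[OF c]) (auto intro!: continuous_intros)
 have d: "\<psi> differentiable at x" for x using C(1)[of 1] by simp
 have "bounded (\<psi> ` ?S)" using K c by (intro compact_imp_bounded compact_continuous_image) (auto intro: continuous_on_subset)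
 then obtain b where b: "0 < b" "!!x. x \<in> ?S ==> norm (\<psi> x) <= b" unfolding bounded_pos by auto
 obtain \<rho> where \<rho>: "?S \<subseteq> cball 0 \<rho>" using compact_imp_bounded[OF K] unfolding bounded_iff by (metis mem_cball_0 subsetI)
 have "norm (\<psi> x) <= norm (indicator (cball 0 \<rho>) x * b)" for x
  using b z[of x] \<rho> by (cases "x \<in> ?S") (auto simp: indicator_def)
 then show "\<exists>Y. lpb lborel p \<psi> Y" if p: "0 < p"
  using lpb_dominated[OF lpb_indicator_cball[of b p 0 \<rho>], of \<psi>] p b borel_measurable_continuous_onI[OF c] by auto
 have s: "{x. partial i \<psi> x \<noteq> 0} \<subseteq> ?S"
 proof
  fix x assume x: "x \<in> {x. partial i \<psi> x \<noteq> 0}"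
  show "x \<in> ?S"
  proof (rule ccontr)
   assume "x \<notin> ?S"
   then have "(\<psi> has_derivative (%_. 0)) (at x)"
    by (intro has_derivative_transform_within_open[OF has_derivative_const[of 0], of "- ?S"]) (use \<open>x \<notin> ?S\<close> in \<open>auto simp: open_Compl intro: z\<close>)
   from partial_eq[OF this] x show False by simp
  qed
 qed
 then have "compact (closure {x. partial i \<psi> x \<noteq> 0})"
  unfolding compact_closure using bounded_subset[OF compact_imp_bounded[OF K]] by blast
 then show "partial i \<psi> \<in> test_functions" using C(2) by (auto simp: test_functions_def)
 show "dird (axis i 1) \<psi> (partial i \<psi>)"
  unfolding dird_def has_vector_derivative_def
 proof
  fix x
  have "((%h. x + h *\<^sub>R axis i 1) has_derivative (%h. h *\<^sub>R axis i (1::real))) (at 0)" by (auto intro!: derivative_eq_intros)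
  moreover have "(\<psi> has_derivative frechet_derivative \<psi> (at x)) (at (x + 0 *\<^sub>R axis i 1))" using frechet_derivative_works[THEN iffD1, OF d] by simp
  ultimately have "((%h. \<psi> (x + h *\<^sub>R axis i 1)) has_derivative (%h. frechet_derivative \<psi> (at x) (h *\<^sub>R axis i 1))) (at 0)"
   by (rule has_derivative_compose)
  then show "((%h. \<psi> (x + h *\<^sub>R axis i 1)) has_derivative (%h. h *\<^sub>R partial i \<psi> x)) (at 0)"
   using linear_frechet_derivative[OF d, of x] by (simp add: partial_def linear_cmul)
 qed
qed

text \<open>Converse of \<open>weak_partial_wd\<close>: the heat flow of \<open>f\<close> has the
  heat flow of \<open>g\<close> as classical line derivative, integration by parts holds there, and
  both flows converge in L^2 as the time tends to 0.\<close>

lemma wd_weak_partial: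
 fixes f g :: "real ^ 'n => complex"
 assumes w: "wd (axis i 1) f g" and f: "l2b f A" and g: "l2b g B"
 shows "weak_partial i f g"
 unfolding weak_partial_def
proof
 fix \<psi> :: "real ^ 'n => complex" assume \<psi>: "\<psi> \<in> test_functions"
 let ?e = "axis i 1 :: real ^ 'n"
 have e: "?e \<in> Basis" by (simp add: axis_in_Basis_iff)
 note \<psi>' = test_function_partial[OF \<psi>, of i]
 obtain Y Y' where Y: "l2b \<psi> Y" "l2b (partial i \<psi>) Y'" using test_function_lpb[OF \<psi>] test_function_lpb[OF \<psi>'] by (meson zero_less_numeral)
 have YY: "0 <= Y" "0 <= Y'" using Y by (auto simp: lpb_def)
 have "norm ((LL x. f x * partial i \<psi> x) + (LL x. g x * \<psi> x)) <= 0 + \<eta>" if \<eta>: "0 < \<eta>" for \<eta>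
 proof -
  define \<zeta> where "\<zeta> = \<eta> / (Y + Y' + 1)"
  have \<zeta>: "0 < \<zeta>" "\<zeta> * (Y + Y') <= \<eta>" using \<eta> YY by (auto simp: \<zeta>_def field_simps)
  obtain s1 s2 where s12: "0 < s1" "0 < s2" "!!s. 0 < s ==> s <= s1 ==> l2b (%x. f x - cv (gker (of_real s)) f x) \<zeta>"
    "!!s. 0 < s ==> s <= s2 ==> l2b (%x. g x - cv (gker (of_real s)) g x) \<zeta>"
   using heat_approximate_identity[OF _ f f \<zeta>(1)] heat_approximate_identity[OF _ g g \<zeta>(1)] by auto
  define s where "s = min s1 s2"
  have s: "0 < s" "s <= s1" "s <= s2" using s12 by (auto simp: s_def)
  define F G where "F = cv (gker (of_real s)) f" and "G = cv (gker (of_real s)) g"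
  have F: "l2b F A" "l2b G B" unfolding F_def G_def by (rule lpb_2_cv_gker; use s f g in simp)+
  obtain A1 c1 where 1: "gbd A1 c1 (gk1 ?e (of_real s))" using gbd_gk1_ex[of "of_real s" ?e] s e by auto
  obtain A2 c2 where 2: "gbd A2 c2 (gker (of_real s) :: real ^ 'n => complex)" using gbd_gker_ex[of "of_real s"] s by auto
  have "cv (gk1 ?e (of_real s)) f = G" using w s by (auto simp: wd_def G_def)
  then have dF: "dird ?e F G" using cv_dird[OF 2 1 dird_gker[OF e] _ f] by (simp add: F_def)
  have dG: "dird ?e G (cv (gk1 ?e (of_real s)) g)" unfolding G_def by (rule cv_dird[OF 2 1 dird_gker[OF e] _ g]) simp
  note i = lpb_2_integrable_mult(1)[OF F(1) Y(2)] lpb_2_integrable_mult(1)[OF F(2) Y(1)] lpb_2_integrable_mult(1)[OF F(1) Y(1)]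
  have "(LL x. F x * partial i \<psi> x + G x * \<psi> x) = 0"
  proof (rule integral_dird_zero[OF dird_mult[OF dF test_function_dird[OF \<psi>]]])
   show "continuous_on UNIV (%t. F (x + t *\<^sub>R ?e) * partial i \<psi> (x + t *\<^sub>R ?e) + G (x + t *\<^sub>R ?e) * \<psi> (x + t *\<^sub>R ?e))" for x
    by (intro continuous_on_add continuous_on_mult dird_line_continuous[OF dF] dird_line_continuous[OF dG] test_function_line \<psi> \<psi>')
  qed (use i in auto)
  then have "(LL x. f x * partial i \<psi> x) + (LL x. g x * \<psi> x)
    = ((LL x. f x * partial i \<psi> x) - (LL x. F x * partial i \<psi> x)) + ((LL x. g x * \<psi> x) - (LL x. G x * \<psi> x))"
   using i by (simp add: add_eq_0_iff2)
  also have "norm \<dots> <= \<zeta> * Y' + \<zeta> * Y"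
   using s12(3)[OF s(1,2)] s12(4)[OF s(1,3)] unfolding F_def[symmetric] G_def[symmetric]
   by (intro norm_triangle_mono lpb_pairing_diff[OF _ f F(1) Y(2)] lpb_pairing_diff[OF _ g F(2) Y(1)])
  finally show ?thesis using \<zeta>(2) by (simp add: distrib_left)
 qed
 then have "norm ((LL x. f x * partial i \<psi> x) + (LL x. g x * \<psi> x)) <= 0" by (rule field_le_epsilon)
 then have "(LL x. f x * partial i \<psi> x) = - (LL x. g x * \<psi> x)" by (simp add: add_eq_0_iff2)
 then show "(LINT x|lebesgue. f x * partial i \<psi> x) = - (LINT x|lebesgue. g x * \<psi> x)"
  using lpb_measurable[OF f] lpb_measurable[OF g] lpb_measurable[OF Y(1)] lpb_measurable[OF Y(2)] by (simp add: integral_completion)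
qed

section \<open>Small data solutions\<close>

lemma borel_representative:
 fixes f :: "'a::euclidean_space => complex"
 assumes "f \<in> borel_measurable lebesgue"
 obtains g where "bm g" "AE x in lborel. f x = g x"
proof -
 have "(%x. Re (f x)) \<in> borel_measurable lebesgue" "(%x. Im (f x)) \<in> borel_measurable lebesgue" using assms by auto
 from this[THEN completion_ex_borel_measurable_real] obtain a b where ab: "a \<in> borel_measurable lborel" "AE x in lborel. Re (f x) = a x"
   "b \<in> borel_measurable lborel" "AE x in lborel. Im (f x) = b x" by blast
 show ?thesis
 proof (rule that[of "%x. Complex (a x) (b x)"])
  show "bm (%x. Complex (a x) (b x))" using ab(1,3) by (simp add: borel_measurable_complex_iff)
  show "AE x in lborel. f x = Complex (a x) (b x)" using ab(2,4) by eventually_elim (simp add: complex_eq_iff)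
 qed
qed

lemma l2b_integral_le:
 assumes "l2b f B"
 shows "(LL x. (norm (f x))^2) <= B^2" "integrable lborel (%x. (norm (f x))^2)"
 using lpb_2_integrable_mult[OF lpb_norm[OF assms] lpb_norm[OF assms]] by (auto simp: power2_eq_square)

text \<open>Passes from the completed measure, in which the function spaces are defined, to a Borel
  function, on which the estimates are proved.\<close>

lemma L2_representative:
 assumes "f \<in> L2"
 obtains g where "AE x in lborel. f x = g x" "(LL x. (norm (g x))^2) = (LINT x|lebesgue. (norm (f x))^2)"
  "l2b g (sqrt (LINT x|lebesgue. (norm (f x))^2))" "f \<in> borel_measurable lebesgue"
proof -
 have m: "f \<in> borel_measurable lebesgue" and J: "(\<integral>\<^sup>+x. ennreal (norm (f x) powr 2) \<partial>lebesgue) < \<infinity>"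
  using assms by (auto simp: L2_def Lp_norm_def Let_def less_top split: if_splits)
 obtain g where g: "bm g" "AE x in lborel. f x = g x" using borel_representative[OF m] .
 have "(NN x. ennreal ((norm (g x))^2)) = (NN x. ennreal (norm (f x) powr 2))"
  using g(2) by (intro nn_integral_cong_AE) (auto elim: eventually_mono)
 then have fin: "(NN x. ennreal ((norm (g x))^2)) < \<infinity>" using J by (simp add: nn_integral_completion)
 then have i: "integrable lborel (%x. (norm (g x))^2)" using g(1) by (intro integrableI_bounded) auto
 have eq: "(LL x. (norm (g x))^2) = (LINT x|lebesgue. (norm (f x))^2)"
  using g m by (subst integral_completion[symmetric]) (auto intro!: integral_cong_AE simp: AE_completion_iff measurable_completion elim: eventually_mono)
 have "l2b g (sqrt (LL x. (norm (g x))^2))" using g(1) i by (simp add: lpb_2_iff nn_integral_eq_integral)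
 then show ?thesis using that[OF g(2) eq _ m] eq by simp
qed

lemma l2b_L2: "l2b f B ==> f \<in> L2"
 by (auto simp: L2_def Lp_norm_def Let_def lpb_def measurable_completion nn_integral_completion less_top split: if_splits intro: le_less_trans[OF _ ennreal_less_top])

lemma weak_partial_cong:
 assumes "weak_partial i f g" "AE x in lborel. f x = f' x" "AE x in lborel. g x = g' x"
  and m: "f \<in> borel_measurable lebesgue" "f' \<in> borel_measurable lebesgue" "g \<in> borel_measurable lebesgue" "g' \<in> borel_measurable lebesgue"
 shows "weak_partial i f' g'"
 unfolding weak_partial_def
proof
 fix \<psi> :: "real ^ 'a => complex" assume \<psi>: "\<psi> \<in> test_functions"
 have [measurable]: "\<psi> \<in> borel_measurable lebesgue" "partial i \<psi> \<in> borel_measurable lebesgue"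
  using test_function_continuous[OF \<psi>] test_function_continuous[OF test_function_partial[OF \<psi>]]
  by (auto intro!: measurable_completion borel_measurable_continuous_onI)
 note m [measurable]
 have "(LINT x|lebesgue. f' x * partial i \<psi> x) = (LINT x|lebesgue. f x * partial i \<psi> x)" "(LINT x|lebesgue. g' x * \<psi> x) = (LINT x|lebesgue. g x * \<psi> x)"
  using assms(2,3) by (auto intro!: integral_cong_AE simp: AE_completion_iff elim: eventually_mono)
 then show "(LINT x|lebesgue. f' x * partial i \<psi> x) = - (LINT x|lebesgue. g' x * \<psi> x)" using assms(1) \<psi> by (simp add: weak_partial_def)
qed

lemma wd_of_weak_partial:
 assumes f: "l2b f A" and f0: "f0 \<in> borel_measurable lebesgue" "AE x in lborel. f0 x = f x" and g0: "g0 \<in> L2" "weak_partial i f0 g0"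
 obtains g where "l2b g (sqrt (LINT x|lebesgue. (norm (g0 x))^2))" "(LL x. (norm (g x))^2) = (LINT x|lebesgue. (norm (g0 x))^2)" "wd (axis i 1) f g"
proof -
 obtain g where g: "AE x in lborel. g0 x = g x" "(LL x. (norm (g x))^2) = (LINT x|lebesgue. (norm (g0 x))^2)"
  "l2b g (sqrt (LINT x|lebesgue. (norm (g0 x))^2))" "g0 \<in> borel_measurable lebesgue" using L2_representative[OF g0(1)] .
 have "weak_partial i f g"
  by (rule weak_partial_cong[OF g0(2) f0(2) g(1) f0(1)]) (use lpb_measurable[OF f] lpb_measurable[OF g(3)] g(4) in \<open>auto intro: measurable_completion\<close>)
 then show ?thesis using that[OF g(3,2)] weak_partial_wd[OF f g(3)] by blast
qed

text \<open>\<open>weak_deriv\<close> is an arbitrary choice among weak derivatives; uniqueness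
  almost everywhere transfers the bound of \<open>w i\<close> to it.\<close>

lemma H1_wd:
 fixes u :: "real ^ 'n => complex" and X Y :: real
 assumes u: "l2b u X" and w: "!!i. wd (axis i 1) u (w i)" "!!i. l2b (w i) Y"
 shows "u \<in> H1" "H1_norm u <= sqrt (X^2 + CARD('n) * Y^2)"
proof -
 have wp: "w i \<in> L2 \<and> weak_partial i u (w i)" for i using wd_weak_partial[OF w(1) u w(2)] l2b_L2[OF w(2)] by blast
 then show "u \<in> H1" using l2b_L2[OF u] by (auto simp: H1_def)
 have um: "u \<in> borel_measurable lebesgue" using lpb_measurable[OF u] by (auto intro: measurable_completion)
 have "(LINT x|lebesgue. (norm (weak_deriv i u x))^2) <= Y^2" for i
 proof -
  have "weak_deriv i u \<in> L2" "weak_partial i u (weak_deriv i u)" using someI[of "%g. g \<in> L2 \<and> weak_partial i u g", OF wp] by (auto simp: weak_deriv_def)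
  from wd_of_weak_partial[OF u um _ this] obtain g where g: "l2b g (sqrt (LINT x|lebesgue. (norm (weak_deriv i u x))^2))"
   "(LL x. (norm (g x))^2) = (LINT x|lebesgue. (norm (weak_deriv i u x))^2)" "wd (axis i 1) u g" by auto
  have "(LL x. (norm (g x))^2) = (LL x. (norm (w i x))^2)"
   using wd_unique[OF g(3) w(1) g(1) w(2)] lpb_measurable[OF g(1)] lpb_measurable[OF w(2)[of i]] by (intro integral_cong_AE) (auto elim: eventually_mono)
  then show ?thesis using l2b_integral_le(1)[OF w(2)] g(2) by simp
 qed
 then have "(\<Sum>i\<in>UNIV. LINT x|lebesgue. (norm (weak_deriv i u x))^2) <= (\<Sum>i\<in>(UNIV :: 'n set). Y^2)" by (intro sum_mono)
 moreover have "(LINT x|lebesgue. (norm (u x))^2) <= X^2"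
  using l2b_integral_le(1)[OF u] lpb_measurable[OF u] by (simp add: integral_completion)
 ultimately show "H1_norm u <= sqrt (X^2 + CARD('n) * Y^2)" unfolding H1_norm_def by simp
qed

lemma Basis_eq_range_axis: "(Basis :: (real ^ 'n) set) = range (%i. axis i 1)"
 by (auto simp: Basis_vec_def)

lemma sum_Basis_axis: "(\<Sum>e\<in>(Basis :: (real ^ 'n) set). F e) = (\<Sum>i\<in>UNIV. F (axis i 1))"
 unfolding Basis_eq_range_axis by (subst sum.reindex) (auto simp: inj_on_def axis_eq_axis)

lemma (in iteration) v_w_continuous:
 assumes \<eta>: "0 < \<eta>"
 shows "\<exists>d>0. \<forall>s. abs (s - t) < d --> l2b (%x. v s x - v t x) \<eta> \<and> (\<forall>e\<in>Basis. l2b (%x. w e s x - w e t x) \<eta>)"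
proof -
 have 1: "(\<exists>d>0. \<forall>s. abs (s - t) < d --> P s) \<longleftrightarrow> eventually P (nhds t)" for P by (auto simp: eventually_nhds_metric dist_real_def)
 show ?thesis using v_continuous[OF \<eta>, of t] w_continuous[OF _ \<eta>, of _ t]
  unfolding 1 eventually_conj_iff by (auto intro: eventually_ball_finite)
qed

text \<open>The exponent of \<theta> is the conjugate of \<open>r\<close>; for infinite
  \<open>r\<close> the quotient \<open>1 / r\<close> is 0 and the exponent is 1. An infinite norm of
  \<open>f\<close> makes the right-hand side infinite because \<open>Z\<close> is positive.\<close>

lemma Lp_norm_pairing:
 fixes f \<theta> :: "real ^ 'n => complex"
 assumes f: "bm f" and r: "2 \<le> r" and \<theta>: "lpb lborel (1 / (1 - enn2real (1 / r))) \<theta> Z" and Z: "0 < Z"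
 shows "ennreal (norm (LL x. f x * \<theta> x)) <= Lp_norm r f * ennreal Z"
proof (cases r)
 case top
 let ?S = "esssup lebesgue (%x. ennreal (norm (f x)))"
 have [measurable]: "bm \<theta>" using \<theta> by (simp add: lpb_def)
 have "ennreal (norm (LL x. f x * \<theta> x)) <= (NN x. ennreal (norm (f x)) * ennreal (norm (\<theta> x)))"
  using norm_integral_le_nn_integral[of lborel "%x. f x * \<theta> x"] by (simp add: norm_mult ennreal_mult')
 also have "\<dots> <= (NN x. ?S * ennreal (norm (\<theta> x)))"
  using esssup_AE[of "%x. ennreal (norm (f x))" lebesgue] unfolding AE_completion_iff
  by (intro nn_integral_mono_AE) (auto elim!: eventually_mono intro: mult_right_mono)
 also have "\<dots> <= ?S * ennreal Z" using \<theta> lpb_nonneg[OF \<theta>] by (simp add: nn_integral_cmult lpb_def top mult_left_mono)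
 also have "?S = Lp_norm r f" using f by (simp add: Lp_norm_def top measurable_completion)
 finally show ?thesis .
next
 case (real \<rho>)
 have \<rho>: "2 \<le> \<rho>" using r real by (simp flip: ennreal_numeral)
 define J where "J = (NN x. ennreal (norm (f x) powr \<rho>))"
 have L: "Lp_norm r f = (if J = \<infinity> then \<infinity> else ennreal (enn2real J powr (1 / \<rho>)))"
  using f real by (simp add: Lp_norm_def J_def measurable_completion nn_integral_completion)
 show ?thesis
 proof (cases "J = \<infinity>")
  case True
  then show ?thesis using Z by (simp add: L ennreal_top_mult)
 next
  case False
  then have "J = ennreal (enn2real J)" by (simp add: less_top)
  then have "lpb lborel \<rho> f (enn2real J powr (1 / \<rho>))" using f \<rho> unfolding J_def by (simp add: lpb_def powr_powr)
  moreover have "enn2real (1 / r) = 1 / \<rho>" using \<rho> real by (simp add: divide_ennreal flip: ennreal_1)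
  ultimately have "lpb lborel (1 / (1 - 1 / \<rho>)) \<theta> Z" using \<theta> by simp
  with \<open>lpb lborel \<rho> f _\<close> have "norm (LL x. f x * \<theta> x) <= enn2real J powr (1 / \<rho>) * Z"
   using \<rho> by (intro lpb_integrable_mult(2)) (auto simp: field_simps)
  then show ?thesis using False Z by (simp add: L ennreal_leI flip: ennreal_mult')
 qed
qed

text \<open>The direction that a lower bound asks for. If \<open>u\<close> were not measurable its
  norm would be infinite by convention, so that case is immediate.\<close>

lemma Lp_norm_mono_AE:
 assumes "AE x in lebesgue. u x = v x" "v \<in> borel_measurable lebesgue"
 shows "Lp_norm r v <= Lp_norm r u"
proof (cases "u \<in> borel_measurable lebesgue")
 case True
 have "(\<integral>\<^sup>+x. ennreal (norm (u x) powr p) \<partial>lebesgue) = (\<integral>\<^sup>+x. ennreal (norm (v x) powr p) \<partial>lebesgue)" for p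
  using assms(1) by (intro nn_integral_cong_AE) (auto elim: eventually_mono)
 moreover have "esssup lebesgue (%x. ennreal (norm (u x))) = esssup lebesgue (%x. ennreal (norm (v x)))"
  using assms(1) by (intro esssup_AE_cong) (use True assms(2) in \<open>auto elim: eventually_mono\<close>)
 ultimately show ?thesis using True assms(2) by (simp add: Lp_norm_def Let_def)
qed (simp add: Lp_norm_def)

lemma small_data_solution:
 fixes \<phi> \<phi>0 :: "real ^ 'n => complex" and \<alpha> lam A B :: real
 assumes \<alpha>: "\<alpha> = 4 / CARD('n)" and sd: "small_data \<alpha> lam C A B \<phi> \<phi>'" and A: "0 < A" "(LL x. (norm (\<phi> x))^2) = A^2"
  and \<phi>0: "AE x in lborel. \<phi> x = \<phi>0 x"
 obtains v where "nls_solution lam \<alpha> \<phi>0 \<infinity> \<infinity> v" "!!t. v t \<in> borel_measurable borel"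
  "!!r. 2 <= r ==> \<exists>c>0. \<forall>t\<ge>1. ennreal c <= ennreal (t powr (CARD('n) * (1 / 2 - enn2real (1 / r)))) * Lp_norm r (v t)"
proof -
 have a0: "0 < \<alpha>" using \<alpha> by simp
 note \<alpha>_eq = \<alpha>
 interpret small_data \<alpha> lam C A B \<phi> \<phi>' by (rule sd)
 obtain \<epsilon> U W where "\<forall>n. 0 < \<epsilon> n \<and> \<epsilon> (Suc n) < \<epsilon> n \<and> adm (U n) (W n) \<and> thr n (\<epsilon> n) (U n) (W n) \<and>
   U (Suc n) = step (\<epsilon> n) (U n) \<and> W (Suc n) = step' (\<epsilon> n) (U n) (W n)" using iteration_exists by blast
 then interpret iteration \<alpha> lam C A B \<phi> \<phi>' \<epsilon> U W by unfold_locales auto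
 have b: "axis i 1 \<in> (Basis :: (real ^ 'n) set)" for i by (simp add: axis_in_Basis_iff)
 have m: "bm (v t)" for t using v_bounds(1)[of t] by (simp add: lpb_def)
 show ?thesis
 proof (rule that[of v])
  show "bm (v t)" for t by (rule m)
  show "nls_solution lam \<alpha> \<phi>0 \<infinity> \<infinity> v"
   unfolding nls_solution_def
  proof (intro conjI ballI)
   show "AE x in lebesgue. v 0 x = \<phi>0 x" using v_initial \<phi>0 unfolding AE_completion_iff by eventually_elim simp
   fix t
   show "v t \<in> H1" by (rule H1_wd(1)[OF v_bounds(1) v_wd[OF b] w_bounds[OF b]])
   show "((%s. H1_norm (%x. v s x - v t x)) \<longlongrightarrow> 0) (at t)"
   proof (rule tendstoI)
    fix \<eta> :: real assume "0 < \<eta>"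
    \<comment> \<open>The function and its \<open>CARD('n)\<close> derivatives, each of size
      \<zeta>, then have total norm at most \<open>\<eta> / 2\<close>.\<close>
    define \<zeta> where "\<zeta> = \<eta> / (2 * sqrt (1 + CARD('n)))"
    have "0 < \<zeta>" using \<open>0 < \<eta>\<close> by (simp add: \<zeta>_def add_pos_nonneg)
    have \<zeta>: "sqrt (\<zeta>^2 + CARD('n) * \<zeta>^2) < \<eta>"
    proof -
     have "sqrt (\<zeta>^2 + CARD('n) * \<zeta>^2) = sqrt (1 + CARD('n)) * \<zeta>" using \<open>0 < \<zeta>\<close>
      by (subst real_sqrt_unique[of "sqrt (1 + CARD('n)) * \<zeta>"]) (auto simp: power_mult_distrib algebra_simps)
     also have "\<dots> = \<eta> / 2" by (simp add: \<zeta>_def)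
     finally show ?thesis using \<open>0 < \<eta>\<close> by simp
    qed
    obtain d where d: "0 < d" "!!s. abs (s - t) < d ==> l2b (%x. v s x - v t x) \<zeta> \<and> (\<forall>e\<in>Basis. l2b (%x. w e s x - w e t x) \<zeta>)"
     using v_w_continuous[OF \<open>0 < \<zeta>\<close>] by blast
    have "dist (H1_norm (%x. v s x - v t x)) 0 < \<eta>" if "abs (s - t) < d" for s
    proof -
     have "H1_norm (%x. v s x - v t x) <= sqrt (\<zeta>^2 + CARD('n) * \<zeta>^2)"
      using d(2)[OF that] b by (intro H1_wd(2)[where w="%i x. w (axis i 1) s x - w (axis i 1) t x"])
       (auto intro: wd_diff[OF v_wd[OF b] v_wd[OF b] b v_bounds(1) v_bounds(1) w_bounds[OF b] w_bounds[OF b]])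
     moreover have "0 <= H1_norm (%x. v s x - v t x)" by (auto simp: H1_norm_def intro!: add_nonneg_nonneg sum_nonneg)
     ultimately show ?thesis using \<zeta> by (simp add: dist_real_def)
    qed
    then show "eventually (%s. dist (H1_norm (%x. v s x - v t x)) 0 < \<eta>) (at t)" using d(1) by (auto simp: eventually_at dist_real_def)
   qed
   fix \<psi> :: "real ^ 'n => complex" assume \<psi>: "\<psi> \<in> test_functions"
   note \<psi>' = test_function_partial[OF \<psi>]
   have c: "continuous_on UNIV (%s. partial i \<psi> (x + s *\<^sub>R axis i 1))" for i x
    by (rule continuous_on_compose2[OF test_function_continuous[OF \<psi>']]) (auto intro!: continuous_intros)
   \<comment> \<open>Derivatives of test functions are indexed by coordinates, those of the
     iteration by basis vectors; this translates between the two.\<close>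
   define \<psi>p where "\<psi>p e = partial (THE i. e = axis i 1) \<psi>" for e :: "real ^ 'n"
   have \<psi>p: "\<psi>p (axis i 1) = partial i \<psi>" for i by (simp add: \<psi>p_def axis_eq_axis)
   have B: "\<exists>i. e = axis i 1" if "e \<in> Basis" for e :: "real ^ 'n" using that by (auto simp: Basis_eq_range_axis)
   obtain Y0 where Y0: "l2b \<psi> Y0" using test_function_lpb[OF \<psi>, of 2] by auto
   obtain Y1 where Y1: "!!i. l2b (partial i \<psi>) (Y1 i)" using test_function_lpb[OF \<psi>', of 2] by (metis zero_less_numeral)
   obtain Y' where Y': "lpb lborel (\<alpha> + 2) \<psi> Y'" using test_function_lpb[OF \<psi>, of "\<alpha> + 2"] a0 by auto
   define Y where "Y = Y0 + (\<Sum>i\<in>UNIV. Y1 i)"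
   have n1: "0 <= Y1 i" for i using lpb_nonneg[OF Y1] .
   have Y: "l2b \<psi> Y" "l2b (partial i \<psi>) Y" for i
    using lpb_mono[OF Y0, of Y] lpb_mono[OF Y1, of i Y] n1 lpb_nonneg[OF Y0] member_le_sum[of i UNIV Y1] sum_nonneg[of UNIV Y1]
    by (auto simp: Y_def)
   let ?D = "(LL x. nF v t x * \<psi> x) - \<i> * (\<Sum>e\<in>Basis. LL x. w e t x * \<psi>p e x)"
   have "((%s. LL x. v s x * \<psi> x) has_vector_derivative ?D) (at t)"
    by (rule v_derivative[OF _ Y(1) _ _ _ Y']) (use \<alpha>_eq Y(2) \<psi>p test_function_dird[OF \<psi>] c in \<open>auto dest!: B\<close>)
   moreover have mt: "bm \<psi>" "bm (partial i \<psi>)" "partial i (partial i \<psi>) \<in> borel_measurable borel" for i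
    using test_function_continuous \<psi> \<psi>' test_function_partial[OF \<psi>'] by (auto intro!: borel_measurable_continuous_onI)
   moreover have "\<i> * ?D + (LINT x|lebesgue. v t x * laplacian \<psi> x) + complex_of_real lam * (LINT x|lebesgue. complex_of_real (norm (v t x) powr \<alpha>) * v t x * \<psi> x) = 0"
   proof -
    have i: "integrable lborel (%x. v t x * partial i (partial i \<psi>) x)" for i
     using test_function_lpb[OF test_function_partial[OF \<psi>'], of 2 i i] lpb_2_integrable_mult(1)[OF v_bounds(1)] by auto
    have "(LINT x|lebesgue. v t x * laplacian \<psi> x) = (LL x. (\<Sum>i\<in>UNIV. v t x * partial i (partial i \<psi>) x))"
     unfolding laplacian_def using m mt by (subst integral_completion) (simp_all add: sum_distrib_left)
    also have "\<dots> = (\<Sum>i\<in>UNIV. LL x. v t x * partial i (partial i \<psi>) x)" using i by simp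
    also have "\<dots> = - (\<Sum>i\<in>UNIV. LL x. w (axis i 1) t x * partial i \<psi> x)"
    proof -
     have "(LL x. v t x * partial i (partial i \<psi>) x) = - (LL x. w (axis i 1) t x * partial i \<psi> x)" for i
     proof -
      have "(LINT x|lebesgue. v t x * partial i (partial i \<psi>) x) = - (LINT x|lebesgue. w (axis i 1) t x * partial i \<psi> x)"
       using wd_weak_partial[OF v_wd[OF b] v_bounds(1) w_bounds[OF b]] \<psi>' unfolding weak_partial_def by blast
      then show ?thesis using m mt lpb_measurable[OF w_bounds[OF b]] by (simp add: integral_completion)
     qed
     then show ?thesis by (simp add: sum_negf)
    qed
    finally have 1: "(LINT x|lebesgue. v t x * laplacian \<psi> x) = - (\<Sum>e\<in>Basis. LL x. w e t x * \<psi>p e x)"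
     by (simp add: sum_Basis_axis \<psi>p)
    have "(LINT x|lebesgue. complex_of_real (norm (v t x) powr \<alpha>) * v t x * \<psi> x) = (LL x. nl \<alpha> (v t x) * \<psi> x)"
     unfolding nl_def using m mt by (subst integral_completion) simp_all
    moreover have "(LL x. nF v t x * \<psi> x) = \<i> * of_real lam * (LL x. nl \<alpha> (v t x) * \<psi> x)"
     by (simp add: nF_def mult.assoc)
    ultimately show ?thesis unfolding 1 by (simp add: algebra_simps)
   qed
   ultimately show "\<exists>D. ((%s. LINT x|lebesgue. v s x * \<psi> x) has_vector_derivative D) (at t) \<and>
     \<i> * D + (LINT x|lebesgue. v t x * laplacian \<psi> x) + complex_of_real lam * (LINT x|lebesgue. complex_of_real (norm (v t x) powr \<alpha>) * v t x * \<psi> x) = 0"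
    using m by (intro exI[of _ ?D]) (simp add: integral_completion)
  qed auto
  fix r :: ennreal assume r: "2 <= r"
  \<comment> \<open>The exponent conjugate to \<open>r\<close>, between 1 and 2. Since
    \<open>1 / p - 1 / 2 = 1 / 2 - 1 / r\<close>, the growth of the test function in this exponent
    is the decay rate claimed for \<open>r\<close>.\<close>
  define p where "p = 1 / (1 - enn2real (1 / r))"
  have rr: "0 <= enn2real (1 / r)" "enn2real (1 / r) <= 1 / 2"
  proof -
   show "enn2real (1 / r) <= 1 / 2"
   proof (cases r)
    case (real \<rho>)
    then have "2 <= \<rho>" using r by (simp flip: ennreal_numeral)
    then show ?thesis using real by (simp add: divide_ennreal flip: ennreal_1)
   qed simp
  qed simp
  then have p: "1 <= p" "p <= 2" "1 / p - 1 / 2 = 1 / 2 - enn2real (1 / r)" by (auto simp: p_def field_simps)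
  obtain \<theta> where \<theta>: "!!t. A^2 / 2 <= norm (LL x. v t x * \<theta> t x)"
   "!!p. 1 <= p ==> p <= 2 ==> \<exists>K. \<forall>t\<ge>1. lpb lborel p (\<theta> t) (K * t powr (DIM(real ^ 'n) * (1 / p - 1 / 2)))"
   by (rule v_dual_lower_bound[OF A]) blast
  let ?T = "%t. t powr (CARD('n) * (1 / 2 - enn2real (1 / r)))"
  obtain K0 where K0: "!!t. 1 <= t ==> lpb lborel p (\<theta> t) (K0 * ?T t)" using \<theta>(2)[OF p(1,2)] unfolding p(3) by auto
  define K where "K = max K0 1"
  have K: "0 < K" "K0 <= K" by (auto simp: K_def)
  have "ennreal (A^2 / 2 / K) <= ennreal (?T t) * Lp_norm r (v t)" if t: "1 <= t" for t
  proof -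
   have "lpb lborel p (\<theta> t) (K * ?T t)" by (rule lpb_mono[OF K0[OF t]]) (use K p in \<open>auto intro: mult_right_mono\<close>)
   then have "ennreal (norm (LL x. v t x * \<theta> t x)) <= Lp_norm r (v t) * ennreal (K * ?T t)"
    unfolding p_def by (rule Lp_norm_pairing[OF m r]) (use K t in simp)
   then have "ennreal (A^2 / 2) <= Lp_norm r (v t) * ennreal (K * ?T t)" using ennreal_leI[OF \<theta>(1)[of t]] by (rule order_trans[rotated])
   also have "\<dots> = ennreal K * (ennreal (?T t) * Lp_norm r (v t))" using K by (simp add: ennreal_mult' ac_simps)
   also have "ennreal (A^2 / 2) = ennreal K * ennreal (A^2 / 2 / K)" using K by (simp flip: ennreal_mult')
   finally show ?thesis using K by (subst (asm) ennreal_mult_le_mult_iff) auto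
  qed
  moreover have "0 < A^2 / 2 / K" using A K by simp
  ultimately show "\<exists>c>0. \<forall>t\<ge>1. ennreal c <= ennreal (?T t) * Lp_norm r (v t)" by blast
 qed
qed

theorem proposition2p5:
  fixes lam \<alpha> :: real
  assumes "lam \<noteq> 0" and "\<alpha> = 4 / real CARD('n)"
  shows "\<exists>\<delta>>0. \<forall>\<phi> :: real ^ 'n \<Rightarrow> complex.
    \<phi> \<in> H1 \<and> \<not> (AE x in lebesgue. \<phi> x = 0) \<and> H1_norm \<phi> \<le> \<delta> \<longrightarrow>
    (\<forall>T1 T2 u. associated_solution lam \<alpha> \<phi> T1 T2 u \<longrightarrow>
       T1 = \<infinity> \<and> T2 = \<infinity> \<and>
       (\<forall>r::ennreal. 2 \<le> r \<longrightarrow>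
          Liminf at_top (\<lambda>t::real.
            ennreal (\<bar>t\<bar> powr (real CARD('n) * (1 / 2 - enn2real (1 / r)))) * Lp_norm r (u t)) > 0))"
proof -
 have \<alpha>: "0 < \<alpha>" using assms(2) by simp
 obtain C where C: "1 <= C" and S1: "!!e (F :: real => real ^ 'n => complex) f A B. 0 < e ==> locL2 F ==> xpb ((\<alpha> + 2) / (\<alpha> + 1)) F A ==> l2b f B ==>
    xpb (\<alpha> + 2) (sol (%t. gker (Complex e t)) f F) (C * (B + A))"
  and S2: "!!e t (F :: real => real ^ 'n => complex) f A B. 0 < e ==> locL2 F ==> xpb ((\<alpha> + 2) / (\<alpha> + 1)) F A ==> l2b f B ==>
    l2b (sol (%t. gker (Complex e t)) f F t) (C * (B + A))"
  using strichartz[where 'a="real ^ 'n", of "\<alpha> + 2" "(\<alpha> + 2) / (\<alpha> + 1)"] assms(2) by (simp add: add.commute) blast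
 \<comment> \<open>\<open>k\<close> is the value of \<open>(4 * C * A) powr \<alpha>\<close> at
   which the smallness condition holds with equality, and \<delta> is the corresponding
   \<open>A\<close>.\<close>
 define k where "k = 1 / (abs lam * (1 + \<alpha>) * (8 * C^2))"
 define \<delta> where "\<delta> = k powr (1 / \<alpha>) / (4 * C)"
 have k: "0 < k" using assms(1) \<alpha> C by (simp add: k_def)
 have \<delta>: "0 < \<delta>" "(4 * C * \<delta>) powr \<alpha> = k" using k \<alpha> C by (simp_all add: \<delta>_def powr_powr)
 show ?thesis
 proof (intro exI conjI allI impI)
  show "0 < \<delta>" by fact
  fix \<phi>0 :: "real ^ 'n => complex" and T1 T2 u
  assume \<phi>0: "\<phi>0 \<in> H1 \<and> \<not> (AE x in lebesgue. \<phi>0 x = 0) \<and> H1_norm \<phi>0 <= \<delta>" and u: "associated_solution lam \<alpha> \<phi>0 T1 T2 u"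
  define A where "A = sqrt (LINT x|lebesgue. (norm (\<phi>0 x))^2)"
  obtain \<phi> where \<phi>: "AE x in lborel. \<phi>0 x = \<phi> x" "(LL x. (norm (\<phi> x))^2) = A^2" "l2b \<phi> A" "\<phi>0 \<in> borel_measurable lebesgue"
   using L2_representative[of \<phi>0] \<phi>0 by (auto simp: A_def H1_def)
  have sq: "0 <= (LINT x|lebesgue. (norm (weak_deriv i \<phi>0 x))^2)" for i by simp
  have "A <= H1_norm \<phi>0" unfolding A_def H1_norm_def by (intro real_sqrt_le_mono) (simp add: sum_nonneg)
  then have A\<delta>: "A <= \<delta>" using \<phi>0 by simp
  have "A \<noteq> 0"
  proof
   assume "A = 0"
   then have "AE x in lborel. \<phi> x = 0" using \<phi>(3) by (intro lpb_zero_AE[of _ 2]) (auto intro: lpb_mono)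
   then have "AE x in lborel. \<phi>0 x = 0" using \<phi>(1) by eventually_elim simp
   then show False using \<phi>0 by (simp add: AE_completion_iff)
  qed
  then have A: "0 < A" using lpb_nonneg[OF \<phi>(3)] by simp
  define B where "B = H1_norm \<phi>0"
  have "\<exists>g. l2b g B \<and> wd e \<phi> g" if e0: "e \<in> Basis" for e
  proof -
   obtain i where e: "e = axis i 1" using e0 by (auto simp: Basis_eq_range_axis)
   have "\<exists>g. g \<in> L2 \<and> weak_partial i \<phi>0 g" using \<phi>0 by (auto simp: H1_def)
   then have "weak_deriv i \<phi>0 \<in> L2 \<and> weak_partial i \<phi>0 (weak_deriv i \<phi>0)" unfolding weak_deriv_def by (rule someI_ex)
   then obtain g where g: "l2b g (sqrt (LINT x|lebesgue. (norm (weak_deriv i \<phi>0 x))^2))" "wd (axis i 1) \<phi> g"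
    using wd_of_weak_partial[OF \<phi>(3,4,1)] by metis
   have "sqrt (LINT x|lebesgue. (norm (weak_deriv i \<phi>0 x))^2) <= B"
    unfolding B_def H1_norm_def using member_le_sum[of i UNIV "%i. LINT x|lebesgue. (norm (weak_deriv i \<phi>0 x))^2"]
    by (intro real_sqrt_le_mono) (simp add: add_increasing)
   then show ?thesis using lpb_mono[OF g(1)] g(2) unfolding e by auto
  qed
  then obtain \<phi>' where \<phi>': "!!e. e \<in> Basis ==> l2b (\<phi>' e) B" "!!e. e \<in> Basis ==> wd e \<phi> (\<phi>' e)" by metis
  have "(4 * C * A) powr \<alpha> <= k" unfolding \<delta>(2)[symmetric] using A A\<delta> C \<alpha> by (intro powr_mono2) auto
  then have "abs lam * (1 + \<alpha>) * (4 * C * A) powr \<alpha> * (2 * C^2) <= abs lam * (1 + \<alpha>) * k * (2 * C^2)"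
   using \<alpha> by (intro mult_right_mono mult_left_mono) auto
  also have "\<dots> = 1 / 4" using assms(1) \<alpha> C by (simp add: k_def)
  finally have sd: "small_data \<alpha> lam C A B \<phi> \<phi>'" using S1 S2 C \<phi>(3) \<phi>' \<alpha> by unfold_locales auto
  obtain v where v: "nls_solution lam \<alpha> \<phi>0 \<infinity> \<infinity> v" "!!t. v t \<in> borel_measurable borel"
   "!!r. 2 <= r ==> \<exists>c>0. \<forall>t\<ge>1. ennreal c <= ennreal (t powr (CARD('n) * (1 / 2 - enn2real (1 / r)))) * Lp_norm r (v t)"
   using small_data_solution[OF assms(2) sd A \<phi>(2), of \<phi>0] \<phi>(1) by (auto simp: eq_commute)
  \<comment> \<open>A solution on the whole line has no proper extension, so it is maximal, and the
    uniqueness clause of \<open>associated_solution\<close> forces \<open>u\<close> to agree with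
    it.\<close>
  have "maximal_solution lam \<alpha> \<phi>0 \<infinity> \<infinity> v" using v(1) by (auto simp: maximal_solution_def)
  then have T: "T1 = \<infinity>" "T2 = \<infinity>" and same: "same_on \<infinity> \<infinity> u v" using u by (auto simp: associated_solution_def)
  show "T1 = \<infinity>" "T2 = \<infinity>" by fact+
  fix r :: ennreal assume r: "2 \<le> r"
  obtain c where c: "0 < c" "!!t. 1 <= t ==> ennreal c <= ennreal (t powr (CARD('n) * (1 / 2 - enn2real (1 / r)))) * Lp_norm r (v t)"
   using v(3)[OF r] by blast
  have "Lp_norm r (v t) <= Lp_norm r (u t)" for t
   using same v(2) by (intro Lp_norm_mono_AE) (auto simp: same_on_def time_interval_def intro: measurable_completion)
  then have "ennreal c <= ennreal (abs t powr (CARD('n) * (1 / 2 - enn2real (1 / r)))) * Lp_norm r (u t)" if "1 <= t" for t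
   using order_trans[OF c(2)[OF that] mult_left_mono] that by simp
  then have "ennreal c <= Liminf at_top (%t. ennreal (abs t powr (CARD('n) * (1 / 2 - enn2real (1 / r)))) * Lp_norm r (u t))"
   by (intro Liminf_bounded eventually_at_top_linorderI[of 1])
  then show "0 < Liminf at_top (%t. ennreal (abs t powr (CARD('n) * (1 / 2 - enn2real (1 / r)))) * Lp_norm r (u t))"
   using c(1) by (auto intro: less_le_trans[of _ "ennreal c"])
 qed
qed


end
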